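(* Let $D=2^N$ and $\epsilon_0=\frac{1}{2^N-2^{-N}}$. Let $\Lambda$ be a completely positive superoperator on the operators on $\mathbb{C}^D$, and let $\Lambda_P$ be the Pauli superoperator obtained from $\Lambda$ by Pauli twirling. For any $\epsilon>0$, twirling the Pauli superoperator $\Lambda_P$ by a subset $\mathcal{SL}_\epsilon(D)\subseteq\mathcal{SL}(D)$ of the symplectic group turns it into a superoperator $\Lambda_\epsilon$ such that $$\|\Lambda_\epsilon-\Lambda_U\|_\diamond\le B(\Lambda)\,(\epsilon_0+\epsilon),\qquad B(\Lambda)=\frac{D\,\mathrm{tr}\,\Lambda(\mathbf 1)-\mathrm{tr}\,\hat\Lambda}{D^4},$$ where $\Lambda_U$ is the unitarily invariant superoperator obtained by twirling $\Lambda_P$ by the whole symplectic group $\mathcal{SL}(D)$. The circuits in $\mathcal{SL}_\epsilon(D)$ consist of $O\!\left(N\log\frac1\epsilon\right)$ single- and two-qubit gates in depth $O\!\left(\log N\,\log\frac1\epsilon\right)$, and the construction needs $O\!\left(N\log\frac1\epsilon\right)$ random bits. The subset is of size $|\mathcal{SL}_\epsilon(D)|=2^{O\left(N\log\frac1\epsilon\right)}$.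
   Context: The system consists of $N$ qubits, with state space $\mathbb{C}^D$, $D=2^N$. A superoperator is a linear map on the space of linear operators on $\mathbb{C}^D$. A completely positive superoperator has the form $\Lambda(\rho)=\sum_kA_k\rho A_k^\dagger$ with at most $D^2$ operators $A_k$; $\hat\Lambda$ denotes the matrix of $\Lambda$ as a linear operator on the $D^2$-dimensional space of operators, so that $\mathrm{tr}\,\hat\Lambda=\sum_k|\mathrm{tr}\,A_k|^2$ and $\mathrm{tr}\,\Lambda(\mathbf 1)=\mathrm{tr}\sum_kA_kA_k^\dagger$. On one qubit, $X:|j\rangle\mapsto|j+1\bmod 2\rangle$ and $Z:|j\rangle\mapsto(-1)^j|j\rangle$. The tensor-product Pauli operators $P_1=\mathbf 1,P_2,\dots,P_{D^2}$ are the operators $X^{a_1}Z^{b_1}\otimes\cdots\otimes X^{a_N}Z^{b_N}$ with $a_i,b_i\in\{0,1\}$; ignoring phases they form the Pauli group $\mathcal P(D)$. The Pauli twirl of $\Lambda$ is $\Lambda_P(\rho)=\frac1{D^2}\sum_{j=1}^{D^2}P_j\Lambda(P_j^\dagger\rho P_j)P_j^\dagger$; it is a Pauli superoperator, i.e. of the form $\Lambda_P(\rho)=\sum_{j=1}^{D^2}\alpha_jP_j\rho P_j^\dagger$. The Clifford group (phases ignored) is $\mathcal C(D)=\{V\in U(D):V\mathcal P(D)V^\dagger\subseteq\mathcal P(D)\}$, and the symplectic group is the quotient $\mathcal{SL}(D)=\mathcal C(D)/\mathcal P(D)$, its elements being represented by Clifford circuits. Twirling $\Lambda_P$ by $\mathcal{SL}(D)$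 means forming $\Lambda_U(\rho)=\frac{1}{|\mathcal{SL}(D)|}\sum_{C\in\mathcal{SL}(D)}C^\dagger\Lambda_P(C\rho C^\dagger)C$; twirling by the subset $\mathcal{SL}_\epsilon(D)$ means forming the corresponding average of $\rho\mapsto C^\dagger\Lambda_P(C\rho C^\dagger)C$ over circuits $C$ randomly sampled from $\mathcal{SL}_\epsilon(D)$. A superoperator $\Lambda'$ is unitarily invariant if $U\Lambda'(U^\dagger\rho U)U^\dagger=\Lambda'(\rho)$ for all $U\in U(D)$ and all operators $\rho$. The norm is $\|\Lambda'\|_\diamond=\sup_{\|\rho\|_1=1}\|(\Lambda'\otimes\mathbf 1)(\rho)\|_1$, where $\mathbf 1$ here is the identity map on operators on an auxiliary system and $\|\cdot\|_1$ is the trace norm. *)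

theory Defs
  imports
    "Jordan_Normal_Form.Spectral_Radius"
    "HOL-Algebra.Coset"
    "HOL-Library.Extended_Real"
begin

section \<open>Matrices\<close>

notation mat_adjoint (\<open>(_\<^sup>\<dagger>)\<close> [1000] 1000)

definition trace :: "complex mat \<Rightarrow> complex" where
  "trace A = (\<Sum>i<dim_row A. A $$ (i, i))"

text \<open>Matrices carry their dimensions, so the type has no zero and \<^term>\<open>sum\<close> does not apply;
  sums of \<open>d\<close>-by-\<open>d\<close> matrices over a finite index set are taken entrywise.\<close>

definition mat_sum :: "nat \<Rightarrow> ('i \<Rightarrow> complex mat) \<Rightarrow> 'i set \<Rightarrow> complex mat" where
  "mat_sum d f I = mat d d (\<lambda>(i, j). \<Sum>k\<in>I. f k $$ (i, j))"

definition kron :: "complex mat \<Rightarrow> complex mat \<Rightarrow> complex mat" (infixr \<open>\<otimes>\<^sub>m\<close> 73) where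
  "A \<otimes>\<^sub>m B = mat (dim_row A * dim_row B) (dim_col A * dim_col B)
     (\<lambda>(i, j). A $$ (i div dim_row B, j div dim_col B) * B $$ (i mod dim_row B, j mod dim_col B))"

definition unitary :: "nat \<Rightarrow> complex mat set" where
  "unitary d = {U \<in> carrier_mat d d. U * U\<^sup>\<dagger> = 1\<^sub>m d \<and> U\<^sup>\<dagger> * U = 1\<^sub>m d}"

definition positive_semidefinite :: "complex mat \<Rightarrow> bool" where
  "positive_semidefinite A \<longleftrightarrow> dim_col A = dim_row A \<and> A\<^sup>\<dagger> = A \<and>
     (\<forall>v\<in>carrier_vec (dim_row A). 0 \<le> Re ((A *\<^sub>v v) \<bullet>c v))"

definition abs_mat :: "complex mat \<Rightarrow> complex mat" where
  "abs_mat A = (THE B. positive_semidefinite B \<and> dim_row B = dim_col A \<and> B * B = A\<^sup>\<dagger> * A)"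

definition trace_norm :: "complex mat \<Rightarrow> real" where
  "trace_norm A = Re (trace (abs_mat A))"


section \<open>Superoperators\<close>

text \<open>A superoperator on \<open>\<complex>\<^sup>d\<close> is represented by a function on matrices of which only the
  values on \<^term>\<open>carrier_mat d d\<close> matter.\<close>

type_synonym superop = "complex mat \<Rightarrow> complex mat"

definition completely_positive :: "nat \<Rightarrow> superop \<Rightarrow> bool" where
  "completely_positive d \<Lambda> \<longleftrightarrow>
     (\<exists>m (A :: nat \<Rightarrow> complex mat). m \<le> d\<^sup>2 \<and> (\<forall>k<m. A k \<in> carrier_mat d d) \<and>
        (\<forall>\<rho>\<in>carrier_mat d d. \<Lambda> \<rho> = mat_sum d (\<lambda>k. A k * \<rho> * (A k)\<^sup>\<dagger>) {..<m}))"

definition unitarily_invariant :: "nat \<Rightarrow> superop \<Rightarrow> bool" where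
  "unitarily_invariant d \<Lambda> \<longleftrightarrow>
     (\<forall>U\<in>unitary d. \<forall>\<rho>\<in>carrier_mat d d. U * \<Lambda> (U\<^sup>\<dagger> * \<rho> * U) * U\<^sup>\<dagger> = \<Lambda> \<rho>)"

text \<open>The matrix of \<open>\<Lambda>\<close> in the basis of matrix units \<open>E\<^sub>a\<^sub>b\<close>, where \<open>E\<^sub>a\<^sub>b\<close> has the index
  \<open>a * d + b\<close>.\<close>

definition superop_mat :: "nat \<Rightarrow> superop \<Rightarrow> complex mat" where
  "superop_mat d \<Lambda> = mat (d\<^sup>2) (d\<^sup>2) (\<lambda>(p, q).
     \<Lambda> (mat d d (\<lambda>(i, j). if i = q div d \<and> j = q mod d then 1 else 0)) $$ (p div d, p mod d))"

text \<open>The extension of \<open>\<Lambda>\<close> by the identity on the operators on an auxiliary \<open>\<complex>\<^sup>n\<close>: write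
  \<open>\<rho> = (\<Sum>k l. R\<^sub>k\<^sub>l \<otimes> E\<^sub>k\<^sub>l)\<close> with \<open>d\<close>-by-\<open>d\<close> blocks \<open>R\<^sub>k\<^sub>l\<close> and apply \<open>\<Lambda>\<close> to each block.\<close>

definition extend_superop :: "nat \<Rightarrow> nat \<Rightarrow> superop \<Rightarrow> superop" where
  "extend_superop d n \<Lambda> \<rho> = mat (d * n) (d * n) (\<lambda>(i, j).
     \<Lambda> (mat d d (\<lambda>(a, b). \<rho> $$ (a * n + i mod n, b * n + j mod n))) $$ (i div n, j div n))"

lemma extend_superop_kron:
  assumes A: "A \<in> carrier_mat d d" and B: "B \<in> carrier_mat n n"
    and dim: "\<Lambda> A \<in> carrier_mat d d"
    and hom: "\<And>c. \<Lambda> (c \<cdot>\<^sub>m A) = c \<cdot>\<^sub>m \<Lambda> A"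
  shows "extend_superop d n \<Lambda> (A \<otimes>\<^sub>m B) = \<Lambda> A \<otimes>\<^sub>m B"
proof (rule eq_matI)
  fix i j
  assume "i < dim_row (\<Lambda> A \<otimes>\<^sub>m B)" "j < dim_col (\<Lambda> A \<otimes>\<^sub>m B)"
  then have i: "i < d * n" and j: "j < d * n"
    using B dim by (auto simp: kron_def)
  then have n: "0 < n" by (cases n) auto
  have less: "a * n + k mod n < d * n" if "a < d" for a k
  proof -
    have "a * n + k mod n < Suc a * n" using n by simp
    also have "\<dots> \<le> d * n" using that by (intro mult_le_mono1) simp
    finally show ?thesis .
  qed
  have block: "mat d d (\<lambda>(a, b). (A \<otimes>\<^sub>m B) $$ (a * n + i mod n, b * n + j mod n))
    = B $$ (i mod n, j mod n) \<cdot>\<^sub>m A"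
    using A B n by (intro eq_matI) (auto simp: kron_def less)
  have "i div n < d" "j div n < d"
    using i j by (simp_all add: less_mult_imp_div_less)
  then show "extend_superop d n \<Lambda> (A \<otimes>\<^sub>m B) $$ (i, j) = (\<Lambda> A \<otimes>\<^sub>m B) $$ (i, j)"
    using i j B dim by (simp add: extend_superop_def block hom) (simp add: kron_def)
qed (use B dim in \<open>auto simp: extend_superop_def kron_def\<close>)

text \<open>The supremum is over auxiliary systems of all finite dimensions.\<close>

definition diamond_norm :: "nat \<Rightarrow> superop \<Rightarrow> ereal" where
  "diamond_norm d \<Lambda> = Sup {ereal (trace_norm (extend_superop d n \<Lambda> \<rho>)) | n \<rho>.
     0 < n \<and> \<rho> \<in> carrier_mat (d * n) (d * n) \<and> trace_norm \<rho> = 1}"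


section \<open>Pauli operators, Clifford and symplectic group\<close>

definition pauli_X :: "complex mat" where
  "pauli_X = mat 2 2 (\<lambda>(i, j). if i = (j + 1) mod 2 then 1 else 0)"

definition pauli_Z :: "complex mat" where
  "pauli_Z = mat 2 2 (\<lambda>(i, j). if i = j then (- 1) ^ j else 0)"

definition pauli_indices :: "nat \<Rightarrow> (nat \<times> nat) list set" where
  "pauli_indices N = {ps. length ps = N \<and> set ps \<subseteq> {0, 1} \<times> {0, 1}}"

definition pauli :: "(nat \<times> nat) list \<Rightarrow> complex mat" where
  "pauli ps = foldr (\<lambda>(a, b) M. (pauli_X ^\<^sub>m a * pauli_Z ^\<^sub>m b) \<otimes>\<^sub>m M) ps (1\<^sub>m 1)"

text \<open>``Ignoring phases'' is rendered by closing the Pauli group under all phases, so that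
  they disappear in the quotient by it.\<close>

definition pauli_group :: "nat \<Rightarrow> complex mat set" where
  "pauli_group N = {\<omega> \<cdot>\<^sub>m pauli ps | \<omega> ps. cmod \<omega> = 1 \<and> ps \<in> pauli_indices N}"

definition clifford_group :: "nat \<Rightarrow> complex mat monoid" where
  "clifford_group N =
     \<lparr>carrier = {V \<in> unitary (2 ^ N). (\<lambda>P. V * P * V\<^sup>\<dagger>) ` pauli_group N \<subseteq> pauli_group N},
      mult = (*), one = 1\<^sub>m (2 ^ N)\<rparr>"

definition symplectic_group :: "nat \<Rightarrow> complex mat set monoid" where
  "symplectic_group N = clifford_group N Mod pauli_group N"

definition symplectic_class :: "nat \<Rightarrow> complex mat \<Rightarrow> complex mat set" where
  "symplectic_class N V = pauli_group N #>\<^bsub>clifford_group N\<^esub> V"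

definition pauli_superop :: "nat \<Rightarrow> superop \<Rightarrow> bool" where
  "pauli_superop N \<Lambda> \<longleftrightarrow>
     (\<exists>\<alpha> :: (nat \<times> nat) list \<Rightarrow> complex. \<forall>\<rho>\<in>carrier_mat (2 ^ N) (2 ^ N).
        \<Lambda> \<rho> = mat_sum (2 ^ N) (\<lambda>p. \<alpha> p \<cdot>\<^sub>m (pauli p * \<rho> * (pauli p)\<^sup>\<dagger>)) (pauli_indices N))"

definition pauli_twirl :: "nat \<Rightarrow> superop \<Rightarrow> superop" where
  "pauli_twirl N \<Lambda> \<rho> = (1 / (2 ^ N)\<^sup>2) \<cdot>\<^sub>m
     mat_sum (2 ^ N) (\<lambda>p. pauli p * \<Lambda> ((pauli p)\<^sup>\<dagger> * \<rho> * pauli p) * (pauli p)\<^sup>\<dagger>) (pauli_indices N)"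

text \<open>For a Pauli superoperator the summands do not depend on the representatives of the cosets.\<close>

definition symplectic_twirl :: "nat \<Rightarrow> superop \<Rightarrow> superop" where
  "symplectic_twirl N \<Lambda> \<rho> = (1 / of_nat (card (carrier (symplectic_group N)))) \<cdot>\<^sub>m
     mat_sum (2 ^ N) (\<lambda>c. let C = (SOME C. C \<in> c) in C\<^sup>\<dagger> * \<Lambda> (C * \<rho> * C\<^sup>\<dagger>) * C)
       (carrier (symplectic_group N))"


section \<open>Random Clifford circuits\<close>

text \<open>A gate is given by the qubits it acts on and its matrix on these qubits, a circuit by its
  layers of gates on disjoint sets of qubits, the first layer being applied first.\<close>

type_synonym gate = "nat list \<times> complex mat"
type_synonym circuit = "gate list list"

definition clifford_gate :: "nat \<Rightarrow> gate \<Rightarrow> bool" where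
  "clifford_gate N = (\<lambda>(qs, U). length qs \<in> {1, 2} \<and> distinct qs \<and> set qs \<subseteq> {..<N} \<and>
     U \<in> carrier (clifford_group (length qs)))"

definition clifford_circuit :: "nat \<Rightarrow> circuit \<Rightarrow> bool" where
  "clifford_circuit N ls \<longleftrightarrow>
     (\<forall>l\<in>set ls. (\<forall>g\<in>set l. clifford_gate N g) \<and> distinct (concat (map fst l)))"

definition gate_count :: "circuit \<Rightarrow> nat" where
  "gate_count ls = length (concat ls)"

definition depth :: "circuit \<Rightarrow> nat" where
  "depth ls = length ls"

text \<open>Qubit \<open>0\<close> is the leftmost tensor factor, that is, the most significant bit of a basis index.\<close>

definition qubit :: "nat \<Rightarrow> nat \<Rightarrow> nat \<Rightarrow> nat" where
  "qubit N x q = (x div 2 ^ (N - 1 - q)) mod 2"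

definition sub_index :: "nat \<Rightarrow> nat list \<Rightarrow> nat \<Rightarrow> nat" where
  "sub_index N qs x = foldl (\<lambda>s q. 2 * s + qubit N x q) 0 qs"

text \<open>A gate acts as the identity on the qubits not mentioned.\<close>

definition gate_unitary :: "nat \<Rightarrow> gate \<Rightarrow> complex mat" where
  "gate_unitary N = (\<lambda>(qs, U). mat (2 ^ N) (2 ^ N) (\<lambda>(x, y).
     if \<forall>q<N. q \<notin> set qs \<longrightarrow> qubit N x q = qubit N y q
     then U $$ (sub_index N qs x, sub_index N qs y) else 0))"

definition circuit_unitary :: "nat \<Rightarrow> circuit \<Rightarrow> complex mat" where
  "circuit_unitary N ls = foldl (\<lambda>V g. gate_unitary N g * V) (1\<^sub>m (2 ^ N)) (concat ls)"

definition bit_strings :: "nat \<Rightarrow> bool list set" where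
  "bit_strings r = {b. length b = r}"

text \<open>Twirling by a circuit sampled with \<open>r\<close> independent uniformly random bits \<open>b\<close>.\<close>

definition sampled_twirl :: "nat \<Rightarrow> nat \<Rightarrow> (bool list \<Rightarrow> circuit) \<Rightarrow> superop \<Rightarrow> superop" where
  "sampled_twirl N r circ \<Lambda> \<rho> = (1 / 2 ^ r) \<cdot>\<^sub>m
     mat_sum (2 ^ N) (\<lambda>b. let C = circuit_unitary N (circ b) in C\<^sup>\<dagger> * \<Lambda> (C * \<rho> * C\<^sup>\<dagger>) * C)
       (bit_strings r)"

definition sampled_subset :: "nat \<Rightarrow> nat \<Rightarrow> (bool list \<Rightarrow> circuit) \<Rightarrow> complex mat set set" where
  "sampled_subset N r circ = (\<lambda>b. symplectic_class N (circuit_unitary N (circ b))) ` bit_strings r"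


section \<open>Error bound\<close>

definition eps0 :: "nat \<Rightarrow> real" where
  "eps0 N = 1 / (2 ^ N - 1 / 2 ^ N)"

definition error_factor :: "nat \<Rightarrow> superop \<Rightarrow> real" where
  "error_factor d \<Lambda> = (real d * Re (trace (\<Lambda> (1\<^sub>m d))) - Re (trace (superop_mat d \<Lambda>))) / real d ^ 4"

end

theory Submission
  imports Defs "HOL-Combinatorics.Permutations" "HOL-Library.Z2" "HOL-Library.Function_Algebras" "HOL-Analysis.L2_Norm"
begin

text \<open>
  Write \<open>D = 2 ^ N\<close>. Up to phases, a Pauli operator is a pair \<open>p = (a, b)\<close> of vectors in \<open>{0,1}\<^sup>N\<close>
  (the \<open>X\<close>- and the \<open>Z\<close>-part), and conjugation with a Clifford unitary permutes these pairs. The Pauli twirl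
  of \<open>\<rho> \<mapsto> \<Sum>\<^sub>k A\<^sub>k \<rho> A\<^sub>k\<^sup>\<dagger>\<close> has the weights \<open>\<alpha>\<^sub>p = (\<Sum>\<^sub>k \<bar>tr (P\<^sub>p\<^sup>\<dagger> A\<^sub>k)\<bar>\<^sup>2) / D\<^sup>2\<close>
  (\<open>pauli_twirl_eq_pauli_mix\<close>), and the error factor is the total weight of the non-identity operators divided by
  \<open>D\<^sup>2\<close> (\<open>error_factor_twirl_weight\<close>). Twirling a Pauli superoperator with random Clifford unitaries replaces
  \<open>\<alpha>\<close> by its image under the Markov kernel of the induced random permutation of the pairs
  (\<open>pauli_mix_average\<close>). The whole symplectic group is transitive on the non-zero pairs, hence it spreads the
  non-identity weight uniformly (\<open>symplectic_kernel_uniform\<close>), and the result is unitarily invariant because the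
  sum of all \<open>P\<^sub>p \<rho> P\<^sub>p\<^sup>\<dagger>\<close> is a multiple of \<open>tr \<rho>\<close> times the identity. The diamond norm of a difference of two Pauli
  superoperators is at most the \<open>\<ell>\<^sub>1\<close>-distance of their weights (\<open>diamond_norm_pauli_mix_le\<close>), by duality of
  the trace norm with contractions. It therefore suffices to find random circuits that send each non-zero pair
  to a random pair whose distribution is within \<open>1 / D ^ 3\<close> of the uniform one. As \<open>1 / D ^ 3\<close> is smaller than
  \<open>eps0 N / D\<^sup>2\<close>, the same circuits serve for every \<open>\<epsilon>\<close>.

  A layer of Hadamard gates exchanges the two parts of a pair, and a circuit of CNOT, CZ and phase gates
  realizes a shear \<open>(x, z) \<mapsto> (x, z + S x)\<close> with a symmetric matrix \<open>S\<close>. Suppose that a random \<open>S\<close>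
  makes \<open>S x\<close> uniform for each fixed \<open>x \<noteq> 0\<close>. Then a round consisting of an exchange and a shear is an exactly
  solvable Markov chain, and a constant number of rounds mixes as required
  (\<open>feistel_chain_mixing\<close>). Such matrices need only \<open>O(N)\<close> random bits: let \<open>S\<close> be a random subset sum of
  symmetric forms \<open>F\<^sub>g\<close>. For \<open>x, y \<noteq> 0\<close> the bit \<open>y\<^sup>T S x\<close> is fair as soon as \<open>y\<^sup>T F\<^sub>g x = 1\<close> for one \<open>g\<close>, and if
  every character is fair, then \<open>S x\<close> is uniform (\<open>shear_uniform\<close>). A family of forms with this separation property, of
  linear size and logarithmic depth, is obtained by encoding windows of \<open>x\<close> and \<open>y\<close> with a linear code of
  linear minimum weight whose encoder is a CNOT circuit of linear size and logarithmic depth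
  (\<open>ex_good_encoders\<close>), and by comparing the code words along finitely many permutations that cross between any
  two dense sets (\<open>ex_separating_plan\<close>). The permutations needed for both steps exist by counting.
\<close>

section \<open>Permutations with expansion and crossing properties\<close>
lemma choose_mult_power_le:
  fixes a M t :: nat
  assumes "a \<le> M"
  shows "(a choose t) * M ^ t \<le> (M choose t) * a ^ t"
proof (induction t)
  case (Suc t)
  have step: "Suc t * (n choose Suc t) = (n choose t) * (n - t)" for n :: nat
    by (metis binomial_absorb_comp binomial_absorption diff_diff_left mult.commute plus_1_eq_Suc)
  have le: "(a - t) * M \<le> (M - t) * a"
    unfolding diff_mult_distrib mult.commute[of M a]
    by (rule diff_le_mono2) (rule mult_le_mono2[OF assms])
  have "Suc t * ((a choose Suc t) * M ^ Suc t) = ((a choose t) * M ^ t) * ((a - t) * M)"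
    by (simp only: power_Suc2 mult.assoc[symmetric] step) (simp only: ac_simps)
  also have "\<dots> \<le> ((M choose t) * a ^ t) * ((M - t) * a)"
    by (intro mult_le_mono Suc.IH le)
  also have "\<dots> = Suc t * ((M choose Suc t) * a ^ Suc t)"
    by (simp only: power_Suc2 mult.assoc[symmetric] step) (simp only: ac_simps)
  finally show ?case by (simp only: mult_le_cancel1 zero_less_Suc simp_thms)
qed simp

text \<open>Double counting of the pairs of a permutation \<open>p\<close> and a set \<open>T'\<close> with \<open>card T' = card T\<close> and \<open>p ` T' \<subseteq> S\<close>: the number
  of such \<open>p\<close> depends on \<open>T'\<close> only through its cardinality.\<close>

lemma card_permutes_into_choose:
  fixes M :: nat
  assumes T: "T \<subseteq> {..<M}" and S: "S \<subseteq> {..<M}"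
  shows "card {p. p permutes {..<M} \<and> p ` T \<subseteq> S} * (M choose card T) = fact M * (card S choose card T)"
proof -
  let ?P = "{p. p permutes {..<M}}" and ?t = "card T"
  let ?F = "{T'. T' \<subseteq> {..<M} \<and> card T' = ?t}"
  have finP: "finite ?P" by (rule finite_permutations) simp
  have finF: "finite ?F" by simp
  have same: "card {p\<in>?P. p ` T' \<subseteq> S} = card {p\<in>?P. p ` T \<subseteq> S}" if T': "T' \<in> ?F" for T'
  proof -
    obtain f where f: "bij_betw f T T'"
      using T T' finite_subset[OF T] finite_subset[of T' "{..<M}"] by (metis (mono_tags, lifting) finite_lessThan finite_same_card_bij mem_Collect_eq)
    obtain g where g: "bij_betw g ({..<M} - T) ({..<M} - T')"
      using T T' by (metis (mono_tags, lifting) card_Diff_subset finite_Diff finite_lessThan finite_same_card_bij finite_subset mem_Collect_eq)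
    define s where "s x = (if x \<in> T then f x else if x < M then g x else x)" for x
    have "bij_betw s T T'" using f by (rule bij_betw_cong[THEN iffD1, rotated]) (simp add: s_def)
    moreover have "bij_betw s ({..<M} - T) ({..<M} - T')"
      using g by (rule bij_betw_cong[THEN iffD1, rotated]) (simp add: s_def)
    ultimately have "bij_betw s (T \<union> ({..<M} - T)) (T' \<union> ({..<M} - T'))"
      by (rule bij_betw_combine) auto
    moreover have "T \<union> ({..<M} - T) = {..<M}" "T' \<union> ({..<M} - T') = {..<M}"
      using T T' by auto
    ultimately have s: "s permutes {..<M}"
      using T by (intro bij_imp_permutes) (auto simp: s_def)
    have sT: "s ` T = T'" using \<open>bij_betw s T T'\<close> by (simp add: bij_betw_def)
    have "bij_betw (\<lambda>p. p \<circ> s) {p\<in>?P. p ` T' \<subseteq> S} {p\<in>?P. p ` T \<subseteq> S}"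
    proof (rule bij_betw_byWitness[where f' = "\<lambda>p. p \<circ> inv_into UNIV s"])
      show "\<forall>p\<in>{p\<in>?P. p ` T' \<subseteq> S}. p \<circ> s \<circ> inv_into UNIV s = p"
        using s by (simp add: comp_assoc permutes_inv_o)
      show "\<forall>p\<in>{p\<in>?P. p ` T \<subseteq> S}. p \<circ> inv_into UNIV s \<circ> s = p"
        using s by (simp add: comp_assoc permutes_inv_o)
      show "(\<lambda>p. p \<circ> s) ` {p\<in>?P. p ` T' \<subseteq> S} \<subseteq> {p\<in>?P. p ` T \<subseteq> S}"
        using s sT by (auto simp: permutes_compose image_comp[symmetric])
      have "inv_into UNIV s ` T' = T" using sT s by (metis permutes_bij bij_def image_inv_f_f)
      then show "(\<lambda>p. p \<circ> inv_into UNIV s) ` {p\<in>?P. p ` T \<subseteq> S} \<subseteq> {p\<in>?P. p ` T' \<subseteq> S}"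
        using s by (auto simp: permutes_compose permutes_inv image_comp[symmetric])
    qed
    then show ?thesis by (rule bij_betw_same_card)
  qed
  have inner: "card {T'\<in>?F. p ` T' \<subseteq> S} = card S choose ?t" if p: "p \<in> ?P" for p
  proof -
    have pp: "p permutes {..<M}" using p by simp
    have ci: "card (p ` X) = card X" for X using pp by (meson card_image permutes_inj_on)
    have ci': "card (inv_into UNIV p ` X) = card X" for X using pp by (meson card_image permutes_inj_on permutes_inv)
    have im: "p ` X \<subseteq> {..<M} \<longleftrightarrow> X \<subseteq> {..<M}" for X using pp by (metis image_subset_iff permutes_in_image subset_iff)
    have im': "inv_into UNIV p ` X \<subseteq> {..<M} \<longleftrightarrow> X \<subseteq> {..<M}" for X using permutes_inv[OF pp] by (metis image_subset_iff permutes_in_image subset_iff)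
    have i1: "inv_into UNIV p ` p ` X = X" for X using pp by (simp add: image_comp permutes_inv_o)
    have i2: "p ` inv_into UNIV p ` X = X" for X using pp by (simp add: image_comp permutes_inv_o)
    have sub: "inv_into UNIV p ` U \<subseteq> {..<M}" if "U \<subseteq> S" for U using im'[of U] that S by blast
    have "bij_betw ((`) p) {T'\<in>?F. p ` T' \<subseteq> S} {U. U \<subseteq> S \<and> card U = ?t}"
    proof (rule bij_betw_byWitness[where f' = "(`) (inv_into UNIV p)"])
      show "(`) (inv_into UNIV p) ` {U. U \<subseteq> S \<and> card U = ?t} \<subseteq> {T'\<in>?F. p ` T' \<subseteq> S}"
      proof (rule image_subsetI)
        fix U assume "U \<in> {U. U \<subseteq> S \<and> card U = ?t}"
        then have U: "U \<subseteq> S" "card U = ?t" by blast+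
        show "inv_into UNIV p ` U \<in> {T'\<in>?F. p ` T' \<subseteq> S}"
          unfolding mem_Collect_eq i2 ci' using U(2) by (intro conjI sub[OF U(1)] U(1))
      qed
    qed (simp_all only: i1 i2 ci mem_Collect_eq image_subset_iff, blast+)
    then show ?thesis
      using n_subsets[OF finite_subset[OF S]] by (simp add: bij_betw_same_card)
  qed
  have "card {p\<in>?P. p ` T \<subseteq> S} * card ?F = (\<Sum>T'\<in>?F. card {p\<in>?P. p ` T' \<subseteq> S})"
    using same by simp
  also have "\<dots> = (\<Sum>T'\<in>?F. \<Sum>p\<in>?P. if p ` T' \<subseteq> S then 1 else 0)"
    using finP by (intro sum.cong refl) (simp add: sum.If_cases Int_def conj_commute)
  also have "\<dots> = (\<Sum>p\<in>?P. \<Sum>T'\<in>?F. if p ` T' \<subseteq> S then 1 else 0)"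
    by (rule sum.swap)
  also have "\<dots> = (\<Sum>p\<in>?P. card {T'\<in>?F. p ` T' \<subseteq> S})"
    using finF by (intro sum.cong refl) (simp add: sum.If_cases Int_def conj_commute)
  also have "\<dots> = fact M * (card S choose ?t)"
    using inner card_permutations[of "{..<M}" M] by simp
  finally show ?thesis
    using n_subsets[of "{..<M}" ?t] by simp
qed

lemma card_permutes_into_le:
  fixes M :: nat
  assumes T: "T \<subseteq> {..<M}" and S: "S \<subseteq> {..<M}"
  shows "card {p. p permutes {..<M} \<and> p ` T \<subseteq> S} * M ^ card T \<le> fact M * card S ^ card T"
proof -
  have "card S \<le> M" using card_mono[OF _ S] by simp
  have "card T \<le> M" using card_mono[OF _ T] by simp
  let ?c = "card {p. p permutes {..<M} \<and> p ` T \<subseteq> S}" and ?t = "card T"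
  have "?c * M ^ ?t * (M choose ?t) = fact M * ((card S choose ?t) * M ^ ?t)"
    using card_permutes_into_choose[OF T S] by (simp add: ac_simps)
  also have "\<dots> \<le> fact M * ((M choose ?t) * card S ^ ?t)"
    using choose_mult_power_le[OF \<open>card S \<le> M\<close>] by simp
  finally have "(?c * M ^ ?t) * (M choose ?t) \<le> (fact M * card S ^ ?t) * (M choose ?t)"
    by (simp add: ac_simps)
  moreover have "0 < (M choose ?t)" using \<open>card T \<le> M\<close> by simp
  ultimately show ?thesis by (simp only: mult_le_cancel2)
qed

text \<open>The union bound for \<open>d\<close> independent random permutations, none of the bad events \<open>p a ` T i \<subseteq> S i\<close> for all \<open>a\<close>.\<close>

lemma ex_permutations_avoiding:
  fixes M d :: nat
  assumes fin: "finite I" and M: "0 < M"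
    and T: "\<And>i. i \<in> I \<Longrightarrow> T i \<subseteq> {..<M}" and S: "\<And>i. i \<in> I \<Longrightarrow> S i \<subseteq> {..<M}"
    and less: "(\<Sum>i\<in>I. ((real (card (S i)) / real M) ^ card (T i)) ^ d) < 1"
  shows "\<exists>p. (\<forall>a<d. p a permutes {..<M}) \<and> (\<forall>i\<in>I. \<exists>a<d. \<not> p a ` T i \<subseteq> S i)"
proof (rule ccontr)
  assume none: "\<not> ?thesis"
  let ?P = "{p. p permutes {..<M}}"
  let ?Q = "\<lambda>i. {p. p permutes {..<M} \<and> p ` T i \<subseteq> S i}"
  have finP: "finite ?P" by (rule finite_permutations) simp
  have finQ: "finite (?Q i)" for i by (rule finite_subset[OF _ finP]) auto
  have "PiE {..<d} (\<lambda>_. ?P) \<subseteq> (\<Union>i\<in>I. PiE {..<d} (\<lambda>_. ?Q i))"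
      proof
    fix p assume p: "p \<in> PiE {..<d} (\<lambda>_. ?P)"
    then have "\<forall>a<d. p a permutes {..<M}" by auto
    then have "\<not> (\<forall>i\<in>I. \<exists>a<d. \<not> p a ` T i \<subseteq> S i)" using none by (simp only: not_ex de_Morgan_conj) metis
    then obtain i where "i \<in> I" "\<forall>a<d. p a ` T i \<subseteq> S i" by metis
    then have "p \<in> PiE {..<d} (\<lambda>_. ?Q i)"
      using \<open>\<forall>a<d. p a permutes {..<M}\<close> PiE_arb[OF p] by (intro PiE_I) simp_all
    then show "p \<in> (\<Union>i\<in>I. PiE {..<d} (\<lambda>_. ?Q i))" using \<open>i \<in> I\<close> by blast
  qed
  moreover have "finite (PiE {..<d} (\<lambda>_. ?Q i))" for i by (rule finite_PiE) (use finQ in auto)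
  ultimately have "card (PiE {..<d} (\<lambda>_. ?P)) \<le> card (\<Union>i\<in>I. PiE {..<d} (\<lambda>_. ?Q i))"
    by (intro card_mono) (auto simp: fin)
  also have "\<dots> \<le> (\<Sum>i\<in>I. card (PiE {..<d} (\<lambda>_. ?Q i)))"
    by (rule card_UN_le[OF fin])
  finally have "fact M ^ d \<le> (\<Sum>i\<in>I. card (?Q i) ^ d)"
    using card_permutations[of "{..<M}" M] by (simp add: card_PiE)
  then have "real (fact M ^ d) \<le> real (\<Sum>i\<in>I. card (?Q i) ^ d)" by (rule of_nat_mono)
  also have "\<dots> = (\<Sum>i\<in>I. real (card (?Q i)) ^ d)" by simp
  also have "\<dots> \<le> (\<Sum>i\<in>I. (fact M * (real (card (S i)) / real M) ^ card (T i)) ^ d)"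
  proof (rule sum_mono, rule power_mono)
    fix i assume i: "i \<in> I"
    have "real (card (?Q i) * M ^ card (T i)) \<le> real (fact M * card (S i) ^ card (T i))"
      using card_permutes_into_le[OF T[OF i] S[OF i]] by (rule of_nat_mono)
    then show "real (card (?Q i)) \<le> fact M * (real (card (S i)) / real M) ^ card (T i)"
      using M by (simp add: power_divide pos_le_divide_eq)
  qed simp
  also have "\<dots> = fact M ^ d * (\<Sum>i\<in>I. ((real (card (S i)) / real M) ^ card (T i)) ^ d)"
    by (simp add: power_mult_distrib sum_distrib_left)
  also have "\<dots> < fact M ^ d * 1"
    using less by (intro mult_strict_left_mono) auto
  finally show False by simp
qed

lemma power_self_le_fact: "real t ^ t \<le> 4 ^ t * fact t"
proof -
  have "real t ^ t / fact t \<le> exp (real t)"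
  proof -
    have "(\<Sum>n\<in>{t}. inverse (fact n) * real t ^ n) \<le> (\<Sum>n. inverse (fact n) * real t ^ n)"
      by (rule sum_le_suminf) (use summable_exp in auto)
    then show ?thesis by (simp add: exp_def scaleR_conv_of_real field_simps)
  qed
  also have "\<dots> = exp 1 ^ t" using exp_of_nat_mult[of t "1::real"] by simp
  also have "\<dots> \<le> 4 ^ t"
    by (rule power_mono) (use exp_le in linarith, simp)
  finally show ?thesis by (simp add: field_simps)
qed

lemma choose_le_power_div_fact: "real (n choose r) \<le> real n ^ r / fact r"
  using of_nat_mono[OF binomial_fact_pow[of n r], where 'a = real] by (simp add: pos_le_divide_eq)

text \<open>Six permutations of \<open>q * R\<close> points, composed with the projection to \<open>R\<close> blocks of length \<open>q\<close>, form a bipartite graph of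
  left degree six in which every small set has at least four times as many neighbours.\<close>

lemma ex_expanding_permutations:
  fixes q R t0 :: nat
  assumes q: "0 < q" and R: "0 < R" and t0: "4 ^ 8 * q\<^sup>2 * t0 \<le> q * R"
  shows "\<exists>p. (\<forall>a<6::nat. p a permutes {..<q * R}) \<and>
    (\<forall>T. T \<subseteq> {..<q * R} \<longrightarrow> T \<noteq> {} \<longrightarrow> card T \<le> t0 \<longrightarrow>
       4 * card T \<le> card (\<Union>a<6. (\<lambda>v. p a v div q) ` T))"
proof -
  let ?M = "q * R"
  define I where "I = (SIGMA T : {T. T \<subseteq> {..<?M} \<and> T \<noteq> {} \<and> card T \<le> t0}. {U. U \<subseteq> {..<R} \<and> card U = 4 * card T})"
  define S where "S U = {v. v < ?M \<and> v div q \<in> U}" for U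
  have finI: "finite I"
    unfolding I_def by (rule finite_SigmaI) auto
  have cardS: "card (S U) \<le> q * card U" if "U \<subseteq> {..<R}" for U
  proof -
    have finU: "finite U" using that finite_subset by blast
    have "S U \<subseteq> (\<Union>u\<in>U. {q * u..<q * u + q})"
      using q by (auto simp: S_def) (metis add.commute add_less_mono1 atLeastLessThan_iff div_mult_mod_eq le_add1 mod_less_divisor mult.commute nat_add_left_cancel_less)
    then have "card (S U) \<le> card (\<Union>u\<in>U. {q * u..<q * u + q})"
      by (intro card_mono) (auto simp: finU)
    also have "\<dots> \<le> (\<Sum>u\<in>U. card {q * u..<q * u + q})" by (rule card_UN_le[OF finU])
    finally show ?thesis by (simp add: mult.commute)
  qed
  have Mpos: "0 < ?M" using q R by simp
  let ?w = "\<lambda>t. ((real (4 * q * t) / real ?M) ^ t) ^ 6"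
  \<comment> \<open>the probability that some set of size \<open>t\<close> has its neighbours in a set of size \<open>4 * t\<close>\<close>
  have tm: "real (?M choose t) * real (R choose (4 * t)) * ?w t \<le> (1 / 4) ^ t"
    if t: "1 \<le> t" "t \<le> t0" for t
  proof -
    have f1: "real t ^ t / 4 ^ t \<le> fact t" using power_self_le_fact[of t] by (simp add: field_simps)
    have f2: "real t ^ (4 * t) \<le> fact (4 * t)"
      using power_self_le_fact[of "4 * t"] by (simp add: power_mult_distrib)
    have c1: "real (?M choose t) \<le> real ?M ^ t / (real t ^ t / 4 ^ t)"
      using f1 t by (intro order_trans[OF choose_le_power_div_fact divide_left_mono]) auto
    have c2: "real (R choose (4 * t)) \<le> real R ^ (4 * t) / real t ^ (4 * t)"
      using f2 t by (intro order_trans[OF choose_le_power_div_fact divide_left_mono]) auto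
    have "real (?M choose t) * real (R choose (4 * t)) * ?w t
       \<le> (real ?M ^ t / (real t ^ t / 4 ^ t)) * (real R ^ (4 * t) / real t ^ (4 * t)) * ?w t"
      using c1 c2 by (intro mult_right_mono mult_mono) auto
    also have "\<dots> = ((real ?M / (real t / 4)) * (real R / real t) ^ 4 * (real (4 * q * t) / real ?M) ^ 6) ^ t"
      by (simp add: power_mult_distrib power_divide power_mult[symmetric] mult.commute)
    also have "(real ?M / (real t / 4)) * (real R / real t) ^ 4 * (real (4 * q * t) / real ?M) ^ 6
        = 4 ^ 7 * real q ^ 2 * real t / real ?M"
      using t q R by (simp add: field_simps power_divide eval_nat_numeral)
    also have "(4 ^ 7 * real q ^ 2 * real t / real ?M) ^ t \<le> (1 / 4) ^ t"
    proof (rule power_mono)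
      have "4 ^ 8 * q\<^sup>2 * t \<le> ?M" using t0 t(2) by (meson le_trans mult_le_mono2)
      then have "real (4 ^ 8 * q\<^sup>2 * t) \<le> real ?M" by (rule of_nat_mono)
      then show "4 ^ 7 * real q ^ 2 * real t / real ?M \<le> 1 / 4" using Mpos by (simp add: field_simps)
    qed simp
    finally show ?thesis .
  qed
  have "(\<Sum>i\<in>I. ((real (card (S (snd i))) / real ?M) ^ card (fst i)) ^ 6)
     \<le> (\<Sum>i\<in>I. ?w (card (fst i)))"
  proof (rule sum_mono)
    fix i assume "i \<in> I"
    then have U: "snd i \<subseteq> {..<R}" "card (snd i) = 4 * card (fst i)" by (auto simp: I_def)
    show "((real (card (S (snd i))) / real ?M) ^ card (fst i)) ^ 6 \<le> ?w (card (fst i))"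
      using cardS[OF U(1)] U(2) by (intro power_mono divide_right_mono of_nat_mono) auto
  qed
  also have "\<dots> = (\<Sum>T | T \<subseteq> {..<?M} \<and> T \<noteq> {} \<and> card T \<le> t0. real (R choose (4 * card T)) * ?w (card T))"
  proof -
    have "(\<Sum>i\<in>I. ?w (card (fst i))) = (\<Sum>T | T \<subseteq> {..<?M} \<and> T \<noteq> {} \<and> card T \<le> t0.
        \<Sum>U | U \<subseteq> {..<R} \<and> card U = 4 * card T. ?w (card T))"
      unfolding I_def by (subst sum.Sigma) (auto simp: case_prod_beta)
    then show ?thesis by (simp add: n_subsets)
  qed
  also have "\<dots> = (\<Sum>t\<in>{1..t0}. \<Sum>T | T \<in> {T. T \<subseteq> {..<?M} \<and> T \<noteq> {} \<and> card T \<le> t0} \<and> card T = t. real (R choose (4 * card T)) * ?w (card T))"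
  proof (rule sum.group[symmetric])
    show "card ` {T. T \<subseteq> {..<?M} \<and> T \<noteq> {} \<and> card T \<le> t0} \<subseteq> {1..t0}"
      by (auto simp: Suc_le_eq card_gt_0_iff dest: finite_subset[OF _ finite_lessThan])
  qed auto
  also have "\<dots> \<le> (\<Sum>t\<in>{1..t0}. (1 / 4) ^ t)"
  proof (rule sum_mono)
    fix t assume t: "t \<in> {1..t0}"
    have eq: "{T. T \<in> {T. T \<subseteq> {..<?M} \<and> T \<noteq> {} \<and> card T \<le> t0} \<and> card T = t} = {T. T \<subseteq> {..<?M} \<and> card T = t}"
      using t by auto
    have "(\<Sum>T | T \<subseteq> {..<?M} \<and> card T = t. real (R choose (4 * card T)) * ?w (card T))
      = real (card {T. T \<subseteq> {..<?M} \<and> card T = t}) * (real (R choose (4 * t)) * ?w t)"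
      by simp
    also have "card {T. T \<subseteq> {..<?M} \<and> card T = t} = (?M choose t)" using n_subsets[of "{..<?M}" t] by simp
    also have "real \<dots> * (real (R choose (4 * t)) * ?w t) \<le> (1 / 4) ^ t"
      unfolding mult.assoc[symmetric] by (rule tm[unfolded mult.assoc[symmetric]]) (use t in auto)
    finally show "(\<Sum>T | T \<in> {T. T \<subseteq> {..<?M} \<and> T \<noteq> {} \<and> card T \<le> t0} \<and> card T = t. real (R choose (4 * card T)) * ?w (card T)) \<le> (1 / 4) ^ t"
      unfolding eq .
  qed
  also have "\<dots> = (\<Sum>t\<in>{0..<Suc t0}. (1 / 4) ^ t) - (1::real)"
    by (subst sum.atLeast_Suc_lessThan) (auto simp: atLeastLessThanSuc_atLeastAtMost)
  also have "\<dots> < 1" by (simp add: geometric_sum atLeast0LessThan del: lessThan_Suc power_Suc sum.lessThan_Suc) (simp add: field_simps add_pos_pos)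
  finally have less: "(\<Sum>i\<in>I. ((real (card (S (snd i))) / real ?M) ^ card (fst i)) ^ 6) < 1" .
  have "\<exists>p. (\<forall>a<6::nat. p a permutes {..<?M}) \<and> (\<forall>i\<in>I. \<exists>a<6. \<not> p a ` fst i \<subseteq> S (snd i))"
    by (rule ex_permutations_avoiding[OF finI Mpos _ _ less]) (auto simp: I_def S_def)
  then obtain p where
    p': "\<forall>a<6::nat. p a permutes {..<?M}" and av': "\<forall>i\<in>I. \<exists>a<6::nat. \<not> p a ` fst i \<subseteq> S (snd i)"
    by (elim exE conjE)
  note p = p'[rule_format] and av = bspec[OF av']
  have "4 * card T \<le> card (\<Union>a<6. (\<lambda>v. p a v div q) ` T)"
    if T: "T \<subseteq> {..<?M}" "T \<noteq> {}" "card T \<le> t0" for T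
  proof (rule ccontr)
    let ?N = "\<Union>a<6. (\<lambda>v. p a v div q) ` T"
    assume "\<not> 4 * card T \<le> card ?N"
    then have small: "card ?N \<le> 4 * card T" by simp
    have inM: "p a v < ?M" if "a < 6" "v \<in> T" for a v
      using permutes_in_image[OF p[OF that(1)], of v] T(1) that(2) by auto
    have NR: "?N \<subseteq> {..<R}"
      using inM by (auto simp: less_mult_imp_div_less mult.commute)
    have "4 * card T \<le> R"
    proof -
      have "q * (4 ^ 8 * q * t0) \<le> q * R"
        using t0 unfolding power2_eq_square by (simp only: ac_simps)
      then have "65536 * (q * t0) \<le> R" using q by simp
      moreover have "t0 \<le> q * t0" using q by simp
      ultimately have "4 * t0 \<le> R" by linarith
      then show ?thesis using T(3) by linarith
    qed
    then obtain U where U: "?N \<subseteq> U" "U \<subseteq> {..<R}" "card U = 4 * card T"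
      using exists_subset_between[OF small _ NR] by auto
    then have "(T, U) \<in> I" using T by (auto simp: I_def)
    from av[OF this] obtain a v where v: "a < 6" "v \<in> T" "p a v \<notin> S U" by auto
    then have "p a v div q \<in> U" using U(1) by blast
    then show False using inM[OF v(1,2)] v(3) by (simp add: S_def)
  qed
  with p' show ?thesis by metis
qed

text \<open>Boundedly many permutations among which, for any two sets of density at least \<open>\<gamma>\<close>, one maps a point of the first set
  into the second.\<close>

lemma ex_crossing_permutations:
  fixes \<gamma> :: real
  assumes \<gamma>: "0 < \<gamma>"
  shows "\<exists>d::nat. \<forall>M>0. \<exists>p. (\<forall>a<d. p a permutes {..<M}) \<and>
    (\<forall>A B. A \<subseteq> {..<M} \<longrightarrow> B \<subseteq> {..<M} \<longrightarrow> \<gamma> * real M \<le> real (card A) \<longrightarrow> \<gamma> * real M \<le> real (card B) \<longrightarrow>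
       (\<exists>a<d. \<exists>v\<in>A. p a v \<in> B))"
proof -
  define d where "d = nat \<lceil>2 / \<gamma>\<^sup>2\<rceil>"
  have d: "2 \<le> \<gamma>\<^sup>2 * real d"
  proof -
    have "2 / \<gamma>\<^sup>2 \<le> real d" unfolding d_def by linarith
    then show ?thesis using \<gamma> by (simp add: field_simps)
  qed
  have "\<exists>p. (\<forall>a<d. p a permutes {..<M}) \<and>
    (\<forall>A B. A \<subseteq> {..<M} \<longrightarrow> B \<subseteq> {..<M} \<longrightarrow> \<gamma> * real M \<le> real (card A) \<longrightarrow> \<gamma> * real M \<le> real (card B) \<longrightarrow>
       (\<exists>a<d. \<exists>v\<in>A. p a v \<in> B))" if M: "0 < M" for M :: nat
  proof -
    let ?F = "{A. A \<subseteq> {..<M} \<and> \<gamma> * real M \<le> real (card A)}"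
    let ?S = "\<lambda>i. {..<M} - snd i"
    have finF: "finite ?F" by simp
    have fin: "finite (?F \<times> ?F)" by simp
    have bound: "((real (card (?S i)) / real M) ^ card (fst i)) ^ d \<le> exp (- 2 * real M)"
      if i: "i \<in> ?F \<times> ?F" for i
    proof -
      have A: "fst i \<subseteq> {..<M}" "\<gamma> * real M \<le> real (card (fst i))"
        and B: "snd i \<subseteq> {..<M}" "\<gamma> * real M \<le> real (card (snd i))" using i by auto
      have cB: "card (snd i) \<le> M" using card_mono[OF _ B(1)] by simp
      have "card (?S i) = M - card (snd i)"
        using B by (subst card_Diff_subset) (auto intro: finite_subset)
      then have "real (card (?S i)) = real M - real (card (snd i))" using cB by simp
      then have "real (card (?S i)) / real M \<le> 1 - \<gamma>"
        using B M by (simp add: field_simps)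
      also have "\<dots> \<le> exp (- \<gamma>)" using exp_ge_add_one_self[of "-\<gamma>"] by simp
      finally have "((real (card (?S i)) / real M) ^ card (fst i)) ^ d \<le> (exp (- \<gamma>) ^ card (fst i)) ^ d"
        by (intro power_mono) auto
      also have "\<dots> = exp (- (\<gamma> * real (card (fst i)) * real d))"
        by (simp add: exp_of_nat_mult[symmetric] ac_simps)
      also have "\<dots> \<le> exp (- (\<gamma> * (\<gamma> * real M) * real d))"
        using A \<gamma> by (simp add: mult_right_mono)
      also have "\<dots> \<le> exp (- 2 * real M)"
        using mult_right_mono[OF d, of "real M"] by (simp add: power2_eq_square ac_simps)
      finally show ?thesis .
    qed
    have "card ?F \<le> card (Pow {..<M})" by (intro card_mono) auto
    then have cF: "card ?F \<le> 2 ^ M" by (simp add: card_Pow)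
    have "(\<Sum>i\<in>?F \<times> ?F. ((real (card (?S i)) / real M) ^ card (fst i)) ^ d) \<le> (\<Sum>i\<in>?F \<times> ?F. exp (- 2 * real M))"
      by (rule sum_mono) (rule bound)
    also have "\<dots> = real (card ?F) * real (card ?F) * exp (- 2 * real M)"
      by (simp add: card_cartesian_product)
    also have "\<dots> \<le> 2 ^ M * 2 ^ M * exp (- 2 * real M)"
    proof -
      have "real (card ?F) \<le> 2 ^ M" using of_nat_mono[OF cF, where 'a = real] by simp
      then show ?thesis by (intro mult_right_mono mult_mono) auto
    qed
    also have "\<dots> = (4 * exp (- 2)) ^ M"
      by (simp add: power_mult_distrib exp_of_nat_mult[symmetric] ac_simps flip: power_mult_distrib)
    also have "\<dots> < 1"
    proof -
      have "(2::real) < exp 1" using exp_lower_Taylor_quadratic[of "1::real"] by simp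
      then have "2 * 2 < exp (1::real) * exp 1" by (intro mult_strict_mono) auto
      then have "4 < exp (2::real)" by (simp add: exp_add[symmetric])
      then have "4 * exp (- 2) < (1::real)" by (simp add: exp_minus field_simps)
      then show ?thesis using M by (intro power_less_one_iff[THEN iffD2]) auto
    qed
    finally have less: "(\<Sum>i\<in>?F \<times> ?F. ((real (card (?S i)) / real M) ^ card (fst i)) ^ d) < 1" .
    have "\<exists>p. (\<forall>a<d. p a permutes {..<M}) \<and> (\<forall>i\<in>?F \<times> ?F. \<exists>a<d. \<not> p a ` fst i \<subseteq> ?S i)"
      by (rule ex_permutations_avoiding[OF fin M _ _ less]) auto
    then obtain p where
      p': "\<forall>a<d. p a permutes {..<M}" and av': "\<forall>i\<in>?F \<times> ?F. \<exists>a<d. \<not> p a ` fst i \<subseteq> ?S i"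
      by (elim exE conjE)
    note p = p'[rule_format] and av = bspec[OF av']
    have "\<exists>a<d. \<exists>v\<in>A. p a v \<in> B" if "A \<in> ?F" "B \<in> ?F" for A B
    proof -
      from that have "(A, B) \<in> ?F \<times> ?F" by blast
      from av[OF this] obtain a where a: "a < d" "\<not> p a ` A \<subseteq> {..<M} - B"
        unfolding fst_conv snd_conv by (elim exE conjE)
      then obtain v where av: "a < d" "v \<in> A" "p a v \<notin> {..<M} - B"
        unfolding image_subset_iff by blast
      then have "p a v < M" using permutes_in_image[OF p[OF av(1)], of v] that by auto
      then show ?thesis using av by auto
    qed
    with p' show ?thesis by (intro exI[of _ p]) auto
  qed
  then show ?thesis by (intro exI[of _ d] allI impI)
qed

section \<open>Linear-size CNOT encoders of good codes\<close>

text \<open>Bit vectors of all lengths have one type; the entries beyond the length are zero (see \<open>supported\<close>).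
  On the type of bits, addition and multiplication are kept as ring operations.\<close>
type_synonym bvec = "nat \<Rightarrow> bit"

declare add_bit_eq_xor [simp del] mult_bit_eq_and [simp del]

lemma bit_add_self [simp]: "(b::bit) + b = 0" by (cases b) auto
lemma bit_add_self_left [simp]: "(b::bit) + (b + c) = c" by (cases b; cases c) auto
lemma bit_not_zero_eq: "(b::bit) \<noteq> 0 \<longleftrightarrow> b = 1" by (cases b) auto

text \<open>A CNOT gate is a pair of a control and a target wire; \<open>cx\<close> and \<open>cxs\<close> are the actions of a gate and of a list of gates,
  the first gate being applied first.\<close>

definition cx :: "nat \<times> nat \<Rightarrow> bvec \<Rightarrow> bvec" where
  "cx g x = x(snd g := x (snd g) + x (fst g))"

definition cxs :: "(nat \<times> nat) list \<Rightarrow> bvec \<Rightarrow> bvec" where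
  "cxs = fold cx"

definition wires :: "(nat \<times> nat) list \<Rightarrow> nat list" where
  "wires l = concat (map (\<lambda>(c, t). [c, t]) l)"

text \<open>A CNOT circuit on \<open>m\<close> wires is a list of layers, each acting on pairwise distinct wires.\<close>

definition cx_circuit :: "nat \<Rightarrow> (nat \<times> nat) list list \<Rightarrow> bool" where
  "cx_circuit m ls \<longleftrightarrow> (\<forall>l\<in>set ls. distinct (wires l) \<and> set (wires l) \<subseteq> {..<m})"

definition relabel :: "(nat \<Rightarrow> nat) \<Rightarrow> (nat \<times> nat) list list \<Rightarrow> (nat \<times> nat) list list" where
  "relabel f = map (map (map_prod f f))"

lemma cxs_simps [simp]: "cxs [] x = x" "cxs (g # gs) x = cxs gs (cx g x)" "cxs (gs @ hs) x = cxs hs (cxs gs x)"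
  by (simp_all add: cxs_def)

lemma cxs_add: "cxs gs (x + y) = cxs gs x + cxs gs y"
proof (induction gs arbitrary: x y)
  case (Cons g gs)
  have "cx g (x + y) = cx g x + cx g y" by (auto simp: cx_def fun_eq_iff ac_simps)
  then show ?case by (simp only: cxs_simps Cons.IH)
qed simp

lemma cxs_no_control_target:
  assumes "\<And>g h. g \<in> set gs \<Longrightarrow> h \<in> set gs \<Longrightarrow> fst g \<noteq> snd h"
  shows "cxs gs x q = x q + (\<Sum>g\<leftarrow>gs. if snd g = q then x (fst g) else 0)"
  using assms
proof (induction gs arbitrary: x)
  case (Cons g gs)
  have IH: "cxs gs (cx g x) q = cx g x q + (\<Sum>h\<leftarrow>gs. if snd h = q then cx g x (fst h) else 0)"
    using Cons.prems by (intro Cons.IH) auto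
  have "cx g x (fst h) = x (fst h)" if "h \<in> set gs" for h
    using Cons.prems[of h g] that by (auto simp: cx_def)
  then have "(\<Sum>h\<leftarrow>gs. if snd h = q then cx g x (fst h) else 0) = (\<Sum>h\<leftarrow>gs. if snd h = q then x (fst h) else 0)"
    by (intro arg_cong[where f = sum_list] map_cong) auto
  then show ?case using IH by (auto simp: cx_def ac_simps)
qed simp

lemma cxs_not_target: "q \<notin> snd ` set gs \<Longrightarrow> cxs gs x q = x q"
  by (induction gs arbitrary: x) (auto simp: cx_def)

lemma wires_Cons: "wires (g # l) = fst g # snd g # wires l"
  by (simp add: wires_def case_prod_beta)

lemma set_wires: "set (wires l) = fst ` set l \<union> snd ` set l"
  by (induction l) (auto simp: wires_def)

lemma cx_circuitD:
  assumes "cx_circuit m ls" "g \<in> set (concat ls)"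
  shows "fst g < m" "snd g < m"
  using assms by (force simp: cx_circuit_def set_wires)+

lemma cx_circuit_append [simp]: "cx_circuit m (ls @ ms) \<longleftrightarrow> cx_circuit m ls \<and> cx_circuit m ms"
  by (auto simp: cx_circuit_def)

lemma wires_map: "wires (map (map_prod f f) l) = map f (wires l)"
  by (induction l) (auto simp: wires_def)

lemma relabel_circuit:
  assumes "cx_circuit m ls" "inj_on f {..<m}" "f ` {..<m} \<subseteq> {..<m'}"
  shows "cx_circuit m' (relabel f ls)"
  using assms unfolding cx_circuit_def relabel_def
  by (fastforce simp: wires_map distinct_map intro: inj_on_subset)

lemma length_relabel [simp]: "length (relabel f ls) = length ls" "length (concat (relabel f ls)) = length (concat ls)"
  by (simp_all add: relabel_def length_concat comp_def)

lemma cxs_relabel: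
  assumes "\<And>g. g \<in> set gs \<Longrightarrow> fst g < m \<and> snd g < m" "inj_on f {..<m}" "p < m"
  shows "cxs (map (map_prod f f) gs) x (f p) = cxs gs (\<lambda>p. x (f p)) p"
proof -
  have "\<forall>p<m. cxs (map (map_prod f f) gs) x (f p) = cxs gs y p" if "\<forall>p<m. x (f p) = y p" for x y
    using that assms(1)
  proof (induction gs arbitrary: x y)
    case (Cons g gs)
    have g: "fst g < m" "snd g < m" using Cons.prems(2)[of g] by auto
    have "f p = f (snd g) \<longleftrightarrow> p = snd g" if "p < m" for p
      using assms(2) g(2) that by (simp add: inj_on_eq_iff)
    then have "\<forall>p<m. cx (map_prod f f g) x (f p) = cx g y p"
      using Cons.prems(1) g by (simp add: cx_def)
    then show ?case using Cons.IH Cons.prems by simp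
  qed simp
  then show ?thesis using assms(3) by simp
qed

lemma cxs_relabel_outside: "q \<notin> f ` {..<m} \<Longrightarrow> (\<And>g. g \<in> set gs \<Longrightarrow> snd g < m) \<Longrightarrow> cxs (map (map_prod f f) gs) x q = x q"
  by (rule cxs_not_target) auto

text \<open>A non-zero linear form on bit masks of length \<open>n\<close> takes the value \<open>1\<close> on half of them.\<close>

lemma card_parity_masks:
  fixes g :: "nat \<Rightarrow> bit"
  assumes a0: "a0 < n" "g a0 \<noteq> 0"
  shows "card {i::nat. i < 2 ^ n \<and> (\<Sum>a<n. if bit i a then g a else 0) = 1} = 2 ^ (n - 1)"
proof -
  let ?f = "\<lambda>i::nat. \<Sum>a<n. if bit i a then g a else 0"
  let ?A = "\<lambda>c. {i. i < 2 ^ n \<and> ?f i = c}"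
  have less: "flip_bit a0 i < 2 ^ n" if "i < 2 ^ n" for i :: nat
    using that a0 by (metis take_bit_flip_bit_eq take_bit_nat_eq_self take_bit_nat_less_exp leD linorder_not_le)
  have flip: "?f (flip_bit a0 i) = ?f i + 1" for i :: nat
  proof -
    have "?f (flip_bit a0 i) = (\<Sum>a<n. (if bit i a then g a else 0) + (if a = a0 then g a0 else 0))"
      using a0 by (intro sum.cong) (auto simp: bit_flip_bit_iff)
    then show ?thesis using a0 by (simp add: sum.distrib bit_not_zero_eq)
  qed
  have inv: "flip_bit a0 (flip_bit a0 i) = i" for i :: nat
    by (rule bit_eqI) (auto simp: bit_flip_bit_iff)
  have "bij_betw (flip_bit a0) (?A 0) (?A 1)"
  proof (rule bij_betw_byWitness[where f' = "flip_bit a0"])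
    show "flip_bit a0 ` ?A 0 \<subseteq> ?A 1" by (intro image_subsetI CollectI) (simp only: less flip mem_Collect_eq, simp)
    show "flip_bit a0 ` ?A 1 \<subseteq> ?A 0" by (intro image_subsetI CollectI) (simp only: less flip mem_Collect_eq, simp)
  qed (simp_all only: inv simp_thms ball_triv)
  then have eq: "card (?A 0) = card (?A 1)" by (rule bij_betw_same_card)
  have split: "{..<2 ^ n} = ?A 0 \<union> ?A 1" using bit_not_zero_eq by auto
  have "card {..<2 ^ n :: nat} = card (?A 0) + card (?A 1)"
    unfolding split by (rule card_Un_disjoint) auto
  then have "2 ^ n = card (?A 0) + card (?A 1)" by simp
  then have "2 ^ n = 2 * card (?A 1)" using eq by (simp only: mult_2)
  moreover have "(2::nat) ^ n = 2 * 2 ^ (n - 1)" using a0 by (cases n) auto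
  ultimately show ?thesis by linarith
qed

definition code_wt :: "nat \<Rightarrow> bvec \<Rightarrow> nat" where
  "code_wt m x = card {p. p < m \<and> x p \<noteq> 0}"

lemma code_wt_pos:
  assumes "\<forall>q\<ge>n. x q = 0" "x \<noteq> 0" "n \<le> m"
  shows "1 \<le> code_wt m x"
proof -
  from assms(2) obtain q where q: "x q \<noteq> 0" by (auto simp: fun_eq_iff)
  have "q < m"
  proof (rule ccontr)
    assume "\<not> q < m"
    then have "n \<le> q" using assms(3) by simp
    then show False using assms(1) q by blast
  qed
  then have "q \<in> {q. q < m \<and> x q \<noteq> 0}" using q by blast
  then have "0 < card {q. q < m \<and> x q \<noteq> 0}" by (intro card_gt_0_iff[THEN iffD2]) auto
  then show ?thesis by (simp add: code_wt_def)
qed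

text \<open>The circuit encodes the \<open>n\<close> message bits, placed on the first wires, into \<open>m\<close> bits; every non-zero message is mapped to
  a word of weight at least \<open>d\<close>.\<close>

definition good_encoder :: "nat \<Rightarrow> nat \<Rightarrow> nat \<Rightarrow> (nat \<times> nat) list list \<Rightarrow> bool" where
  "good_encoder n m d V \<longleftrightarrow> cx_circuit m V \<and>
    (\<forall>x. (\<forall>p\<ge>n. x p = 0) \<longrightarrow> x \<noteq> 0 \<longrightarrow> d \<le> code_wt m (cxs (concat V) x))"

text \<open>A set of which six times the size counts the edges, but which has at least four times as many neighbours, has a neighbour
  that is met by a single edge.\<close>

lemma unique_neighbour:
  fixes p :: "nat \<Rightarrow> nat \<Rightarrow> nat"
  assumes fin: "finite T" and ne: "T \<noteq> {}" and ex: "4 * card T \<le> card (\<Union>a<6. (\<lambda>v. p a v div q) ` T)"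
  shows "\<exists>a0<6. \<exists>v0\<in>T. \<forall>a<6. \<forall>v\<in>T. p a v div q = p a0 v0 div q \<longrightarrow> a = a0 \<and> v = v0"
proof (rule ccontr)
  assume no: "\<not> ?thesis"
  let ?E = "{..<6::nat} \<times> T" and ?h = "\<lambda>(a, v). p a v div q"
  let ?N = "\<Union>a<6. (\<lambda>v. p a v div q) ` T"
  have N: "?N = ?h ` ?E" by force
  have finE: "finite ?E" using fin by simp
  have two: "2 \<le> card {e\<in>?E. ?h e = r}" if r: "r \<in> ?h ` ?E" for r
  proof -
    obtain a0 v0 where e: "a0 < 6" "v0 \<in> T" "r = p a0 v0 div q" using r by auto
    with no obtain a v where e': "a < 6" "v \<in> T" "p a v div q = r" "(a, v) \<noteq> (a0, v0)" by blast
    have "card {(a, v), (a0, v0)} \<le> card {e\<in>?E. ?h e = r}"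
      using e e' finE by (intro card_mono) auto
    then show ?thesis using e'(4) by simp
  qed
  have "2 * (4 * card T) \<le> 2 * card (?h ` ?E)" using ex unfolding N by simp
  also have "\<dots> = (\<Sum>r\<in>?h ` ?E. 2)" by simp
  also have "\<dots> \<le> (\<Sum>r\<in>?h ` ?E. card {e\<in>?E. ?h e = r})" by (rule sum_mono) (rule two)
  also have "\<dots> = card ?E" using sum.image_gen[OF finE, of "\<lambda>_. 1::nat" ?h, symmetric] by (simp only: card_eq_sum)
  finally have "8 * card T \<le> 6 * card T" by (simp add: card_cartesian_product)
  then show False using fin ne by (simp add: card_gt_0_iff)
qed

lemma sum_list_map_concat: "sum_list (map f (concat xss)) = (\<Sum>xs\<leftarrow>xss. \<Sum>x\<leftarrow>xs. f x)"
  by (induction xss) auto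

lemma sum_list_upt: "(\<Sum>i\<leftarrow>[0..<n]. f i) = (\<Sum>i<n. f i)"
  by (simp add: interv_sum_list_conv_sum_set_nat atLeast0LessThan)

lemma distinct_wires_map:
  assumes "distinct vs" "inj_on f (set vs)" "inj_on g (set vs)" "\<And>v v'. v \<in> set vs \<Longrightarrow> v' \<in> set vs \<Longrightarrow> f v \<noteq> g v'"
  shows "distinct (wires (map (\<lambda>v. (f v, g v)) vs))"
  using assms
proof (induction vs)
  case (Cons v vs)
  have IH: "distinct (wires (map (\<lambda>v. (f v, g v)) vs))"
    using Cons.prems by (intro Cons.IH) (auto simp: inj_on_def)
  have "f v \<notin> f ` set vs" "g v \<notin> g ` set vs"
    using Cons.prems(1-3) by (auto simp: inj_on_def)
  moreover have "f v \<notin> g ` set vs" "g v \<notin> f ` set vs" "f v \<noteq> g v"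
    using Cons.prems(4) by force+
  ultimately show ?case using IH
    by (simp add: wires_Cons set_wires image_image)
qed (simp add: wires_def)

lemma add_mult_add_eq_iff:
  fixes b i j m s s' :: nat
  assumes "s < m" "s' < m"
  shows "b + i * m + s = b + j * m + s' \<longleftrightarrow> i = j \<and> s = s'"
proof
  assume "b + i * m + s = b + j * m + s'"
  then have eq: "s + i * m = s' + j * m" by simp
  have "i = (s + i * m) div m" using assms by simp
  also have "\<dots> = j" unfolding eq using assms by simp
  finally show "i = j \<and> s = s'" using eq by simp
qed simp

text \<open>The recursion. The \<open>128 * w\<close> message bits are summed along an expander into \<open>w\<close> bits, these are encoded by
  \<open>V'\<close> into \<open>2 * w\<close> bits, and the result is spread along a second expander over \<open>126 * w\<close> further
  wires. A message of weight at least \<open>128 * t\<close> is itself heavy. A lighter non-zero message has a unique neighbour,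
  so the input of \<open>V'\<close> is non-zero and its output has weight at least \<open>t\<close>; the second expander then reaches
  \<open>4 * t\<close> positions \<open>s\<close>, and for each of them the sums over the subsets of the six edges at \<open>s\<close> (a subset for each of
  the masks \<open>1 \<le> i < 64\<close>) contribute \<open>32\<close> ones. The size grows by a bounded multiple of \<open>w\<close>, the
  depth by a constant.\<close>

lemma good_encoder_step:
  fixes w t :: nat
  assumes w: "0 < w" and cw: "2 ^ 30 * t \<le> w" and V': "good_encoder w (2 * w) t V'"
  shows "\<exists>V. good_encoder (128 * w) (256 * w) (128 * t) V \<and>
    length (concat V) \<le> 100000 * w + length (concat V') \<and> length V \<le> 1200 + length V'"
proof -
  have "\<exists>p. (\<forall>a<6::nat. p a permutes {..<128 * w}) \<and>
    (\<forall>T. T \<subseteq> {..<128 * w} \<longrightarrow> T \<noteq> {} \<longrightarrow> card T \<le> 128 * t \<longrightarrow>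
       4 * card T \<le> card (\<Union>a<6. (\<lambda>v. p a v div 128) ` T))"
    using w cw by (intro ex_expanding_permutations) auto
  then obtain p where p: "\<forall>a<6::nat. p a permutes {..<128 * w}" and
    p_exp: "\<forall>T. T \<subseteq> {..<128 * w} \<longrightarrow> T \<noteq> {} \<longrightarrow> card T \<le> 128 * t \<longrightarrow>
       4 * card T \<le> card (\<Union>a<6. (\<lambda>v. p a v div 128) ` T)"
    by (elim exE conjE)
  have "\<exists>\<rho>. (\<forall>a<6::nat. \<rho> a permutes {..<1 * (2 * w)}) \<and>
    (\<forall>T. T \<subseteq> {..<1 * (2 * w)} \<longrightarrow> T \<noteq> {} \<longrightarrow> card T \<le> t \<longrightarrow>
       4 * card T \<le> card (\<Union>a<6. (\<lambda>v. \<rho> a v div 1) ` T))"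
    using w cw by (intro ex_expanding_permutations) auto
  then obtain \<rho> where \<rho>: "\<forall>a<6::nat. \<rho> a permutes {..<2 * w}" and
    \<rho>_exp: "\<forall>T. T \<subseteq> {..<2 * w} \<longrightarrow> T \<noteq> {} \<longrightarrow> card T \<le> t \<longrightarrow>
       4 * card T \<le> card (\<Union>a<6. \<rho> a ` T)"
    unfolding mult_1 div_by_1 by (elim exE conjE)
  have p_less: "p a v < 128 * w" if "a < 6" "v < 128 * w" for a v
    using permutes_in_image[of "p a" "{..<128 * w}" v] p that by auto
  have \<rho>_less: "\<rho> a v < 2 * w" if "a < 6" "v < 2 * w" for a v
    using permutes_in_image[of "\<rho> a" "{..<2 * w}" v] \<rho> that by auto
  have p_inj: "p a v = p a v' \<longleftrightarrow> v = v'" if "a < 6" for a v v'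
    using permutes_inj[of "p a"] p that by (auto dest: injD)
  have \<rho>_inj: "\<rho> a v = \<rho> a v' \<longleftrightarrow> v = v'" if "a < 6" for a v v'
    using permutes_inj[of "\<rho> a"] \<rho> that by (auto dest: injD)

  \<comment> \<open>the gates of one permutation have distinct controls; those with a fixed residue of the image modulo \<open>128\<close> also
    have distinct targets, so they form a layer\<close>
  define La where "La a c = map (\<lambda>v. (v, 128 * w + p a v div 128)) (filter (\<lambda>v. p a v mod 128 = c) [0..<128 * w])" for a c
  define A where "A = concat (map (\<lambda>a. map (La a) [0..<128]) [0..<6])"
  define Lb where "Lb i a = map (\<lambda>r. (128 * w + r, 128 * w + i * (2 * w) + \<rho> a r)) [0..<2 * w]" for i a
  \<comment> \<open>block \<open>i\<close> of length \<open>2 * w\<close> receives the sum over the edges in the mask \<open>i\<close>; block \<open>0\<close> holds the output of \<open>V'\<close>\<close>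
  define B where "B = concat (map (\<lambda>i. map (Lb i) (filter (\<lambda>a. bit i a) [0..<6])) [1..<64::nat])"
  define V where "V = A @ relabel (\<lambda>q. 128 * w + q) V' @ B"

  have circV': "cx_circuit (2 * w) V'" using V' by (simp add: good_encoder_def)
  have setA: "l \<in> set A \<longleftrightarrow> (\<exists>a<6. \<exists>c<128. l = La a c)" for l
    unfolding A_def by force
  have setB: "l \<in> set B \<longleftrightarrow> (\<exists>i a. 1 \<le> i \<and> i < 64 \<and> a < 6 \<and> bit i a \<and> l = Lb i a)" for l
    unfolding B_def by force
  have A_wires: "fst g < 128 * w" "128 * w \<le> snd g" "snd g < 129 * w" if "g \<in> set (concat A)" for g
  proof -
    from that obtain a c where "a < 6" "g \<in> set (La a c)" by (auto simp: setA)
    moreover have "p a v div 128 < w" if "a < 6" "v < 128 * w" for a v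
      using p_less[OF that] by (simp add: less_mult_imp_div_less mult.commute)
    ultimately show "fst g < 128 * w" "128 * w \<le> snd g" "snd g < 129 * w" by (auto simp: La_def)
  qed
  have B_less: "128 * w + i * (2 * w) + s < 256 * w" if "i < 64" "s < 2 * w" for i s :: nat
  proof -
    have "i * (2 * w) \<le> 63 * (2 * w)" using that by (intro mult_le_mono1) simp
    then show ?thesis using that by linarith
  qed
  have B_ge: "130 * w \<le> 128 * w + i * (2 * w) + s" if "1 \<le> i" for i s :: nat
  proof -
    have "1 * (2 * w) \<le> i * (2 * w)" using that by (intro mult_le_mono1)
    then show ?thesis by linarith
  qed
  have B_wires: "128 * w \<le> fst g" "fst g < 130 * w" "130 * w \<le> snd g" "snd g < 256 * w" if "g \<in> set (concat B)" for g
  proof -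
    from that obtain i a where i: "1 \<le> i" "i < 64" "a < 6" "g \<in> set (Lb i a)" by (auto simp: setB)
    then obtain r where r: "r < 2 * w" "g = (128 * w + r, 128 * w + i * (2 * w) + \<rho> a r)" by (auto simp: Lb_def)
    show "128 * w \<le> fst g" "fst g < 130 * w" "130 * w \<le> snd g" "snd g < 256 * w"
      using r i B_less[of i "\<rho> a r"] B_ge[of i "\<rho> a r"] \<rho>_less[of a r] by simp_all
  qed

  have "cx_circuit (256 * w) A"
    unfolding cx_circuit_def
  proof (intro ballI conjI)
    fix l assume l: "l \<in> set A"
    show "set (wires l) \<subseteq> {..<256 * w}"
      using A_wires l by (fastforce simp: set_wires)
    from l obtain a c where ac: "a < 6" "l = La a c" by (auto simp: setA)
    have eq: "p a v = p a v'" if "p a v mod 128 = c" "p a v' mod 128 = c" "p a v div 128 = p a v' div 128" for v v'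
      using that by (metis div_mod_decomp)
    have inj: "v = v'" if "p a v mod 128 = c" "p a v' mod 128 = c" "p a v div 128 = p a v' div 128" for v v'
      by (rule p_inj[OF ac(1), THEN iffD1, OF eq[OF that]])
    show "distinct (wires l)"
      unfolding ac La_def
    proof (rule distinct_wires_map)
      show "inj_on (\<lambda>v. 128 * w + p a v div 128) (set (filter (\<lambda>v. p a v mod 128 = c) [0..<128 * w]))"
        by (rule inj_onI, rule inj) simp_all
    qed auto
  qed
  moreover have "cx_circuit (256 * w) (relabel (\<lambda>q. 128 * w + q) V')"
    using circV' by (rule relabel_circuit) auto
  moreover have "cx_circuit (256 * w) B"
    unfolding cx_circuit_def
  proof (intro ballI conjI)
    fix l assume l: "l \<in> set B"
    show "set (wires l) \<subseteq> {..<256 * w}"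
      using B_wires l by (fastforce simp: set_wires)
    from l obtain i a where ia: "1 \<le> i" "a < 6" "l = Lb i a" by (auto simp: setB)
    have "128 * w + r \<noteq> 128 * w + i * (2 * w) + \<rho> a r'" if "r < 2 * w" for r r'
      using B_ge[OF ia(1), of "\<rho> a r'"] that by linarith
    then show "distinct (wires l)"
      unfolding ia Lb_def
    proof (intro distinct_wires_map)
      show "inj_on (\<lambda>r. 128 * w + i * (2 * w) + \<rho> a r) (set [0..<2 * w])"
        by (rule inj_onI) (simp add: \<rho>_inj[OF ia(2)])
    qed (auto intro: inj_onI)
  qed
  ultimately have circ: "cx_circuit (256 * w) V" by (simp add: V_def)

  have lenLa: "length (La a c) \<le> 128 * w" for a c
    using length_filter_le[of _ "[0..<128 * w]"] by (simp add: La_def)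
  have sum_le: "(\<Sum>l\<leftarrow>ls. length l) \<le> length ls * k" if "\<And>l. l \<in> set ls \<Longrightarrow> length l \<le> k" for ls :: "(nat \<times> nat) list list" and k
    using that by (induction ls) (auto intro: add_mono)
  have lenA: "length A = 768" by (simp add: A_def length_concat comp_def sum_list_triv)
  have lenB: "length B \<le> 378"
  proof -
    have "length B = (\<Sum>i\<leftarrow>[1..<64::nat]. length (filter (\<lambda>a. bit i a) [0..<6]))"
      by (simp add: B_def length_concat comp_def)
    also have "\<dots> \<le> (\<Sum>i\<leftarrow>[1..<64::nat]. 6)"
      by (rule sum_list_mono) (metis length_filter_le length_upt diff_zero)
    finally show ?thesis by (simp add: sum_list_triv)
  qed
  have "length (concat A) \<le> 768 * (128 * w)"
    using sum_le[of A "128 * w"] lenLa lenA by (auto simp: length_concat setA)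
  moreover have "length (concat B) \<le> 378 * (2 * w)"
  proof -
    have "length (concat B) \<le> length B * (2 * w)"
      unfolding length_concat by (rule sum_le) (auto simp: setB Lb_def)
    also have "\<dots> \<le> 378 * (2 * w)" using lenB by (rule mult_le_mono1)
    finally show ?thesis .
  qed
  ultimately have len: "length (concat V) \<le> 100000 * w + length (concat V')"
    by (simp add: V_def)
  have lenV: "length V \<le> 1200 + length V'" using lenA lenB by (simp add: V_def)

  have wt: "128 * t \<le> code_wt (256 * w) (cxs (concat V) x)"
    if x0: "\<forall>q\<ge>128 * w. x q = 0" and x: "x \<noteq> 0" for x
  proof -
    define y where "y = cxs (concat A) x"
    define z where "z = cxs (concat (relabel (\<lambda>q. 128 * w + q) V')) y"
    define f where "f = cxs (concat B) z"
    have f: "cxs (concat V) x = f" by (simp add: V_def f_def z_def y_def)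
    have rel: "concat (relabel (\<lambda>q. 128 * w + q) V') = map (map_prod (\<lambda>q. 128 * w + q) (\<lambda>q. 128 * w + q)) (concat V')"
      by (simp add: relabel_def map_concat)
    have f_low: "f q = z q" if "q < 130 * w" for q
      unfolding f_def using B_wires(3) that by (intro cxs_not_target) fastforce
    have z_out: "z q = y q" if "q < 128 * w \<or> 130 * w \<le> q" for q
      unfolding z_def rel using that
      by (intro cxs_relabel_outside[where m = "2 * w"] cx_circuitD(2)[OF circV']) auto
    have y_out: "y q = x q" if "q < 128 * w \<or> 129 * w \<le> q" for q
      unfolding y_def using A_wires(2,3) that by (intro cxs_not_target) fastforce
    have f_x: "f q = x q" if "q < 128 * w" for q
      using f_low[of q] z_out[of q] y_out[of q] that by simp
    have z_high: "z q = 0" if "130 * w \<le> q" for q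
      using z_out[of q] y_out[of q] x0 that by simp
    define SA where "SA r = (\<Sum>a<6. \<Sum>v<128 * w. if p a v div 128 = r then x v else 0)" for r
    have y_mid: "y (128 * w + r) = SA r" for r
    proof -
      have "y (128 * w + r) = x (128 * w + r) + (\<Sum>g\<leftarrow>concat A. if snd g = 128 * w + r then x (fst g) else 0)"
        unfolding y_def using A_wires by (intro cxs_no_control_target) fastforce
      also have "(\<Sum>g\<leftarrow>concat A. if snd g = 128 * w + r then x (fst g) else 0)
        = (\<Sum>a<6. \<Sum>c<128. \<Sum>v | v \<in> {..<128 * w} \<and> p a v mod 128 = c. if p a v div 128 = r then x v else 0)"
        unfolding A_def sum_list_map_concat by (simp add: comp_def sum_list_map_concat sum_list_upt La_def
            sum_list_distinct_conv_sum_set lessThan_def cong del: if_weak_cong)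
      also have "\<dots> = SA r"
        unfolding SA_def by (intro sum.cong refl sum.group) auto
      finally show ?thesis using x0 by simp
    qed
    define G where "G s a = (\<Sum>r<2 * w. if \<rho> a r = s then z (128 * w + r) else 0)" for s a
    have f_high: "f (128 * w + i * (2 * w) + s) = (\<Sum>a<6. if bit i a then G s a else 0)"
      if i: "1 \<le> i" "i < 64" and s: "s < 2 * w" for i s
    proof -
      let ?q = "128 * w + i * (2 * w) + s"
      have "f ?q = z ?q + (\<Sum>g\<leftarrow>concat B. if snd g = ?q then z (fst g) else 0)"
        unfolding f_def using B_wires by (intro cxs_no_control_target) fastforce
      also have "z ?q = 0" using B_ge[OF i(1)] by (rule z_high)
      also have "(\<Sum>g\<leftarrow>concat B. if snd g = ?q then z (fst g) else 0)
        = (\<Sum>j\<in>{1..<64::nat}. \<Sum>a | a \<in> {..<6} \<and> bit j a. \<Sum>r<2 * w. if 128 * w + j * (2 * w) + \<rho> a r = ?q then z (128 * w + r) else 0)"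
        unfolding B_def sum_list_map_concat by (simp add: comp_def sum_list_map_concat sum_list_upt Lb_def
            sum_list_distinct_conv_sum_set lessThan_def cong del: if_weak_cong)
      also have "\<dots> = (\<Sum>j\<in>{1..<64::nat}. \<Sum>a | a \<in> {..<6} \<and> bit j a. if j = i then G s a else 0)"
      proof (intro sum.cong refl)
        fix j a :: nat assume a: "a \<in> {a. a \<in> {..<6} \<and> bit j a}"
        have "128 * w + j * (2 * w) + \<rho> a r = ?q \<longleftrightarrow> j = i \<and> \<rho> a r = s" if r: "r < 2 * w" for r
          by (rule add_mult_add_eq_iff) (use a r s \<rho>_less in auto)
        then show "(\<Sum>r<2 * w. if 128 * w + j * (2 * w) + \<rho> a r = ?q then z (128 * w + r) else 0) = (if j = i then G s a else 0)"
          by (auto simp: G_def intro!: sum.cong)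
      qed
      also have "\<dots> = (\<Sum>j\<in>{1..<64::nat}. if j = i then (\<Sum>a | a \<in> {..<6} \<and> bit i a. G s a) else 0)"
        by (intro sum.cong refl) simp
      also have "\<dots> = (\<Sum>a | a \<in> {..<6} \<and> bit i a. G s a)"
        by (subst sum.delta) (use i in simp_all)
      also have "\<dots> = (\<Sum>a<6. if bit i a then G s a else 0)"
        by (rule sum.inter_filter) simp
      finally show ?thesis by simp
    qed
    let ?T = "{q. q < 128 * w \<and> x q \<noteq> 0}"
    have finT: "finite ?T" by simp
    show ?thesis
    proof (cases "128 * t \<le> card ?T")
      case True
      also have "card ?T \<le> code_wt (256 * w) f"
        unfolding code_wt_def using f_x by (intro card_mono) auto
      finally show ?thesis by (simp add: f)
    next
      case False
      have neT: "?T \<noteq> {}"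
      proof -
        from x obtain q where "x q \<noteq> 0" by (auto simp: fun_eq_iff)
        then have "q \<in> ?T" using x0 by (metis (mono_tags, lifting) linorder_not_le mem_Collect_eq)
        then show ?thesis by blast
      qed
      have "4 * card ?T \<le> card (\<Union>a<6. (\<lambda>v. p a v div 128) ` ?T)"
        using p_exp[rule_format, of ?T] neT False by auto
      from unique_neighbour[OF finT neT this] obtain a0 v0 where
        u: "a0 < 6" "v0 < 128 * w" "x v0 \<noteq> 0" and
        uniq: "\<And>a v. a < 6 \<Longrightarrow> v < 128 * w \<Longrightarrow> x v \<noteq> 0 \<Longrightarrow> p a v div 128 = p a0 v0 div 128 \<Longrightarrow> a = a0 \<and> v = v0"
        by blast
      define r where "r = p a0 v0 div 128"
      have "SA r = (\<Sum>a<6. \<Sum>v<128 * w. if v = v0 then (if a = a0 then x v0 else 0) else 0)"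
        unfolding SA_def
      proof (intro sum.cong refl)
        fix a v assume "a \<in> {..<6::nat}" "v \<in> {..<128 * w}"
        then show "(if p a v div 128 = r then x v else 0) = (if v = v0 then (if a = a0 then x v0 else 0) else 0)"
          using uniq[of a v] by (cases "x v = 0") (auto simp: r_def)
      qed
      also have "\<dots> = x v0" using u by simp
      finally have SA: "SA r \<noteq> 0" using u by simp
      define e where "e q = y (128 * w + q)" for q
      have "\<forall>q\<ge>w. e q = 0" unfolding e_def using y_out x0 by simp
      moreover have "e \<noteq> 0" using y_mid[of r] SA by (auto simp: e_def fun_eq_iff)
      ultimately have heavy: "t \<le> code_wt (2 * w) (cxs (concat V') e)"
        using V' by (simp add: good_encoder_def)
      have z_mid: "z (128 * w + q) = cxs (concat V') e q" if "q < 2 * w" for q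
        unfolding z_def rel e_def
        by (rule cxs_relabel[where m = "2 * w"]) (use that cx_circuitD[OF circV'] in auto)
      have "t \<le> card {q. q < 2 * w \<and> z (128 * w + q) \<noteq> 0}"
        using heavy z_mid unfolding code_wt_def by (metis (mono_tags, lifting) Collect_cong)
      then obtain T where T: "T \<subseteq> {q. q < 2 * w \<and> z (128 * w + q) \<noteq> 0}" "card T = t"
        by (meson obtain_subset_with_card_n)
      define S where "S = (\<Union>a<6. \<rho> a ` T)"
      have S: "4 * t \<le> card S"
      proof (cases "T = {}")
        case True
        then show ?thesis using T by simp
      next
        case False
        then show ?thesis using \<rho>_exp[rule_format, of T] T unfolding S_def by auto
      qed
      have S_less: "s < 2 * w" if "s \<in> S" for s
        using that T(1) \<rho>_less by (auto simp: S_def)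
      have finS: "finite S" using S_less by (meson finite_lessThan finite_subset lessThan_iff subsetI)
      have G: "\<exists>a<6. G s a \<noteq> 0" if s: "s \<in> S" for s
      proof -
        from s obtain a q where a: "a < 6" "q \<in> T" "s = \<rho> a q" by (auto simp: S_def)
        have "G s a = (\<Sum>r<2 * w. if r = q then z (128 * w + q) else 0)"
          unfolding G_def a(3) \<rho>_inj[OF a(1)] by (intro sum.cong) auto
        also have "\<dots> = z (128 * w + q)" using a(2) T(1) by auto
        also have "\<dots> \<noteq> 0" using a(2) T(1) by blast
        finally show ?thesis using a(1) by blast
      qed
      define M where "M s = {i::nat. i < 64 \<and> (\<Sum>a<6. if bit i a then G s a else 0) = 1}" for s
      have cardM: "card (M s) = 32" if "s \<in> S" for s
      proof -
        from G[OF that] obtain a where a: "a < 6" "G s a \<noteq> 0" by blast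
        then show ?thesis using card_parity_masks[of a 6 "G s"] by (simp add: M_def)
      qed
      have M_pos: "1 \<le> i" if "i \<in> M s" for i s
        using that by (cases i) (auto simp: M_def)
      let ?h = "\<lambda>(s, i). 128 * w + i * (2 * w) + s"
      have "inj_on ?h (Sigma S M)"
      proof (rule inj_onI, clarify)
        fix s i s' i' assume si: "s \<in> S" "s' \<in> S" and eq: "128 * w + i * (2 * w) + s = 128 * w + i' * (2 * w) + s'"
        show "s = s' \<and> i = i'"
          using eq add_mult_add_eq_iff[OF S_less[OF si(1)] S_less[OF si(2)], of "128 * w" i i'] by blast
      qed
      then have "card (?h ` Sigma S M) = card (Sigma S M)" by (rule card_image)
      also have "\<dots> = card S * 32"
        using finS cardM by (subst card_SigmaI) (auto simp: M_def)
      finally have "128 * t \<le> card (?h ` Sigma S M)" using S by simp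
      also have "\<dots> \<le> code_wt (256 * w) f"
        unfolding code_wt_def
      proof (rule card_mono)
        show "?h ` Sigma S M \<subseteq> {q. q < 256 * w \<and> f q \<noteq> 0}"
        proof clarify
          fix s i assume si: "s \<in> S" "i \<in> M s"
          then have "i < 64" "(\<Sum>a<6. if bit i a then G s a else 0) = 1" by (auto simp: M_def)
          then show "128 * w + i * (2 * w) + s < 256 * w \<and> f (128 * w + i * (2 * w) + s) \<noteq> 0"
            using f_high[OF M_pos[OF si(2)] _ S_less[OF si(1)]] B_less[OF _ S_less[OF si(1)]] by simp
        qed
      qed simp
      finally show ?thesis by (simp add: f)
    qed
  qed
  show ?thesis
    using circ wt len lenV by (intro exI[of _ V]) (simp add: good_encoder_def)
qed

text \<open>While \<open>k \<le> 5\<close>, the minimum weight \<open>128 ^ (k - 5)\<close> is \<open>1\<close> and the empty circuit suffices; from then on the density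
  required by \<open>good_encoder_step\<close> is available.\<close>

theorem ex_good_encoders:
  "\<exists>V. good_encoder (128 ^ k) (2 * 128 ^ k) (128 ^ (k - 5)) V \<and>
    length (concat V) \<le> 1000 * 128 ^ k \<and> length V \<le> 1200 * k"
proof (induction k)
  case 0
  have "1 \<le> code_wt 2 x" if "\<forall>q\<ge>1. x q = 0" "x \<noteq> 0" for x
    using that by (rule code_wt_pos) simp
  then show ?case by (intro exI[of _ "[]"]) (simp add: good_encoder_def cx_circuit_def)
next
  case (Suc k)
  show ?case
  proof (cases "5 \<le> k")
    case True
    from Suc obtain V' where V': "good_encoder (128 ^ k) (2 * 128 ^ k) (128 ^ (k - 5)) V'"
      "length (concat V') \<le> 1000 * 128 ^ k" "length V' \<le> 1200 * k" by blast
    have "(128::nat) ^ k = 128 ^ 5 * 128 ^ (k - 5)" using power_add[of "128::nat" 5 "k - 5"] True by simp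
    moreover have "(2::nat) ^ 30 \<le> 128 ^ 5" by simp
    ultimately have "2 ^ 30 * 128 ^ (k - 5) \<le> (128::nat) ^ k" by (simp only: mult_le_mono1)
    from good_encoder_step[OF _ this V'(1)] obtain V where V: "good_encoder (128 * 128 ^ k) (256 * 128 ^ k) (128 * 128 ^ (k - 5)) V"
      "length (concat V) \<le> 100000 * 128 ^ k + length (concat V')" "length V \<le> 1200 + length V'" by auto
    show ?thesis
      unfolding Suc_diff_le[OF True] using V V' by (intro exI[of _ V]) simp
  next
    case False
    have "1 \<le> code_wt (2 * 128 ^ Suc k) x" if "\<forall>q\<ge>128 ^ Suc k. x q = 0" "x \<noteq> 0" for x
      using that by (rule code_wt_pos) simp
    then show ?thesis using False by (intro exI[of _ "[]"]) (simp add: good_encoder_def cx_circuit_def)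
  qed
qed

section \<open>Separating families of symmetric forms\<close>

text \<open>The elementary symmetric bilinear forms; a diagonal pair stands for the form \<open>x\<^sub>q * y\<^sub>q\<close>.\<close>
definition pair_form :: "nat \<times> nat \<Rightarrow> bvec \<Rightarrow> bvec \<Rightarrow> bit" where
  "pair_form g x y = (if fst g = snd g then x (fst g) * y (fst g)
     else x (fst g) * y (snd g) + x (snd g) * y (fst g))"

definition pair_wires :: "(nat \<times> nat) list \<Rightarrow> nat list" where
  "pair_wires l = concat (map (\<lambda>g. if fst g = snd g then [fst g] else [fst g, snd g]) l)"

definition pair_layers :: "nat \<Rightarrow> (nat \<times> nat) list list \<Rightarrow> bool" where
  "pair_layers m ls \<longleftrightarrow> (\<forall>l\<in>set ls. distinct (pair_wires l) \<and> set (pair_wires l) \<subseteq> {..<m})"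

text \<open>A plan is a list of pairs \<open>(W, E)\<close>: a CNOT circuit \<open>W\<close> and layers \<open>E\<close> of index pairs. It describes the symmetric forms
  \<open>(x, y) \<mapsto> pair_form g (W x) (W y)\<close> for \<open>g\<close> in \<open>E\<close>. Size and depth count \<open>W\<close> twice, since it is undone after \<open>E\<close>.\<close>

type_synonym plan = "((nat \<times> nat) list list \<times> (nat \<times> nat) list list) list"

definition plan_ok :: "nat \<Rightarrow> plan \<Rightarrow> bool" where
  "plan_ok N pl \<longleftrightarrow> (\<forall>(W, E)\<in>set pl. cx_circuit N W \<and> pair_layers N E)"

definition plan_size :: "plan \<Rightarrow> nat" where
  "plan_size pl = (\<Sum>(W, E)\<leftarrow>pl. 2 * length (concat W) + length (concat E))"

definition plan_depth :: "plan \<Rightarrow> nat" where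
  "plan_depth pl = (\<Sum>(W, E)\<leftarrow>pl. 2 * length W + length E)"

definition supported :: "nat \<Rightarrow> bvec \<Rightarrow> bool" where
  "supported N x \<longleftrightarrow> (\<forall>q\<ge>N. x q = 0)"

text \<open>Any two non-zero vectors are paired to \<open>1\<close> by one of the forms.\<close>

definition separating :: "nat \<Rightarrow> plan \<Rightarrow> bool" where
  "separating N pl \<longleftrightarrow> (\<forall>x y. supported N x \<longrightarrow> supported N y \<longrightarrow> x \<noteq> 0 \<longrightarrow> y \<noteq> 0 \<longrightarrow>
    (\<exists>(W, E)\<in>set pl. \<exists>g\<in>set (concat E). pair_form g (cxs (concat W) x) (cxs (concat W) y) = 1))"

lemma set_pair_wires: "set (pair_wires l) = fst ` set l \<union> snd ` set l"
  by (induction l) (auto simp: pair_wires_def)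

lemma pair_wires_eq_wires: "(\<And>g. g \<in> set l \<Longrightarrow> fst g \<noteq> snd g) \<Longrightarrow> pair_wires l = wires l"
  by (induction l) (auto simp: pair_wires_def wires_def)

lemma pair_wires_diag: "pair_wires (map (\<lambda>q. (q, q)) qs) = qs"
  by (induction qs) (auto simp: pair_wires_def)

lemma supported_nonzero:
  assumes "supported N x" "x \<noteq> 0"
  obtains q where "q < N" "x q = 1"
proof -
  from assms(2) obtain q where "x q \<noteq> 0" by (auto simp: fun_eq_iff)
  then have "q < N" "x q = 1" using assms(1) by (auto simp: supported_def not_le[symmetric])
  then show ?thesis by (rule that)
qed

text \<open>All elementary forms together separate; this quadratic plan is used for the finitely many small \<open>N\<close>.\<close>

lemma ex_small_plan:
  assumes "1 \<le> N"
  shows "\<exists>pl. plan_ok N pl \<and> separating N pl \<and> plan_size pl \<le> N * N \<and> plan_depth pl \<le> N * N"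
proof -
  define ps where "ps = concat (map (\<lambda>p. map (\<lambda>q. [(p, q)]) [0..<N]) [0..<N])"
  have set_ps: "set ps = {[(p, q)] | p q. p < N \<and> q < N}"
    by (auto simp: ps_def)
  have len: "length ps = N * N"
    by (simp add: ps_def length_concat comp_def sum_list_triv)
  have len1: "length (concat ls) = length ls" if "\<forall>l\<in>set ls. length l = 1" for ls :: "(nat \<times> nat) list list"
    using that by (induction ls) auto
  then have len': "length (concat ps) = N * N" using len by (subst len1) (auto simp: set_ps)
  have "\<exists>g\<in>set (concat ps). pair_form g x y = 1"
    if xy: "supported N x" "supported N y" "x \<noteq> 0" "y \<noteq> 0" for x y
  proof -
    have "\<exists>p<N. \<exists>q<N. pair_form (p, q) x y = 1"
    proof (rule ccontr)
      assume no: "\<not> ?thesis"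
      obtain p where p: "p < N" "x p = 1" using xy by (auto elim: supported_nonzero)
      have *: "y q = x q * y p" if q: "q < N" "q \<noteq> p" for q
      proof -
        have "pair_form (p, q) x y \<noteq> 1" using no p q by blast
        then show ?thesis using p q by (cases "y q"; cases "x q"; cases "y p") (auto simp: pair_form_def)
      qed
      have "pair_form (p, p) x y \<noteq> 1" using no p by blast
      then have "y p = 0" using p by (simp add: pair_form_def)
      obtain q where q: "q < N" "y q = 1" using xy by (auto elim: supported_nonzero)
      then show False using *[of q] \<open>y p = 0\<close> by (cases "q = p") auto
    qed
    then obtain p q where pq: "p < N" "q < N" "pair_form (p, q) x y = 1" by blast
    have "(p, q) \<in> set (concat ps)" using pq(1,2) by (simp add: ps_def)
    then show ?thesis using pq(3) by blast
  qed
  then have "separating N [([], ps)]" by (simp add: separating_def)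
  moreover have "plan_ok N [([], ps)]"
    unfolding plan_ok_def by (auto simp: set_ps cx_circuit_def pair_layers_def pair_wires_def)
  ultimately show ?thesis
    using len len' by (intro exI[of _ "[([], ps)]"]) (simp add: plan_size_def plan_depth_def)
qed

lemma cxs_zero [simp]: "cxs gs 0 = 0"
proof (induction gs)
  case (Cons g gs)
  have "cx g 0 = 0" by (auto simp: cx_def fun_eq_iff)
  then show ?case by (simp only: cxs_simps Cons.IH)
qed simp

lemma cong_cxs:
  assumes "\<And>g. g \<in> set gs \<Longrightarrow> fst g < m \<and> snd g < m" "\<And>p. p < m \<Longrightarrow> x p = y p" "p < m"
  shows "cxs gs x p = cxs gs y p"
proof -
  have "\<forall>p<m. cxs gs x p = cxs gs y p" if "\<forall>p<m. x p = y p" for x y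
    using that assms(1)
  proof (induction gs arbitrary: x y)
    case (Cons g gs)
    have "\<forall>p<m. cx g x p = cx g y p" using Cons.prems(1) Cons.prems(2)[of g] by (simp add: cx_def)
    then show ?case using Cons.IH Cons.prems by simp
  qed simp
  then show ?thesis using assms by blast
qed

lemma cxs_copy:
  assumes "inj_on f {..<m}" "n \<le> m" "\<And>p. p < n \<Longrightarrow> c p \<notin> f ` {..<m}"
  shows "p < m \<Longrightarrow> cxs (map (\<lambda>p. (c p, f p)) [0..<n]) x (f p) = x (f p) + (if p < n then x (c p) else 0)"
    and "q \<notin> f ` {..<m} \<Longrightarrow> cxs (map (\<lambda>p. (c p, f p)) [0..<n]) x q = x q"
proof -
  have "cxs (map (\<lambda>p. (c p, f p)) [0..<n]) x q = x q + (\<Sum>g\<leftarrow>map (\<lambda>p. (c p, f p)) [0..<n]. if snd g = q then x (fst g) else 0)" for q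
    using assms by (intro cxs_no_control_target) fastforce
  then have eq: "cxs (map (\<lambda>p. (c p, f p)) [0..<n]) x q = x q + (\<Sum>p<n. if f p = q then x (c p) else 0)" for q
    by (simp add: comp_def sum_list_upt cong: if_cong)
  show "cxs (map (\<lambda>p. (c p, f p)) [0..<n]) x (f p) = x (f p) + (if p < n then x (c p) else 0)" if p: "p < m"
  proof -
    have "f r = f p \<longleftrightarrow> r = p" if "r < n" for r
      using assms(1,2) p that by (auto dest: inj_onD)
    then have "(\<Sum>r<n. if f r = f p then x (c r) else 0) = (\<Sum>r<n. if r = p then x (c r) else 0)"
      by (intro sum.cong) auto
    then show ?thesis unfolding eq by simp
  qed
  show "cxs (map (\<lambda>p. (c p, f p)) [0..<n]) x q = x q" if "q \<notin> f ` {..<m}"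
  proof -
    have "f p \<noteq> q" if "p < n" for p using \<open>q \<notin> f ` {..<m}\<close> assms(2) that by auto
    then show ?thesis unfolding eq by simp
  qed
qed

lemma bit_pair_det: "(a::bit) * d + b * c = 1 \<longleftrightarrow> (a, b) \<noteq> (0, 0) \<and> (c, d) \<noteq> (0, 0) \<and> (a, b) \<noteq> (c, d)"
  by (cases a; cases b; cases c; cases d) auto

text \<open>If the determinant of the added vectors \<open>(e, e')\<close> and \<open>(f, f')\<close> is \<open>1\<close>, then one of the four determinants obtained by
  adding them or not to arbitrary vectors is \<open>1\<close>: the sum of all four is the determinant of the added vectors.\<close>

lemma four_config:
  fixes t e t' e' u f u' f' :: bit
  assumes "e * f' + f * e' = 1"
  shows "\<exists>c1 c2. (t + (if c1 then e else 0)) * (u' + (if c2 then f' else 0)) + (u + (if c2 then f else 0)) * (t' + (if c1 then e' else 0)) = 1"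
  using assms
  by (cases t; cases e; cases t'; cases e'; cases u; cases f; cases u'; cases f')
     (simp_all add: ex_bool_eq split: if_splits)

text \<open>Windows of length \<open>n\<close> cover the \<open>N\<close> wires. For windows \<open>i\<close> and \<open>j\<close>, the circuits copy (or not) the two windows onto
  disjoint groups of \<open>m\<close> other wires and encode both groups; the forms pair the two groups along the crossing
  permutations. If \<open>x \<noteq> y\<close> are non-zero, then \<open>x\<close>, \<open>y\<close> and \<open>x + y\<close> are non-zero on some windows, where their code words
  are heavy; so two different non-zero values of the pair (bit of the code word of \<open>x\<close>, bit of the code word of \<open>y\<close>) are
  frequent in suitable windows, and some crossing permutation joins positions with these two values. The
  determinant of two different non-zero vectors of \<open>{0,1}\<^sup>2\<close> is \<open>1\<close>. The four choices of copying remove the influence of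
  the previous contents of the target wires (\<open>four_config\<close>). If \<open>x = y\<close>, a diagonal form is \<open>1\<close>.\<close>

lemma ex_large_plan:
  fixes N n m d D :: nat
  assumes n: "0 < n" and m: "m = 2 * n" and N: "6 * n \<le> N" "N < 768 * n"
    and V: "good_encoder n m d V"
    and pm: "\<forall>a<D. pm a permutes {..<m}"
    and cross: "\<And>A B. A \<subseteq> {..<m} \<Longrightarrow> B \<subseteq> {..<m} \<Longrightarrow> d \<le> 2 * card A \<Longrightarrow> d \<le> 2 * card B \<Longrightarrow> \<exists>a<D. \<exists>v\<in>A. pm a v \<in> B"
  shows "\<exists>pl. plan_ok N pl \<and> separating N pl \<and>
    plan_size pl \<le> N + 4 * 768 ^ 2 * (4 * n + 4 * length (concat V) + D * m) \<and>
    plan_depth pl \<le> 1 + 4 * 768 ^ 2 * (4 + 4 * length V + D)"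
proof -
  have circV: "cx_circuit m V" using V by (simp add: good_encoder_def)
  define nw where "nw = (768::nat)"
  \<comment> \<open>the last windows are shifted so as to end within the \<open>N\<close> wires\<close>
  define off where "off i = min (i * n) (N - n)" for i
  have off_le: "off i + n \<le> N" for i using N by (simp add: off_def)
  have covered: "\<exists>i<nw. \<exists>p<n. q = off i + p" if q: "q < N" for q
  proof (cases "q div n * n \<le> N - n")
    case True
    have "q div n < nw" using q N n by (simp add: nw_def less_mult_imp_div_less)
    moreover have "q = off (q div n) + q mod n" using True by (simp add: off_def)
    moreover have "q mod n < n" using n by simp
    ultimately show ?thesis by blast
  next
    case False
    have "q div n < nw" using q N n by (simp add: nw_def less_mult_imp_div_less)
    moreover have "q div n * n \<le> q" by simp
    then have "q = off (q div n) + (q - (N - n))" "q - (N - n) < n" using False q N n unfolding off_def by linarith+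
    ultimately show ?thesis by blast
  qed
  define inw where "inw i q \<longleftrightarrow> off i \<le> q \<and> q < off i + n" for i q
  define free where "free i j = filter (\<lambda>q. \<not> inw i q \<and> \<not> inw j q) [0..<N]" for i j
  have len_free: "2 * m \<le> length (free i j)" for i j
  proof -
    have "{0..<N} \<subseteq> set (free i j) \<union> ({off i..<off i + n} \<union> {off j..<off j + n})"
      by (auto simp: free_def inw_def)
    then have "card {0..<N} \<le> card (set (free i j) \<union> ({off i..<off i + n} \<union> {off j..<off j + n}))"
      by (rule card_mono[rotated]) simp
    also have "\<dots> \<le> card (set (free i j)) + (card {off i..<off i + n} + card {off j..<off j + n})"
      by (meson card_Un_le add_le_mono order_refl order_trans)
    also have "card (set (free i j)) = length (free i j)"
      by (rule distinct_card) (simp add: free_def)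
    finally show ?thesis using N m by simp
  qed
  define ta where "ta i j p = free i j ! p" for i j p
  define tb where "tb i j p = free i j ! (m + p)" for i j p
  have dist_free: "distinct (free i j)" for i j by (simp add: free_def)
  have inj_ta: "inj_on (ta i j) {..<m}" for i j
    using dist_free[of i j] len_free[of i j] by (auto simp: ta_def inj_on_def nth_eq_iff_index_eq)
  have inj_tb: "inj_on (tb i j) {..<m}" for i j
    using dist_free[of i j] len_free[of i j] by (auto simp: tb_def inj_on_def nth_eq_iff_index_eq)
  have ta_tb: "ta i j p \<noteq> tb i j q" if "p < m" "q < m" for i j p q
    using dist_free[of i j] len_free[of i j] that by (auto simp: ta_def tb_def nth_eq_iff_index_eq)
  have ta_free: "ta i j p \<in> set (free i j)" and tb_free: "tb i j p \<in> set (free i j)" if "p < m" for i j p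
    using len_free[of i j] that by (auto simp: ta_def tb_def)
  have free_N: "q < N" and free_w: "p < n \<Longrightarrow> off i + p \<noteq> q" "p < n \<Longrightarrow> off j + p \<noteq> q"
    if "q \<in> set (free i j)" for i j p q
    using that by (auto simp: free_def inw_def)
  define ca where "ca i j = map (\<lambda>p. (off i + p, ta i j p)) [0..<n]" for i j
  define cb where "cb i j = map (\<lambda>p. (off j + p, tb i j p)) [0..<n]" for i j
  define W where "W i j c1 c2 = (if c1 then [ca i j] else []) @ (if c2 then [cb i j] else []) @ relabel (ta i j) V @ relabel (tb i j) V" for i j c1 c2
  define E where "E i j = map (\<lambda>a. map (\<lambda>p. (ta i j p, tb i j (pm a p))) [0..<m]) [0..<D]" for i j
  define S where "S = (([] :: (nat \<times> nat) list list), [map (\<lambda>q. (q, q)) [0..<N]])"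
  define idx where "idx = List.product [0..<nw] (List.product [0..<nw] (List.product [False, True] [False, True]))"
  define pl where "pl = S # map (\<lambda>(i, j, c1, c2). (W i j c1 c2, E i j)) idx"
  have len_idx: "length idx = 4 * 768 ^ 2" by (simp add: idx_def nw_def power2_eq_square)

  have pm_less: "pm a p < m" if "a < D" "p < m" for a p
    using permutes_in_image[of "pm a" "{..<m}" p] pm that by auto
  have pm_inj: "pm a p = pm a p' \<longleftrightarrow> p = p'" if "a < D" for a p p'
    using permutes_inj[of "pm a"] pm that by (auto dest: injD)

  have layer: "distinct (wires (map (\<lambda>p. (c p, f p)) [0..<k]))" "set (wires (map (\<lambda>p. (c p, f p)) [0..<k])) \<subseteq> {..<N}"
    if "inj_on c {..<k}" "inj_on f {..<k}" "\<And>p q. p < k \<Longrightarrow> q < k \<Longrightarrow> c p \<noteq> f q" "\<And>p. p < k \<Longrightarrow> c p < N" "\<And>p. p < k \<Longrightarrow> f p < N" for c f k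
    using that by (auto simp: atLeast0LessThan set_wires intro!: distinct_wires_map)
  have "cx_circuit N (W i j c1 c2)" for i j c1 c2
  proof -
    have "cx_circuit N [ca i j]"
      unfolding ca_def cx_circuit_def using layer[of "\<lambda>p. off i + p" n "ta i j"] inj_ta[of i j] m ta_free[of _ i j] free_N[of _ i j] free_w(1)[of _ i j] off_le[of i]
      by (auto simp: inj_on_def)
    moreover have "cx_circuit N [cb i j]"
      unfolding cb_def cx_circuit_def using layer[of "\<lambda>p. off j + p" n "tb i j"] inj_tb[of i j] m tb_free[of _ i j] free_N[of _ i j] free_w(2)[of _ i j] off_le[of j]
      by (auto simp: inj_on_def)
    moreover have "cx_circuit N (relabel (ta i j) V)" "cx_circuit N (relabel (tb i j) V)"
      using circV inj_ta[of i j] inj_tb[of i j] ta_free[of _ i j] tb_free[of _ i j] free_N[of _ i j] by (auto intro!: relabel_circuit)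
    moreover have "cx_circuit N []" by (simp add: cx_circuit_def)
    ultimately show ?thesis by (simp only: W_def cx_circuit_append split: if_split) blast
  qed
  moreover have "pair_layers N (E i j)" for i j
    unfolding pair_layers_def
  proof
    fix l assume "l \<in> set (E i j)"
    then obtain a where a: "a < D" "l = map (\<lambda>p. (ta i j p, tb i j (pm a p))) [0..<m]" by (auto simp: E_def)
    have "pair_wires l = wires l"
      unfolding a using ta_tb pm_less a(1) by (intro pair_wires_eq_wires) auto
    moreover have "inj_on (\<lambda>p. tb i j (pm a p)) {..<m}"
    proof (rule inj_onI)
      fix p p' assume "p \<in> {..<m}" "p' \<in> {..<m}" "tb i j (pm a p) = tb i j (pm a p')"
      then have "pm a p = pm a p'" using inj_onD[OF inj_tb[of i j], of "pm a p" "pm a p'"] pm_less[OF a(1)] by auto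
      then show "p = p'" by (rule pm_inj[OF a(1), THEN iffD1])
    qed
    ultimately show "distinct (pair_wires l) \<and> set (pair_wires l) \<subseteq> {..<N}"
      unfolding a using layer[of "ta i j" m "\<lambda>p. tb i j (pm a p)"] inj_ta ta_tb pm_less[OF a(1)] ta_free[of _ i j] tb_free[of _ i j] free_N[of _ i j] by auto
  qed
  moreover have "pair_layers N (snd S)" by (simp add: S_def pair_layers_def pair_wires_diag atLeast0LessThan)
  moreover have "cx_circuit N (fst S)" by (simp add: S_def cx_circuit_def)
  ultimately have ok: "plan_ok N pl" by (auto simp: plan_ok_def pl_def S_def)

  have sum_le: "(\<Sum>t\<leftarrow>ts. g t) \<le> length ts * b" if "\<And>t. g t \<le> b" for g :: "'a \<Rightarrow> nat" and ts b
    using that by (induction ts) (auto intro: add_mono)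
  have size: "plan_size pl \<le> N + 4 * 768 ^ 2 * (4 * n + 4 * length (concat V) + D * m)"
  proof -
    have "(case (case t of (i, j, c1, c2) \<Rightarrow> (W i j c1 c2, E i j)) of (W, E) \<Rightarrow> 2 * length (concat W) + length (concat E))
       \<le> 4 * n + 4 * length (concat V) + D * m" for t
      by (cases t) (simp add: W_def E_def ca_def cb_def length_concat[of "map _ [0..<D]"] comp_def sum_list_triv)
    then have "(\<Sum>t\<leftarrow>idx. case (case t of (i, j, c1, c2) \<Rightarrow> (W i j c1 c2, E i j)) of (W, E) \<Rightarrow> 2 * length (concat W) + length (concat E))
       \<le> length idx * (4 * n + 4 * length (concat V) + D * m)" by (rule sum_le)
    moreover have "plan_size pl = N + (\<Sum>t\<leftarrow>idx. case (case t of (i, j, c1, c2) \<Rightarrow> (W i j c1 c2, E i j)) of (W, E) \<Rightarrow> 2 * length (concat W) + length (concat E))"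
      by (simp add: pl_def plan_size_def S_def comp_def)
    ultimately show ?thesis unfolding len_idx by linarith
  qed
  have depth: "plan_depth pl \<le> 1 + 4 * 768 ^ 2 * (4 + 4 * length V + D)"
  proof -
    have "(case (case t of (i, j, c1, c2) \<Rightarrow> (W i j c1 c2, E i j)) of (W, E) \<Rightarrow> 2 * length W + length E)
       \<le> 4 + 4 * length V + D" for t
      by (cases t) (simp add: W_def E_def)
    then have "(\<Sum>t\<leftarrow>idx. case (case t of (i, j, c1, c2) \<Rightarrow> (W i j c1 c2, E i j)) of (W, E) \<Rightarrow> 2 * length W + length E)
       \<le> length idx * (4 + 4 * length V + D)" by (rule sum_le)
    moreover have "plan_depth pl = 1 + (\<Sum>t\<leftarrow>idx. case (case t of (i, j, c1, c2) \<Rightarrow> (W i j c1 c2, E i j)) of (W, E) \<Rightarrow> 2 * length W + length E)"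
      by (simp add: pl_def plan_depth_def S_def comp_def)
    ultimately show ?thesis unfolding len_idx by linarith
  qed

  define win where "win i x p = (if p < n then x (off i + p) else 0)" for i and x :: bvec and p
  have Wa: "cxs (concat (W i j c1 c2)) x (ta i j p) = cxs (concat V) (\<lambda>p. x (ta i j p)) p + (if c1 then cxs (concat V) (win i x) p else 0)"
    and Wb: "cxs (concat (W i j c1 c2)) x (tb i j p) = cxs (concat V) (\<lambda>p. x (tb i j p)) p + (if c2 then cxs (concat V) (win j x) p else 0)"
    if p: "p < m" for i j c1 c2 x p
  proof -
    define y where "y = cxs (if c1 then ca i j else []) x"
    define z where "z = cxs (if c2 then cb i j else []) y"
    have W: "cxs (concat (W i j c1 c2)) x = cxs (map (map_prod (tb i j) (tb i j)) (concat V)) (cxs (map (map_prod (ta i j) (ta i j)) (concat V)) z)"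
      by (simp add: W_def z_def y_def relabel_def map_concat)
    note copy_a = cxs_copy[OF inj_ta[of i j], of n "\<lambda>p. off i + p", folded ca_def]
      and copy_b = cxs_copy[OF inj_tb[of i j], of n "\<lambda>p. off j + p", folded cb_def]
    have out_a: "off i + p \<notin> ta i j ` {..<m}" "off j + p \<notin> ta i j ` {..<m}"
      and out_b: "off i + p \<notin> tb i j ` {..<m}" "off j + p \<notin> tb i j ` {..<m}" if "p < n" for p
      using free_w[of _ i j p] ta_free[of _ i j] tb_free[of _ i j] that by blast+
    have tb_out: "tb i j p \<notin> ta i j ` {..<m}" if "p < m" for p
      using ta_tb[of _ p i j] that by (metis imageE lessThan_iff)
    have ta_out: "ta i j p \<notin> tb i j ` {..<m}" if "p < m" for p
      using ta_tb[of p _ i j] that by (metis imageE lessThan_iff)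
    have ya: "y (ta i j p) = x (ta i j p) + (if c1 then win i x p else 0)" if "p < m" for p
      using copy_a(1)[OF _ _ that] out_a(1) m by (auto simp: y_def win_def)
    have y_out: "y q = x q" if "q \<notin> ta i j ` {..<m}" for q
      using copy_a(2)[OF _ _ that] out_a(1) m by (auto simp: y_def)
    have yw: "win j y = win j x" using y_out[OF out_a(2)] by (auto simp: win_def fun_eq_iff)
    have zb: "z (tb i j p) = x (tb i j p) + (if c2 then win j x p else 0)" if "p < m" for p
      using copy_b(1)[OF _ _ that] out_b(2) m y_out[OF tb_out[OF that]] fun_cong[OF yw, of p] by (auto simp: z_def win_def)
    have z_out: "z q = y q" if "q \<notin> tb i j ` {..<m}" for q
      using copy_b(2)[OF _ _ that] out_b(2) m by (auto simp: z_def)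
    have za: "z (ta i j p) = x (ta i j p) + (if c1 then win i x p else 0)" if "p < m" for p
      using z_out[OF ta_out[OF that]] ya[OF that] by simp
    have loc: "cxs (concat V) u p = cxs (concat V) v p" if "\<And>p. p < m \<Longrightarrow> u p = v p" "p < m" for u v p
      using cx_circuitD[OF circV] that by (intro cong_cxs[where m = m]) auto
    have "cxs (concat (W i j c1 c2)) x (ta i j p) = cxs (map (map_prod (ta i j) (ta i j)) (concat V)) z (ta i j p)"
      unfolding W using ta_out[OF p] cx_circuitD(2)[OF circV] by (intro cxs_relabel_outside)
    also have "\<dots> = cxs (concat V) (\<lambda>p. z (ta i j p)) p"
      using cx_circuitD[OF circV] inj_ta p by (intro cxs_relabel[where m = m]) auto
    also have "\<dots> = cxs (concat V) ((\<lambda>p. x (ta i j p)) + (if c1 then win i x else 0)) p"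
      using p by (intro loc) (auto simp: za)
    also have "\<dots> = cxs (concat V) (\<lambda>p. x (ta i j p)) p + (if c1 then cxs (concat V) (win i x) p else 0)"
      by (simp add: cxs_add)
    finally show "cxs (concat (W i j c1 c2)) x (ta i j p) = cxs (concat V) (\<lambda>p. x (ta i j p)) p + (if c1 then cxs (concat V) (win i x) p else 0)" .
    have z': "cxs (map (map_prod (ta i j) (ta i j)) (concat V)) z (tb i j p) = z (tb i j p)" if "p < m" for p
      using tb_out[OF that] cx_circuitD(2)[OF circV] by (intro cxs_relabel_outside)
    have "cxs (concat (W i j c1 c2)) x (tb i j p) = cxs (concat V) (\<lambda>p. cxs (map (map_prod (ta i j) (ta i j)) (concat V)) z (tb i j p)) p"
      unfolding W using cx_circuitD[OF circV] inj_tb p by (intro cxs_relabel[where m = m]) auto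
    also have "\<dots> = cxs (concat V) ((\<lambda>p. x (tb i j p)) + (if c2 then win j x else 0)) p"
      using p by (intro loc) (auto simp: z' zb)
    also have "\<dots> = cxs (concat V) (\<lambda>p. x (tb i j p)) p + (if c2 then cxs (concat V) (win j x) p else 0)"
      by (simp add: cxs_add)
    finally show "cxs (concat (W i j c1 c2)) x (tb i j p) = cxs (concat V) (\<lambda>p. x (tb i j p)) p + (if c2 then cxs (concat V) (win j x) p else 0)" .
  qed

  have "\<exists>(W, E)\<in>set pl. \<exists>g\<in>set (concat E). pair_form g (cxs (concat W) x) (cxs (concat W) y) = 1"
    if xy: "supported N x" "supported N y" "x \<noteq> 0" "y \<noteq> 0" for x y
  proof (cases "x = y")
    case True
    from xy obtain q where "q < N" "x q = 1" by (auto elim: supported_nonzero)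
    then have "pair_form (q, q) x y = 1" "(q, q) \<in> set (concat (snd S))"
      using True by (auto simp: pair_form_def S_def)
    then show ?thesis unfolding pl_def S_def by force
  next
    case False
    define e where "e i = cxs (concat V) (win i x)" for i
    define f where "f i = cxs (concat V) (win i y)" for i
    \<comment> \<open>\<open>l\<close> is a frequent value of the pair of code word bits of \<open>x\<close> and \<open>y\<close> in some window\<close>
    define rich where "rich l \<longleftrightarrow> (\<exists>i<nw. d \<le> 2 * card {p. p < m \<and> (e i p, f i p) = l})" for l
    have win_nz: "\<exists>i<nw. win i u \<noteq> 0" if u: "supported N u" "u \<noteq> 0" for u
    proof -
      from u obtain q where q: "q < N" "u q = 1" by (rule supported_nonzero)
      then obtain i p where "i < nw" "p < n" "q = off i + p" using covered by blast
      then have "win i u p = 1" using q by (simp add: win_def)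
      then show ?thesis using \<open>i < nw\<close> by (auto simp: fun_eq_iff)
    qed
    have heavy: "d \<le> card {p. p < m \<and> cxs (concat V) (win i u) p \<noteq> 0}" if "win i u \<noteq> 0" for i u
      using V that unfolding good_encoder_def code_wt_def by (simp add: win_def)
    have two: "d \<le> 2 * card {p. p < m \<and> P p} \<or> d \<le> 2 * card {p. p < m \<and> Q p}"
      if "d \<le> card {p. p < m \<and> R p}" "\<And>p. R p \<Longrightarrow> P p \<or> Q p" for P Q R
    proof -
      have "card {p. p < m \<and> R p} \<le> card ({p. p < m \<and> P p} \<union> {p. p < m \<and> Q p})"
        using that(2) by (intro card_mono) auto
      also have "\<dots> \<le> card {p. p < m \<and> P p} + card {p. p < m \<and> Q p}" by (rule card_Un_le)
      finally show ?thesis using that(1) by linarith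
    qed
    obtain i where i: "i < nw" "win i x \<noteq> 0" using win_nz xy by blast
    have r1: "rich (1, 0) \<or> rich (1, 1)"
    proof -
      have "d \<le> 2 * card {p. p < m \<and> (e i p, f i p) = (1, 0)} \<or> d \<le> 2 * card {p. p < m \<and> (e i p, f i p) = (1, 1)}"
        by (rule two[OF heavy[OF i(2), folded e_def]]) (metis (full_types) bit_not_zero_iff)
      then show ?thesis using i(1) unfolding rich_def by blast
    qed
    obtain j where j: "j < nw" "win j y \<noteq> 0" using win_nz xy by blast
    have r2: "rich (0, 1) \<or> rich (1, 1)"
    proof -
      have "d \<le> 2 * card {p. p < m \<and> (e j p, f j p) = (0, 1)} \<or> d \<le> 2 * card {p. p < m \<and> (e j p, f j p) = (1, 1)}"
        by (rule two[OF heavy[OF j(2), folded f_def]]) (metis (full_types) bit_not_zero_iff)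
      then show ?thesis using j(1) unfolding rich_def by blast
    qed
    have "supported N (x + y)" using xy by (simp add: supported_def)
    moreover have "x + y \<noteq> 0"
    proof
      assume "x + y = 0"
      then have "x q + y q = 0" for q by (metis plus_fun_apply zero_fun_apply)
      then have "x q = y q" for q by (metis add.right_neutral bit_add_self_left)
      then show False using False by blast
    qed
    ultimately obtain k where k: "k < nw" "win k (x + y) \<noteq> 0" using win_nz by blast
    have "win k (x + y) = win k x + win k y" by (auto simp: win_def fun_eq_iff)
    then have ef: "cxs (concat V) (win k (x + y)) p = e k p + f k p" for p by (simp add: cxs_add e_def f_def)
    have r3: "rich (1, 0) \<or> rich (0, 1)"
    proof -
      have *: "(a, b) = (1, 0) \<or> (a, b) = (0, 1)" if "a + b \<noteq> 0" for a b :: bit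
        using that by (cases a; cases b) simp_all
      have "d \<le> 2 * card {p. p < m \<and> (e k p, f k p) = (1, 0)} \<or> d \<le> 2 * card {p. p < m \<and> (e k p, f k p) = (0, 1)}"
        by (rule two[OF heavy[OF k(2), unfolded ef]]) (rule *)
      then show ?thesis using k(1) unfolding rich_def by blast
    qed
    have ne: "(1, 0) \<noteq> ((0, 0) :: bit \<times> bit)" "(0, 1) \<noteq> ((0, 0) :: bit \<times> bit)" "(1, 1) \<noteq> ((0, 0) :: bit \<times> bit)"
      "(1, 0) \<noteq> ((0, 1) :: bit \<times> bit)" "(1, 0) \<noteq> ((1, 1) :: bit \<times> bit)" "(0, 1) \<noteq> ((1, 1) :: bit \<times> bit)" by simp_all
    from r1 r2 r3 obtain l l' where l: "rich l" "rich l'" "l \<noteq> (0, 0)" "l' \<noteq> (0, 0)" "l \<noteq> l'"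
      using ne by blast
    then obtain i j where ij: "i < nw" "j < nw" "d \<le> 2 * card {p. p < m \<and> (e i p, f i p) = l}" "d \<le> 2 * card {p. p < m \<and> (e j p, f j p) = l'}"
      unfolding rich_def by blast
    from cross[OF _ _ ij(3,4)] obtain a p where a: "a < D" "p < m" "(e i p, f i p) = l" "pm a p < m" "(e j (pm a p), f j (pm a p)) = l'"
      by auto
    let ?q = "pm a p"
    have "e i p * f j ?q + e j ?q * f i p = 1"
      using l a bit_pair_det[of "e i p" "f j ?q" "f i p" "e j ?q"] by (auto simp: mult.commute)
    from four_config[OF this, of "cxs (concat V) (\<lambda>p. x (ta i j p)) p" "cxs (concat V) (\<lambda>p. y (tb i j p)) ?q" "cxs (concat V) (\<lambda>p. x (tb i j p)) ?q" "cxs (concat V) (\<lambda>p. y (ta i j p)) p"]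
    obtain c1 c2 where c: "(cxs (concat V) (\<lambda>p. x (ta i j p)) p + (if c1 then e i p else 0)) * (cxs (concat V) (\<lambda>p. y (tb i j p)) ?q + (if c2 then f j ?q else 0))
        + (cxs (concat V) (\<lambda>p. x (tb i j p)) ?q + (if c2 then e j ?q else 0)) * (cxs (concat V) (\<lambda>p. y (ta i j p)) p + (if c1 then f i p else 0)) = 1"
      by blast
    have "pair_form (ta i j p, tb i j ?q) (cxs (concat (W i j c1 c2)) x) (cxs (concat (W i j c1 c2)) y) = 1"
      using ta_tb[OF a(2,4), of i j] c unfolding pair_form_def fst_conv snd_conv Wa[OF a(2)] Wb[OF a(4)] e_def f_def by simp
    moreover have "(ta i j p, tb i j ?q) \<in> set (concat (E i j))"
      unfolding E_def using a(1,2) by (auto intro!: bexI[of _ a] imageI)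
    moreover have "(W i j c1 c2, E i j) \<in> set pl"
      using ij by (auto simp: pl_def idx_def intro!: image_eqI[where x = "(i, j, c1, c2)"])
    ultimately show ?thesis by blast
  qed
  then have "separating N pl" by (simp add: separating_def)
  then show ?thesis using ok size depth by blast
qed

theorem ex_separating_plan:
  "\<exists>C::nat. \<forall>N\<ge>1. \<exists>pl. plan_ok N pl \<and> separating N pl \<and> plan_size pl \<le> C * N \<and>
    real (plan_depth pl) \<le> real C * (1 + log 2 (real N))"
proof -
  define \<gamma> :: real where "\<gamma> = 1 / (4 * 128 ^ 5)"
  have "0 < \<gamma>" by (simp add: \<gamma>_def)
  from ex_crossing_permutations[OF this] obtain D :: nat where
    D: "\<forall>M>0. \<exists>p. (\<forall>a<D. p a permutes {..<M}) \<and>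
      (\<forall>A B. A \<subseteq> {..<M} \<longrightarrow> B \<subseteq> {..<M} \<longrightarrow> \<gamma> * real M \<le> real (card A) \<longrightarrow> \<gamma> * real M \<le> real (card B) \<longrightarrow>
         (\<exists>a<D. \<exists>v\<in>A. p a v \<in> B))" by (elim exE)
  define K :: nat where "K = 4 * 768 ^ 2"
  define C where "C = 6 + K * (5000 + 2 * D)"
  have "\<exists>pl. plan_ok N pl \<and> separating N pl \<and> plan_size pl \<le> C * N \<and>
    real (plan_depth pl) \<le> real C * (1 + log 2 (real N))" if N: "1 \<le> N" for N
  proof (cases "N < 6")
    case True
    from ex_small_plan[OF N] obtain pl where pl: "plan_ok N pl" "separating N pl" "plan_size pl \<le> N * N" "plan_depth pl \<le> N * N"
      by blast
    have "N \<le> C" using True by (simp add: C_def)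
    then have "N * N \<le> C * N" by (rule mult_le_mono1)
    moreover have "real (plan_depth pl) \<le> real C * (1 + log 2 (real N))"
    proof -
      have "N * N \<le> 5 * 5" using True by (intro mult_le_mono) auto
      moreover have "25 \<le> C" by (simp add: C_def K_def)
      ultimately have "plan_depth pl \<le> C" using pl(4) by linarith
      then have "real (plan_depth pl) \<le> real C * 1" by simp
      also have "\<dots> \<le> real C * (1 + log 2 (real N))" using N by (intro mult_left_mono) auto
      finally show ?thesis .
    qed
    ultimately show ?thesis using pl by (meson le_trans)
  next
    case False
    define k where "k = (GREATEST k. 6 * 128 ^ k \<le> N)"
    have bound: "k \<le> N" if "6 * 128 ^ k \<le> N" for k :: nat
    proof -
      have "k < 2 ^ k" by (rule less_exp)
      also have "(2::nat) ^ k \<le> 128 ^ k" by (rule power_mono) auto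
      finally show ?thesis using that by simp
    qed
    have k: "6 * 128 ^ k \<le> N"
      unfolding k_def
    proof (rule GreatestI_nat)
      show "6 * 128 ^ 0 \<le> N" using False by simp
    qed (rule bound)
    have "\<not> 6 * 128 ^ Suc k \<le> N"
    proof
      assume "6 * 128 ^ Suc k \<le> N"
      then have "Suc k \<le> k" unfolding k_def by (rule Greatest_le_nat) (rule bound)
      then show False by simp
    qed
    then have k': "N < 768 * 128 ^ k" by simp
    define n :: nat where "n = 128 ^ k"
    define d :: nat where "d = 128 ^ (k - 5)"
    from ex_good_encoders[of k] obtain V where V: "good_encoder n (2 * n) d V"
      "length (concat V) \<le> 1000 * n" "length V \<le> 1200 * k" by (auto simp: n_def d_def)
    have "0 < n" by (simp add: n_def)
    then obtain p where p: "\<forall>a<D. p a permutes {..<2 * n}" and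
      cross: "\<forall>A B. A \<subseteq> {..<2 * n} \<longrightarrow> B \<subseteq> {..<2 * n} \<longrightarrow> \<gamma> * real (2 * n) \<le> real (card A) \<longrightarrow> \<gamma> * real (2 * n) \<le> real (card B) \<longrightarrow>
         (\<exists>a<D. \<exists>v\<in>A. p a v \<in> B)" using D[rule_format, of "2 * n"] by auto
    have "n \<le> 128 ^ 5 * d"
    proof -
      have "k \<le> 5 + (k - 5)" by simp
      then have "(128::nat) ^ k \<le> 128 ^ (5 + (k - 5))" by (intro power_increasing) auto
      then show ?thesis by (simp add: n_def d_def power_add)
    qed
    then have "real n \<le> real (128 ^ 5 * d)" by (rule of_nat_mono)
    then have \<gamma>: "\<gamma> * real (2 * n) \<le> real c" if "d \<le> 2 * c" for c
    proof -
      have "real d \<le> real (2 * c)" using that by (rule of_nat_mono)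
      then show ?thesis using \<open>real n \<le> real (128 ^ 5 * d)\<close> by (simp add: \<gamma>_def)
    qed
    have "\<exists>a<D. \<exists>v\<in>A. p a v \<in> B"
      if "A \<subseteq> {..<2 * n}" "B \<subseteq> {..<2 * n}" "d \<le> 2 * card A" "d \<le> 2 * card B" for A B
      using cross \<gamma>[OF that(3)] \<gamma>[OF that(4)] that(1,2) by blast
    from ex_large_plan[OF \<open>0 < n\<close> refl _ _ V(1) p this, of N] obtain pl where
      pl: "plan_ok N pl" "separating N pl"
        "plan_size pl \<le> N + K * (4 * n + 4 * length (concat V) + D * (2 * n))"
        "plan_depth pl \<le> 1 + K * (4 + 4 * length V + D)"
      using k k' unfolding n_def[symmetric] K_def by blast
    have "n \<le> N" using k by (simp add: n_def)
    have "4 * n + 4 * length (concat V) + D * (2 * n) \<le> (5000 + 2 * D) * n"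
      using V(2) by (simp add: algebra_simps)
    also have "\<dots> \<le> (5000 + 2 * D) * N" using \<open>n \<le> N\<close> by (rule mult_le_mono2)
    finally have "K * (4 * n + 4 * length (concat V) + D * (2 * n)) \<le> K * ((5000 + 2 * D) * N)" by (rule mult_le_mono2)
    then have size: "plan_size pl \<le> C * N"
      using pl(3) by (simp add: C_def algebra_simps)
    have log_k: "real k \<le> log 2 (real N)"
    proof -
      have "(2::nat) ^ k \<le> 128 ^ k" by (rule power_mono) auto
      also have "\<dots> \<le> N" using k by simp
      finally have "2 ^ k \<le> real N" by (metis of_nat_le_iff of_nat_numeral of_nat_power)
      then show ?thesis using N by (simp add: le_log_iff powr_realpow)
    qed
    have "real (plan_depth pl) \<le> real C * (1 + real k)"
    proof -
      have "4 + 4 * length V + D \<le> (5000 + 2 * D) * (1 + k)"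
        using V(3) by (simp add: algebra_simps)
      then have "K * (4 + 4 * length V + D) \<le> K * ((5000 + 2 * D) * (1 + k))" by (rule mult_le_mono2)
      then have "plan_depth pl \<le> C * (1 + k)" using pl(4) by (simp add: C_def algebra_simps)
      then have "real (plan_depth pl) \<le> real (C * (1 + k))" by (rule of_nat_mono)
      also have "\<dots> = real C * (1 + real k)" by (simp only: of_nat_mult of_nat_add of_nat_1)
      finally show ?thesis .
    qed
    moreover have "real C * (1 + real k) \<le> real C * (1 + log 2 (real N))"
      using log_k by (intro mult_left_mono) auto
    ultimately have "real (plan_depth pl) \<le> real C * (1 + log 2 (real N))" by linarith
    then show ?thesis using pl size by blast
  qed
  then show ?thesis by blast
qed

section \<open>Symbolic Clifford circuits\<close>

text \<open>Hadamard gates, phase gates and CNOT gates. On a diagonal pair a phase gate is the single-qubit gate \<open>diag (1, \<i>)\<close>,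
  otherwise it is the controlled sign.\<close>
datatype sgate = HG nat | PG "nat \<times> nat" | CXG "nat \<times> nat"

fun sgate_wires :: "sgate \<Rightarrow> nat list" where
  "sgate_wires (HG q) = [q]"
| "sgate_wires (PG g) = (if fst g = snd g then [fst g] else [fst g, snd g])"
| "sgate_wires (CXG g) = [fst g, snd g]"

definition pair_shift :: "nat \<times> nat \<Rightarrow> bvec \<Rightarrow> bvec" where
  "pair_shift g x = (\<lambda>r. if r = fst g then x (snd g) else if r = snd g then x (fst g) else 0)"

text \<open>The action \<open>P \<mapsto> C\<^sup>\<dagger> P C\<close> of a gate \<open>C\<close> on Pauli operators, without phases, in terms of \<open>X\<close>- and \<open>Z\<close>-part. In a list the
  gate applied last in time is the innermost one under this conjugation, hence \<open>foldr\<close>.\<close>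

fun sgate_act :: "sgate \<Rightarrow> bvec \<times> bvec \<Rightarrow> bvec \<times> bvec" where
  "sgate_act (HG q) v = ((fst v)(q := snd v q), (snd v)(q := fst v q))"
| "sgate_act (PG g) v = (fst v, snd v + pair_shift g (fst v))"
| "sgate_act (CXG g) v = (cx g (fst v), cx (snd g, fst g) (snd v))"

definition act :: "sgate list \<Rightarrow> bvec \<times> bvec \<Rightarrow> bvec \<times> bvec" where
  "act = foldr sgate_act"

lemma act_simps [simp]: "act [] v = v" "act (g # gs) v = sgate_act g (act gs v)" "act (gs @ hs) v = act gs (act hs v)"
  by (simp_all add: act_def)

definition scircuit_ok :: "nat \<Rightarrow> sgate list list \<Rightarrow> bool" where
  "scircuit_ok N ls \<longleftrightarrow> (\<forall>l\<in>set ls. distinct (concat (map sgate_wires l)) \<and> set (concat (map sgate_wires l)) \<subseteq> {..<N})"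

text \<open>The standard bilinear form on the first \<open>N\<close> entries.\<close>

definition dot :: "nat \<Rightarrow> bvec \<Rightarrow> bvec \<Rightarrow> bit" where
  "dot N y z = (\<Sum>q<N. y q * z q)"

lemmas bit_ac = add.assoc[where 'a = bit] add.commute[where 'a = bit] add.left_commute[where 'a = bit]

lemma dot_add_right: "dot N y (z + z') = dot N y z + dot N y z'"
  by (simp add: dot_def distrib_left sum.distrib)

lemma dot_add_left: "dot N (y + y') z = dot N y z + dot N y' z"
  by (simp add: dot_def distrib_right sum.distrib)

lemma dot_zero [simp]: "dot N 0 z = 0" "dot N y 0 = 0"
  by (simp_all add: dot_def)

lemma dot_fun_upd: "c < N \<Longrightarrow> dot N y (z(c := z c + b)) = dot N y z + y c * b"
proof -
  assume c: "c < N"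
  have "dot N y (z(c := z c + b)) = (\<Sum>q<N. y q * z q + (if q = c then y c * b else 0))"
    unfolding dot_def by (intro sum.cong) (auto simp: distrib_left)
  then show ?thesis using c by (simp add: sum.distrib dot_def)
qed

lemma dot_commute: "dot N y z = dot N z y"
  by (simp add: dot_def mult.commute)

lemma dot_cx:
  assumes "fst g < N" "snd g < N" "fst g \<noteq> snd g"
  shows "dot N (cx g y) (cx (snd g, fst g) z) = dot N y z"
proof -
  let ?c = "fst g" and ?t = "snd g"
  have "dot N (cx g y) (cx (?t, ?c) z) = dot N (cx g y) z + cx g y ?c * z ?t"
    unfolding cx_def[of "(?t, ?c)"] using assms by (simp add: dot_fun_upd)
  also have "dot N (cx g y) z = dot N y z + z ?t * y ?c"
    unfolding cx_def using assms dot_fun_upd[of ?t N z y "y ?c"] by (simp add: dot_commute)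
  also have "cx g y ?c = y ?c" using assms by (simp add: cx_def)
  finally show ?thesis by (simp add: ac_simps)
qed

lemma cx_cx: "fst g \<noteq> snd g \<Longrightarrow> cx g (cx g x) = x"
  by (auto simp: cx_def fun_eq_iff ac_simps)

lemma cxs_rev:
  "(\<And>g. g \<in> set gs \<Longrightarrow> fst g \<noteq> snd g) \<Longrightarrow> cxs (rev gs) (cxs gs x) = x"
  by (induction gs arbitrary: x) (simp_all add: cx_cx)

lemma act_CXG:
  assumes "\<And>g. g \<in> set gs \<Longrightarrow> fst g < N \<and> snd g < N \<and> fst g \<noteq> snd g"
  shows "fst (act (map CXG gs) v) = cxs (rev gs) (fst v)"
    "dot N (cxs (rev gs) y) (snd (act (map CXG gs) v)) = dot N y (snd v)"
  using assms by (induction gs) (simp_all add: dot_cx)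

lemma dot_pair_shift:
  assumes "fst g < N" "snd g < N"
  shows "dot N y (pair_shift g x) = pair_form g x y"
proof (cases "fst g = snd g")
  case True
  then have "pair_shift g x = 0(fst g := 0 (fst g) + x (fst g))" by (auto simp: pair_shift_def fun_eq_iff)
  then show ?thesis using dot_fun_upd[OF assms(1), of y 0 "x (fst g)"] True by (simp add: pair_form_def mult.commute)
next
  case False
  let ?u = "(0::bvec)(fst g := 0 (fst g) + x (snd g))"
  have "pair_shift g x = ?u(snd g := ?u (snd g) + x (fst g))" using False by (auto simp: pair_shift_def fun_eq_iff)
  then show ?thesis
    using dot_fun_upd[OF assms(2), of y ?u "x (fst g)"] dot_fun_upd[OF assms(1), of y 0 "x (snd g)"] False
    by (simp add: pair_form_def ac_simps)
qed

lemma act_PG: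
  assumes "\<And>g. g \<in> set gs \<Longrightarrow> fst g < N \<and> snd g < N"
  shows "fst (act (map PG gs) v) = fst v"
    "dot N y (snd (act (map PG gs) v)) = dot N y (snd v) + (\<Sum>g\<leftarrow>gs. pair_form g (fst v) y)"
  using assms
proof (induction gs)
  case (Cons g gs)
  {
    case 1
    then show ?case using Cons by simp
  next
    case 2
    then have g: "fst g < N" "snd g < N" and gs: "\<And>g. g \<in> set gs \<Longrightarrow> fst g < N \<and> snd g < N" by auto
    show ?case
      by (simp only: list.map act_simps sgate_act.simps snd_conv dot_add_right Cons.IH[OF gs] dot_pair_shift[OF g] sum_list.Cons bit_ac)
  }
qed simp_all

text \<open>The controlled phases of \<open>E\<close>, conjugated by the CNOT circuit \<open>W\<close>.\<close>

definition block :: "(nat \<times> nat) list list \<Rightarrow> (nat \<times> nat) list list \<Rightarrow> sgate list list" where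
  "block W E = map (map CXG) W @ map (map PG) E @ map (map CXG) (rev (map rev W))"

lemma distinct_wires_neq: "distinct (wires l) \<Longrightarrow> g \<in> set l \<Longrightarrow> fst g \<noteq> snd g"
  by (induction l) (auto simp: wires_Cons wires_def)

lemma act_block:
  assumes W: "cx_circuit N W" and E: "\<And>g. g \<in> set (concat E) \<Longrightarrow> fst g < N \<and> snd g < N"
  shows "fst (act (concat (block W E)) v) = fst v"
    "dot N y (snd (act (concat (block W E)) v)) = dot N y (snd v) +
       (\<Sum>g\<leftarrow>concat E. pair_form g (cxs (concat W) (fst v)) (cxs (concat W) y))"
proof -
  have gW: "fst g < N \<and> snd g < N \<and> fst g \<noteq> snd g" if "g \<in> set (concat W)" for g
    using that cx_circuitD[OF W that] W distinct_wires_neq[of _ g] by (auto simp: cx_circuit_def)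
  have gW': "fst g < N \<and> snd g < N \<and> fst g \<noteq> snd g" if "g \<in> set (rev (concat W))" for g
    using gW that by simp
  have eq: "concat (block W E) = map CXG (concat W) @ map PG (concat E) @ map CXG (rev (concat W))"
    by (simp add: block_def map_concat rev_concat rev_map)
  let ?v1 = "act (map CXG (rev (concat W))) v"
  let ?v2 = "act (map PG (concat E)) ?v1"
  have v1: "fst ?v1 = cxs (concat W) (fst v)" "dot N (cxs (concat W) y) (snd ?v1) = dot N y (snd v)" for y
    using act_CXG(1)[of "rev (concat W)" N v, OF gW'] act_CXG(2)[of "rev (concat W)" N y v, OF gW'] by simp_all
  have v2: "fst ?v2 = fst ?v1" "dot N y (snd ?v2) = dot N y (snd ?v1) + (\<Sum>g\<leftarrow>concat E. pair_form g (fst ?v1) y)" for y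
    using act_PG(1)[of "concat E" N ?v1, OF E] act_PG(2)[of "concat E" N y ?v1, OF E] by blast+
  have v3: "fst (act (map CXG (concat W)) ?v2) = cxs (rev (concat W)) (fst ?v2)"
    "dot N (cxs (rev (concat W)) y) (snd (act (map CXG (concat W)) ?v2)) = dot N y (snd ?v2)" for y
    using act_CXG(1)[of "concat W" N ?v2, OF gW] act_CXG(2)[of "concat W" N y ?v2, OF gW] by blast+
  have rev: "cxs (rev (concat W)) (cxs (concat W) u) = u" for u by (rule cxs_rev) (use gW in blast)
  show "fst (act (concat (block W E)) v) = fst v"
    unfolding eq by (simp add: v3(1) v2(1) v1(1) rev)
  have "dot N y (snd (act (concat (block W E)) v)) = dot N (cxs (concat W) y) (snd ?v2)"
    unfolding eq using v3(2)[of "cxs (concat W) y"] by (simp add: rev)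
  then show "dot N y (snd (act (concat (block W E)) v)) = dot N y (snd v) +
       (\<Sum>g\<leftarrow>concat E. pair_form g (cxs (concat W) (fst v)) (cxs (concat W) y))"
    by (simp only: v2(2) v1)
qed

definition select :: "(nat \<times> nat) list \<Rightarrow> bool list \<Rightarrow> (nat \<times> nat) list" where
  "select l bs = map snd (filter fst (zip bs l))"

fun select_layers :: "(nat \<times> nat) list list \<Rightarrow> bool list \<Rightarrow> (nat \<times> nat) list list" where
  "select_layers [] bs = []"
| "select_layers (l # E) bs = select l bs # select_layers E (drop (length l) bs)"

text \<open>The circuit of the random shear: the bits decide which of the forms of the plan are added to the matrix of the shear.\<close>

fun shear :: "plan \<Rightarrow> bool list \<Rightarrow> sgate list list" where
  "shear [] bs = []"
| "shear ((W, E) # pl) bs = block W (select_layers E bs) @ shear pl (drop (length (concat E)) bs)"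

text \<open>The values at \<open>(x, y)\<close> of all forms of a plan, in the order in which \<open>shear\<close> uses its bits.\<close>

definition forms :: "plan \<Rightarrow> bvec \<Rightarrow> bvec \<Rightarrow> bit list" where
  "forms pl x y = concat (map (\<lambda>(W, E). map (\<lambda>g. pair_form g (cxs (concat W) x) (cxs (concat W) y)) (concat E)) pl)"

definition plan_bits :: "plan \<Rightarrow> nat" where
  "plan_bits pl = (\<Sum>(W, E)\<leftarrow>pl. length (concat E))"

fun subset_sum :: "bool list \<Rightarrow> bit list \<Rightarrow> bit" where
  "subset_sum (b # bs) (f # fs) = (if b then f else 0) + subset_sum bs fs"
| "subset_sum _ _ = 0"

lemma subset_sum_append: "subset_sum bs (fs @ gs) = subset_sum bs fs + subset_sum (drop (length fs) bs) gs"
  by (induction bs fs rule: subset_sum.induct) (simp_all add: ac_simps drop_Cons')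

lemma sum_list_select: "(\<Sum>g\<leftarrow>select l bs. f g) = subset_sum bs (map f l)"
  unfolding select_def
  by (induction bs "map f l" arbitrary: l rule: subset_sum.induct) (auto simp: zip_Cons1 split: list.splits)

lemma select_append: "select (l @ l') bs = select l bs @ select l' (drop (length l) bs)"
proof -
  have "zip (take (length l) bs) l = zip bs l" by (induction bs l rule: list_induct2') auto
  then show ?thesis unfolding select_def zip_append2 by simp
qed

lemma concat_select_layers: "concat (select_layers E bs) = select (concat E) bs"
  by (induction E arbitrary: bs) (simp_all add: select_append, simp add: select_def)

lemma set_select: "set (select l bs) \<subseteq> set l"
  by (auto simp: select_def dest: set_zip_rightD)

lemma act_shear:
  assumes "plan_ok N pl"
  shows "fst (act (concat (shear pl bs)) v) = fst v \<and>
    dot N y (snd (act (concat (shear pl bs)) v)) = dot N y (snd v) + subset_sum bs (forms pl (fst v) y)"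
  using assms
proof (induction pl bs rule: shear.induct)
  case (2 W E pl bs)
  have W: "cx_circuit N W" and E: "pair_layers N E" and ok: "plan_ok N pl"
    using "2.prems" by (auto simp: plan_ok_def)
  have E': "fst g < N \<and> snd g < N" if "g \<in> set (concat (select_layers E bs))" for g
    using that E set_select[of "concat E" bs] unfolding concat_select_layers pair_layers_def set_pair_wires by fastforce
  note IH = "2.IH"[OF ok, THEN conjunct1] "2.IH"[OF ok, THEN conjunct2]
  have blk: "fst (act (concat (block W (select_layers E bs))) u) = fst u"
    "dot N y (snd (act (concat (block W (select_layers E bs))) u)) = dot N y (snd u) +
       (\<Sum>g\<leftarrow>concat (select_layers E bs). pair_form g (cxs (concat W) (fst u)) (cxs (concat W) y))" for u
    by (rule act_block[OF W]; use E' in blast)+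
  let ?v' = "act (concat (shear pl (drop (length (concat E)) bs))) v"
  have "fst (act (concat (shear ((W, E) # pl) bs)) v) = fst ?v'" by (simp add: blk(1))
  also have "\<dots> = fst v" by (rule IH)
  finally have A: "fst (act (concat (shear ((W, E) # pl) bs)) v) = fst v" .
  have "dot N y (snd (act (concat (shear ((W, E) # pl) bs)) v)) = dot N y (snd ?v') +
      (\<Sum>g\<leftarrow>concat (select_layers E bs). pair_form g (cxs (concat W) (fst ?v')) (cxs (concat W) y))"
    by (simp add: blk(2))
  also have "\<dots> = dot N y (snd v) + subset_sum bs (forms ((W, E) # pl) (fst v) y)"
    unfolding IH concat_select_layers sum_list_select
    by (simp add: forms_def subset_sum_append bit_ac)
  finally have B: "dot N y (snd (act (concat (shear ((W, E) # pl) bs)) v)) = dot N y (snd v) + subset_sum bs (forms ((W, E) # pl) (fst v) y)" .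
  show ?case using A B by blast
qed (simp_all add: forms_def)

section \<open>Characters and uniform shears\<close>
definition vecs :: "nat \<Rightarrow> bvec set" where
  "vecs N = {x. supported N x}"

lemma vecs_bij: "bij_betw (\<lambda>S q. if q \<in> S then 1 else 0) (Pow {..<N}) (vecs N)"
  by (rule bij_betw_byWitness[where f' = "\<lambda>x. {q. x q = 1}"])
    (auto simp: vecs_def supported_def fun_eq_iff not_le[symmetric])

lemma finite_vecs [simp]: "finite (vecs N)"
  using bij_betw_finite[OF vecs_bij] by simp

lemma card_vecs: "card (vecs N) = 2 ^ N"
  using bij_betw_same_card[OF vecs_bij, of N] by (simp add: card_Pow)

lemma zero_in_vecs [simp]: "0 \<in> vecs N"
  by (simp add: vecs_def supported_def)

lemma add_in_vecs: "x \<in> vecs N \<Longrightarrow> y \<in> vecs N \<Longrightarrow> x + y \<in> vecs N"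
  by (simp add: vecs_def supported_def)

lemma bvec_add_self [simp]: "(x::bvec) + x = 0"
  by (simp add: fun_eq_iff)

lemma bvec_add_self_left [simp]: "(x::bvec) + (x + y) = y"
  by (simp add: fun_eq_iff)

lemma bvec_add_eq_zero: "(x::bvec) + y = 0 \<longleftrightarrow> x = y"
  by (metis add.right_neutral bvec_add_self bvec_add_self_left)

text \<open>The character \<open>(-1) ^ b\<close>.\<close>

definition sg :: "bit \<Rightarrow> 'a :: comm_ring_1" where
  "sg b = (if b = 0 then 1 else - 1)"

lemma sg_simps [simp]: "sg 0 = 1" "sg 1 = - 1"
  by (simp_all add: sg_def)

lemma sg_add: "sg (a + b) = sg a * sg b"
  by (cases a; cases b) simp_all

lemma sum_sg_dot:
  assumes "z \<in> vecs N"
  shows "(\<Sum>y\<in>vecs N. sg (dot N y z)) = (if z = 0 then 2 ^ N else 0 :: 'a :: {idom, ring_char_0})"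
proof (cases "z = 0")
  case True
  then show ?thesis by (simp add: card_vecs)
next
  case False
  then obtain q where q: "q < N" "z q = 1"
    using supported_nonzero[of N z] assms by (auto simp: vecs_def)
  define e :: bvec where "e = 0(q := 1)"
  have e: "e \<in> vecs N" using q by (auto simp: e_def vecs_def supported_def)
  have "dot N z e = 1"
    unfolding e_def using dot_fun_upd[of q N z 0 1] q by simp
  then have "dot N e z = 1" by (simp add: dot_commute)
  then have neg: "sg (dot N (e + y) z) = - (sg (dot N y z) :: 'a)" for y
    by (simp add: dot_add_left sg_add)
  have "bij_betw ((+) e) (vecs N) (vecs N)"
    by (rule bij_betw_byWitness[where f' = "(+) e"]) (use e in \<open>auto intro: add_in_vecs\<close>)
  then have "(\<Sum>y\<in>vecs N. sg (dot N y z)) = (\<Sum>y\<in>vecs N. sg (dot N (e + y) z) :: 'a)"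
    by (rule sum.reindex_bij_betw[symmetric])
  also have "\<dots> = - (\<Sum>y\<in>vecs N. sg (dot N y z))" by (simp only: neg sum_negf)
  finally show ?thesis using False by simp
qed

definition blists :: "nat \<Rightarrow> bool list set" where
  "blists r = {bs. length bs = r}"

lemma blists_0: "blists 0 = {[]}"
  by (auto simp: blists_def)

lemma blists_Suc: "blists (Suc r) = (Cons True ` blists r) \<union> (Cons False ` blists r)"
  by (force simp: blists_def length_Suc_conv)

lemma finite_blists [simp]: "finite (blists r)"
  by (induction r) (simp_all add: blists_0 blists_Suc)

lemma sum_blists_Suc: "(\<Sum>bs\<in>blists (Suc r). f bs) = (\<Sum>bs\<in>blists r. f (True # bs)) + (\<Sum>bs\<in>blists r. f (False # bs))"
proof -
  have "(\<Sum>bs\<in>blists (Suc r). f bs) = (\<Sum>bs\<in>Cons True ` blists r. f bs) + (\<Sum>bs\<in>Cons False ` blists r. f bs)"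
    unfolding blists_Suc by (rule sum.union_disjoint) auto
  then show ?thesis by (simp add: sum.reindex)
qed

lemma card_blists: "card (blists r) = 2 ^ r"
proof -
  have "(\<Sum>bs\<in>blists r. 1) = (2 ^ r :: nat)"
    by (induction r) (simp_all only: sum_blists_Suc, simp_all add: blists_0)
  then show ?thesis by simp
qed

lemma sum_blists_add:
  "(\<Sum>bs\<in>blists (r + s). f (take r bs) (drop r bs)) = (\<Sum>as\<in>blists r. \<Sum>cs\<in>blists s. f as cs)"
proof -
  have "bij_betw (\<lambda>(as, cs). as @ cs) (blists r \<times> blists s) (blists (r + s))"
    by (rule bij_betw_byWitness[where f' = "\<lambda>bs. (take r bs, drop r bs)"]) (auto simp: blists_def)
  then have "(\<Sum>bs\<in>blists (r + s). f (take r bs) (drop r bs))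
      = (\<Sum>(as, cs)\<in>blists r \<times> blists s. f (take r (as @ cs)) (drop r (as @ cs)))"
    by (subst sum.reindex_bij_betw[symmetric, where h = "\<lambda>(as, cs). as @ cs"]) (auto simp: case_prod_beta)
  also have "\<dots> = (\<Sum>(as, cs)\<in>blists r \<times> blists s. f as cs)"
    by (rule sum.cong) (auto simp: blists_def)
  finally show ?thesis by (simp add: sum.cartesian_product)
qed

lemma sum_sg_subset_sum:
  "(\<Sum>bs\<in>blists (length fs). sg (subset_sum bs fs)) = (if 1 \<in> set fs then 0 else 2 ^ length fs :: 'a :: comm_ring_1)"
proof (induction fs)
  case (Cons f fs)
  have "(\<Sum>bs\<in>blists (length (f # fs)). sg (subset_sum bs (f # fs)))
     = sg f * (\<Sum>bs\<in>blists (length fs). sg (subset_sum bs fs)) + (\<Sum>bs\<in>blists (length fs). sg (subset_sum bs fs) :: 'a)"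
    by (simp only: list.size sum_blists_Suc subset_sum.simps sg_add sum_distrib_left if_True if_False add_0 add_0_right add_Suc_right)
  then show ?case unfolding Cons.IH by (cases f) auto
qed (simp add: blists_0)

lemma wires_append [simp]: "wires (l @ l') = wires l @ wires l'"
  by (simp add: wires_def)

lemma distinct_wires_rev: "distinct (wires (rev l)) \<longleftrightarrow> distinct (wires l)"
proof (induction l)
  case (Cons g l)
  have "wires [g] = [fst g, snd g]" by (simp add: wires_def case_prod_beta)
  then show ?case using Cons by (auto simp: wires_Cons set_wires)
qed (simp add: wires_def)

lemma wires_CXG: "concat (map sgate_wires (map CXG l)) = wires l"
  by (induction l) (simp_all add: wires_Cons wires_def[of "[]"])

lemma wires_PG: "concat (map sgate_wires (map PG l)) = pair_wires l"
  by (induction l) (simp_all add: pair_wires_def)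

lemma pair_wires_select:
  "distinct (pair_wires l) \<Longrightarrow> distinct (pair_wires (select l bs)) \<and> set (pair_wires (select l bs)) \<subseteq> set (pair_wires l)"
proof (induction bs l rule: list_induct2')
  case (4 b bs g l)
  have "select (g # l) (b # bs) = (if b then [g] else []) @ select l bs" by (simp add: select_def)
  moreover have "pair_wires (g # l) = (if fst g = snd g then [fst g] else [fst g, snd g]) @ pair_wires l" for l
    by (simp add: pair_wires_def)
  ultimately show ?case using 4 by (cases b) auto
qed (simp_all add: select_def pair_wires_def)

lemma scircuit_ok_append [simp]: "scircuit_ok N (ls @ ms) \<longleftrightarrow> scircuit_ok N ls \<and> scircuit_ok N ms"
  by (auto simp: scircuit_ok_def)

lemma scircuit_ok_Cons: "scircuit_ok N (l # ls) \<longleftrightarrow> distinct (concat (map sgate_wires l)) \<and> set (concat (map sgate_wires l)) \<subseteq> {..<N} \<and> scircuit_ok N ls"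
  by (simp add: scircuit_ok_def)

lemma scircuit_ok_CXG: "cx_circuit N W \<Longrightarrow> scircuit_ok N (map (map CXG) W)"
  unfolding scircuit_ok_def cx_circuit_def by (simp add: wires_CXG del: map_map map_concat set_concat)

lemma scircuit_ok_block:
  assumes "cx_circuit N W" "pair_layers N E"
  shows "scircuit_ok N (block W (select_layers E bs))"
proof -
  have "cx_circuit N (rev (map rev W))"
    using assms(1) by (auto simp: cx_circuit_def distinct_wires_rev set_wires)
  moreover have "scircuit_ok N (map (map PG) (select_layers E bs))"
    using assms(2)
  proof (induction E arbitrary: bs)
    case (Cons l E)
    then have "scircuit_ok N (map (map PG) (select_layers E (drop (length l) bs)))" by (simp add: pair_layers_def)
    moreover have "distinct (pair_wires l)" "set (pair_wires l) \<subseteq> {..<N}" using Cons.prems by (auto simp: pair_layers_def)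
    ultimately show ?case
      using pair_wires_select[of l bs] unfolding select_layers.simps list.map scircuit_ok_Cons wires_PG by blast
  qed (simp add: scircuit_ok_def)
  ultimately show ?thesis using assms(1) by (simp add: block_def scircuit_ok_CXG del: map_map)
qed

lemma scircuit_ok_shear: "plan_ok N pl \<Longrightarrow> scircuit_ok N (shear pl bs)"
proof (induction pl bs rule: shear.induct)
  case (2 W E pl bs)
  then show ?case by (auto simp: plan_ok_def intro: scircuit_ok_block)
qed (simp add: scircuit_ok_def)

lemma sgate_act_supported:
  assumes "set (sgate_wires g) \<subseteq> {..<N}" "supported N (fst v)" "supported N (snd v)"
  shows "supported N (fst (sgate_act g v))" "supported N (snd (sgate_act g v))"
  using assms by (cases g; auto simp: supported_def cx_def pair_shift_def split: if_splits)+

lemma act_supported: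
  assumes "scircuit_ok N ls" "supported N (fst v)" "supported N (snd v)"
  shows "supported N (fst (act (concat ls) v)) \<and> supported N (snd (act (concat ls) v))"
proof -
  have "\<forall>g\<in>set (concat ls). set (sgate_wires g) \<subseteq> {..<N}"
    using assms(1) by (force simp: scircuit_ok_def)
  moreover have "supported N (fst (act gs v)) \<and> supported N (snd (act gs v))"
    if "\<forall>g\<in>set gs. set (sgate_wires g) \<subseteq> {..<N}" for gs
    using that assms(2,3) by (induction gs) (auto intro: sgate_act_supported)
  ultimately show ?thesis by blast
qed

lemma length_forms: "length (forms pl x y) = plan_bits pl"
  by (induction pl) (auto simp: forms_def plan_bits_def)

text \<open>Separation makes the expectation of every non-trivial character of the \<open>Z\<close>-part vanish, hence this part is uniform.\<close>

lemma shear_uniform: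
  assumes pl: "plan_ok N pl" "separating N pl" and x: "x \<in> vecs N" "x \<noteq> 0" and z: "z \<in> vecs N" and a: "a \<in> vecs N"
  shows "real (card {bs\<in>blists (plan_bits pl). snd (act (concat (shear pl bs)) (x, z)) = a}) * 2 ^ N = 2 ^ plan_bits pl"
proof -
  let ?Z = "\<lambda>bs. snd (act (concat (shear pl bs)) (x, z))"
  let ?B = "blists (plan_bits pl)"
  have Z: "?Z bs \<in> vecs N" for bs
    using act_supported[OF scircuit_ok_shear[OF pl(1)], of "(x, z)"] x z by (simp add: vecs_def)
  have "real (card {bs\<in>?B. ?Z bs = a}) * 2 ^ N = (\<Sum>bs\<in>?B. if ?Z bs + a = 0 then 2 ^ N else 0)"
    by (simp add: sum.If_cases Int_def bvec_add_eq_zero)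
  also have "\<dots> = (\<Sum>bs\<in>?B. \<Sum>y\<in>vecs N. sg (dot N y (?Z bs + a)))"
    using sum_sg_dot[OF add_in_vecs[OF Z a], where 'a = real] by simp
  also have "\<dots> = (\<Sum>y\<in>vecs N. \<Sum>bs\<in>?B. sg (dot N y (?Z bs + a)))" by (rule sum.swap)
  also have "\<dots> = (\<Sum>y\<in>vecs N. if y = 0 then 2 ^ plan_bits pl else 0)"
  proof (rule sum.cong[OF refl])
    fix y assume y: "y \<in> vecs N"
    have eq: "(sg (dot N y (?Z bs + a)) :: real) = sg (dot N y z) * sg (dot N y a) * sg (subset_sum bs (forms pl x y))" for bs
      unfolding dot_add_right act_shear[OF pl(1), THEN conjunct2] by (simp add: sg_add)
    have S: "(\<Sum>bs\<in>?B. sg (subset_sum bs (forms pl x y))) = (if 1 \<in> set (forms pl x y) then 0 else 2 ^ plan_bits pl :: real)"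
      using sum_sg_subset_sum[of "forms pl x y"] by (simp only: length_forms)
    have "(\<Sum>bs\<in>?B. sg (dot N y (?Z bs + a)))
        = sg (dot N y z) * sg (dot N y a) * (\<Sum>bs\<in>?B. sg (subset_sum bs (forms pl x y)) :: real)"
      by (simp only: eq sum_distrib_left)
    also have "\<dots> = (if y = 0 then 2 ^ plan_bits pl else 0)"
    proof (cases "y = 0")
      case True
      have "\<forall>f\<in>set (forms pl x 0). f = 0" by (auto simp: forms_def pair_form_def)
      then have "1 \<notin> set (forms pl x y)" using True by auto
      then show ?thesis unfolding S using True by simp
    next
      case False
      then have "\<exists>(W, E)\<in>set pl. \<exists>g\<in>set (concat E). pair_form g (cxs (concat W) x) (cxs (concat W) y) = 1"
        using pl(2) x y unfolding separating_def vecs_def mem_Collect_eq by simp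
      then obtain W E g where WE: "(W, E) \<in> set pl" and g: "g \<in> set (concat E)" "pair_form g (cxs (concat W) x) (cxs (concat W) y) = 1"
        by (elim bexE) (auto simp only: split_paired_all prod.case)
      have "1 \<in> set (map (\<lambda>g. pair_form g (cxs (concat W) x) (cxs (concat W) y)) (concat E))"
        unfolding set_map using g by (intro image_eqI[of _ _ g]) simp_all
      then have "1 \<in> set (forms pl x y)"
        unfolding forms_def set_concat[of "map _ pl"] set_map[of _ pl]
        by (intro UN_I[OF imageI[OF WE]]) simp
      then show ?thesis unfolding S using False by simp
    qed
    finally show "(\<Sum>bs\<in>?B. sg (dot N y (?Z bs + a))) = (if y = 0 then 2 ^ plan_bits pl else 0 :: real)" .
  qed
  finally show ?thesis by simp
qed

section \<open>Mixing of the random circuits\<close>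

text \<open>The chain exchanges the two parts and then randomizes the first part completely, unless the second part is \<open>0\<close>. The
  function \<open>f t\<close> is the distribution after \<open>t\<close> rounds; \<open>e\<close> and \<open>h\<close> below are the deviations of its first marginal from the
  stationary values at \<open>0\<close> and at \<open>a \<noteq> 0\<close>. They satisfy linear recursions that contract by the factor \<open>D\<close> in one and in
  two rounds, respectively, so \<open>20\<close> rounds leave about \<open>D ^ (- 10)\<close>, of which \<open>D ^ 7\<close> absorbs the constant.\<close>
lemma feistel_chain_mixing:
  fixes f :: "nat \<Rightarrow> 'a::zero \<Rightarrow> 'a \<Rightarrow> real" and D :: real
  assumes A: "finite A" "0 \<in> A" and D: "D = real (card A)" "2 \<le> D"
    and nonneg: "\<And>a b. 0 \<le> f 0 a b" and total: "(\<Sum>a\<in>A. \<Sum>b\<in>A. f 0 a b) = 1" and start: "f 0 0 0 = 0"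
    and step: "\<And>t a b. a \<in> A \<Longrightarrow> b \<in> A \<Longrightarrow> f (Suc t) b a = (if a = 0 then f t 0 b else (\<Sum>c\<in>A. f t a c) / D)"
  shows "(\<Sum>(a, b)\<in>A \<times> A - {(0, 0)}. \<bar>f 22 a b - 1 / (D\<^sup>2 - 1)\<bar>) \<le> 1 / D ^ 3"
proof -
  define u where "u = 1 / (D\<^sup>2 - 1)"
  define g where "g t a = (\<Sum>b\<in>A. f t a b)" for t a
  define A' where "A' = A - {0}"
  have fin': "finite A'" using A by (simp add: A'_def)
  have card': "real (card A') = D - 1"
    using A D by (simp add: A'_def card_Diff_singleton of_nat_diff)
  have D2: "D\<^sup>2 - 1 = (D - 1) * (D + 1)" by (simp add: power2_eq_square algebra_simps)
  have Dpos: "0 < D" "0 < D - 1" "0 < D\<^sup>2 - 1" using D unfolding D2 by auto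
  have split: "(\<Sum>a\<in>A. h a) = h 0 + (\<Sum>a\<in>A'. h a)" for h :: "'a \<Rightarrow> real"
    unfolding A'_def using A by (simp add: sum.remove)
  have f0: "f (Suc t) b 0 = f t 0 b" if "b \<in> A" for t b
    using step[of 0 b t] A that by simp
  have fnz: "f (Suc t) b a = g t a / D" if "a \<in> A'" "b \<in> A" for t a b
    using step[of a b t] that by (simp add: A'_def g_def)
  have f00: "f t 0 0 = 0" for t
    using start f0 A by (induction t) auto
  have g_Suc: "g (Suc t) b = f t 0 b + (\<Sum>a\<in>A'. g t a) / D" if "b \<in> A" for t b
    unfolding g_def[of "Suc t"] split using f0 fnz that by (simp add: sum_divide_distrib)
  have g_total: "g t 0 + (\<Sum>a\<in>A'. g t a) = 1" for t
  proof (induction t)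
    case 0
    show ?case using total split[of "g 0"] by (simp add: g_def)
  next
    case (Suc t)
    have "(\<Sum>a\<in>A. g (Suc t) a) = (\<Sum>b\<in>A. f t 0 b) + D * ((\<Sum>a\<in>A'. g t a) / D)"
      using g_Suc by (simp add: sum.distrib D)
    also have "\<dots> = 1" using Suc Dpos by (simp add: g_def)
    finally show ?case by (simp only: split)
  qed
  have f_nonneg: "0 \<le> f t b a" if "a \<in> A" "b \<in> A" for t a b
    using that
  proof (induction t arbitrary: a b)
    case (Suc t)
    then show ?case using step[of a b t] A Dpos by (auto intro!: divide_nonneg_pos sum_nonneg)
  qed (rule nonneg)
  have g_nonneg: "0 \<le> g t a" if "a \<in> A" for t a
    unfolding g_def using f_nonneg that by (intro sum_nonneg) auto
  have sum_nonneg': "0 \<le> (\<Sum>a\<in>A'. g t a)" for t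
    using g_nonneg by (intro sum_nonneg) (auto simp: A'_def)

  define e where "e t = g t 0 - (D - 1) * u" for t
  define h where "h t a = g t a - D * u" for t a
  have e_Suc: "e (Suc t) = - e t / D" for t
  proof -
    have "g (Suc t) 0 = (1 - g t 0) / D" using g_Suc[of 0 t] A f00[of t] g_total[of t] by simp
    moreover have "(D - 1) * u = (1 - (D - 1) * u) / D"
      using Dpos unfolding u_def D2 by (simp add: field_simps)
    ultimately show ?thesis unfolding e_def using Dpos by (simp add: field_simps)
  qed
  have e_bound: "\<bar>e t\<bar> \<le> 1 / D ^ t" for t
  proof (induction t)
    case 0
    have "0 \<le> g 0 0" "g 0 0 \<le> 1" using g_nonneg[of 0 0] A g_total[of 0] sum_nonneg'[of 0] by auto
    moreover have "0 \<le> (D - 1) * u" "(D - 1) * u \<le> 1" using Dpos unfolding u_def D2 by (simp_all add: field_simps)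
    ultimately show ?case by (simp add: e_def)
  next
    case (Suc t)
    have "\<bar>e (Suc t)\<bar> = \<bar>e t\<bar> / D" using Dpos by (simp add: e_Suc)
    also have "\<dots> \<le> (1 / D ^ t) / D" using Suc Dpos by (intro divide_right_mono) auto
    finally show ?case by (simp add: mult.commute)
  qed
  have h_Suc: "h (Suc (Suc t)) a = - e (Suc t) / D + h t a / D" if a: "a \<in> A'" for t a
  proof -
    have "g (Suc (Suc t)) a = g t a / D + (1 - g (Suc t) 0) / D"
      using g_Suc[of a "Suc t"] fnz[OF a, of 0 t] A a g_total[of "Suc t"] by (simp add: A'_def)
    moreover have "D * u = (D * u) / D + (1 - (D - 1) * u) / D"
    proof -
      have "D * (D * u) = 1 + u" using Dpos(3) by (simp add: u_def power2_eq_square field_simps)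
      then have "D * u = (1 + u) / D" using Dpos(1) by (simp add: field_simps)
      also have "1 + u = D * u + (1 - (D - 1) * u)" by (simp add: algebra_simps)
      finally show ?thesis by (simp only: add_divide_distrib)
    qed
    ultimately show ?thesis unfolding e_def h_def using Dpos by (simp add: field_simps)
  qed
  define H where "H t = (\<Sum>a\<in>A'. \<bar>h t a\<bar>)" for t
  have H2: "H t \<le> 2" for t
  proof -
    have "H t \<le> (\<Sum>a\<in>A'. g t a + D * u)"
      unfolding H_def h_def using g_nonneg Dpos by (intro sum_mono) (auto simp: A'_def u_def abs_le_iff)
    also have "\<dots> = (\<Sum>a\<in>A'. g t a) + (D - 1) * (D * u)" by (simp add: sum.distrib card')
    also have "(\<Sum>a\<in>A'. g t a) \<le> 1" using g_total[of t] g_nonneg[of 0 t] A by linarith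
    also have "(D - 1) * (D * u) \<le> 1" using Dpos unfolding u_def D2 by (simp add: field_simps)
    finally show ?thesis by simp
  qed
  have H_Suc: "H (Suc (Suc t)) \<le> 1 / D ^ Suc t + H t / D" for t
  proof -
    have "H (Suc (Suc t)) \<le> (\<Sum>a\<in>A'. \<bar>e (Suc t)\<bar> / D + \<bar>h t a\<bar> / D)"
      unfolding H_def
    proof (rule sum_mono)
      fix a assume a: "a \<in> A'"
      have "\<bar>h (Suc (Suc t)) a\<bar> \<le> \<bar>- e (Suc t) / D\<bar> + \<bar>h t a / D\<bar>" unfolding h_Suc[OF a] by (rule abs_triangle_ineq)
      then show "\<bar>h (Suc (Suc t)) a\<bar> \<le> \<bar>e (Suc t)\<bar> / D + \<bar>h t a\<bar> / D" using Dpos by simp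
    qed
    also have "\<dots> = ((D - 1) / D) * \<bar>e (Suc t)\<bar> + H t / D"
      by (simp add: sum.distrib card' H_def sum_divide_distrib)
    also have "((D - 1) / D) * \<bar>e (Suc t)\<bar> \<le> 1 * \<bar>e (Suc t)\<bar>" using Dpos by (intro mult_right_mono) auto
    also have "1 * \<bar>e (Suc t)\<bar> \<le> 1 / D ^ Suc t" using e_bound[of "Suc t"] by simp
    finally show ?thesis by simp
  qed
  have H_bound: "H (2 * s) \<le> 2 * real (s + 1) / D ^ s \<and> H (Suc (2 * s)) \<le> 2 * real (s + 1) / D ^ s" for s
  proof (induction s)
    case 0
    then show ?case using H2 by simp
  next
    case (Suc s)
    have pow: "1 / D ^ Suc t \<le> 1 / D ^ Suc s" if "s \<le> t" for t
      using D that by (intro divide_left_mono power_increasing) auto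
    have "H (Suc (Suc t)) \<le> 2 * real (Suc s + 1) / D ^ Suc s" if "H t \<le> 2 * real (s + 1) / D ^ s" "s \<le> t" for t
    proof -
      have "H (Suc (Suc t)) \<le> 1 / D ^ Suc s + (2 * real (s + 1) / D ^ s) / D"
        using H_Suc[of t] pow[OF that(2)] divide_right_mono[OF that(1), of D] Dpos by linarith
      also have "\<dots> = (1 + 2 * real (s + 1)) / D ^ Suc s" using Dpos by (simp add: field_simps)
      also have "\<dots> \<le> 2 * real (Suc s + 1) / D ^ Suc s" using Dpos by (intro divide_right_mono) auto
      finally show ?thesis .
    qed
    from this[of "2 * s"] this[of "Suc (2 * s)"] show ?case using Suc by simp
  qed
  have "(\<Sum>(a, b)\<in>A \<times> A - {(0, 0)}. \<bar>f 22 a b - u\<bar>) = (\<Sum>b\<in>A'. \<bar>f 22 b 0 - u\<bar>) + (\<Sum>a\<in>A'. \<Sum>b\<in>A. \<bar>f 22 b a - u\<bar>)"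
  proof -
    have "A \<times> A - {(0, 0)} = (A' \<times> {0}) \<union> (A \<times> A')" using A by (auto simp: A'_def)
    moreover have "(A' \<times> {0}) \<inter> (A \<times> A') = {}" by (auto simp: A'_def)
    ultimately have "(\<Sum>(a, b)\<in>A \<times> A - {(0, 0)}. \<bar>f 22 a b - u\<bar>)
        = (\<Sum>(a, b)\<in>A' \<times> {0}. \<bar>f 22 a b - u\<bar>) + (\<Sum>(a, b)\<in>A \<times> A'. \<bar>f 22 a b - u\<bar>)"
      using A(1) fin' by (simp add: sum.union_disjoint)
    also have "(\<Sum>(a, b)\<in>A' \<times> {0}. \<bar>f 22 a b - u\<bar>) = (\<Sum>b\<in>A'. \<bar>f 22 b 0 - u\<bar>)"
      by (simp add: sum.cartesian_product[symmetric])
    also have "(\<Sum>(a, b)\<in>A \<times> A'. \<bar>f 22 a b - u\<bar>) = (\<Sum>a\<in>A'. \<Sum>b\<in>A. \<bar>f 22 b a - u\<bar>)"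
      unfolding sum.cartesian_product[symmetric] by (rule sum.swap)
    finally show ?thesis .
  qed
  also have "(\<Sum>b\<in>A'. \<bar>f 22 b 0 - u\<bar>) = H 20 / D"
  proof -
    have "f 22 b 0 - u = h 20 b / D" if "b \<in> A'" for b
    proof -
      have "f 22 b 0 = f 21 0 b" using f0[of b 21] that by (simp add: A'_def)
      also have "\<dots> = g 20 b / D" using fnz[OF that A(2), of 20] by simp
      finally show ?thesis using Dpos by (simp add: h_def field_simps)
    qed
    then show ?thesis using Dpos by (simp add: H_def sum_divide_distrib)
  qed
  also have "(\<Sum>a\<in>A'. \<Sum>b\<in>A. \<bar>f 22 b a - u\<bar>) = H 21"
  proof -
    have "(\<Sum>b\<in>A. \<bar>f 22 b a - u\<bar>) = \<bar>h 21 a\<bar>" if "a \<in> A'" for a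
    proof -
      have "f 22 b a - u = h 21 a / D" if "b \<in> A" for b
        using fnz[OF \<open>a \<in> A'\<close> that, of 21] Dpos by (simp add: h_def field_simps)
      then have "(\<Sum>b\<in>A. \<bar>f 22 b a - u\<bar>) = D * (\<bar>h 21 a\<bar> / D)" using Dpos D by simp
      then show ?thesis using Dpos by simp
    qed
    then show ?thesis by (simp add: H_def)
  qed
  also have "H 20 / D + H 21 \<le> 1 / D ^ 3"
  proof -
    have "H 20 \<le> 22 / D ^ 10" "H 21 \<le> 22 / D ^ 10" using H_bound[of 10] by simp_all
    moreover have "H 20 / D \<le> H 20 / 1" using D by (intro divide_left_mono) (auto simp: H_def sum_nonneg)
    ultimately have "H 20 / D + H 21 \<le> 44 / D ^ 10" by simp
    also have "44 / D ^ 10 \<le> 128 / D ^ 10" using Dpos by (intro divide_right_mono) auto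
    also have "\<dots> \<le> D ^ 7 / D ^ 10" using power_mono[OF D(2), of 7] Dpos by (intro divide_right_mono) auto
    also have "\<dots> = 1 / D ^ 3" using Dpos by (simp add: field_simps flip: power_add)
    finally show ?thesis .
  qed
  finally show ?thesis by (simp add: u_def)
qed

definition mixing_round :: "nat \<Rightarrow> plan \<Rightarrow> bool list \<Rightarrow> sgate list list" where
  "mixing_round N pl bs = map HG [0..<N] # shear pl bs"

fun rounds :: "nat \<Rightarrow> plan \<Rightarrow> nat \<Rightarrow> bool list \<Rightarrow> sgate list list" where
  "rounds N pl 0 bs = []"
| "rounds N pl (Suc t) bs = mixing_round N pl (take (plan_bits pl) bs) @ rounds N pl t (drop (plan_bits pl) bs)"

lemma act_HG:
  assumes "distinct qs"
  shows "act (map HG qs) v = ((\<lambda>q. if q \<in> set qs then snd v q else fst v q), (\<lambda>q. if q \<in> set qs then fst v q else snd v q))"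
  using assms by (induction qs) (auto simp: fun_eq_iff)

lemma act_HG_swap:
  assumes "supported N (fst v)" "supported N (snd v)"
  shows "act (map HG [0..<N]) v = (snd v, fst v)"
  using assms by (auto simp: act_HG fun_eq_iff supported_def)

lemma act_mixing_round:
  assumes "plan_ok N pl" "x \<in> vecs N" "z \<in> vecs N"
  shows "act (concat (mixing_round N pl bs)) (x, z) = (snd (act (concat (shear pl bs)) (x, z)), x)"
  using act_supported[OF scircuit_ok_shear[OF assms(1)], of "(x, z)" bs] assms act_shear[OF assms(1), of bs "(x, z)"]
  by (simp add: mixing_round_def act_HG_swap vecs_def)

lemma scircuit_ok_rounds:
  assumes "plan_ok N pl"
  shows "scircuit_ok N (rounds N pl t bs)"
proof (induction t arbitrary: bs)
  case (Suc t)
  have "concat (map sgate_wires (map HG [0..<N])) = [0..<N]" by (simp add: comp_def)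
  then have "scircuit_ok N (mixing_round N pl bs)" for bs
    unfolding mixing_round_def scircuit_ok_Cons using scircuit_ok_shear[OF assms, of bs] by auto
  then show ?case using Suc by simp
qed (simp add: scircuit_ok_def)

lemma length_select: "length (select l bs) \<le> length l"
  unfolding select_def using length_filter_le[of fst "zip bs l"] by simp

lemma shear_length:
  "length (shear pl bs) = plan_depth pl" "length (concat (shear pl bs)) \<le> plan_size pl"
proof -
  have [simp]: "length (select_layers E bs) = length E" for E bs by (induction E arbitrary: bs) auto
  show "length (shear pl bs) = plan_depth pl"
    by (induction pl bs rule: shear.induct) (auto simp: plan_depth_def block_def)
  have blk: "length (concat (block W E)) = 2 * length (concat W) + length (concat E)" for W E
  proof -
    have "length (concat (rev (map rev W))) = length (concat W)"
      by (induction W) auto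
    then show ?thesis by (simp add: block_def map_concat[symmetric] del: rev_concat)
  qed
  show "length (concat (shear pl bs)) \<le> plan_size pl"
  proof (induction pl bs rule: shear.induct)
    case (2 W E pl bs)
    then show ?case using length_select[of "concat E" bs] by (simp add: plan_size_def blk concat_select_layers)
  qed (simp add: plan_size_def)
qed

lemma rounds_length:
  "length (rounds N pl t bs) = t * (1 + plan_depth pl)" "length (concat (rounds N pl t bs)) \<le> t * (N + plan_size pl)"
proof -
  show "length (rounds N pl t bs) = t * (1 + plan_depth pl)"
    by (induction t arbitrary: bs) (auto simp: mixing_round_def shear_length)
  show "length (concat (rounds N pl t bs)) \<le> t * (N + plan_size pl)"
  proof (induction t arbitrary: bs)
    case (Suc t)
    have "length (concat (mixing_round N pl (take (plan_bits pl) bs))) \<le> N + plan_size pl"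
      using shear_length(2)[of pl "take (plan_bits pl) bs"] by (simp add: mixing_round_def)
    then show ?case using Suc[of "drop (plan_bits pl) bs"] by simp
  qed simp
qed

text \<open>The probability that the random circuit \<open>circ\<close> with \<open>r\<close> bits maps \<open>v\<close> to \<open>w\<close>.\<close>

definition trans_prob :: "nat \<Rightarrow> (bool list \<Rightarrow> sgate list list) \<Rightarrow> bvec \<times> bvec \<Rightarrow> bvec \<times> bvec \<Rightarrow> real" where
  "trans_prob r circ v w = real (card {bs\<in>blists r. act (concat (circ bs)) v = w}) / 2 ^ r"

lemma trans_prob_sum: "trans_prob r circ v w = (\<Sum>bs\<in>blists r. of_bool (act (concat (circ bs)) v = w)) / 2 ^ r"
  by (simp add: trans_prob_def Int_def)

lemma trans_prob_rounds_Suc: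
  assumes pl: "plan_ok N pl" and v: "v \<in> vecs N \<times> vecs N"
  shows "trans_prob (Suc t * plan_bits pl) (rounds N pl (Suc t)) v w
    = (\<Sum>v'\<in>vecs N \<times> vecs N. trans_prob (t * plan_bits pl) (rounds N pl t) v v' * trans_prob (plan_bits pl) (mixing_round N pl) v' w)"
proof -
  let ?r = "plan_bits pl" and ?s = "t * plan_bits pl" and ?V = "vecs N \<times> vecs N"
  let ?a = "\<lambda>cs. act (concat (rounds N pl t cs)) v"
  have in_V: "?a cs \<in> ?V" for cs
    using act_supported[OF scircuit_ok_rounds[OF pl, of t cs], of v] v by (auto simp: vecs_def mem_Times_iff)
  have "(\<Sum>bs\<in>blists (Suc t * ?r). of_bool (act (concat (rounds N pl (Suc t) bs)) v = w))
     = (\<Sum>as\<in>blists ?r. \<Sum>cs\<in>blists ?s. of_bool (act (concat (mixing_round N pl as)) (?a cs) = w) :: real)"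
    using sum_blists_add[of "\<lambda>as cs. of_bool (act (concat (mixing_round N pl as)) (?a cs) = w)" ?r ?s]
    by (simp only: mult_Suc rounds.simps concat_append act_simps)
  also have "\<dots> = (\<Sum>cs\<in>blists ?s. \<Sum>as\<in>blists ?r. of_bool (act (concat (mixing_round N pl as)) (?a cs) = w))"
    by (rule sum.swap)
  also have "\<dots> = (\<Sum>cs\<in>blists ?s. \<Sum>v'\<in>?V. of_bool (?a cs = v') * (\<Sum>as\<in>blists ?r. of_bool (act (concat (mixing_round N pl as)) v' = w)))"
  proof (rule sum.cong[OF refl])
    fix cs
    have "(\<Sum>v'\<in>?V. of_bool (?a cs = v') * (\<Sum>as\<in>blists ?r. of_bool (act (concat (mixing_round N pl as)) v' = w)))
      = (\<Sum>v'\<in>?V. if v' = ?a cs then (\<Sum>as\<in>blists ?r. of_bool (act (concat (mixing_round N pl as)) v' = w)) else 0 :: real)"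
      by (intro sum.cong) auto
    also have "\<dots> = (\<Sum>as\<in>blists ?r. of_bool (act (concat (mixing_round N pl as)) (?a cs) = w))"
      using in_V[of cs] by (subst sum.delta) auto
    finally show "(\<Sum>as\<in>blists ?r. of_bool (act (concat (mixing_round N pl as)) (?a cs) = w)) =
      (\<Sum>v'\<in>?V. of_bool (?a cs = v') * (\<Sum>as\<in>blists ?r. of_bool (act (concat (mixing_round N pl as)) v' = w)) :: real)" by simp
  qed
  also have "\<dots> = (\<Sum>v'\<in>?V. (\<Sum>cs\<in>blists ?s. of_bool (?a cs = v')) * (\<Sum>as\<in>blists ?r. of_bool (act (concat (mixing_round N pl as)) v' = w)))"
    by (subst sum.swap) (simp only: sum_distrib_right)
  finally have eq: "(\<Sum>bs\<in>blists (Suc t * ?r). of_bool (act (concat (rounds N pl (Suc t) bs)) v = w))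
     = (\<Sum>v'\<in>?V. (\<Sum>cs\<in>blists ?s. of_bool (?a cs = v')) * (\<Sum>as\<in>blists ?r. of_bool (act (concat (mixing_round N pl as)) v' = w)) :: real)" .
  have pow: "(2::real) ^ (Suc t * ?r) = 2 ^ ?s * 2 ^ ?r" by (simp add: power_add)
  show ?thesis
    unfolding trans_prob_sum eq pow by (subst sum_divide_distrib) (simp only: times_divide_times_eq)
qed

text \<open>One round is a step of the chain of \<open>feistel_chain_mixing\<close>; the shear does nothing if the \<open>X\<close>-part is \<open>0\<close>.\<close>

lemma trans_prob_mixing_round:
  assumes pl: "plan_ok N pl" "separating N pl" and x: "x \<in> vecs N" and z: "z \<in> vecs N" and b: "b \<in> vecs N"
  shows "trans_prob (plan_bits pl) (mixing_round N pl) (x, z) (b, a) =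
    (if a = x then (if x = 0 then of_bool (z = b) else 1 / 2 ^ N) else 0)"
proof (cases "a = x")
  case True
  have eq: "trans_prob (plan_bits pl) (mixing_round N pl) (x, z) (b, a) =
      real (card {bs\<in>blists (plan_bits pl). snd (act (concat (shear pl bs)) (x, z)) = b}) / 2 ^ plan_bits pl"
    unfolding trans_prob_def act_mixing_round[OF pl(1) x z] using True by simp
  show ?thesis
  proof (cases "x = 0")
    case False
    then show ?thesis
      using shear_uniform[OF pl x False z b] True unfolding eq by (simp add: field_simps)
  next
    case True': True
    have "snd (act (concat (shear pl bs)) (x, z)) = z" for bs
    proof -
      let ?z = "snd (act (concat (shear pl bs)) (x, z))"
      have z': "?z \<in> vecs N" using act_supported[OF scircuit_ok_shear[OF pl(1)], of "(x, z)"] x z by (simp add: vecs_def)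
      have fz: "\<forall>f\<in>set (forms pl 0 y). f = 0" for y by (auto simp: forms_def pair_form_def)
      have ss: "subset_sum bs fs = 0" if "\<forall>f\<in>set fs. f = 0" for fs
        using that by (induction bs fs rule: subset_sum.induct) auto
      have "dot N y (?z + z) = 0" for y
        using act_shear[OF pl(1), of bs "(x, z)" y] ss[OF fz] True' by (simp add: dot_add_right)
      then have "(\<Sum>y\<in>vecs N. sg (dot N y (?z + z))) = (2 ^ N :: real)" by (simp add: card_vecs)
      then have "?z + z = 0" using sum_sg_dot[OF add_in_vecs[OF z' z], where 'a = real] by (auto split: if_splits)
      then show ?thesis by (simp add: bvec_add_eq_zero)
    qed
    then show ?thesis unfolding eq using True True' by (simp add: card_blists)
  qed
next
  case False
  then show ?thesis unfolding trans_prob_def act_mixing_round[OF pl(1) x z] by simp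
qed

lemma rounds_mixing:
  assumes pl: "plan_ok N pl" "separating N pl" and N: "1 \<le> N" and v: "v \<in> vecs N \<times> vecs N" "v \<noteq> (0, 0)"
  shows "(\<Sum>w\<in>vecs N \<times> vecs N - {(0, 0)}. \<bar>trans_prob (22 * plan_bits pl) (rounds N pl 22) v w - 1 / ((2 ^ N)\<^sup>2 - 1)\<bar>) \<le> 1 / (2 ^ N) ^ 3"
proof -
  let ?V = "vecs N"
  define f where "f t a b = trans_prob (t * plan_bits pl) (rounds N pl t) v (a, b)" for t a b
  have f0: "f 0 a b = of_bool (v = (a, b))" for a b
    by (simp add: f_def trans_prob_sum blists_0)
  have "(\<Sum>(a, b)\<in>?V \<times> ?V - {(0, 0)}. \<bar>f 22 a b - 1 / ((2 ^ N)\<^sup>2 - 1)\<bar>) \<le> 1 / (2 ^ N) ^ 3"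
  proof (rule feistel_chain_mixing)
    show "(2::real) ^ N = real (card ?V)" by (simp add: card_vecs)
    show "(2::real) \<le> 2 ^ N" using power_increasing[OF N, of "2::real"] by simp
    show "0 \<le> f 0 a b" for a b by (simp add: f0)
    show "f 0 0 0 = 0" using v by (simp add: f0)
    have "(\<Sum>(a, b)\<in>?V \<times> ?V. f 0 a b) = (\<Sum>w\<in>?V \<times> ?V. if w = v then 1 else 0)"
      by (intro sum.cong) (auto simp: f0)
    also have "\<dots> = 1" using v by simp
    finally show "(\<Sum>a\<in>?V. \<Sum>b\<in>?V. f 0 a b) = 1" by (simp add: sum.cartesian_product)
    show "f (Suc t) b a = (if a = 0 then f t 0 b else (\<Sum>c\<in>?V. f t a c) / 2 ^ N)" if a: "a \<in> ?V" and b: "b \<in> ?V" for t a b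
    proof -
      have "f (Suc t) b a = (\<Sum>x\<in>?V. \<Sum>z\<in>?V. f t x z * trans_prob (plan_bits pl) (mixing_round N pl) (x, z) (b, a))"
        unfolding f_def trans_prob_rounds_Suc[OF pl(1) v(1)] sum.cartesian_product
        by (intro sum.cong refl) auto
      also have "\<dots> = (\<Sum>x\<in>?V. if x = a then (\<Sum>z\<in>?V. f t a z * (if a = 0 then of_bool (z = b) else 1 / 2 ^ N)) else 0)"
        using b by (intro sum.cong refl) (auto simp: trans_prob_mixing_round[OF pl] intro!: sum.cong)
      also have "\<dots> = (\<Sum>z\<in>?V. f t a z * (if a = 0 then of_bool (z = b) else 1 / 2 ^ N))" using a by simp
      also have "\<dots> = (if a = 0 then f t 0 b else (\<Sum>c\<in>?V. f t a c) / 2 ^ N)"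
      proof (cases "a = 0")
        case True
        have "(\<Sum>z\<in>?V. f t 0 z * of_bool (z = b)) = (\<Sum>z\<in>?V. if z = b then f t 0 b else 0)" by (intro sum.cong) auto
        then show ?thesis using True b by simp
      qed (simp add: sum_divide_distrib)
      finally show ?thesis .
    qed
  qed simp_all
  then show ?thesis by (simp add: f_def case_prod_beta)
qed

theorem ex_mixing_circuits:
  "\<exists>C::nat. \<forall>N\<ge>1. \<exists>r circ.
    (\<forall>bs. scircuit_ok N (circ bs) \<and> length (concat (circ bs)) \<le> C * N \<and> real (length (circ bs)) \<le> real C * (1 + log 2 (real N))) \<and>
    r \<le> C * N \<and>
    (\<forall>v\<in>vecs N \<times> vecs N - {(0, 0)}.
      (\<Sum>w\<in>vecs N \<times> vecs N - {(0, 0)}. \<bar>trans_prob r circ v w - 1 / ((2 ^ N)\<^sup>2 - 1)\<bar>) \<le> 1 / (2 ^ N) ^ 3)"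
proof -
  obtain C where C: "\<forall>N\<ge>1. \<exists>pl. plan_ok N pl \<and> separating N pl \<and> plan_size pl \<le> C * N \<and>
    real (plan_depth pl) \<le> real C * (1 + log 2 (real N))" using ex_separating_plan by blast
  have "\<exists>r circ.
    (\<forall>bs. scircuit_ok N (circ bs) \<and> length (concat (circ bs)) \<le> 22 * (1 + C) * N \<and> real (length (circ bs)) \<le> real (22 * (1 + C)) * (1 + log 2 (real N))) \<and>
    r \<le> 22 * (1 + C) * N \<and>
    (\<forall>v\<in>vecs N \<times> vecs N - {(0, 0)}.
      (\<Sum>w\<in>vecs N \<times> vecs N - {(0, 0)}. \<bar>trans_prob r circ v w - 1 / ((2 ^ N)\<^sup>2 - 1)\<bar>) \<le> 1 / (2 ^ N) ^ 3)" if N: "1 \<le> N" for N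
  proof -
    from C N obtain pl where pl: "plan_ok N pl" "separating N pl" and size: "plan_size pl \<le> C * N"
      and depth: "real (plan_depth pl) \<le> real C * (1 + log 2 (real N))" by blast
    have "plan_bits pl \<le> plan_size pl" by (induction pl) (auto simp: plan_bits_def plan_size_def)
    then have "22 * plan_bits pl \<le> 22 * (1 + C) * N" using size by (simp add: algebra_simps)
    moreover have "length (concat (rounds N pl 22 bs)) \<le> 22 * (1 + C) * N" for bs
      using rounds_length(2)[of N pl 22 bs] size by (simp add: algebra_simps)
    moreover have "real (length (rounds N pl 22 bs)) \<le> real (22 * (1 + C)) * (1 + log 2 (real N))" for bs
    proof -
      have "0 \<le> log 2 (real N)" using N by simp
      then show ?thesis using depth by (simp add: rounds_length algebra_simps)
    qed
    ultimately show ?thesis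
      using scircuit_ok_rounds[OF pl(1)] rounds_mixing[OF pl N]
      by (intro exI[of _ "22 * plan_bits pl"] exI[of _ "rounds N pl 22"] conjI allI ballI) blast+
  qed
  then show ?thesis by blast
qed

section \<open>Unitary matrices and the spectral theorem\<close>
lemma adj_dim [simp]: "dim_row (A\<^sup>\<dagger>) = dim_col A" "dim_col (A\<^sup>\<dagger>) = dim_row A"
  by (simp_all add: mat_adjoint_def)

lemma adj_carrier [simp]: "A \<in> carrier_mat n m \<Longrightarrow> A\<^sup>\<dagger> \<in> carrier_mat m n"
  by (intro carrier_matI) auto

lemma adj_index [simp]:
  fixes A :: "complex mat"
  assumes "i < dim_col A" "j < dim_row A"
  shows "A\<^sup>\<dagger> $$ (i, j) = cnj (A $$ (j, i))"
  using assms by (simp add: mat_adjoint_def mat_of_rows_def conjugate_vec_def)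

lemma adj_adj [simp]: "(A :: complex mat)\<^sup>\<dagger>\<^sup>\<dagger> = A"
  by (rule eq_matI) simp_all

lemma mult_index:
  assumes "A \<in> carrier_mat n m" "B \<in> carrier_mat m k" "i < n" "j < k"
  shows "(A * B) $$ (i, j) = (\<Sum>l<m. A $$ (i, l) * B $$ (l, j))"
  using assms by (simp add: scalar_prod_def atLeast0LessThan)

lemma adj_mult:
  fixes A B :: "complex mat"
  assumes "A \<in> carrier_mat n m" "B \<in> carrier_mat m k"
  shows "(A * B)\<^sup>\<dagger> = B\<^sup>\<dagger> * A\<^sup>\<dagger>"
proof (rule eq_matI)
  fix i j assume "i < dim_row (B\<^sup>\<dagger> * A\<^sup>\<dagger>)" "j < dim_col (B\<^sup>\<dagger> * A\<^sup>\<dagger>)"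
  then have ij: "i < k" "j < n" using assms by auto
  have "(A * B)\<^sup>\<dagger> $$ (i, j) = cnj ((A * B) $$ (j, i))" using assms ij by (intro adj_index) auto
  also have "\<dots> = (\<Sum>l<m. cnj (A $$ (j, l)) * cnj (B $$ (l, i)))"
    unfolding mult_index[OF assms ij(2) ij(1)] by simp
  also have "\<dots> = (\<Sum>l<m. B\<^sup>\<dagger> $$ (i, l) * A\<^sup>\<dagger> $$ (l, j))"
    using assms ij by (intro sum.cong) (auto simp: mult.commute)
  also have "\<dots> = (B\<^sup>\<dagger> * A\<^sup>\<dagger>) $$ (i, j)"
    by (rule mult_index[symmetric, OF _ _ ij]) (use assms in auto)
  finally show "(A * B)\<^sup>\<dagger> $$ (i, j) = (B\<^sup>\<dagger> * A\<^sup>\<dagger>) $$ (i, j)" .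
qed (use assms in auto)

lemma adj_one [simp]: "(1\<^sub>m n :: complex mat)\<^sup>\<dagger> = 1\<^sub>m n"
  by (rule eq_matI) simp_all

lemma sq_assoc: "A \<in> carrier_mat n n \<Longrightarrow> B \<in> carrier_mat n n \<Longrightarrow> C \<in> carrier_mat n n \<Longrightarrow> (A * B) * C = A * (B * C)"
  by (rule assoc_mult_mat)

lemma sq_closed: "A \<in> carrier_mat n n \<Longrightarrow> B \<in> carrier_mat n n \<Longrightarrow> A * B \<in> carrier_mat n n"
  by (rule mult_carrier_mat)

lemma trace_mult_commute:
  assumes "A \<in> carrier_mat n m" "B \<in> carrier_mat m n"
  shows "trace (A * B) = trace (B * A)"
proof -
  have "trace (A * B) = (\<Sum>i<n. \<Sum>l<m. A $$ (i, l) * B $$ (l, i))"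
    using assms unfolding trace_def by (intro sum.cong) (auto simp: mult_index[OF assms] simp del: index_mult_mat(1))
  also have "\<dots> = (\<Sum>l<m. \<Sum>i<n. B $$ (l, i) * A $$ (i, l))"
    by (subst sum.swap) (simp only: mult.commute)
  also have "\<dots> = trace (B * A)"
    using assms unfolding trace_def by (intro sum.cong) (auto simp: mult_index[OF assms(2,1)] simp del: index_mult_mat(1))
  finally show ?thesis .
qed

lemma unitaryD:
  assumes "U \<in> unitary n"
  shows "U \<in> carrier_mat n n" "U * U\<^sup>\<dagger> = 1\<^sub>m n" "U\<^sup>\<dagger> * U = 1\<^sub>m n"
  using assms by (auto simp: unitary_def)

lemma unitary_adj: "U \<in> unitary n \<Longrightarrow> U\<^sup>\<dagger> \<in> unitary n"
  by (simp add: unitary_def)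

lemma unitary_mult:
  assumes "U \<in> unitary n" "V \<in> unitary n"
  shows "U * V \<in> unitary n"
proof -
  note U = unitaryD[OF assms(1)] and V = unitaryD[OF assms(2)]
  have "U * V * (V\<^sup>\<dagger> * U\<^sup>\<dagger>) = U * (V * V\<^sup>\<dagger>) * U\<^sup>\<dagger>"
    using U(1) V(1) by (simp add: sq_assoc[of _ n] sq_closed del: assoc_mult_mat)
  moreover have "V\<^sup>\<dagger> * U\<^sup>\<dagger> * (U * V) = V\<^sup>\<dagger> * (U\<^sup>\<dagger> * U) * V"
    using U(1) V(1) by (simp add: sq_assoc[of _ n] sq_closed del: assoc_mult_mat)
  ultimately show ?thesis using U V by (simp add: unitary_def adj_mult[of _ n n _ n])
qed

lemma unitary_conj_cancel:
  assumes U: "U \<in> unitary n" and A: "A \<in> carrier_mat n n"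
  shows "U * (U\<^sup>\<dagger> * A * U) * U\<^sup>\<dagger> = A" "U\<^sup>\<dagger> * (U * A * U\<^sup>\<dagger>) * U = A"
proof -
  note U = unitaryD[OF U]
  have "U * (U\<^sup>\<dagger> * A * U) * U\<^sup>\<dagger> = (U * U\<^sup>\<dagger>) * A * (U * U\<^sup>\<dagger>)"
    using U(1) A by (simp add: sq_assoc[of _ n] sq_closed del: assoc_mult_mat)
  then show "U * (U\<^sup>\<dagger> * A * U) * U\<^sup>\<dagger> = A" using U A by simp
  have "U\<^sup>\<dagger> * (U * A * U\<^sup>\<dagger>) * U = (U\<^sup>\<dagger> * U) * A * (U\<^sup>\<dagger> * U)"
    using U(1) A by (simp add: sq_assoc[of _ n] sq_closed del: assoc_mult_mat)
  then show "U\<^sup>\<dagger> * (U * A * U\<^sup>\<dagger>) * U = A" using U A by simp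
qed

text \<open>Diagonal matrices with real entries.\<close>

definition diagm :: "nat \<Rightarrow> (nat \<Rightarrow> real) \<Rightarrow> complex mat" where
  "diagm n d = mat n n (\<lambda>(i, j). if i = j then complex_of_real (d i) else 0)"

lemma diagm_carrier [simp]: "diagm n d \<in> carrier_mat n n"
  by (simp add: diagm_def)

lemma diagm_adj [simp]: "(diagm n d)\<^sup>\<dagger> = diagm n d"
  by (rule eq_matI) (auto simp: diagm_def)

lemma diagm_mult_left:
  assumes "A \<in> carrier_mat n m" "i < n" "j < m"
  shows "(diagm n d * A) $$ (i, j) = d i * A $$ (i, j)"
proof -
  have "(diagm n d * A) $$ (i, j) = (\<Sum>l<n. if l = i then d i * A $$ (i, j) else 0)"
    unfolding mult_index[OF diagm_carrier assms] using assms by (intro sum.cong) (auto simp: diagm_def)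
  then show ?thesis using assms by simp
qed

lemma diagm_mult_right:
  assumes "A \<in> carrier_mat m n" "i < m" "j < n"
  shows "(A * diagm n d) $$ (i, j) = A $$ (i, j) * d j"
proof -
  have "(A * diagm n d) $$ (i, j) = (\<Sum>l<n. if l = j then A $$ (i, j) * d j else 0)"
    unfolding mult_index[OF assms(1) diagm_carrier assms(2,3)] using assms by (intro sum.cong) (auto simp: diagm_def)
  then show ?thesis using assms by simp
qed

lemma diagm_mult: "diagm n d * diagm n e = diagm n (\<lambda>i. d i * e i)"
proof (rule eq_matI)
  fix i j assume "i < dim_row (diagm n (\<lambda>i. d i * e i))" "j < dim_col (diagm n (\<lambda>i. d i * e i))"
  then have ij: "i < n" "j < n" by (auto simp: diagm_def)
  show "(diagm n d * diagm n e) $$ (i, j) = diagm n (\<lambda>i. d i * e i) $$ (i, j)"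
    unfolding diagm_mult_left[OF diagm_carrier ij] using ij by (simp add: diagm_def)
qed (simp_all add: diagm_def)

lemma trace_diagm: "trace (diagm n d) = complex_of_real (\<Sum>i<n. d i)"
  by (simp add: trace_def diagm_def)

definition vnorm2 :: "complex vec \<Rightarrow> real" where
  "vnorm2 v = (\<Sum>i<dim_vec v. (cmod (v $ i))\<^sup>2)"

lemma vnorm2_nonneg: "0 \<le> vnorm2 v"
  by (simp add: vnorm2_def sum_nonneg)

lemma vnorm2_eq_0: "v \<in> carrier_vec n \<Longrightarrow> vnorm2 v = 0 \<longleftrightarrow> v = 0\<^sub>v n"
  by (auto simp: vnorm2_def sum_nonneg_eq_0_iff)

lemma cprod_index: "w \<in> carrier_vec n \<Longrightarrow> v \<bullet>c w = (\<Sum>i<n. v $ i * cnj (w $ i))"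
  by (simp add: scalar_prod_def atLeast0LessThan conjugate_vec_def)

lemma cprod_self: "v \<in> carrier_vec n \<Longrightarrow> v \<bullet>c v = complex_of_real (vnorm2 v)"
  by (simp add: cprod_index vnorm2_def of_real_power[symmetric] complex_norm_square[symmetric] del: of_real_power)

lemma mult_vec_index:
  assumes "A \<in> carrier_mat m n" "v \<in> carrier_vec n" "i < m"
  shows "(A *\<^sub>v v) $ i = (\<Sum>j<n. A $$ (i, j) * v $ j)"
  using assms by (simp add: scalar_prod_def atLeast0LessThan)

lemma cprod_adj:
  fixes A :: "complex mat"
  assumes "A \<in> carrier_mat m n" "v \<in> carrier_vec n" "w \<in> carrier_vec m"
  shows "(A *\<^sub>v v) \<bullet>c w = v \<bullet>c (A\<^sup>\<dagger> *\<^sub>v w)"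
proof -
  have "(A *\<^sub>v v) \<bullet>c w = (\<Sum>i<m. \<Sum>j<n. A $$ (i, j) * v $ j * cnj (w $ i))"
    using assms by (simp add: cprod_index[of w m] mult_vec_index[OF assms(1,2)] sum_distrib_right del: index_mult_mat_vec)
  also have "\<dots> = (\<Sum>j<n. \<Sum>i<m. v $ j * cnj (A\<^sup>\<dagger> $$ (j, i) * w $ i))"
    using assms by (subst sum.swap) (simp add: ac_simps)
  also have "\<dots> = v \<bullet>c (A\<^sup>\<dagger> *\<^sub>v w)"
  proof -
    have A': "A\<^sup>\<dagger> \<in> carrier_mat n m" using assms by auto
    then have c: "A\<^sup>\<dagger> *\<^sub>v w \<in> carrier_vec n" using assms(3) by (rule mult_mat_vec_carrier)
    show ?thesis
      unfolding cprod_index[OF c]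
      by (intro sum.cong refl) (simp add: mult_vec_index[OF A' assms(3)] sum_distrib_left del: index_mult_mat_vec)
  qed
  finally show ?thesis .
qed

lemma cprod_le: 
  assumes "v \<in> carrier_vec n" "w \<in> carrier_vec n"
  shows "cmod (v \<bullet>c w) \<le> sqrt (vnorm2 v) * sqrt (vnorm2 w)"
proof -
  have "cmod (v \<bullet>c w) \<le> (\<Sum>i<n. \<bar>cmod (v $ i)\<bar> * \<bar>cmod (w $ i)\<bar>)"
    unfolding cprod_index[OF assms(2)] by (rule order_trans[OF norm_sum]) (simp add: norm_mult)
  also have "\<dots> \<le> L2_set (\<lambda>i. cmod (v $ i)) {..<n} * L2_set (\<lambda>i. cmod (w $ i)) {..<n}"
    by (rule L2_set_mult_ineq)
  finally show ?thesis using assms by (simp add: L2_set_def vnorm2_def)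
qed

text \<open>A Householder reflection. If the first unit vector is \<open>v\<close> itself, then \<open>s = 0\<close> and, as division by zero yields zero, \<open>H\<close> is
  the identity.\<close>

lemma ex_unitary_first_col:
  assumes v: "v \<in> carrier_vec n" "vnorm2 v = 1" "v $ 0 = complex_of_real c" and n: "0 < n"
  shows "\<exists>H\<in>unitary n. \<forall>i<n. H $$ (i, 0) = v $ i"
proof -
  define u where "u i = v $ i - (if i = 0 then 1 else 0)" for i
  define s where "s = (\<Sum>i<n. (cmod (u i))\<^sup>2)"
  have vsum: "(\<Sum>i<n. (cmod (v $ i))\<^sup>2) = 1" using v by (simp add: vnorm2_def)
  have s: "s = 2 - 2 * c"
  proof -
    have "s = (cmod (u 0))\<^sup>2 + (\<Sum>i\<in>{..<n} - {0}. (cmod (u i))\<^sup>2)"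
      unfolding s_def using n by (subst sum.remove[of _ 0]) auto
    also have "(\<Sum>i\<in>{..<n} - {0}. (cmod (u i))\<^sup>2) = (\<Sum>i\<in>{..<n} - {0}. (cmod (v $ i))\<^sup>2)"
      by (intro sum.cong) (auto simp: u_def)
    also have "\<dots> = 1 - (cmod (v $ 0))\<^sup>2"
      using vsum n by (subst (asm) sum.remove[of _ 0]) auto
    also have "u 0 = complex_of_real (c - 1)" by (simp add: u_def v(3))
    also have "(cmod (complex_of_real (c - 1)))\<^sup>2 = (c - 1)\<^sup>2" by (simp only: norm_of_real power2_abs)
    also have "(cmod (v $ 0))\<^sup>2 = c\<^sup>2" by (simp add: v(3))
    finally show ?thesis by (simp add: power2_eq_square algebra_simps)
  qed
  define K where "K = complex_of_real (2 / s)"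
  define H where "H = mat n n (\<lambda>(i, j). (if i = j then 1 else 0) - K * (u i * cnj (u j)))"
  have H: "H \<in> carrier_mat n n" by (simp add: H_def)
  have "cnj K = K" by (simp add: K_def)
  then have Hadj: "H\<^sup>\<dagger> = H" by (intro eq_matI) (auto simp: H_def)
  have uu: "(\<Sum>l<n. cnj (u l) * u l) = complex_of_real s"
    by (simp add: s_def mult.commute[of "cnj _"] of_real_power[symmetric] complex_norm_square[symmetric] del: of_real_power)
  have "H * H = 1\<^sub>m n"
  proof (rule eq_matI)
    fix i j assume "i < dim_row (1\<^sub>m n :: complex mat)" "j < dim_col (1\<^sub>m n :: complex mat)"
    then have ij: "i < n" "j < n" by auto
    have "(H * H) $$ (i, j) = (\<Sum>l<n. ((if i = l then 1 else 0) - K * (u i * cnj (u l))) * ((if l = j then 1 else 0) - K * (u l * cnj (u j))))"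
      unfolding mult_index[OF H H ij] using ij by (intro sum.cong) (auto simp: H_def)
    also have "\<dots> = (\<Sum>l<n. (if l = i then (if i = j then 1 else 0) else 0) - (if l = i then K * (u i * cnj (u j)) else 0)
         - (if l = j then K * (u i * cnj (u j)) else 0) + K * K * u i * cnj (u j) * (cnj (u l) * u l))"
      by (intro sum.cong) (auto simp: algebra_simps)
    also have "\<dots> = (if i = j then 1 else 0) - 2 * (K * (u i * cnj (u j))) + K * K * u i * cnj (u j) * (\<Sum>l<n. cnj (u l) * u l)"
      using ij unfolding sum.distrib sum_subtractf by (subst sum_distrib_left[symmetric]) simp
    also have "\<dots> = (if i = j then 1 else 0)"
    proof -
      have "K * complex_of_real s = (if s = 0 then 0 else 2)"
        unfolding K_def of_real_mult[symmetric] by simp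
      moreover have "K * K * u i * cnj (u j) * complex_of_real s = (K * complex_of_real s) * (K * (u i * cnj (u j)))"
        by (simp only: mult_ac)
      ultimately have "K * K * u i * cnj (u j) * complex_of_real s = (if s = 0 then 0 else 2) * (K * (u i * cnj (u j)))"
        by (simp only:)
      then show ?thesis unfolding uu by (simp add: K_def)
    qed
    finally show "(H * H) $$ (i, j) = 1\<^sub>m n $$ (i, j)" using ij by simp
  qed (use H in auto)
  then have "H \<in> unitary n" using H Hadj by (simp add: unitary_def)
  moreover have "H $$ (i, 0) = v $ i" if i: "i < n" for i
  proof (cases "s = 0")
    case True
    then have "\<forall>i\<in>{..<n}. (cmod (u i))\<^sup>2 = 0"
      unfolding s_def by (subst (asm) sum_nonneg_eq_0_iff) auto
    then have "u i = 0" using i by simp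
    moreover have "H $$ (i, 0) = (if i = 0 then 1 else 0)" using True i n by (simp add: H_def K_def)
    ultimately show ?thesis unfolding u_def by simp
  next
    case False
    have "2 / s * (c - 1) = - 1" using False s by (simp add: field_simps)
    have "K * cnj (u 0) = complex_of_real (2 / s * (c - 1))" by (simp add: K_def u_def v(3))
    also have "\<dots> = - 1" unfolding \<open>2 / s * (c - 1) = - 1\<close> by simp
    finally have "K * (u i * cnj (u 0)) = - u i" by (simp add: mult.left_commute[of K])
    then show ?thesis using i n by (simp add: H_def u_def)
  qed
  ultimately show ?thesis by blast
qed

lemma ex_unit_eigenvector:
  assumes A: "(A :: complex mat) \<in> carrier_mat n n" and n: "0 < n"
  shows "\<exists>v k c. v \<in> carrier_vec n \<and> vnorm2 v = 1 \<and> v $ 0 = complex_of_real c \<and> A *\<^sub>v v = k \<cdot>\<^sub>v v"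
proof -
  obtain k where "eigenvalue A k" using spectrum_non_empty[OF A n] by (auto simp: spectrum_def)
  then obtain w where w: "w \<in> carrier_vec n" "w \<noteq> 0\<^sub>v n" "A *\<^sub>v w = k \<cdot>\<^sub>v w"
    using A by (auto simp: eigenvalue_def eigenvector_def)
  define r where "r = sqrt (vnorm2 w)"
  have "vnorm2 w \<noteq> 0" using w vnorm2_eq_0 by blast
  then have r: "0 < r" "r\<^sup>2 = vnorm2 w" using vnorm2_nonneg[of w] by (auto simp: r_def)
  define ph where "ph = (if w $ 0 = 0 then 1 else cnj (w $ 0) / complex_of_real (cmod (w $ 0)))"
  have ph: "cmod ph = 1" by (simp add: ph_def norm_divide)
  have ph0: "ph * w $ 0 = complex_of_real (cmod (w $ 0))"
    using complex_norm_square[of "w $ 0"] by (simp add: ph_def power2_eq_square mult.commute field_simps)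
  define v where "v = (ph / complex_of_real r) \<cdot>\<^sub>v w"
  have "v \<in> carrier_vec n" using w by (simp add: v_def)
  moreover have "vnorm2 v = 1"
  proof -
    have "vnorm2 v = (\<Sum>i<n. (cmod (w $ i))\<^sup>2 / r\<^sup>2)"
      using w r by (simp add: vnorm2_def v_def norm_mult norm_divide ph power_divide)
    also have "\<dots> = vnorm2 w / r\<^sup>2" using w by (simp add: vnorm2_def sum_divide_distrib)
    finally show ?thesis using \<open>vnorm2 w \<noteq> 0\<close> r by simp
  qed
  moreover have "v $ 0 = complex_of_real (cmod (w $ 0) / r)"
    using w n ph0 by (simp add: v_def)
  moreover have "A *\<^sub>v v = k \<cdot>\<^sub>v v"
    using A w by (simp add: v_def mult_mat_vec smult_smult_assoc mult.commute)
  ultimately show ?thesis by (intro exI conjI)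
qed

text \<open>A unit eigenvector is completed to a unitary matrix; conjugation with it splits off a one-dimensional block.\<close>

theorem hermitian_diagonalization:
  assumes "A \<in> carrier_mat n n" "A\<^sup>\<dagger> = A"
  shows "\<exists>U d. U \<in> unitary n \<and> A = U * diagm n d * U\<^sup>\<dagger>"
  using assms
proof (induction n arbitrary: A)
  case 0
  then have "A = 1\<^sub>m 0 * diagm 0 (\<lambda>_. 0) * (1\<^sub>m 0)\<^sup>\<dagger>"
    by (intro eq_matI) (simp_all add: diagm_def)
  moreover have "(1\<^sub>m 0 :: complex mat) \<in> unitary 0" by (simp add: unitary_def)
  ultimately show ?case by blast
next
  case (Suc n)
  note A = Suc.prems
  obtain v k c where v: "v \<in> carrier_vec (Suc n)" "vnorm2 v = 1" "v $ 0 = complex_of_real c" "A *\<^sub>v v = k \<cdot>\<^sub>v v"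
    using ex_unit_eigenvector[OF A(1)] by blast
  obtain H where H: "H \<in> unitary (Suc n)" "\<forall>i<Suc n. H $$ (i, 0) = v $ i"
    using ex_unitary_first_col[OF v(1-3)] by blast
  note H' = unitaryD[OF H(1)]
  have col: "col H 0 = v" using H(2) H'(1) v(1) by (intro eq_vecI) auto
  define M where "M = H\<^sup>\<dagger> * A * H"
  have M: "M \<in> carrier_mat (Suc n) (Suc n)" unfolding M_def using A(1) H'(1) by (intro sq_closed) auto
  have Madj: "M\<^sup>\<dagger> = M"
    using A H'(1) by (simp add: M_def adj_mult[of _ "Suc n" "Suc n" _ "Suc n"] sq_assoc[of _ "Suc n"] sq_closed del: assoc_mult_mat)
  have col0: "M $$ (i, 0) = (if i = 0 then k else 0)" if i: "i < Suc n" for i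
  proof -
    have "M = H\<^sup>\<dagger> * (A * H)" unfolding M_def using A(1) H'(1) by (intro sq_assoc) auto
    then have "col M 0 = H\<^sup>\<dagger> *\<^sub>v col (A * H) 0"
      using A(1) H'(1) by (simp add: col_mult2[of _ "Suc n" "Suc n" _ "Suc n"] sq_closed[of _ "Suc n"])
    also have "col (A * H) 0 = A *\<^sub>v col H 0" using A(1) H'(1) by (intro col_mult2) auto
    finally have "col M 0 = H\<^sup>\<dagger> *\<^sub>v (A *\<^sub>v col H 0)" .
    also have "H\<^sup>\<dagger> *\<^sub>v (A *\<^sub>v col H 0) = k \<cdot>\<^sub>v (H\<^sup>\<dagger> *\<^sub>v col H 0)" unfolding col v(4) using v(1) H'(1) by (intro mult_mat_vec[of _ "Suc n" "Suc n"]) auto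
    also have "H\<^sup>\<dagger> *\<^sub>v col H 0 = col (1\<^sub>m (Suc n)) 0"
      unfolding H'(3)[symmetric] using H'(1) by (intro col_mult2[symmetric]) auto
    finally have "col M 0 = k \<cdot>\<^sub>v col (1\<^sub>m (Suc n)) 0" .
    then have "col M 0 $ i = (k \<cdot>\<^sub>v col (1\<^sub>m (Suc n)) 0) $ i" by simp
    then show ?thesis using i M by simp
  qed
  have row0: "M $$ (0, j) = (if j = 0 then cnj k else 0)" if j: "j < Suc n" for j
  proof -
    have "M $$ (0, j) = M\<^sup>\<dagger> $$ (0, j)" by (simp add: Madj)
    also have "\<dots> = cnj (M $$ (j, 0))" using M j by (intro adj_index) auto
    finally show ?thesis using col0[OF j] by simp
  qed
  have "cnj k = k" using row0[of 0] col0[of 0] by simp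
  then have k: "k = complex_of_real (Re k)" by (simp add: complex_eq_iff)
  define B where "B = mat n n (\<lambda>(i, j). M $$ (Suc i, Suc j))"
  have B: "B \<in> carrier_mat n n" by (simp add: B_def)
  have "B\<^sup>\<dagger> = B"
  proof (rule eq_matI)
    fix i j assume "i < dim_row B" "j < dim_col B"
    then have ij: "i < n" "j < n" by (auto simp: B_def)
    then have "B\<^sup>\<dagger> $$ (i, j) = M\<^sup>\<dagger> $$ (Suc i, Suc j)" using M by (simp add: B_def)
    then show "B\<^sup>\<dagger> $$ (i, j) = B $$ (i, j)" using ij by (simp add: Madj B_def)
  qed (simp_all add: B_def)
  from Suc.IH[OF B this] obtain V d where V: "V \<in> unitary n" and Beq: "B = V * diagm n d * V\<^sup>\<dagger>" by (elim exE conjE)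
  note V' = unitaryD[OF V]
  define X where "X = four_block_mat (1\<^sub>m 1) (0\<^sub>m 1 n) (0\<^sub>m n 1) V"
  have X: "X \<in> carrier_mat (Suc n) (Suc n)" using V'(1) by (intro carrier_matI) (auto simp: X_def)
  have Xadj: "X\<^sup>\<dagger> = four_block_mat (1\<^sub>m 1) (0\<^sub>m 1 n) (0\<^sub>m n 1) (V\<^sup>\<dagger>)"
    using V'(1) by (intro eq_matI) (auto simp: X_def)
  define e where "e i = (if i = 0 then Re k else d (i - 1))" for i
  let ?k = "mat 1 1 (\<lambda>_. k) :: complex mat"
  have De: "diagm (Suc n) e = four_block_mat ?k (0\<^sub>m 1 n) (0\<^sub>m n 1) (diagm n d)"
    using k by (intro eq_matI) (auto simp: diagm_def e_def)
  have Meq: "M = four_block_mat ?k (0\<^sub>m 1 n) (0\<^sub>m n 1) B"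
    using M col0 row0 \<open>cnj k = k\<close> by (intro eq_matI) (auto simp: B_def)
  have mult: "four_block_mat A1 (0\<^sub>m 1 n) (0\<^sub>m n 1) D1 * four_block_mat A2 (0\<^sub>m 1 n) (0\<^sub>m n 1) D2
     = four_block_mat (A1 * A2) (0\<^sub>m 1 n) (0\<^sub>m n 1) (D1 * D2)"
    if "A1 \<in> carrier_mat 1 1" "A2 \<in> carrier_mat 1 1" "D1 \<in> carrier_mat n n" "D2 \<in> carrier_mat n n" for A1 A2 D1 D2 :: "complex mat"
    using that by (subst mult_four_block_mat[of _ 1 1 _ n _ n _ _ 1 _ n]) auto
  have one: "four_block_mat (1\<^sub>m 1) (0\<^sub>m 1 n) (0\<^sub>m n 1) (1\<^sub>m n) = (1\<^sub>m (Suc n) :: complex mat)"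
    using four_block_one_mat[of 1 n] by simp
  have XU: "X \<in> unitary (Suc n)"
  proof -
    have "X * X\<^sup>\<dagger> = 1\<^sub>m (Suc n)" unfolding Xadj unfolding X_def using V' by (simp add: mult one plus_1_eq_Suc del: One_nat_def)
    moreover have "X\<^sup>\<dagger> * X = 1\<^sub>m (Suc n)" unfolding Xadj unfolding X_def using V' by (simp add: mult one plus_1_eq_Suc del: One_nat_def)
    ultimately show ?thesis using X by (simp add: unitary_def)
  qed
  have "X * diagm (Suc n) e * X\<^sup>\<dagger> = M"
    unfolding De Meq Xadj unfolding X_def using V'(1)
    by (simp add: mult Beq sq_closed[of _ n] del: One_nat_def assoc_mult_mat)
  then have "A = H * (X * diagm (Suc n) e * X\<^sup>\<dagger>) * H\<^sup>\<dagger>"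
    using unitary_conj_cancel(1)[OF H(1) A(1)] by (simp add: M_def)
  also have "\<dots> = (H * X) * diagm (Suc n) e * (H * X)\<^sup>\<dagger>"
    using H'(1) X by (simp add: adj_mult[of _ "Suc n" "Suc n" _ "Suc n"] sq_assoc[of _ "Suc n"] sq_closed del: assoc_mult_mat)
  finally show ?case using unitary_mult[OF H(1) XU] by (intro exI[of _ "H * X"] exI[of _ e] conjI)
qed

section \<open>Trace norm and contractions\<close>
lemma one_mult_diagm [simp]: "1\<^sub>m n * diagm n d = diagm n d"
  by (rule left_mult_one_mat[OF diagm_carrier])

lemma diagm_vec_index:
  assumes "v \<in> carrier_vec n" "i < n"
  shows "(diagm n d *\<^sub>v v) $ i = d i * v $ i"
proof -
  have "(diagm n d *\<^sub>v v) $ i = (\<Sum>j<n. if j = i then d i * v $ i else 0)"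
    unfolding mult_vec_index[OF diagm_carrier assms] using assms by (intro sum.cong) (auto simp: diagm_def)
  then show ?thesis using assms by simp
qed

lemma cprod_diagm_conj:
  assumes U: "U \<in> unitary n" and v: "v \<in> carrier_vec n"
  shows "((U * diagm n e * U\<^sup>\<dagger>) *\<^sub>v v) \<bullet>c v = complex_of_real (\<Sum>i<n. e i * (cmod ((U\<^sup>\<dagger> *\<^sub>v v) $ i))\<^sup>2)"
proof -
  note U' = unitaryD[OF U]
  have Ua: "U\<^sup>\<dagger> \<in> carrier_mat n n" using U'(1) by simp
  define w where "w = U\<^sup>\<dagger> *\<^sub>v v"
  have w: "w \<in> carrier_vec n" unfolding w_def by (rule mult_mat_vec_carrier[OF Ua v])
  have dw: "diagm n e *\<^sub>v w \<in> carrier_vec n" by (rule mult_mat_vec_carrier[OF diagm_carrier w])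
  have "(U * diagm n e * U\<^sup>\<dagger>) *\<^sub>v v = U *\<^sub>v (diagm n e *\<^sub>v w)"
    unfolding w_def
    by (simp only: assoc_mult_mat_vec[OF sq_closed[OF U'(1) diagm_carrier] Ua v]
      assoc_mult_mat_vec[OF U'(1) diagm_carrier w[unfolded w_def]])
  then have "((U * diagm n e * U\<^sup>\<dagger>) *\<^sub>v v) \<bullet>c v = (diagm n e *\<^sub>v w) \<bullet>c w"
    using cprod_adj[OF U'(1) dw v] by (simp add: w_def)
  also have "\<dots> = (\<Sum>i<n. complex_of_real (e i * (cmod (w $ i))\<^sup>2))"
    unfolding cprod_index[OF w]
    by (intro sum.cong refl) (simp add: diagm_vec_index[OF w] mult.assoc complex_norm_square[symmetric] del: index_mult_mat_vec)
  finally show ?thesis by (simp add: w_def)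
qed

lemma vnorm2_unitary:
  assumes U: "U \<in> unitary n" and v: "v \<in> carrier_vec n"
  shows "vnorm2 (U *\<^sub>v v) = vnorm2 v"
proof -
  note U' = unitaryD[OF U]
  have w: "U *\<^sub>v v \<in> carrier_vec n" by (rule mult_mat_vec_carrier[OF U'(1) v])
  have "complex_of_real (vnorm2 (U *\<^sub>v v)) = (U *\<^sub>v v) \<bullet>c (U *\<^sub>v v)" using cprod_self[OF w] by simp
  also have "\<dots> = v \<bullet>c (U\<^sup>\<dagger> *\<^sub>v (U *\<^sub>v v))" by (rule cprod_adj[OF U'(1) v w])
  also have "U\<^sup>\<dagger> *\<^sub>v (U *\<^sub>v v) = v"
    using assoc_mult_mat_vec[OF adj_carrier[OF U'(1)] U'(1) v] U'(3) v by simp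
  also have "v \<bullet>c v = complex_of_real (vnorm2 v)" by (rule cprod_self[OF v])
  finally show ?thesis by (simp only: of_real_eq_iff)
qed

lemma psd_diagm_conj:
  assumes U: "U \<in> unitary n" and e: "\<And>i. i < n \<Longrightarrow> 0 \<le> e i"
  shows "positive_semidefinite (U * diagm n e * U\<^sup>\<dagger>)"
proof -
  note U' = unitaryD[OF U]
  have "(U * diagm n e * U\<^sup>\<dagger>)\<^sup>\<dagger> = U * diagm n e * U\<^sup>\<dagger>"
    using U'(1) by (simp add: adj_mult[of _ n n _ n] sq_assoc[of _ n] sq_closed del: assoc_mult_mat)
  moreover have "0 \<le> Re (((U * diagm n e * U\<^sup>\<dagger>) *\<^sub>v v) \<bullet>c v)" if "v \<in> carrier_vec n" for v
    unfolding cprod_diagm_conj[OF U that] using e by (auto intro!: sum_nonneg)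
  ultimately show ?thesis using U'(1) by (simp add: positive_semidefinite_def)
qed

lemma diagm_conj_entry:
  assumes U: "U \<in> unitary n" and A: "A \<in> carrier_mat n n" "A = U * diagm n e * U\<^sup>\<dagger>" and i: "i < n"
  shows "(A *\<^sub>v col U i) \<bullet>c col U i = complex_of_real (e i)"
proof -
  note U' = unitaryD[OF U]
  have c: "col U i \<in> carrier_vec n" using U'(1) by auto
  have "U\<^sup>\<dagger> *\<^sub>v col U i = col (U\<^sup>\<dagger> * U) i" using U'(1) i by (intro col_mult2[symmetric]) auto
  also have "\<dots> = unit_vec n i" unfolding U'(3) using i by simp
  finally have *: "U\<^sup>\<dagger> *\<^sub>v col U i = unit_vec n i" .
  have "(A *\<^sub>v col U i) \<bullet>c col U i = complex_of_real (\<Sum>j<n. e j * (cmod (unit_vec n i $ j))\<^sup>2)"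
    unfolding A(2) cprod_diagm_conj[OF U c] * ..
  also have "(\<Sum>j<n. e j * (cmod (unit_vec n i $ j))\<^sup>2) = (\<Sum>j<n. if j = i then e i else 0)"
    using i by (intro sum.cong) (auto simp: unit_vec_def)
  finally show ?thesis using i by simp
qed

lemma vnorm2_col_unitary:
  assumes U: "U \<in> unitary n" and i: "i < n"
  shows "vnorm2 (col U i) = 1"
proof -
  note U' = unitaryD[OF U]
  have "col U i = U *\<^sub>v unit_vec n i" using U'(1) i col_mult2[of U n n "1\<^sub>m n" n i] by simp
  then have "vnorm2 (col U i) = vnorm2 (unit_vec n i)" using vnorm2_unitary[OF U] by simp
  also have "\<dots> = (\<Sum>j<n. if j = i then 1 else 0)"
    unfolding vnorm2_def using i by (intro sum.cong) (auto simp: unit_vec_def)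
  finally show ?thesis using i by simp
qed

lemma psd_diagonalization:
  assumes "positive_semidefinite B" "dim_row B = n"
  shows "\<exists>V e. V \<in> unitary n \<and> (\<forall>i<n. 0 \<le> e i) \<and> B = V * diagm n e * V\<^sup>\<dagger>"
proof -
  have B: "B \<in> carrier_mat n n" "B\<^sup>\<dagger> = B" using assms by (auto simp: positive_semidefinite_def)
  obtain V e where V: "V \<in> unitary n" "B = V * diagm n e * V\<^sup>\<dagger>"
    using hermitian_diagonalization[OF B] by (elim exE conjE)
  have "0 \<le> e i" if i: "i < n" for i
  proof -
    have "col V i \<in> carrier_vec n" using unitaryD(1)[OF V(1)] by auto
    then have "0 \<le> Re ((B *\<^sub>v col V i) \<bullet>c col V i)"
      using assms by (auto simp: positive_semidefinite_def)
    then show ?thesis by (simp add: diagm_conj_entry[OF V(1) B(1) V(2) i])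
  qed
  then show ?thesis using V by (intro exI[of _ V] exI[of _ e] conjI allI impI)
qed

lemma diagm_conj_square:
  assumes "U \<in> unitary n"
  shows "(U * diagm n d * U\<^sup>\<dagger>) * (U * diagm n e * U\<^sup>\<dagger>) = U * diagm n (\<lambda>i. d i * e i) * U\<^sup>\<dagger>"
proof -
  note U = unitaryD[OF assms]
  have "(U * diagm n d * U\<^sup>\<dagger>) * (U * diagm n e * U\<^sup>\<dagger>) = U * (diagm n d * (U\<^sup>\<dagger> * U) * diagm n e) * U\<^sup>\<dagger>"
    using U(1) by (simp add: sq_assoc[of _ n] sq_closed del: assoc_mult_mat)
  then show ?thesis by (simp add: U(3) right_mult_one_mat[OF diagm_carrier] diagm_mult)
qed

text \<open>Between two diagonalizations, the matrix \<open>Q\<close> intertwines the squared eigenvalues and hence, these being non-negative, the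
  eigenvalues.\<close>

lemma psd_sqrt_unique:
  assumes B: "positive_semidefinite B" "dim_row B = n" and C: "positive_semidefinite C" "dim_row C = n"
    and eq: "B * B = C * C"
  shows "B = C"
proof -
  obtain V e where V: "V \<in> unitary n" and e: "\<forall>i<n. 0 \<le> e i" and BV: "B = V * diagm n e * V\<^sup>\<dagger>"
    using psd_diagonalization[OF B] by (elim exE conjE)
  obtain W f where W: "W \<in> unitary n" and f: "\<forall>i<n. 0 \<le> f i" and CW: "C = W * diagm n f * W\<^sup>\<dagger>"
    using psd_diagonalization[OF C] by (elim exE conjE)
  note V' = unitaryD[OF V] and W' = unitaryD[OF W]
  define Q where "Q = V\<^sup>\<dagger> * W"
  have Q: "Q \<in> carrier_mat n n" unfolding Q_def using V' W' by (intro sq_closed) auto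
  let ?e2 = "diagm n (\<lambda>i. e i * e i)" and ?f2 = "diagm n (\<lambda>i. f i * f i)"
  have eq': "V * ?e2 * V\<^sup>\<dagger> = W * ?f2 * W\<^sup>\<dagger>"
    using eq unfolding BV CW diagm_conj_square[OF V] diagm_conj_square[OF W] .
  have "V\<^sup>\<dagger> * (V * ?e2 * V\<^sup>\<dagger>) * W = (V\<^sup>\<dagger> * V) * ?e2 * Q"
    unfolding Q_def using V'(1) W'(1) by (simp add: sq_assoc[of _ n] sq_closed del: assoc_mult_mat)
  moreover have "V\<^sup>\<dagger> * (W * ?f2 * W\<^sup>\<dagger>) * W = Q * ?f2 * (W\<^sup>\<dagger> * W)"
    unfolding Q_def using V'(1) W'(1) by (simp add: sq_assoc[of _ n] sq_closed del: assoc_mult_mat)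
  ultimately have "?e2 * Q = Q * ?f2"
    unfolding eq' by (simp only: V'(3) W'(3) left_mult_one_mat[OF diagm_carrier] right_mult_one_mat[OF sq_closed[OF Q diagm_carrier]])
  have "diagm n e * Q = Q * diagm n f"
  proof (rule eq_matI)
    fix i j assume "i < dim_row (Q * diagm n f)" "j < dim_col (Q * diagm n f)"
    then have ij: "i < n" "j < n" using Q by (auto simp: diagm_def)
    have "(?e2 * Q) $$ (i, j) = (Q * ?f2) $$ (i, j)" by (simp only: \<open>?e2 * Q = Q * ?f2\<close>)
    then have "complex_of_real (e i * e i) * Q $$ (i, j) = Q $$ (i, j) * complex_of_real (f j * f j)"
      unfolding diagm_mult_left[OF Q ij] diagm_mult_right[OF Q ij] .
    then have "complex_of_real (e i) * Q $$ (i, j) = Q $$ (i, j) * complex_of_real (f j)"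
    proof (cases "Q $$ (i, j) = 0")
      case False
      assume "complex_of_real (e i * e i) * Q $$ (i, j) = Q $$ (i, j) * complex_of_real (f j * f j)"
      with False have "complex_of_real (e i * e i) = complex_of_real (f j * f j)" by (simp add: mult.commute)
      then have "(e i)\<^sup>2 = (f j)\<^sup>2" unfolding of_real_eq_iff power2_eq_square .
      then have "e i = f j" using e f ij by (simp add: power2_eq_iff_nonneg)
      then show ?thesis by (simp add: mult.commute)
    qed simp
    then show "(diagm n e * Q) $$ (i, j) = (Q * diagm n f) $$ (i, j)"
      unfolding diagm_mult_left[OF Q ij] diagm_mult_right[OF Q ij] .
  qed (use Q in \<open>auto simp: diagm_def\<close>)
  have "B = V * (diagm n e * Q) * W\<^sup>\<dagger>"
  proof -
    have "V * (diagm n e * Q) * W\<^sup>\<dagger> = V * diagm n e * V\<^sup>\<dagger> * (W * W\<^sup>\<dagger>)"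
      unfolding Q_def using V'(1) W'(1) by (simp add: sq_assoc[of _ n] sq_closed del: assoc_mult_mat)
    then show ?thesis
      by (simp only: W'(2) BV right_mult_one_mat[OF sq_closed[OF sq_closed[OF V'(1) diagm_carrier] adj_carrier[OF V'(1)]]])
  qed
  also have "\<dots> = V * V\<^sup>\<dagger> * (W * diagm n f * W\<^sup>\<dagger>)"
    unfolding \<open>diagm n e * Q = Q * diagm n f\<close> unfolding Q_def
    using V'(1) W'(1) by (simp add: sq_assoc[of _ n] sq_closed del: assoc_mult_mat)
  also have "\<dots> = C"
    by (simp only: V'(2) CW left_mult_one_mat[OF sq_closed[OF sq_closed[OF W'(1) diagm_carrier] adj_carrier[OF W'(1)]]])
  finally show ?thesis .
qed

text \<open>The numbers \<open>s\<close> are the singular values of \<open>A\<close>.\<close>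

lemma gram_diagonalization:
  assumes A: "A \<in> carrier_mat n n"
  shows "\<exists>U s. U \<in> unitary n \<and> (\<forall>i<n. 0 \<le> s i) \<and> A\<^sup>\<dagger> * A = U * diagm n (\<lambda>i. s i * s i) * U\<^sup>\<dagger>
     \<and> trace_norm A = (\<Sum>i<n. s i)"
proof -
  have c: "A\<^sup>\<dagger> * A \<in> carrier_mat n n" using A by (intro sq_closed) auto
  have herm: "(A\<^sup>\<dagger> * A)\<^sup>\<dagger> = A\<^sup>\<dagger> * A" using A by (simp add: adj_mult[of _ n n _ n])
  obtain U d where U: "U \<in> unitary n" and eq: "A\<^sup>\<dagger> * A = U * diagm n d * U\<^sup>\<dagger>"
    using hermitian_diagonalization[OF c herm] by (elim exE conjE)
  note U' = unitaryD[OF U]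
  have d: "0 \<le> d i" if i: "i < n" for i
  proof -
    have v: "col U i \<in> carrier_vec n" using U'(1) by auto
    have w: "A *\<^sub>v col U i \<in> carrier_vec n" by (rule mult_mat_vec_carrier[OF A v])
    have "complex_of_real (d i) = ((A\<^sup>\<dagger> * A) *\<^sub>v col U i) \<bullet>c col U i"
      by (rule diagm_conj_entry[OF U c eq i, symmetric])
    also have "\<dots> = (A\<^sup>\<dagger> *\<^sub>v (A *\<^sub>v col U i)) \<bullet>c col U i"
      by (simp only: assoc_mult_mat_vec[OF adj_carrier[OF A] A v])
    also have "\<dots> = (A *\<^sub>v col U i) \<bullet>c (A *\<^sub>v col U i)"
      using cprod_adj[OF adj_carrier[OF A] w v] by simp
    also have "\<dots> = complex_of_real (vnorm2 (A *\<^sub>v col U i))" by (rule cprod_self[OF w])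
    finally have "d i = vnorm2 (A *\<^sub>v col U i)" by (simp only: of_real_eq_iff)
    then show ?thesis using vnorm2_nonneg by simp
  qed
  define s where "s i = sqrt (d i)" for i
  have s: "\<forall>i<n. 0 \<le> s i" using d by (simp add: s_def)
  have "diagm n d = diagm n (\<lambda>i. s i * s i)" using d by (intro eq_matI) (auto simp: diagm_def s_def)
  then have eq': "A\<^sup>\<dagger> * A = U * diagm n (\<lambda>i. s i * s i) * U\<^sup>\<dagger>" using eq by simp
  define B where "B = U * diagm n s * U\<^sup>\<dagger>"
  have B: "positive_semidefinite B" "dim_row B = n" "B * B = A\<^sup>\<dagger> * A"
    using psd_diagm_conj[OF U] s U'(1) by (auto simp: B_def diagm_conj_square[OF U] eq')
  have "abs_mat A = B"
    unfolding abs_mat_def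
  proof (rule the_equality)
    show "positive_semidefinite B \<and> dim_row B = dim_col A \<and> B * B = A\<^sup>\<dagger> * A" using B A by simp
    fix C assume C: "positive_semidefinite C \<and> dim_row C = dim_col A \<and> C * C = A\<^sup>\<dagger> * A"
    have "C * C = B * B" unfolding B(3) using C by (elim conjE)
    moreover have "dim_row C = n" using C A by simp
    ultimately show "C = B" by (intro psd_sqrt_unique[OF conjunct1[OF C] _ B(1,2)])
  qed
  have "trace B = trace ((U * diagm n s) * U\<^sup>\<dagger>)" by (simp add: B_def)
  also have "\<dots> = trace (U\<^sup>\<dagger> * (U * diagm n s))"
    using U'(1) by (intro trace_mult_commute[of _ n n] sq_closed) auto
  also have "U\<^sup>\<dagger> * (U * diagm n s) = (U\<^sup>\<dagger> * U) * diagm n s"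
    using U'(1) by (intro sq_assoc[symmetric]) auto
  also have "\<dots> = diagm n s" by (simp add: U'(3))
  finally have "trace_norm A = (\<Sum>i<n. s i)" by (simp add: trace_norm_def \<open>abs_mat A = B\<close> trace_diagm)
  then show ?thesis using U s eq' by (intro exI[of _ U] exI[of _ s] conjI)
qed

text \<open>Matrices that do not increase the Euclidean norm. They are the unit ball dual to the trace norm.\<close>

definition contraction :: "nat \<Rightarrow> complex mat \<Rightarrow> bool" where
  "contraction n W \<longleftrightarrow> W \<in> carrier_mat n n \<and> (\<forall>v\<in>carrier_vec n. vnorm2 (W *\<^sub>v v) \<le> vnorm2 v)"

lemma contraction_adj:
  assumes "contraction n (W\<^sup>\<dagger>)" "W \<in> carrier_mat n n"
  shows "contraction n W"
  unfolding contraction_def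
proof (intro conjI ballI)
  fix v :: "complex vec" assume v: "v \<in> carrier_vec n"
  have w: "W *\<^sub>v v \<in> carrier_vec n" by (rule mult_mat_vec_carrier[OF assms(2) v])
  have u: "W\<^sup>\<dagger> *\<^sub>v (W *\<^sub>v v) \<in> carrier_vec n" by (rule mult_mat_vec_carrier[OF adj_carrier[OF assms(2)] w])
  have "vnorm2 (W *\<^sub>v v) = cmod ((W *\<^sub>v v) \<bullet>c (W *\<^sub>v v))"
    unfolding cprod_self[OF w] using vnorm2_nonneg by simp
  also have "\<dots> = cmod (v \<bullet>c (W\<^sup>\<dagger> *\<^sub>v (W *\<^sub>v v)))" by (simp only: cprod_adj[OF assms(2) v w])
  also have "\<dots> \<le> sqrt (vnorm2 v) * sqrt (vnorm2 (W\<^sup>\<dagger> *\<^sub>v (W *\<^sub>v v)))" by (rule cprod_le[OF v u])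
  also have "\<dots> \<le> sqrt (vnorm2 v) * sqrt (vnorm2 (W *\<^sub>v v))"
    using assms(1) w vnorm2_nonneg by (intro mult_left_mono) (auto simp: contraction_def)
  finally have le: "vnorm2 (W *\<^sub>v v) \<le> sqrt (vnorm2 v) * sqrt (vnorm2 (W *\<^sub>v v))" .
  show "vnorm2 (W *\<^sub>v v) \<le> vnorm2 v"
  proof (cases "vnorm2 (W *\<^sub>v v) = 0")
    case False
    then have pos: "0 < sqrt (vnorm2 (W *\<^sub>v v))" using vnorm2_nonneg[of "W *\<^sub>v v"] by simp
    have "sqrt (vnorm2 (W *\<^sub>v v)) * sqrt (vnorm2 (W *\<^sub>v v)) \<le> sqrt (vnorm2 v) * sqrt (vnorm2 (W *\<^sub>v v))"
      using le vnorm2_nonneg[of "W *\<^sub>v v"] by simp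
    then have "sqrt (vnorm2 (W *\<^sub>v v)) \<le> sqrt (vnorm2 v)" using pos by (rule mult_right_le_imp_le)
    then show ?thesis by simp
  qed (simp add: vnorm2_nonneg)
qed (fact assms(2))

lemma trace_contraction_le:
  assumes W: "contraction n W" and A: "A \<in> carrier_mat n n"
  shows "cmod (trace (W * A)) \<le> trace_norm A"
proof -
  have Wc: "W \<in> carrier_mat n n" using W by (simp add: contraction_def)
  obtain U s where U: "U \<in> unitary n" and s: "\<forall>i<n. 0 \<le> s i"
    and eq: "A\<^sup>\<dagger> * A = U * diagm n (\<lambda>i. s i * s i) * U\<^sup>\<dagger>" and tn: "trace_norm A = (\<Sum>i<n. s i)"
    using gram_diagonalization[OF A] by (elim exE conjE)
  note U' = unitaryD[OF U]
  have Ua: "U\<^sup>\<dagger> \<in> carrier_mat n n" using U'(1) by simp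
  have c: "A\<^sup>\<dagger> * A \<in> carrier_mat n n" using A by (intro sq_closed) auto
  have "trace (W * A) = trace (U\<^sup>\<dagger> * ((W * A) * U))"
  proof -
    have "trace (U\<^sup>\<dagger> * ((W * A) * U)) = trace (((W * A) * U) * U\<^sup>\<dagger>)"
      using U'(1) Wc A by (intro trace_mult_commute[of _ n n] sq_closed) auto
    also have "((W * A) * U) * U\<^sup>\<dagger> = (W * A) * (U * U\<^sup>\<dagger>)"
      using U'(1) Wc A by (intro sq_assoc[of _ n] sq_closed) auto
    also have "\<dots> = W * A" unfolding U'(2) by (rule right_mult_one_mat[OF sq_closed[OF Wc A]])
    finally show ?thesis ..
  qed
  also have "\<dots> = (\<Sum>i<n. (W *\<^sub>v (A *\<^sub>v col U i)) \<bullet>c col U i)"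
    unfolding trace_def
  proof (rule sum.cong)
    fix i assume "i \<in> {..<n}" then have i: "i < n" by simp
    have v: "col U i \<in> carrier_vec n" using U'(1) by auto
    have WAU: "(W * A) * U \<in> carrier_mat n n" using U'(1) Wc A by (intro sq_closed) auto
    have "(W *\<^sub>v (A *\<^sub>v col U i)) = (W * A) *\<^sub>v col U i"
      by (simp only: assoc_mult_mat_vec[OF Wc A v])
    also have "\<dots> = col ((W * A) * U) i" by (rule col_mult2[symmetric, OF sq_closed[OF Wc A] U'(1) i])
    finally have colM: "W *\<^sub>v (A *\<^sub>v col U i) = col ((W * A) * U) i" .
    have "(W *\<^sub>v (A *\<^sub>v col U i)) \<bullet>c col U i = (\<Sum>j<n. col ((W * A) * U) i $ j * cnj (col U i $ j))"
      unfolding colM by (rule cprod_index[OF v])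
    also have "\<dots> = (\<Sum>j<n. ((W * A) * U) $$ (j, i) * cnj (U $$ (j, i)))"
    proof (rule sum.cong)
      fix j assume "j \<in> {..<n}"
      then have j: "j < n" by simp
      have "col ((W * A) * U) i $ j = ((W * A) * U) $$ (j, i)" using WAU i j by (intro index_col) auto
      moreover have "col U i $ j = U $$ (j, i)" using U'(1) i j by (intro index_col) auto
      ultimately show "col ((W * A) * U) i $ j * cnj (col U i $ j) = ((W * A) * U) $$ (j, i) * cnj (U $$ (j, i))"
        by (simp only:)
    qed simp
    also have "\<dots> = (\<Sum>j<n. U\<^sup>\<dagger> $$ (i, j) * ((W * A) * U) $$ (j, i))"
      using U'(1) i by (intro sum.cong refl) (simp add: mult.commute del: index_mult_mat(1))
    also have "\<dots> = (U\<^sup>\<dagger> * ((W * A) * U)) $$ (i, i)" by (rule mult_index[OF Ua WAU i i, symmetric])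
    finally show "(U\<^sup>\<dagger> * ((W * A) * U)) $$ (i, i) = (W *\<^sub>v (A *\<^sub>v col U i)) \<bullet>c col U i" ..
  qed (use U'(1) in auto)
  finally have "cmod (trace (W * A)) \<le> (\<Sum>i<n. cmod ((W *\<^sub>v (A *\<^sub>v col U i)) \<bullet>c col U i))"
    by (simp only: norm_sum)
  also have "\<dots> \<le> (\<Sum>i<n. s i)"
  proof (rule sum_mono)
    fix i assume "i \<in> {..<n}" then have i: "i < n" by simp
    have v: "col U i \<in> carrier_vec n" using U'(1) by auto
    have w: "A *\<^sub>v col U i \<in> carrier_vec n" by (rule mult_mat_vec_carrier[OF A v])
    have u: "W *\<^sub>v (A *\<^sub>v col U i) \<in> carrier_vec n" by (rule mult_mat_vec_carrier[OF Wc w])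
    have "complex_of_real (vnorm2 (A *\<^sub>v col U i)) = (A *\<^sub>v col U i) \<bullet>c (A *\<^sub>v col U i)"
      by (rule cprod_self[OF w, symmetric])
    also have "\<dots> = (A\<^sup>\<dagger> *\<^sub>v (A *\<^sub>v col U i)) \<bullet>c col U i"
      using cprod_adj[OF adj_carrier[OF A] w v] by simp
    also have "\<dots> = ((A\<^sup>\<dagger> * A) *\<^sub>v col U i) \<bullet>c col U i"
      by (simp only: assoc_mult_mat_vec[OF adj_carrier[OF A] A v])
    also have "\<dots> = complex_of_real (s i * s i)" by (rule diagm_conj_entry[OF U c eq i])
    finally have vs: "vnorm2 (A *\<^sub>v col U i) = s i * s i" by (simp only: of_real_eq_iff)
    have "cmod ((W *\<^sub>v (A *\<^sub>v col U i)) \<bullet>c col U i) \<le> sqrt (vnorm2 (W *\<^sub>v (A *\<^sub>v col U i))) * sqrt (vnorm2 (col U i))"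
      by (rule cprod_le[OF u v])
    also have "\<dots> \<le> sqrt (vnorm2 (A *\<^sub>v col U i))"
      using W w by (simp add: vnorm2_col_unitary[OF U i] contraction_def)
    also have "\<dots> = s i" using s i by (simp add: vs)
    finally show "cmod ((W *\<^sub>v (A *\<^sub>v col U i)) \<bullet>c col U i) \<le> s i" .
  qed
  finally show ?thesis by (simp add: tn)
qed

text \<open>The contraction is the adjoint of the partial isometry in the polar decomposition of \<open>A\<close>.\<close>

lemma ex_contraction_trace_norm:
  assumes A: "A \<in> carrier_mat n n"
  shows "\<exists>W. contraction n W \<and> trace (W * A) = complex_of_real (trace_norm A)"
proof -
  obtain U s where U: "U \<in> unitary n" and s: "\<forall>i<n. 0 \<le> s i"
    and eq: "A\<^sup>\<dagger> * A = U * diagm n (\<lambda>i. s i * s i) * U\<^sup>\<dagger>" and tn: "trace_norm A = (\<Sum>i<n. s i)"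
    using gram_diagonalization[OF A] by (elim exE conjE)
  note U' = unitaryD[OF U]
  define t where "t i = (if s i = 0 then 0 else 1 / s i)" for i
  define p where "p i = (if s i = 0 then 0 else 1 :: real)" for i
  let ?T = "U * diagm n t * U\<^sup>\<dagger>"
  have T: "?T \<in> carrier_mat n n" using U'(1) by (intro sq_closed) auto
  have Tadj: "?T\<^sup>\<dagger> = ?T"
    using U'(1) by (simp add: adj_mult[of _ n n _ n] sq_assoc[of _ n] sq_closed del: assoc_mult_mat)
  define W where "W = ?T * A\<^sup>\<dagger>"
  have Aa: "A\<^sup>\<dagger> \<in> carrier_mat n n" using A by simp
  have W: "W \<in> carrier_mat n n" unfolding W_def by (rule sq_closed[OF T Aa])
  have Wa: "W\<^sup>\<dagger> = A * ?T" unfolding W_def adj_mult[OF T Aa] Tadj by simp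
  have WA: "W * A = ?T * (A\<^sup>\<dagger> * A)" unfolding W_def by (rule sq_assoc[OF T Aa A])
  have ts: "t i * (s i * s i) = s i" for i by (simp add: t_def)
  have WA': "W * A = U * diagm n s * U\<^sup>\<dagger>" unfolding WA eq diagm_conj_square[OF U] ts ..
  have "W * W\<^sup>\<dagger> = (W * A) * ?T" unfolding Wa by (rule sq_assoc[OF W A T, symmetric])
  also have "\<dots> = U * diagm n p * U\<^sup>\<dagger>"
  proof -
    have "s i * t i = p i" for i by (simp add: t_def p_def)
    then show ?thesis unfolding WA' diagm_conj_square[OF U] by simp
  qed
  finally have WW: "W * W\<^sup>\<dagger> = U * diagm n p * U\<^sup>\<dagger>" .
  have "contraction n (W\<^sup>\<dagger>)"
    unfolding contraction_def
  proof (intro conjI ballI)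
    fix v :: "complex vec" assume v: "v \<in> carrier_vec n"
    have w: "W\<^sup>\<dagger> *\<^sub>v v \<in> carrier_vec n" by (rule mult_mat_vec_carrier[OF adj_carrier[OF W] v])
    have "complex_of_real (vnorm2 (W\<^sup>\<dagger> *\<^sub>v v)) = (W\<^sup>\<dagger> *\<^sub>v v) \<bullet>c (W\<^sup>\<dagger> *\<^sub>v v)" by (rule cprod_self[OF w, symmetric])
    also have "\<dots> = (W *\<^sub>v (W\<^sup>\<dagger> *\<^sub>v v)) \<bullet>c v" by (rule cprod_adj[OF W w v, symmetric])
    also have "\<dots> = ((W * W\<^sup>\<dagger>) *\<^sub>v v) \<bullet>c v" by (simp only: assoc_mult_mat_vec[OF W adj_carrier[OF W] v])
    also have "\<dots> = complex_of_real (\<Sum>i<n. p i * (cmod ((U\<^sup>\<dagger> *\<^sub>v v) $ i))\<^sup>2)"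
      unfolding WW by (rule cprod_diagm_conj[OF U v])
    finally have "vnorm2 (W\<^sup>\<dagger> *\<^sub>v v) = (\<Sum>i<n. p i * (cmod ((U\<^sup>\<dagger> *\<^sub>v v) $ i))\<^sup>2)" by (simp only: of_real_eq_iff)
    also have "\<dots> \<le> (\<Sum>i<n. (cmod ((U\<^sup>\<dagger> *\<^sub>v v) $ i))\<^sup>2)"
      by (intro sum_mono) (simp add: p_def)
    also have "\<dots> = vnorm2 (U\<^sup>\<dagger> *\<^sub>v v)" using U'(1) by (simp add: vnorm2_def)
    also have "\<dots> = vnorm2 v" by (rule vnorm2_unitary[OF unitary_adj[OF U] v])
    finally show "vnorm2 (W\<^sup>\<dagger> *\<^sub>v v) \<le> vnorm2 v" .
  qed (use W in simp)
  then have "contraction n W" using W by (rule contraction_adj)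
  moreover have "trace (W * A) = complex_of_real (trace_norm A)"
  proof -
    have "trace (W * A) = trace ((U * diagm n s) * U\<^sup>\<dagger>)" by (simp add: WA')
    also have "\<dots> = trace (U\<^sup>\<dagger> * (U * diagm n s))"
      using U'(1) by (intro trace_mult_commute[of _ n n] sq_closed) auto
    also have "U\<^sup>\<dagger> * (U * diagm n s) = (U\<^sup>\<dagger> * U) * diagm n s"
      using U'(1) by (intro sq_assoc[symmetric]) auto
    finally show ?thesis by (simp add: U'(3) tn trace_diagm)
  qed
  ultimately show ?thesis by (intro exI conjI)
qed

lemma contraction_unitary_conj:
  assumes W: "contraction n W" and U: "U \<in> unitary n"
  shows "contraction n (U\<^sup>\<dagger> * W * U)"
  unfolding contraction_def
proof (intro conjI ballI)
  note U' = unitaryD[OF U]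
  have Wc: "W \<in> carrier_mat n n" using W by (simp add: contraction_def)
  have Ua: "U\<^sup>\<dagger> \<in> carrier_mat n n" using U'(1) by simp
  show "U\<^sup>\<dagger> * W * U \<in> carrier_mat n n" by (intro sq_closed Ua Wc U'(1))
  fix v :: "complex vec" assume v: "v \<in> carrier_vec n"
  have u: "U *\<^sub>v v \<in> carrier_vec n" by (rule mult_mat_vec_carrier[OF U'(1) v])
  have "(U\<^sup>\<dagger> * W * U) *\<^sub>v v = U\<^sup>\<dagger> *\<^sub>v (W *\<^sub>v (U *\<^sub>v v))"
    by (simp only: assoc_mult_mat_vec[OF sq_closed[OF Ua Wc] U'(1) v] assoc_mult_mat_vec[OF Ua Wc u])
  then have "vnorm2 ((U\<^sup>\<dagger> * W * U) *\<^sub>v v) = vnorm2 (W *\<^sub>v (U *\<^sub>v v))"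
    using vnorm2_unitary[OF unitary_adj[OF U] mult_mat_vec_carrier[OF Wc u]] by (simp only:)
  also have "\<dots> \<le> vnorm2 (U *\<^sub>v v)" using W u by (simp add: contraction_def)
  also have "\<dots> = vnorm2 v" by (rule vnorm2_unitary[OF U v])
  finally show "vnorm2 ((U\<^sup>\<dagger> * W * U) *\<^sub>v v) \<le> vnorm2 v" .
qed

lemma mat_sum_carrier [simp]: "mat_sum d f I \<in> carrier_mat d d"
  by (simp add: mat_sum_def)

lemma mat_sum_index [simp]: "i < d \<Longrightarrow> j < d \<Longrightarrow> mat_sum d f I $$ (i, j) = (\<Sum>k\<in>I. f k $$ (i, j))"
  by (simp add: mat_sum_def)

lemma trace_mult_index:
  assumes "A \<in> carrier_mat n n" "B \<in> carrier_mat n n"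
  shows "trace (A * B) = (\<Sum>i<n. \<Sum>l<n. A $$ (i, l) * B $$ (l, i))"
  using assms unfolding trace_def
  by (intro sum.cong) (auto simp: mult_index[OF assms] simp del: index_mult_mat(1))

lemma trace_mult_mat_sum:
  assumes "W \<in> carrier_mat n n" "\<And>p. p \<in> I \<Longrightarrow> f p \<in> carrier_mat n n"
  shows "trace (W * mat_sum n f I) = (\<Sum>p\<in>I. trace (W * f p))"
proof -
  have "trace (W * mat_sum n f I) = (\<Sum>i<n. \<Sum>l<n. \<Sum>p\<in>I. W $$ (i, l) * f p $$ (l, i))"
    unfolding trace_mult_index[OF assms(1) mat_sum_carrier]
    by (intro sum.cong refl) (simp add: sum_distrib_left)
  also have "\<dots> = (\<Sum>p\<in>I. \<Sum>i<n. \<Sum>l<n. W $$ (i, l) * f p $$ (l, i))"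
    by (simp only: sum.swap[of _ "{..<n}" I])
  also have "\<dots> = (\<Sum>p\<in>I. trace (W * f p))"
    by (intro sum.cong refl) (simp only: trace_mult_index[OF assms])
  finally show ?thesis .
qed

lemma trace_smult: "A \<in> carrier_mat n n \<Longrightarrow> trace (c \<cdot>\<^sub>m A) = c * trace A"
  by (simp add: trace_def sum_distrib_left)

text \<open>A contraction that computes the trace norm of the sum is moved onto \<open>\<rho>\<close>, where each conjugate of it is again a contraction.\<close>

theorem trace_norm_unitary_mixture:
  assumes \<rho>: "\<rho> \<in> carrier_mat n n" and U: "\<And>p. p \<in> I \<Longrightarrow> U p \<in> unitary n"
  shows "trace_norm (mat_sum n (\<lambda>p. c p \<cdot>\<^sub>m (U p * \<rho> * (U p)\<^sup>\<dagger>)) I) \<le> (\<Sum>p\<in>I. cmod (c p)) * trace_norm \<rho>"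
proof -
  let ?M = "mat_sum n (\<lambda>p. c p \<cdot>\<^sub>m (U p * \<rho> * (U p)\<^sup>\<dagger>)) I"
  obtain W where W: "contraction n W" and tr: "trace (W * ?M) = complex_of_real (trace_norm ?M)"
    using ex_contraction_trace_norm[of ?M n, OF mat_sum_carrier] by (elim exE conjE)
  have Wc: "W \<in> carrier_mat n n" using W by (simp add: contraction_def)
  have cl: "U p * \<rho> * (U p)\<^sup>\<dagger> \<in> carrier_mat n n" if "p \<in> I" for p
    using unitaryD(1)[OF U[OF that]] \<rho> by (intro sq_closed) auto
  have "complex_of_real (trace_norm ?M) = (\<Sum>p\<in>I. trace (W * (c p \<cdot>\<^sub>m (U p * \<rho> * (U p)\<^sup>\<dagger>))))"
    unfolding tr[symmetric] using Wc by (intro trace_mult_mat_sum smult_carrier_mat cl)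
  also have "\<dots> = (\<Sum>p\<in>I. c p * trace (((U p)\<^sup>\<dagger> * W * U p) * \<rho>))"
  proof (rule sum.cong)
    fix p assume p: "p \<in> I"
    note U' = unitaryD[OF U[OF p]]
    have "W * (c p \<cdot>\<^sub>m (U p * \<rho> * (U p)\<^sup>\<dagger>)) = c p \<cdot>\<^sub>m (W * (U p * \<rho> * (U p)\<^sup>\<dagger>))"
      by (rule mult_smult_distrib[OF Wc cl[OF p]])
    then have "trace (W * (c p \<cdot>\<^sub>m (U p * \<rho> * (U p)\<^sup>\<dagger>))) = c p * trace (W * (U p * \<rho> * (U p)\<^sup>\<dagger>))"
      using trace_smult[OF sq_closed[OF Wc cl[OF p]]] by simp
    also have "W * (U p * \<rho> * (U p)\<^sup>\<dagger>) = (W * U p * \<rho>) * (U p)\<^sup>\<dagger>"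
      using U'(1) Wc \<rho> by (simp add: sq_assoc[of _ n] sq_closed del: assoc_mult_mat)
    also have "trace \<dots> = trace ((U p)\<^sup>\<dagger> * (W * U p * \<rho>))"
      using U'(1) Wc \<rho> by (intro trace_mult_commute[of _ n n] sq_closed) auto
    also have "(U p)\<^sup>\<dagger> * (W * U p * \<rho>) = ((U p)\<^sup>\<dagger> * W * U p) * \<rho>"
      using U'(1) Wc \<rho> by (simp add: sq_assoc[of _ n] sq_closed del: assoc_mult_mat)
    finally show "trace (W * (c p \<cdot>\<^sub>m (U p * \<rho> * (U p)\<^sup>\<dagger>))) = c p * trace (((U p)\<^sup>\<dagger> * W * U p) * \<rho>)" .
  qed simp
  finally have "cmod (complex_of_real (trace_norm ?M)) \<le> (\<Sum>p\<in>I. cmod (c p * trace (((U p)\<^sup>\<dagger> * W * U p) * \<rho>)))"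
    by (simp only: norm_sum)
  also have "\<dots> \<le> (\<Sum>p\<in>I. cmod (c p) * trace_norm \<rho>)"
    unfolding norm_mult
    by (intro sum_mono mult_left_mono trace_contraction_le[OF contraction_unitary_conj[OF W U] \<rho>]) auto
  finally show ?thesis by (simp add: sum_distrib_right)
qed

section \<open>Pauli operators indexed by pairs of bit vectors\<close>

text \<open>\<open>bits N i\<close> are the values of the qubits in the basis state \<open>i\<close>, \<open>idx N\<close> is the inverse map, and \<open>ent N M\<close> are the
  entries of \<open>M\<close> with rows and columns indexed by bit vectors.\<close>
definition bits :: "nat \<Rightarrow> nat \<Rightarrow> bvec" where
  "bits N i = (\<lambda>q. if q < N then of_nat (qubit N i q) else 0)"

definition idx :: "nat \<Rightarrow> bvec \<Rightarrow> nat" where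
  "idx N = inv_into {..<2 ^ N} (bits N)"

lemma bits_in_vecs [simp]: "bits N i \<in> vecs N"
  by (simp add: bits_def vecs_def supported_def)

lemma of_nat_bit_eq: "a < 2 \<Longrightarrow> b < 2 \<Longrightarrow> (of_nat a :: bit) = of_nat b \<longleftrightarrow> a = b"
  by (auto simp: less_2_cases_iff)

lemma qubit_less [simp]: "qubit N i q < 2"
  by (simp add: qubit_def)

lemma bits_eq_iff: "q < N \<Longrightarrow> bits N i q = bits N j q \<longleftrightarrow> qubit N i q = qubit N j q"
  by (simp add: bits_def of_nat_bit_eq)

lemma bij_bits: "bij_betw (bits N) {..<2 ^ N} (vecs N)"
proof -
  have inj: "inj_on (bits N) {..<2 ^ N}"
  proof (rule inj_onI)
    fix i j :: nat assume ij: "i \<in> {..<2 ^ N}" "j \<in> {..<2 ^ N}" and eq: "bits N i = bits N j"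
    have q: "qubit N i q = qubit N j q" if "q < N" for q
      using bits_eq_iff[OF that, of i j] eq by simp
    have "take_bit N i = take_bit N j"
    proof (rule bit_eqI)
      fix k :: nat
      have tb: "bit (take_bit N l) k \<longleftrightarrow> k < N \<and> bit l k" for l :: nat by (rule bit_take_bit_iff)
      show "bit (take_bit N i) k \<longleftrightarrow> bit (take_bit N j) k"
      proof (cases "k < N")
        case True
        then have "N - 1 - (N - 1 - k) = k" by simp
        then have "i div 2 ^ k mod 2 = j div 2 ^ k mod 2" using q[of "N - 1 - k"] True by (simp add: qubit_def)
        then have "odd (i div 2 ^ k) \<longleftrightarrow> odd (j div 2 ^ k)" by (simp only: odd_iff_mod_2_eq_one)
        then show ?thesis unfolding tb by (simp only: bit_iff_odd)
      qed (simp only: tb, simp)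
    qed
    then show "i = j" using ij by (simp add: take_bit_eq_mod)
  qed
  have "bits N ` {..<2 ^ N} = vecs N"
    by (rule card_subset_eq) (auto simp: card_image[OF inj] card_vecs)
  then show ?thesis using inj by (simp add: bij_betw_def)
qed

lemma idx_less [simp]: "x \<in> vecs N \<Longrightarrow> idx N x < 2 ^ N"
  using bij_betwE[OF bij_betw_inv_into[OF bij_bits]] by (auto simp: idx_def)

lemma bits_idx [simp]: "x \<in> vecs N \<Longrightarrow> bits N (idx N x) = x"
  using bij_betw_inv_into_right[OF bij_bits] by (simp add: idx_def)

lemma idx_bits [simp]: "i < 2 ^ N \<Longrightarrow> idx N (bits N i) = i"
  using bij_betw_inv_into_left[OF bij_bits] by (simp add: idx_def)

lemma idx_eq_iff: "x \<in> vecs N \<Longrightarrow> y \<in> vecs N \<Longrightarrow> idx N x = idx N y \<longleftrightarrow> x = y"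
  by (metis bits_idx)

lemma sum_index: "(\<Sum>i<2 ^ N. f i) = (\<Sum>x\<in>vecs N. f (idx N x))"
  unfolding idx_def by (rule sum.reindex_bij_betw[OF bij_betw_inv_into[OF bij_bits], symmetric])

definition ent :: "nat \<Rightarrow> complex mat \<Rightarrow> bvec \<Rightarrow> bvec \<Rightarrow> complex" where
  "ent N M x y = M $$ (idx N x, idx N y)"

abbreviation cmat :: "nat \<Rightarrow> complex mat set" where
  "cmat N \<equiv> carrier_mat (2 ^ N) (2 ^ N)"

lemma ent_eqI:
  assumes "A \<in> cmat N" "B \<in> cmat N" "\<And>x y. x \<in> vecs N \<Longrightarrow> y \<in> vecs N \<Longrightarrow> ent N A x y = ent N B x y"
  shows "A = B"
proof (rule eq_matI)
  fix i j assume "i < dim_row B" "j < dim_col B"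
  then have "i < 2 ^ N" "j < 2 ^ N" using assms by auto
  then show "A $$ (i, j) = B $$ (i, j)" using assms(3)[of "bits N i" "bits N j"] by (simp add: ent_def)
qed (use assms in auto)

lemma ent_mult:
  assumes "A \<in> cmat N" "B \<in> cmat N" "x \<in> vecs N" "y \<in> vecs N"
  shows "ent N (A * B) x y = (\<Sum>z\<in>vecs N. ent N A x z * ent N B z y)"
  using assms by (simp add: ent_def mult_index[OF assms(1,2)] sum_index del: index_mult_mat(1))

lemma ent_adj: "A \<in> cmat N \<Longrightarrow> x \<in> vecs N \<Longrightarrow> y \<in> vecs N \<Longrightarrow> ent N (A\<^sup>\<dagger>) x y = cnj (ent N A y x)"
  by (simp add: ent_def)

lemma ent_smult: "A \<in> cmat N \<Longrightarrow> x \<in> vecs N \<Longrightarrow> y \<in> vecs N \<Longrightarrow> ent N (c \<cdot>\<^sub>m A) x y = c * ent N A x y"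
  by (simp add: ent_def)

lemma ent_one: "x \<in> vecs N \<Longrightarrow> y \<in> vecs N \<Longrightarrow> ent N (1\<^sub>m (2 ^ N)) x y = (if x = y then 1 else 0)"
  by (simp add: ent_def idx_eq_iff)

lemma ent_mat_sum: "x \<in> vecs N \<Longrightarrow> y \<in> vecs N \<Longrightarrow> ent N (mat_sum (2 ^ N) f I) x y = (\<Sum>k\<in>I. ent N (f k) x y)"
  by (simp add: ent_def)

lemma trace_ent: "A \<in> cmat N \<Longrightarrow> trace A = (\<Sum>x\<in>vecs N. ent N A x x)"
  by (simp add: trace_def ent_def sum_index)

lemma sum_delta_vecs:
  assumes "a \<in> vecs N"
  shows "(\<Sum>z\<in>vecs N. (if z = a then f z else 0) :: 'a::comm_monoid_add) = f a"
  using assms by simp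

lemma bvec_eq_add_iff: "(x::bvec) = y + a \<longleftrightarrow> y = x + a"
  by (metis add.commute bvec_add_self_left)

lemma bij_add_vecs: "a \<in> vecs N \<Longrightarrow> bij_betw (\<lambda>x. x + a) (vecs N) (vecs N)"
  by (rule bij_betw_byWitness[where f' = "\<lambda>x. x + a"]) (auto simp: add_in_vecs add.assoc)

lemma sum_shift: "a \<in> vecs N \<Longrightarrow> (\<Sum>x\<in>vecs N. f (x + a)) = (\<Sum>x\<in>vecs N. f x)"
  by (rule sum.reindex_bij_betw[OF bij_add_vecs])

type_synonym pidx = "bvec \<times> bvec"

definition pvecs :: "nat \<Rightarrow> pidx set" where
  "pvecs N = vecs N \<times> vecs N"

text \<open>The Pauli operator with \<open>X\<close>-part \<open>a\<close> and \<open>Z\<close>-part \<open>b\<close> of \<open>p = (a, b)\<close>: it maps the basis state \<open>y\<close> to \<open>(-1) ^ (b \<cdot> y)\<close> times \<open>y + a\<close>.\<close>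

definition pm :: "nat \<Rightarrow> pidx \<Rightarrow> complex mat" where
  "pm N p = mat (2 ^ N) (2 ^ N) (\<lambda>(i, j). if bits N i = bits N j + fst p then sg (dot N (snd p) (bits N j)) else 0)"

lemma pm_carrier [simp]: "pm N p \<in> cmat N"
  by (simp add: pm_def)

lemma finite_pvecs [simp]: "finite (pvecs N)"
  by (simp add: pvecs_def)

lemma card_pvecs: "card (pvecs N) = (2 ^ N)\<^sup>2"
  by (simp add: pvecs_def card_cartesian_product card_vecs power2_eq_square)

lemma ent_pm: "x \<in> vecs N \<Longrightarrow> y \<in> vecs N \<Longrightarrow> ent N (pm N p) x y = (if x = y + fst p then sg (dot N (snd p) y) else 0)"
  by (simp add: ent_def pm_def)

lemma ent_pm_mult:
  assumes "p \<in> pvecs N" "M \<in> cmat N" "x \<in> vecs N" "y \<in> vecs N"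
  shows "ent N (pm N p * M) x y = sg (dot N (snd p) (x + fst p)) * ent N M (x + fst p) y"
proof -
  have a: "x + fst p \<in> vecs N" using assms by (auto simp: pvecs_def add_in_vecs)
  have "ent N (pm N p * M) x y = (\<Sum>z\<in>vecs N. if z = x + fst p then sg (dot N (snd p) z) * ent N M z y else 0)"
    unfolding ent_mult[OF pm_carrier assms(2-4)]
    by (intro sum.cong refl) (simp add: ent_pm assms bvec_eq_add_iff[of x])
  then show ?thesis using a by (simp only: sum_delta_vecs)
qed

lemma ent_mult_pm:
  assumes "p \<in> pvecs N" "M \<in> cmat N" "x \<in> vecs N" "y \<in> vecs N"
  shows "ent N (M * pm N p) x y = ent N M x (y + fst p) * sg (dot N (snd p) y)"
proof -
  have a: "y + fst p \<in> vecs N" using assms by (auto simp: pvecs_def add_in_vecs)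
  have "ent N (M * pm N p) x y = (\<Sum>z\<in>vecs N. if z = y + fst p then ent N M x z * sg (dot N (snd p) y) else 0)"
    unfolding ent_mult[OF assms(2) pm_carrier assms(3,4)]
    by (intro sum.cong refl) (simp add: ent_pm assms)
  then show ?thesis using a by (simp only: sum_delta_vecs)
qed

lemma smult_smult_mat: "(a :: complex) \<cdot>\<^sub>m (b \<cdot>\<^sub>m A) = (a * b) \<cdot>\<^sub>m A"
  by (rule eq_matI) simp_all

lemma one_smult_mat [simp]: "(1 :: complex) \<cdot>\<^sub>m A = A"
  by (rule eq_matI) simp_all

lemma sg_sg [simp]: "sg b * sg b = (1 :: complex)" "sg b * (sg b * c) = (c :: complex)"
  by (simp_all add: sg_def)

lemma cnj_sg [simp]: "cnj (sg b) = sg b"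
  by (simp add: sg_def)

lemma cmod_sg [simp]: "cmod (sg b) = 1"
  by (simp add: sg_def)

lemma pm_zero: "pm N (0, 0) = 1\<^sub>m (2 ^ N)"
  by (rule ent_eqI[of _ N]) (simp_all add: ent_pm ent_one)

lemma pm_adj:
  assumes "p \<in> pvecs N"
  shows "(pm N p)\<^sup>\<dagger> = sg (dot N (snd p) (fst p)) \<cdot>\<^sub>m pm N p"
proof (rule ent_eqI[of _ N])
  fix x y assume xy: "x \<in> vecs N" "y \<in> vecs N"
  show "ent N ((pm N p)\<^sup>\<dagger>) x y = ent N (sg (dot N (snd p) (fst p)) \<cdot>\<^sub>m pm N p) x y"
    using xy by (auto simp: ent_adj ent_smult ent_pm bvec_eq_add_iff[of y] dot_add_right sg_add add.assoc)
qed simp_all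

lemma pm_mult:
  assumes "p \<in> pvecs N" "p' \<in> pvecs N"
  shows "pm N p * pm N p' = sg (dot N (snd p) (fst p')) \<cdot>\<^sub>m pm N (fst p + fst p', snd p + snd p')"
proof (rule ent_eqI[of _ N])
  fix x y assume xy: "x \<in> vecs N" "y \<in> vecs N"
  then have a: "x + fst p \<in> vecs N" using assms by (auto simp: pvecs_def add_in_vecs)
  have iff: "x + fst p = y + fst p' \<longleftrightarrow> x = y + (fst p + fst p')"
    unfolding bvec_eq_add_iff[of "x + fst p"] bvec_eq_add_iff[of x] by (simp only: add.assoc)
  show "ent N (pm N p * pm N p') x y = ent N (sg (dot N (snd p) (fst p')) \<cdot>\<^sub>m pm N (fst p + fst p', snd p + snd p')) x y"
    unfolding ent_pm_mult[OF assms(1) pm_carrier xy]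
    using xy a by (auto simp: ent_smult ent_pm dot_add_right dot_add_left sg_add iff)
qed (auto intro: sq_closed)

lemma pm_unitary:
  assumes "p \<in> pvecs N"
  shows "pm N p \<in> unitary (2 ^ N)"
proof -
  have s: "pm N p * pm N p = sg (dot N (snd p) (fst p)) \<cdot>\<^sub>m 1\<^sub>m (2 ^ N)"
    unfolding pm_mult[OF assms assms] by (simp add: pm_zero)
  have "pm N p * (pm N p)\<^sup>\<dagger> = sg (dot N (snd p) (fst p)) \<cdot>\<^sub>m (pm N p * pm N p)"
    unfolding pm_adj[OF assms] by (rule mult_smult_distrib[OF pm_carrier pm_carrier])
  moreover have "(pm N p)\<^sup>\<dagger> * pm N p = sg (dot N (snd p) (fst p)) \<cdot>\<^sub>m (pm N p * pm N p)"
    unfolding pm_adj[OF assms] by (rule mult_smult_assoc_mat[OF pm_carrier pm_carrier])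
  ultimately show ?thesis unfolding s by (simp add: unitary_def smult_smult_mat)
qed

lemma ent_pm_conj:
  assumes p: "p \<in> pvecs N" and M: "M \<in> cmat N" and xy: "x \<in> vecs N" "y \<in> vecs N"
  shows "ent N (pm N p * M * (pm N p)\<^sup>\<dagger>) x y = sg (dot N (snd p) (x + y)) * ent N M (x + fst p) (y + fst p)"
proof -
  have a: "x + fst p \<in> vecs N" "y + fst p \<in> vecs N" using p xy by (auto simp: pvecs_def add_in_vecs)
  have PM: "pm N p * M \<in> cmat N" using M by (intro sq_closed) auto
  have "pm N p * M * (pm N p)\<^sup>\<dagger> = sg (dot N (snd p) (fst p)) \<cdot>\<^sub>m (pm N p * M * pm N p)"
    unfolding pm_adj[OF p] by (rule mult_smult_distrib[OF PM pm_carrier])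
  then have "ent N (pm N p * M * (pm N p)\<^sup>\<dagger>) x y = sg (dot N (snd p) (fst p)) * ent N (pm N p * M * pm N p) x y"
    using xy by (simp only: ent_smult[OF sq_closed[OF PM pm_carrier]])
  also have "\<dots> = sg (dot N (snd p) (fst p)) * (sg (dot N (snd p) (x + fst p)) * ent N M (x + fst p) (y + fst p) * sg (dot N (snd p) y))"
    unfolding ent_mult_pm[OF p PM xy] ent_pm_mult[OF p M xy(1) a(2)] ..
  finally show ?thesis by (simp add: dot_add_right sg_add)
qed

lemma pm_conj_adj:
  assumes p: "p \<in> pvecs N" and M: "M \<in> cmat N"
  shows "(pm N p)\<^sup>\<dagger> * M * pm N p = pm N p * M * (pm N p)\<^sup>\<dagger>"
proof -
  have PM: "pm N p * M \<in> cmat N" using M by (intro sq_closed) auto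
  have "(pm N p)\<^sup>\<dagger> * M * pm N p = sg (dot N (snd p) (fst p)) \<cdot>\<^sub>m (pm N p * M * pm N p)"
    unfolding pm_adj[OF p] mult_smult_assoc_mat[OF pm_carrier M] by (rule mult_smult_assoc_mat[OF PM pm_carrier])
  also have "\<dots> = pm N p * M * (pm N p)\<^sup>\<dagger>"
    unfolding pm_adj[OF p] by (rule mult_smult_distrib[OF PM pm_carrier, symmetric])
  finally show ?thesis .
qed

lemma sum_pm_conj:
  assumes M: "M \<in> cmat N"
  shows "mat_sum (2 ^ N) (\<lambda>p. pm N p * M * (pm N p)\<^sup>\<dagger>) (pvecs N) = (2 ^ N * trace M) \<cdot>\<^sub>m 1\<^sub>m (2 ^ N)"
proof (rule ent_eqI[of _ N])
  fix x y assume xy: "x \<in> vecs N" "y \<in> vecs N"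
  have "ent N (mat_sum (2 ^ N) (\<lambda>p. pm N p * M * (pm N p)\<^sup>\<dagger>) (pvecs N)) x y
     = (\<Sum>p\<in>pvecs N. sg (dot N (snd p) (x + y)) * ent N M (x + fst p) (y + fst p))"
    unfolding ent_mat_sum[OF xy] by (intro sum.cong refl ent_pm_conj M xy)
  also have "\<dots> = (\<Sum>a\<in>vecs N. \<Sum>b\<in>vecs N. sg (dot N b (x + y)) * ent N M (x + a) (y + a))"
    unfolding pvecs_def sum.cartesian_product by (simp add: case_prod_beta)
  also have "\<dots> = (\<Sum>a\<in>vecs N. (if x + y = 0 then 2 ^ N else 0) * ent N M (x + a) (y + a))"
    unfolding sum_distrib_right[symmetric] sum_sg_dot[OF add_in_vecs[OF xy]] ..
  also have "\<dots> = (if x = y then 2 ^ N * trace M else 0)"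
  proof (cases "x = y")
    case True
    have "(\<Sum>a\<in>vecs N. ent N M (y + a) (y + a)) = (\<Sum>a\<in>vecs N. ent N M (a + y) (a + y))"
      by (simp only: add.commute)
    also have "\<dots> = trace M" unfolding trace_ent[OF M] by (rule sum_shift[OF xy(2)])
    finally show ?thesis using True by (simp flip: sum_distrib_left)
  qed (simp add: bvec_add_eq_zero)
  finally show "ent N (mat_sum (2 ^ N) (\<lambda>p. pm N p * M * (pm N p)\<^sup>\<dagger>) (pvecs N)) x y = ent N ((2 ^ N * trace M) \<cdot>\<^sub>m 1\<^sub>m (2 ^ N)) x y"
    using xy by (simp add: ent_smult ent_one)
qed simp_all

lemma sum_pvecs: "(\<Sum>p\<in>pvecs N. f p) = (\<Sum>a\<in>vecs N. \<Sum>b\<in>vecs N. f (a, b))"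
  unfolding pvecs_def sum.cartesian_product by (simp add: case_prod_beta)

text \<open>The pair of bit vectors that corresponds to a list of exponents.\<close>

definition pauli_code :: "nat \<Rightarrow> (nat \<times> nat) list \<Rightarrow> pidx" where
  "pauli_code N ps = ((\<lambda>q. if q < N then of_nat (fst (ps ! q)) else 0), (\<lambda>q. if q < N then of_nat (snd (ps ! q)) else 0))"

definition pauli_decode :: "nat \<Rightarrow> pidx \<Rightarrow> (nat \<times> nat) list" where
  "pauli_decode N p = map (\<lambda>q. (if fst p q = 0 then 0 else 1, if snd p q = 0 then 0 else 1)) [0..<N]"

lemma pauli_decode_code:
  assumes "ps \<in> pauli_indices N"
  shows "pauli_decode N (pauli_code N ps) = ps"
proof (rule nth_equalityI)
  have len: "length ps = N" using assms by (simp add: pauli_indices_def)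
  then show "length (pauli_decode N (pauli_code N ps)) = length ps" by (simp add: pauli_decode_def)
  fix q assume "q < length (pauli_decode N (pauli_code N ps))"
  then have q: "q < N" by (simp add: pauli_decode_def)
  then have "ps ! q \<in> set ps" using len by simp
  then have "ps ! q \<in> {0, 1} \<times> {0, 1}" using assms by (auto simp: pauli_indices_def)
  then show "pauli_decode N (pauli_code N ps) ! q = ps ! q"
    using q by (cases "ps ! q") (auto simp: pauli_decode_def pauli_code_def)
qed

lemma pauli_code_decode:
  assumes "p \<in> pvecs N"
  shows "pauli_code N (pauli_decode N p) = p"
proof (rule prod_eqI)
  have z: "fst p q = 0" "snd p q = 0" if "\<not> q < N" for q
    using assms that by (auto simp: pvecs_def vecs_def supported_def)
  show "fst (pauli_code N (pauli_decode N p)) = fst p"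
    using z by (intro ext) (simp add: pauli_code_def pauli_decode_def bit_not_zero_eq)
  show "snd (pauli_code N (pauli_decode N p)) = snd p"
    using z by (intro ext) (simp add: pauli_code_def pauli_decode_def bit_not_zero_eq)
qed

lemma pauli_decode_in_indices: "pauli_decode N p \<in> pauli_indices N"
  by (auto simp: pauli_indices_def pauli_decode_def split: if_splits cong: if_cong)

lemma bij_pauli_code: "bij_betw (pauli_code N) (pauli_indices N) (pvecs N)"
proof (rule bij_betw_byWitness[where f' = "pauli_decode N"])
  show "\<forall>ps\<in>pauli_indices N. pauli_decode N (pauli_code N ps) = ps" by (simp add: pauli_decode_code)
  show "\<forall>p\<in>pvecs N. pauli_code N (pauli_decode N p) = p" by (simp add: pauli_code_decode)
  show "pauli_code N ` pauli_indices N \<subseteq> pvecs N"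
    by (auto simp: pauli_code_def pvecs_def vecs_def supported_def)
  show "pauli_decode N ` pvecs N \<subseteq> pauli_indices N"
    by (auto intro: pauli_decode_in_indices)
qed

text \<open>The entry of \<open>X ^ a Z ^ b\<close> on one qubit at \<open>(x, y)\<close>, where \<open>p = (a, b)\<close>.\<close>

definition pauli_entry :: "nat \<times> nat \<Rightarrow> nat \<Rightarrow> nat \<Rightarrow> complex" where
  "pauli_entry p x y = (if x = (y + fst p) mod 2 then (- 1) ^ (snd p * y) else 0)"

lemma pauli_X_pow: "a \<in> {0, 1} \<Longrightarrow> pauli_X ^\<^sub>m a = mat 2 2 (\<lambda>(i, j). if i = (j + a) mod 2 then 1 else 0)"
  by (auto intro!: eq_matI simp: pauli_X_def)

lemma pauli_Z_pow: "b \<in> {0, 1} \<Longrightarrow> pauli_Z ^\<^sub>m b = mat 2 2 (\<lambda>(i, j). if i = j then (- 1) ^ (b * j) else 0)"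
  by (auto intro!: eq_matI simp: pauli_Z_def)

lemma single_pauli:
  assumes "p \<in> {0, 1} \<times> {0, 1}"
  shows "pauli_X ^\<^sub>m fst p * pauli_Z ^\<^sub>m snd p = mat 2 2 (\<lambda>(i, j). pauli_entry p i j)"
proof (rule eq_matI)
  have X: "pauli_X ^\<^sub>m fst p = mat 2 2 (\<lambda>(i, j). if i = (j + fst p) mod 2 then 1 else 0)"
    using assms by (intro pauli_X_pow) auto
  have Z: "pauli_Z ^\<^sub>m snd p = mat 2 2 (\<lambda>(i, j). if i = j then (- 1) ^ (snd p * j) else 0)"
    using assms by (intro pauli_Z_pow) auto
  fix i j assume "i < dim_row (mat 2 2 (\<lambda>(i, j). pauli_entry p i j))" "j < dim_col (mat 2 2 (\<lambda>(i, j). pauli_entry p i j))"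
  then have ij: "i < 2" "j < 2" by auto
  have c: "pauli_X ^\<^sub>m fst p \<in> carrier_mat 2 2" "pauli_Z ^\<^sub>m snd p \<in> carrier_mat 2 2" unfolding X Z by auto
  have "(pauli_X ^\<^sub>m fst p * pauli_Z ^\<^sub>m snd p) $$ (i, j) = (\<Sum>l<2. if l = j then pauli_entry p i j else 0)"
    unfolding mult_index[OF c ij] unfolding X Z using ij by (intro sum.cong) (auto simp: pauli_entry_def)
  then show "(pauli_X ^\<^sub>m fst p * pauli_Z ^\<^sub>m snd p) $$ (i, j) = mat 2 2 (\<lambda>(i, j). pauli_entry p i j) $$ (i, j)"
    using ij by simp
qed (simp_all add: pauli_X_def pauli_Z_def)

lemma qubit_Suc_0: "i < 2 ^ Suc N \<Longrightarrow> qubit (Suc N) i 0 = i div 2 ^ N"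
proof -
  assume "i < 2 ^ Suc N"
  then have "i div 2 ^ N < 2" by (simp add: less_mult_imp_div_less)
  then show ?thesis by (simp add: qubit_def)
qed

lemma qubit_Suc_Suc: "q < N \<Longrightarrow> qubit (Suc N) i (Suc q) = qubit N (i mod 2 ^ N) q"
proof -
  assume q: "q < N"
  define k where "k = N - Suc q"
  have N: "(2::nat) ^ N = 2 ^ k * (2 * 2 ^ q)"
  proof -
    have "N = k + Suc q" using q by (simp add: k_def)
    then have "(2::nat) ^ N = 2 ^ (k + Suc q)" by (simp only:)
    then show ?thesis by (simp only: power_add power_Suc)
  qed
  have "i mod 2 ^ N div 2 ^ k = i div 2 ^ k mod (2 * 2 ^ q)"
    unfolding N by (simp add: mod_mult2_eq)
  then have "i mod 2 ^ N div 2 ^ k mod 2 = i div 2 ^ k mod 2" by (simp add: mod_mod_cancel)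
  then show ?thesis by (simp add: qubit_def k_def)
qed

lemma pauli_index:
  assumes "length ps = N" "set ps \<subseteq> {0, 1} \<times> {0, 1}"
  shows "pauli ps \<in> cmat N"
    "i < 2 ^ N \<Longrightarrow> j < 2 ^ N \<Longrightarrow> pauli ps $$ (i, j) = (\<Prod>q<N. pauli_entry (ps ! q) (qubit N i q) (qubit N j q))"
proof -
  have "pauli ps \<in> cmat N \<and> (\<forall>i<2 ^ N. \<forall>j<2 ^ N. pauli ps $$ (i, j) = (\<Prod>q<N. pauli_entry (ps ! q) (qubit N i q) (qubit N j q)))"
    using assms
  proof (induction N arbitrary: ps)
    case 0
    then show ?case by (simp add: pauli_def)
  next
    case (Suc N)
    obtain p ps' where ps: "ps = p # ps'" using Suc.prems by (cases ps) auto
    have p: "p \<in> {0, 1} \<times> {0, 1}" and ps': "length ps' = N" "set ps' \<subseteq> {0, 1} \<times> {0, 1}" using Suc.prems ps by auto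
    note IH = Suc.IH[OF ps']
    have eq: "pauli ps = mat 2 2 (\<lambda>(i, j). pauli_entry p i j) \<otimes>\<^sub>m pauli ps'"
      unfolding single_pauli[OF p, symmetric] ps pauli_def by (simp add: case_prod_beta)
    have d: "dim_row (pauli ps') = 2 ^ N" "dim_col (pauli ps') = 2 ^ N" using IH by auto
    have "pauli ps \<in> cmat (Suc N)" unfolding eq kron_def using d by auto
    moreover have "pauli ps $$ (i, j) = (\<Prod>q<Suc N. pauli_entry (ps ! q) (qubit (Suc N) i q) (qubit (Suc N) j q))"
      if ij: "i < 2 ^ Suc N" "j < 2 ^ Suc N" for i j
    proof -
      have dv: "i div 2 ^ N < 2" "j div 2 ^ N < 2" using ij by (simp_all add: less_mult_imp_div_less)
      have "pauli ps $$ (i, j) = pauli_entry p (i div 2 ^ N) (j div 2 ^ N) * pauli ps' $$ (i mod 2 ^ N, j mod 2 ^ N)"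
        unfolding eq kron_def using d ij dv by simp
      also have "pauli ps' $$ (i mod 2 ^ N, j mod 2 ^ N) = (\<Prod>q<N. pauli_entry (ps' ! q) (qubit N (i mod 2 ^ N) q) (qubit N (j mod 2 ^ N) q))"
        using IH by simp
      also have "\<dots> = (\<Prod>q<N. pauli_entry (ps ! Suc q) (qubit (Suc N) i (Suc q)) (qubit (Suc N) j (Suc q)))"
        by (intro prod.cong refl) (simp add: ps qubit_Suc_Suc)
      finally show ?thesis using ij by (simp add: prod.lessThan_Suc_shift ps qubit_Suc_0 del: prod.lessThan_Suc)
    qed
    ultimately show ?case by (intro conjI allI impI)
  qed
  then show "pauli ps \<in> cmat N"
    "i < 2 ^ N \<Longrightarrow> j < 2 ^ N \<Longrightarrow> pauli ps $$ (i, j) = (\<Prod>q<N. pauli_entry (ps ! q) (qubit N i q) (qubit N j q))"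
    by simp_all
qed

lemma sg_sum: "finite A \<Longrightarrow> sg (sum f A) = (\<Prod>x\<in>A. sg (f x))"
  by (induction A rule: finite_induct) (simp_all add: sg_add)

lemma pauli_entry_bit:
  assumes "p \<in> {0, 1} \<times> {0, 1}" "x < 2" "y < 2"
  shows "pauli_entry p x y = (if (of_nat x :: bit) = of_nat y + of_nat (fst p) then sg (of_nat (snd p) * of_nat y) else 0)"
  using assms by (auto simp: pauli_entry_def less_2_cases_iff)

lemma pauli_eq_pm:
  assumes "ps \<in> pauli_indices N"
  shows "pauli ps = pm N (pauli_code N ps)"
proof (rule eq_matI)
  have ps: "length ps = N" "set ps \<subseteq> {0, 1} \<times> {0, 1}" using assms by (auto simp: pauli_indices_def)
  fix i j assume "i < dim_row (pm N (pauli_code N ps))" "j < dim_col (pm N (pauli_code N ps))"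
  then have ij: "i < 2 ^ N" "j < 2 ^ N" by (auto simp: pm_def)
  have e: "pauli_entry (ps ! q) (qubit N i q) (qubit N j q)
      = (if bits N i q = (bits N j + fst (pauli_code N ps)) q then sg (snd (pauli_code N ps) q * bits N j q) else 0)" if "q < N" for q
  proof -
    have "ps ! q \<in> set ps" using ps(1) that by simp
    with ps(2) have "ps ! q \<in> {0, 1} \<times> {0, 1}" by (rule subsetD)
    then show ?thesis using that by (simp add: pauli_entry_bit bits_def pauli_code_def)
  qed
  have "pauli ps $$ (i, j) = (\<Prod>q<N. if bits N i q = (bits N j + fst (pauli_code N ps)) q then sg (snd (pauli_code N ps) q * bits N j q) else 0)"
    unfolding pauli_index(2)[OF ps ij] by (intro prod.cong refl e) simp
  also have "\<dots> = pm N (pauli_code N ps) $$ (i, j)"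
  proof (cases "bits N i = bits N j + fst (pauli_code N ps)")
    case True
    then show ?thesis using ij by (simp add: pm_def dot_def sg_sum)
  next
    case False
    then obtain q where q: "bits N i q \<noteq> (bits N j + fst (pauli_code N ps)) q" by (auto simp: fun_eq_iff)
    then have "q < N" by (cases "q < N") (auto simp: bits_def pauli_code_def)
    then have "(\<Prod>q<N. if bits N i q = (bits N j + fst (pauli_code N ps)) q then sg (snd (pauli_code N ps) q * bits N j q) else 0) = (0 :: complex)"
      using q by (intro prod_zero) auto
    then show ?thesis using False ij by (simp add: pm_def)
  qed
  finally show "pauli ps $$ (i, j) = pm N (pauli_code N ps) $$ (i, j)" .
next
  have ps: "length ps = N" "set ps \<subseteq> {0, 1} \<times> {0, 1}" using assms by (auto simp: pauli_indices_def)
  show "dim_row (pauli ps) = dim_row (pm N (pauli_code N ps))" "dim_col (pauli ps) = dim_col (pm N (pauli_code N ps))"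
    using pauli_index(1)[OF ps] by (auto simp: pm_def)
qed

lemma pauli_code_in_pvecs: "ps \<in> pauli_indices N \<Longrightarrow> pauli_code N ps \<in> pvecs N"
  using bij_betwE[OF bij_pauli_code] by blast

lemma sum_pauli_indices: "(\<Sum>ps\<in>pauli_indices N. f (pauli_code N ps)) = (\<Sum>p\<in>pvecs N. f p)"
  by (rule sum.reindex_bij_betw[OF bij_pauli_code])

lemma mat_sum_cong: "(\<And>k. k \<in> I \<Longrightarrow> f k = g k) \<Longrightarrow> mat_sum d f I = mat_sum d g I"
  by (rule eq_matI) (auto simp: mat_sum_def intro!: sum.cong)

lemma mat_sum_pauli_indices:
  "mat_sum d (\<lambda>ps. f (pauli ps) (pauli_code N ps)) (pauli_indices N) = mat_sum d (\<lambda>p. f (pm N p) p) (pvecs N)"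
proof -
  have "mat_sum d (\<lambda>ps. f (pauli ps) (pauli_code N ps)) (pauli_indices N)
      = mat_sum d (\<lambda>ps. f (pm N (pauli_code N ps)) (pauli_code N ps)) (pauli_indices N)"
    by (intro mat_sum_cong) (simp add: pauli_eq_pm)
  also have "\<dots> = mat_sum d (\<lambda>p. f (pm N p) p) (pvecs N)"
    unfolding mat_sum_def sum_pauli_indices[of "\<lambda>p. f (pm N p) p $$ _"] ..
  finally show ?thesis .
qed

lemma pauli_group_eq: "pauli_group N = {\<omega> \<cdot>\<^sub>m pm N p | \<omega> p. cmod \<omega> = 1 \<and> p \<in> pvecs N}"
proof (intro subset_antisym subsetI)
  fix M assume "M \<in> pauli_group N"
  then obtain \<omega> ps where "M = \<omega> \<cdot>\<^sub>m pauli ps" "cmod \<omega> = 1" "ps \<in> pauli_indices N"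
    unfolding pauli_group_def by blast
  then show "M \<in> {\<omega> \<cdot>\<^sub>m pm N p | \<omega> p. cmod \<omega> = 1 \<and> p \<in> pvecs N}"
    unfolding mem_Collect_eq by (intro exI[of _ \<omega>] exI[of _ "pauli_code N ps"] conjI pauli_code_in_pvecs) (simp_all add: pauli_eq_pm)
next
  fix M assume "M \<in> {\<omega> \<cdot>\<^sub>m pm N p | \<omega> p. cmod \<omega> = 1 \<and> p \<in> pvecs N}"
  then obtain \<omega> p where M: "M = \<omega> \<cdot>\<^sub>m pm N p" "cmod \<omega> = 1" "p \<in> pvecs N" by blast
  have ps: "pauli_decode N p \<in> pauli_indices N" by (rule pauli_decode_in_indices)
  then have "M = \<omega> \<cdot>\<^sub>m pauli (pauli_decode N p)" using M by (simp add: pauli_eq_pm pauli_code_decode)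
  then show "M \<in> pauli_group N"
    unfolding pauli_group_def mem_Collect_eq using M ps by (intro exI[of _ \<omega>] exI[of _ "pauli_decode N p"] conjI)
qed

section \<open>The Pauli twirl\<close>

text \<open>The Pauli superoperator with the weights \<open>\<alpha>\<close>.\<close>
definition pauli_mix :: "nat \<Rightarrow> (pidx \<Rightarrow> complex) \<Rightarrow> superop" where
  "pauli_mix N \<alpha> \<rho> = mat_sum (2 ^ N) (\<lambda>p. \<alpha> p \<cdot>\<^sub>m (pm N p * \<rho> * (pm N p)\<^sup>\<dagger>)) (pvecs N)"

lemma pauli_mix_carrier [simp]: "pauli_mix N \<alpha> \<rho> \<in> cmat N"
  by (simp add: pauli_mix_def)

lemma pm_conj_carrier: "\<rho> \<in> cmat N \<Longrightarrow> pm N p * \<rho> * (pm N p)\<^sup>\<dagger> \<in> cmat N"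
  by (intro sq_closed) auto

lemma ent_pauli_mix:
  assumes "\<rho> \<in> cmat N" "x \<in> vecs N" "y \<in> vecs N"
  shows "ent N (pauli_mix N \<alpha> \<rho>) x y = (\<Sum>p\<in>pvecs N. \<alpha> p * (sg (dot N (snd p) (x + y)) * ent N \<rho> (x + fst p) (y + fst p)))"
  unfolding pauli_mix_def ent_mat_sum[OF assms(2,3)]
  by (intro sum.cong refl) (simp add: ent_smult assms ent_pm_conj pm_conj_carrier)

lemma pauli_superop_pauli_mix:
  assumes "\<And>\<rho>. \<rho> \<in> cmat N \<Longrightarrow> \<Lambda> \<rho> = pauli_mix N \<alpha> \<rho>"
  shows "pauli_superop N \<Lambda>"
  unfolding pauli_superop_def
proof (intro exI[of _ "\<lambda>ps. \<alpha> (pauli_code N ps)"] ballI)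
  fix \<rho> assume "\<rho> \<in> cmat N"
  then have "\<Lambda> \<rho> = pauli_mix N \<alpha> \<rho>" by (rule assms)
  also have "\<dots> = mat_sum (2 ^ N) (\<lambda>ps. \<alpha> (pauli_code N ps) \<cdot>\<^sub>m (pauli ps * \<rho> * (pauli ps)\<^sup>\<dagger>)) (pauli_indices N)"
    unfolding pauli_mix_def by (rule mat_sum_pauli_indices[symmetric, where f = "\<lambda>P p. \<alpha> p \<cdot>\<^sub>m (P * \<rho> * P\<^sup>\<dagger>)"])
  finally show "\<Lambda> \<rho> = mat_sum (2 ^ N) (\<lambda>ps. \<alpha> (pauli_code N ps) \<cdot>\<^sub>m (pauli ps * \<rho> * (pauli ps)\<^sup>\<dagger>)) (pauli_indices N)" .
qed

lemma pauli_twirl_pm: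
  "pauli_twirl N \<Lambda> \<rho> = (1 / (2 ^ N)\<^sup>2) \<cdot>\<^sub>m
     mat_sum (2 ^ N) (\<lambda>p. pm N p * \<Lambda> ((pm N p)\<^sup>\<dagger> * \<rho> * pm N p) * (pm N p)\<^sup>\<dagger>) (pvecs N)"
  unfolding pauli_twirl_def
  mat_sum_pauli_indices[where f = "\<lambda>P p. P * \<Lambda> (P\<^sup>\<dagger> * \<rho> * P) * P\<^sup>\<dagger>" for \<Lambda> \<rho>, simplified] ..

lemma trace_pm_adj_mult:
  assumes p: "p \<in> pvecs N" and A: "A \<in> cmat N"
  shows "trace ((pm N p)\<^sup>\<dagger> * A) = (\<Sum>z\<in>vecs N. sg (dot N (snd p) z) * ent N A (z + fst p) z)"
proof -
  have "(pm N p)\<^sup>\<dagger> * A = sg (dot N (snd p) (fst p)) \<cdot>\<^sub>m (pm N p * A)"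
    unfolding pm_adj[OF p] by (rule mult_smult_assoc_mat[OF pm_carrier A])
  moreover have PA: "pm N p * A \<in> cmat N" using A by (intro sq_closed) auto
  ultimately have "trace ((pm N p)\<^sup>\<dagger> * A) = (\<Sum>z\<in>vecs N. sg (dot N (snd p) (fst p)) * ent N (pm N p * A) z z)"
    by (simp add: trace_ent[of _ N] ent_smult)
  also have "\<dots> = (\<Sum>z\<in>vecs N. sg (dot N (snd p) z) * ent N A (z + fst p) z)"
  proof (rule sum.cong)
    fix z assume z: "z \<in> vecs N"
    have "s * ((t * s) * e) = (s * s) * (t * e)" for s t e :: complex by (simp only: mult_ac)
    then show "sg (dot N (snd p) (fst p)) * ent N (pm N p * A) z z = sg (dot N (snd p) z) * ent N A (z + fst p) z"
      unfolding ent_pm_mult[OF p A z z] dot_add_right sg_add by (simp only: sg_sg mult_1_left)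
  qed simp
  finally show ?thesis .
qed

text \<open>The correlation of the entries of \<open>A\<close> through which both the Pauli twirl of \<open>\<rho> \<mapsto> A \<rho> A\<^sup>\<dagger>\<close> (\<open>twirl_entry_single\<close>) and the
  numbers \<open>\<bar>tr (P\<^sub>p\<^sup>\<dagger> A)\<bar>\<^sup>2\<close> (\<open>sum_trace_sq\<close>) are expressed.\<close>

definition entry_corr :: "nat \<Rightarrow> complex mat \<Rightarrow> bvec \<Rightarrow> bvec \<Rightarrow> bvec \<Rightarrow> complex" where
  "entry_corr N A u x y = (\<Sum>m\<in>vecs N. ent N A (x + m + u) (x + m) * cnj (ent N A (y + m + u) (y + m)))"

lemma sum_sg_delta:
  assumes "x \<in> vecs N" "y \<in> vecs N" "m \<in> vecs N"
  shows "(\<Sum>n\<in>vecs N. (\<Sum>b\<in>vecs N. sg (dot N b (x + y + m + n))) * f n) = (2 ^ N :: complex) * f (x + y + m)"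
proof -
  have z: "x + y + m \<in> vecs N" using assms by (intro add_in_vecs)
  have "(\<Sum>n\<in>vecs N. (\<Sum>b\<in>vecs N. sg (dot N b (x + y + m + n))) * f n)
      = (\<Sum>n\<in>vecs N. if n = x + y + m then 2 ^ N * f n else 0)"
  proof (rule sum.cong)
    fix n assume n: "n \<in> vecs N"
    show "(\<Sum>b\<in>vecs N. sg (dot N b (x + y + m + n))) * f n = (if n = x + y + m then 2 ^ N * f n else 0)"
      unfolding sum_sg_dot[OF add_in_vecs[OF z n]] bvec_add_eq_zero by auto
  qed simp
  then show ?thesis using z by (simp only: sum_delta_vecs)
qed

lemma sum_trace_sq:
  assumes A: "A \<in> cmat N" and u: "u \<in> vecs N" and xy: "x \<in> vecs N" "y \<in> vecs N"
  shows "(\<Sum>b\<in>vecs N. complex_of_real ((cmod (trace ((pm N (u, b))\<^sup>\<dagger> * A)))\<^sup>2) * sg (dot N b (x + y))) = 2 ^ N * entry_corr N A u x y"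
proof -
  let ?A = "\<lambda>z. ent N A (z + u) z"
  have "(\<Sum>b\<in>vecs N. complex_of_real ((cmod (trace ((pm N (u, b))\<^sup>\<dagger> * A)))\<^sup>2) * sg (dot N b (x + y)))
     = (\<Sum>b\<in>vecs N. \<Sum>m\<in>vecs N. \<Sum>n\<in>vecs N. sg (dot N b (x + y + m + n)) * (?A m * cnj (?A n)))"
  proof (rule sum.cong)
    fix b assume b: "b \<in> vecs N"
    then have p: "(u, b) \<in> pvecs N" using u by (simp add: pvecs_def)
    show "complex_of_real ((cmod (trace ((pm N (u, b))\<^sup>\<dagger> * A)))\<^sup>2) * sg (dot N b (x + y))
      = (\<Sum>m\<in>vecs N. \<Sum>n\<in>vecs N. sg (dot N b (x + y + m + n)) * (?A m * cnj (?A n)))"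
      unfolding complex_norm_square trace_pm_adj_mult[OF p A] cnj_sum sum_product sum_distrib_right fst_conv snd_conv
      by (intro sum.cong refl) (simp add: dot_add_right sg_add mult_ac sum_distrib_left)
  qed simp
  also have "\<dots> = (\<Sum>m\<in>vecs N. \<Sum>n\<in>vecs N. (\<Sum>b\<in>vecs N. sg (dot N b (x + y + m + n))) * (?A m * cnj (?A n)))"
    unfolding sum_distrib_right by (subst sum.swap) (intro sum.cong refl sum.swap)
  also have "\<dots> = (\<Sum>m\<in>vecs N. 2 ^ N * (?A m * cnj (?A (x + y + m))))"
    by (intro sum.cong refl) (simp only: sum_sg_delta[OF xy])
  also have "\<dots> = (\<Sum>m\<in>vecs N. 2 ^ N * (?A (m + x) * cnj (?A (x + y + (m + x)))))"
    by (rule sum_shift[OF xy(1), symmetric])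
  also have "\<dots> = 2 ^ N * entry_corr N A u x y"
    unfolding entry_corr_def sum_distrib_left
  proof (rule sum.cong)
    fix m
    have "x + y + (m + x) = x + (x + (y + m))" by (simp only: add_ac)
    then have "x + y + (m + x) = y + m" by (simp only: bvec_add_self_left)
    then show "2 ^ N * (?A (m + x) * cnj (?A (x + y + (m + x)))) = 2 ^ N * (ent N A (x + m + u) (x + m) * cnj (ent N A (y + m + u) (y + m)))"
      by (simp only: add.commute[of m x])
  qed simp
  finally show ?thesis .
qed

lemma twirl_entry_single:
  assumes A: "A \<in> cmat N" and \<rho>: "\<rho> \<in> cmat N" and xy: "x \<in> vecs N" "y \<in> vecs N"
  shows "(\<Sum>p\<in>pvecs N. ent N (pm N p * (A * ((pm N p)\<^sup>\<dagger> * \<rho> * pm N p) * A\<^sup>\<dagger>) * (pm N p)\<^sup>\<dagger>) x y)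
     = 2 ^ N * (\<Sum>u\<in>vecs N. entry_corr N A u x y * ent N \<rho> (x + u) (y + u))"
proof -
  define g where "g a z = ent N A (x + a) z * ent N \<rho> (z + a) (x + y + z + a) * cnj (ent N A (y + a) (x + y + z))" for a z
  have entry: "ent N (pm N (a, b) * (A * ((pm N (a, b))\<^sup>\<dagger> * \<rho> * pm N (a, b)) * A\<^sup>\<dagger>) * (pm N (a, b))\<^sup>\<dagger>) x y
     = (\<Sum>z\<in>vecs N. \<Sum>w\<in>vecs N. sg (dot N b (x + y + z + w)) * (ent N A (x + a) z * ent N \<rho> (z + a) (w + a) * cnj (ent N A (y + a) w)))"
    if a: "a \<in> vecs N" and b: "b \<in> vecs N" for a b
  proof -
    have p: "(a, b) \<in> pvecs N" using a b by (simp add: pvecs_def)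
    have xa: "x + a \<in> vecs N" "y + a \<in> vecs N" using xy a by (simp_all add: add_in_vecs)
    define R where "R = (pm N (a, b))\<^sup>\<dagger> * \<rho> * pm N (a, b)"
    have R: "R \<in> cmat N" unfolding R_def using \<rho> by (intro sq_closed) auto
    have Aa: "A\<^sup>\<dagger> \<in> cmat N" using A by simp
    have AR: "A * R \<in> cmat N" by (rule sq_closed[OF A R])
    have entR: "ent N R z w = sg (dot N b (z + w)) * ent N \<rho> (z + a) (w + a)" if "z \<in> vecs N" "w \<in> vecs N" for z w
      unfolding R_def pm_conj_adj[OF p \<rho>] using ent_pm_conj[OF p \<rho> that] by simp
    have "ent N (pm N (a, b) * (A * R * A\<^sup>\<dagger>) * (pm N (a, b))\<^sup>\<dagger>) x y = sg (dot N b (x + y)) * ent N (A * R * A\<^sup>\<dagger>) (x + a) (y + a)"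
      using ent_pm_conj[OF p sq_closed[OF AR Aa] xy] by simp
    also have "ent N (A * R * A\<^sup>\<dagger>) (x + a) (y + a) = (\<Sum>w\<in>vecs N. (\<Sum>z\<in>vecs N. ent N A (x + a) z * ent N R z w) * cnj (ent N A (y + a) w))"
      unfolding ent_mult[OF AR Aa xa]
      by (intro sum.cong refl) (simp only: ent_mult[OF A R xa(1)] ent_adj[OF A _ xa(2)])
    also have "\<dots> = (\<Sum>z\<in>vecs N. \<Sum>w\<in>vecs N. ent N A (x + a) z * ent N R z w * cnj (ent N A (y + a) w))"
      unfolding sum_distrib_right by (rule sum.swap)
    finally show ?thesis
      unfolding R_def[symmetric] sum_distrib_left
      by (simp only:) (intro sum.cong refl, simp add: entR dot_add_right sg_add mult_ac)
  qed
  have "(\<Sum>p\<in>pvecs N. ent N (pm N p * (A * ((pm N p)\<^sup>\<dagger> * \<rho> * pm N p) * A\<^sup>\<dagger>) * (pm N p)\<^sup>\<dagger>) x y)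
     = (\<Sum>a\<in>vecs N. \<Sum>b\<in>vecs N. \<Sum>z\<in>vecs N. \<Sum>w\<in>vecs N. sg (dot N b (x + y + z + w)) * (ent N A (x + a) z * ent N \<rho> (z + a) (w + a) * cnj (ent N A (y + a) w)))"
    unfolding sum_pvecs by (intro sum.cong refl entry)
  also have "\<dots> = (\<Sum>a\<in>vecs N. \<Sum>z\<in>vecs N. \<Sum>w\<in>vecs N. (\<Sum>b\<in>vecs N. sg (dot N b (x + y + z + w))) * (ent N A (x + a) z * ent N \<rho> (z + a) (w + a) * cnj (ent N A (y + a) w)))"
    unfolding sum_distrib_right
    by (rule sum.cong[OF refl], subst sum.swap, rule sum.cong[OF refl], rule sum.swap)
  also have "\<dots> = (\<Sum>a\<in>vecs N. \<Sum>z\<in>vecs N. 2 ^ N * g a z)"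
    unfolding g_def by (intro sum.cong refl) (simp only: sum_sg_delta[OF xy])
  also have "\<dots> = (\<Sum>a\<in>vecs N. \<Sum>m\<in>vecs N. 2 ^ N * g a (m + x))"
    by (rule sum.cong[OF refl], rule sum_shift[OF xy(1), symmetric])
  also have "\<dots> = (\<Sum>m\<in>vecs N. \<Sum>a\<in>vecs N. 2 ^ N * g a (m + x))" by (rule sum.swap)
  also have "\<dots> = (\<Sum>m\<in>vecs N. \<Sum>u\<in>vecs N. 2 ^ N * g (u + m) (m + x))"
  proof (rule sum.cong)
    fix m assume "m \<in> vecs N"
    then show "(\<Sum>a\<in>vecs N. 2 ^ N * g a (m + x)) = (\<Sum>u\<in>vecs N. 2 ^ N * g (u + m) (m + x))"
      by (rule sum_shift[symmetric])
  qed simp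
  also have "\<dots> = (\<Sum>u\<in>vecs N. \<Sum>m\<in>vecs N. 2 ^ N * g (u + m) (m + x))" by (rule sum.swap)
  also have "\<dots> = 2 ^ N * (\<Sum>u\<in>vecs N. entry_corr N A u x y * ent N \<rho> (x + u) (y + u))"
    unfolding entry_corr_def sum_distrib_left sum_distrib_right
  proof (intro sum.cong refl)
    fix u m
    have r: "m + x + (u + m) = x + u" "x + y + (m + x) + (u + m) = y + u" "x + y + (m + x) = y + m"
      "y + m + (u + m) = y + u" "x + (u + m) = x + m + u" "y + (u + m) = y + m + u"
      by (simp_all only: add_ac bvec_add_self bvec_add_self_left add_0_right)
    show "2 ^ N * g (u + m) (m + x) = 2 ^ N * (ent N A (x + m + u) (x + m) * cnj (ent N A (y + m + u) (y + m)) * ent N \<rho> (x + u) (y + u))"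
      unfolding g_def r by (simp only: add.commute[of m x] mult_ac)
  qed
  finally show ?thesis .
qed

text \<open>The weights of the Pauli twirl of the map with Kraus operators \<open>A k\<close>, \<open>k < m\<close>.\<close>

definition twirl_weight :: "nat \<Rightarrow> (nat \<Rightarrow> complex mat) \<Rightarrow> nat \<Rightarrow> pidx \<Rightarrow> real" where
  "twirl_weight N A m p = (\<Sum>k<m. (cmod (trace ((pm N p)\<^sup>\<dagger> * A k)))\<^sup>2) / (2 ^ N)\<^sup>2"

lemma twirl_weight_nonneg: "0 \<le> twirl_weight N A m p"
  by (simp add: twirl_weight_def sum_nonneg)

lemma sum_twirl_weight_sg:
  assumes A: "\<And>k. k < m \<Longrightarrow> A k \<in> cmat N" and u: "u \<in> vecs N" and xy: "x \<in> vecs N" "y \<in> vecs N"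
  shows "(\<Sum>b\<in>vecs N. complex_of_real (twirl_weight N A m (u, b)) * sg (dot N b (x + y))) = (\<Sum>k<m. entry_corr N (A k) u x y) / 2 ^ N"
proof -
  have "(\<Sum>b\<in>vecs N. complex_of_real (twirl_weight N A m (u, b)) * sg (dot N b (x + y)))
     = (\<Sum>b\<in>vecs N. \<Sum>k<m. complex_of_real ((cmod (trace ((pm N (u, b))\<^sup>\<dagger> * A k)))\<^sup>2) * sg (dot N b (x + y))) / (2 ^ N)\<^sup>2"
    unfolding twirl_weight_def sum_divide_distrib by (intro sum.cong refl) (simp add: sum_distrib_right)
  also have "(\<Sum>b\<in>vecs N. \<Sum>k<m. complex_of_real ((cmod (trace ((pm N (u, b))\<^sup>\<dagger> * A k)))\<^sup>2) * sg (dot N b (x + y)))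
     = (\<Sum>k<m. \<Sum>b\<in>vecs N. complex_of_real ((cmod (trace ((pm N (u, b))\<^sup>\<dagger> * A k)))\<^sup>2) * sg (dot N b (x + y)))"
    by (rule sum.swap)
  also have "\<dots> = (\<Sum>k<m. 2 ^ N * entry_corr N (A k) u x y)"
    by (intro sum.cong refl sum_trace_sq u xy) (simp add: A)
  also have "\<dots> / (2 ^ N)\<^sup>2 = (\<Sum>k<m. entry_corr N (A k) u x y) / 2 ^ N"
    by (simp add: power2_eq_square sum_distrib_left[symmetric])
  finally show ?thesis .
qed

lemma pauli_twirl_eq_pauli_mix:
  assumes A: "\<And>k. k < m \<Longrightarrow> A k \<in> cmat N"
    and \<Lambda>: "\<And>\<rho>. \<rho> \<in> cmat N \<Longrightarrow> \<Lambda> \<rho> = mat_sum (2 ^ N) (\<lambda>k. A k * \<rho> * (A k)\<^sup>\<dagger>) {..<m}"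
    and \<rho>: "\<rho> \<in> cmat N"
  shows "pauli_twirl N \<Lambda> \<rho> = pauli_mix N (\<lambda>p. complex_of_real (twirl_weight N A m p)) \<rho>"
proof (rule ent_eqI[of _ N])
  show "pauli_twirl N \<Lambda> \<rho> \<in> cmat N" unfolding pauli_twirl_def by simp
  fix x y assume xy: "x \<in> vecs N" "y \<in> vecs N"
  have t: "ent N (pm N p * \<Lambda> ((pm N p)\<^sup>\<dagger> * \<rho> * pm N p) * (pm N p)\<^sup>\<dagger>) x y
     = (\<Sum>k<m. ent N (pm N p * (A k * ((pm N p)\<^sup>\<dagger> * \<rho> * pm N p) * (A k)\<^sup>\<dagger>) * (pm N p)\<^sup>\<dagger>) x y)"
    if p: "p \<in> pvecs N" for p
  proof -
    define R where "R = (pm N p)\<^sup>\<dagger> * \<rho> * pm N p"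
    have R: "R \<in> cmat N" unfolding R_def using \<rho> by (intro sq_closed) auto
    have xa: "x + fst p \<in> vecs N" "y + fst p \<in> vecs N" using xy p by (auto simp: add_in_vecs pvecs_def)
    have c: "A k * R * (A k)\<^sup>\<dagger> \<in> cmat N" if "k < m" for k using A[OF that] R by (intro sq_closed) auto
    show ?thesis
      unfolding R_def[symmetric] \<Lambda>[OF R] ent_pm_conj[OF p mat_sum_carrier xy] ent_mat_sum[OF xa] sum_distrib_left
      by (intro sum.cong refl) (simp add: ent_pm_conj[OF p c xy])
  qed
  have "ent N (pauli_twirl N \<Lambda> \<rho>) x y
     = 1 / (2 ^ N)\<^sup>2 * (\<Sum>p\<in>pvecs N. ent N (pm N p * \<Lambda> ((pm N p)\<^sup>\<dagger> * \<rho> * pm N p) * (pm N p)\<^sup>\<dagger>) x y)"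
    unfolding pauli_twirl_pm ent_smult[OF mat_sum_carrier xy] ent_mat_sum[OF xy] ..
  also have "(\<Sum>p\<in>pvecs N. ent N (pm N p * \<Lambda> ((pm N p)\<^sup>\<dagger> * \<rho> * pm N p) * (pm N p)\<^sup>\<dagger>) x y)
     = (\<Sum>p\<in>pvecs N. \<Sum>k<m. ent N (pm N p * (A k * ((pm N p)\<^sup>\<dagger> * \<rho> * pm N p) * (A k)\<^sup>\<dagger>) * (pm N p)\<^sup>\<dagger>) x y)"
    by (intro sum.cong refl t)
  also have "\<dots> = (\<Sum>k<m. \<Sum>p\<in>pvecs N. ent N (pm N p * (A k * ((pm N p)\<^sup>\<dagger> * \<rho> * pm N p) * (A k)\<^sup>\<dagger>) * (pm N p)\<^sup>\<dagger>) x y)"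
    by (rule sum.swap)
  also have "\<dots> = (\<Sum>k<m. 2 ^ N * (\<Sum>u\<in>vecs N. entry_corr N (A k) u x y * ent N \<rho> (x + u) (y + u)))"
    by (intro sum.cong refl twirl_entry_single A \<rho> xy) simp
  also have "\<dots> = 2 ^ N * (\<Sum>u\<in>vecs N. (\<Sum>k<m. entry_corr N (A k) u x y) * ent N \<rho> (x + u) (y + u))"
    unfolding sum_distrib_left[symmetric] sum_distrib_right by (simp only: sum.swap[of _ "{..<m}" "vecs N"])
  also have "1 / (2 ^ N)\<^sup>2 * \<dots> = (\<Sum>u\<in>vecs N. (\<Sum>k<m. entry_corr N (A k) u x y) / 2 ^ N * ent N \<rho> (x + u) (y + u))"
    unfolding sum_distrib_left by (intro sum.cong refl) (simp add: power2_eq_square)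
  also have "\<dots> = (\<Sum>u\<in>vecs N. (\<Sum>b\<in>vecs N. complex_of_real (twirl_weight N A m (u, b)) * sg (dot N b (x + y))) * ent N \<rho> (x + u) (y + u))"
    by (intro sum.cong refl) (simp only: sum_twirl_weight_sg[OF A _ xy])
  also have "\<dots> = ent N (pauli_mix N (\<lambda>p. complex_of_real (twirl_weight N A m p)) \<rho>) x y"
    unfolding ent_pauli_mix[OF \<rho> xy] sum_pvecs sum_distrib_right by (intro sum.cong refl) (simp add: mult.assoc)
  finally show "ent N (pauli_twirl N \<Lambda> \<rho>) x y = ent N (pauli_mix N (\<lambda>p. complex_of_real (twirl_weight N A m p)) \<rho>) x y" .
qed simp

lemma sum_divmod:
  assumes "0 < n"
  shows "(\<Sum>k<d * n. f (k div n) (k mod n)) = (\<Sum>a<d. \<Sum>r<n. f a (r::nat))"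
proof -
  have *: "a * n + r < d * n" if "a < d" "r < n" for a r
  proof -
    have "a * n + r < Suc a * n" using that by simp
    also have "\<dots> \<le> d * n" using that by (intro mult_le_mono1) simp
    finally show ?thesis .
  qed
  have "bij_betw (\<lambda>k. (k div n, k mod n)) {..<d * n} ({..<d} \<times> {..<n})"
    by (rule bij_betw_byWitness[where f' = "\<lambda>(a, r). a * n + r"])
      (use assms in \<open>auto simp: less_mult_imp_div_less intro: *\<close>)
  then have "(\<Sum>k<d * n. case (k div n, k mod n) of (a, r) \<Rightarrow> f a r) = (\<Sum>(a, r)\<in>{..<d} \<times> {..<n}. f a r)"
    by (rule sum.reindex_bij_betw)
  then show ?thesis by (simp add: sum.cartesian_product)
qed

lemma mult3_index:
  assumes "A \<in> carrier_mat n n" "B \<in> carrier_mat n n" "C \<in> carrier_mat n n" "i < n" "j < n"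
  shows "(A * B * C) $$ (i, j) = (\<Sum>l<n. \<Sum>k<n. A $$ (i, k) * B $$ (k, l) * C $$ (l, j))"
  unfolding mult_index[OF sq_closed[OF assms(1,2)] assms(3-5)] sum_distrib_right[symmetric]
  by (intro sum.cong refl) (simp add: mult_index[OF assms(1,2,4)] del: index_mult_mat(1))

lemma trace_superop_mat:
  assumes A: "\<And>k. k < m \<Longrightarrow> A k \<in> carrier_mat d d"
    and \<Lambda>: "\<And>\<rho>. \<rho> \<in> carrier_mat d d \<Longrightarrow> \<Lambda> \<rho> = mat_sum d (\<lambda>k. A k * \<rho> * (A k)\<^sup>\<dagger>) {..<m}"
    and d: "0 < d"
  shows "trace (superop_mat d \<Lambda>) = complex_of_real (\<Sum>k<m. (cmod (trace (A k)))\<^sup>2)"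
proof -
  define E :: "nat \<Rightarrow> nat \<Rightarrow> complex mat" where "E a b = mat d d (\<lambda>(i, j). if i = a \<and> j = b then 1 else 0)" for a b
  have E: "E a b \<in> carrier_mat d d" for a b by (simp add: E_def)
  have "trace (superop_mat d \<Lambda>) = (\<Sum>p<d * d. \<Lambda> (E (p div d) (p mod d)) $$ (p div d, p mod d))"
    unfolding trace_def superop_mat_def by (simp add: E_def power2_eq_square)
  also have "\<dots> = (\<Sum>a<d. \<Sum>b<d. \<Lambda> (E a b) $$ (a, b))" by (rule sum_divmod[OF d])
  also have "\<dots> = (\<Sum>a<d. \<Sum>b<d. \<Sum>k<m. A k $$ (a, a) * cnj (A k $$ (b, b)))"
  proof (intro sum.cong refl)
    fix a b assume "a \<in> {..<d}" "b \<in> {..<d}"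
    then have ab: "a < d" "b < d" by auto
    have "(A k * E a b * (A k)\<^sup>\<dagger>) $$ (a, b) = A k $$ (a, a) * cnj (A k $$ (b, b))" if k: "k < m" for k
    proof -
      have "(A k * E a b * (A k)\<^sup>\<dagger>) $$ (a, b) = (\<Sum>l<d. if l = b then A k $$ (a, a) * cnj (A k $$ (b, b)) else 0)"
        unfolding mult3_index[OF A[OF k] E adj_carrier[OF A[OF k]] ab]
      proof (rule sum.cong)
        fix l assume "l \<in> {..<d}"
        then have l: "l < d" by simp
        have "(\<Sum>j<d. A k $$ (a, j) * E a b $$ (j, l) * (A k)\<^sup>\<dagger> $$ (l, b))
          = (\<Sum>j<d. if j = a then (if l = b then A k $$ (a, a) * cnj (A k $$ (b, b)) else 0) else 0)"
          using A[OF k] ab l by (intro sum.cong) (auto simp: E_def)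
        then show "(\<Sum>j<d. A k $$ (a, j) * E a b $$ (j, l) * (A k)\<^sup>\<dagger> $$ (l, b)) = (if l = b then A k $$ (a, a) * cnj (A k $$ (b, b)) else 0)"
          using ab by simp
      qed simp
      then show ?thesis using ab by simp
    qed
    then show "\<Lambda> (E a b) $$ (a, b) = (\<Sum>k<m. A k $$ (a, a) * cnj (A k $$ (b, b)))"
      using ab by (simp add: \<Lambda>[OF E])
  qed
  also have "\<dots> = (\<Sum>k<m. \<Sum>a<d. \<Sum>b<d. A k $$ (a, a) * cnj (A k $$ (b, b)))"
    by (simp only: sum.swap[of _ "{..<d}" "{..<m}"])
  also have "\<dots> = (\<Sum>k<m. complex_of_real ((cmod (trace (A k)))\<^sup>2))"
  proof (rule sum.cong)
    fix k assume "k \<in> {..<m}"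
    then have "trace (A k) = (\<Sum>a<d. A k $$ (a, a))" using A[of k] by (simp add: trace_def)
    then show "(\<Sum>a<d. \<Sum>b<d. A k $$ (a, a) * cnj (A k $$ (b, b))) = complex_of_real ((cmod (trace (A k)))\<^sup>2)"
      unfolding complex_norm_square by (simp add: sum_product)
  qed simp
  finally show ?thesis by simp
qed

lemma error_factor_twirl_weight:
  assumes A: "\<And>k. k < m \<Longrightarrow> A k \<in> cmat N"
    and \<Lambda>: "\<And>\<rho>. \<rho> \<in> cmat N \<Longrightarrow> \<Lambda> \<rho> = mat_sum (2 ^ N) (\<lambda>k. A k * \<rho> * (A k)\<^sup>\<dagger>) {..<m}"
  shows "error_factor (2 ^ N) \<Lambda> = (\<Sum>p\<in>pvecs N - {(0, 0)}. twirl_weight N A m p) / (2 ^ N)\<^sup>2"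
proof -
  have "complex_of_real (\<Sum>p\<in>pvecs N. twirl_weight N A m p) = (\<Sum>u\<in>vecs N. \<Sum>b\<in>vecs N. complex_of_real (twirl_weight N A m (u, b)) * sg (dot N b (0 + 0)))"
    unfolding sum_pvecs by simp
  also have "\<dots> = (\<Sum>u\<in>vecs N. (\<Sum>k<m. entry_corr N (A k) u 0 0) / 2 ^ N)"
    by (intro sum.cong refl sum_twirl_weight_sg A zero_in_vecs)
  also have "\<dots> = (\<Sum>k<m. \<Sum>u\<in>vecs N. entry_corr N (A k) u 0 0) / 2 ^ N"
    unfolding sum_divide_distrib[symmetric] by (simp only: sum.swap[of _ "vecs N" "{..<m}"])
  also have "(\<Sum>k<m. \<Sum>u\<in>vecs N. entry_corr N (A k) u 0 0) = trace (\<Lambda> (1\<^sub>m (2 ^ N)))"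
  proof -
    have c: "A k * 1\<^sub>m (2 ^ N) * (A k)\<^sup>\<dagger> \<in> cmat N" if "k < m" for k using A[OF that] by (intro sq_closed) auto
    have "(\<Sum>u\<in>vecs N. entry_corr N (A k) u 0 0) = (\<Sum>x\<in>vecs N. ent N (A k * 1\<^sub>m (2 ^ N) * (A k)\<^sup>\<dagger>) x x)" if k: "k < m" for k
    proof -
      have "(\<Sum>u\<in>vecs N. entry_corr N (A k) u 0 0) = (\<Sum>n\<in>vecs N. \<Sum>u\<in>vecs N. ent N (A k) (u + n) n * cnj (ent N (A k) (u + n) n))"
        unfolding entry_corr_def by (subst sum.swap) (simp add: add.commute)
      also have "\<dots> = (\<Sum>n\<in>vecs N. \<Sum>x\<in>vecs N. ent N (A k) x n * cnj (ent N (A k) x n))"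
      proof (rule sum.cong)
        fix n assume "n \<in> vecs N"
        then show "(\<Sum>u\<in>vecs N. ent N (A k) (u + n) n * cnj (ent N (A k) (u + n) n)) = (\<Sum>x\<in>vecs N. ent N (A k) x n * cnj (ent N (A k) x n))"
          by (rule sum_shift[where f = "\<lambda>x. ent N (A k) x n * cnj (ent N (A k) x n)" for n])
      qed simp
      also have "\<dots> = (\<Sum>x\<in>vecs N. \<Sum>n\<in>vecs N. ent N (A k) x n * cnj (ent N (A k) x n))" by (rule sum.swap)
      also have "\<dots> = (\<Sum>x\<in>vecs N. ent N (A k * 1\<^sub>m (2 ^ N) * (A k)\<^sup>\<dagger>) x x)"
        using A[OF k] by (intro sum.cong refl) (simp add: ent_mult[OF A[OF k] adj_carrier[OF A[OF k]]] ent_adj[OF A[OF k]])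
      finally show ?thesis .
    qed
    then have "(\<Sum>k<m. \<Sum>u\<in>vecs N. entry_corr N (A k) u 0 0) = (\<Sum>k<m. \<Sum>x\<in>vecs N. ent N (A k * 1\<^sub>m (2 ^ N) * (A k)\<^sup>\<dagger>) x x)"
      by - (rule sum.cong[OF refl], simp)
    also have "\<dots> = (\<Sum>x\<in>vecs N. \<Sum>k<m. ent N (A k * 1\<^sub>m (2 ^ N) * (A k)\<^sup>\<dagger>) x x)" by (rule sum.swap)
    also have "\<dots> = trace (\<Lambda> (1\<^sub>m (2 ^ N)))"
      unfolding \<Lambda>[OF one_carrier_mat] trace_ent[OF mat_sum_carrier] by (intro sum.cong refl) (simp add: ent_mat_sum)
    finally show ?thesis .
  qed
  finally have "Re (complex_of_real (\<Sum>p\<in>pvecs N. twirl_weight N A m p)) = Re (trace (\<Lambda> (1\<^sub>m (2 ^ N))) / complex_of_real (2 ^ N))"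
    by simp
  then have tot: "(\<Sum>p\<in>pvecs N. twirl_weight N A m p) = Re (trace (\<Lambda> (1\<^sub>m (2 ^ N)))) / 2 ^ N"
    unfolding Re_divide_of_real by simp
  have "twirl_weight N A m (0, 0) = Re (trace (superop_mat (2 ^ N) \<Lambda>)) / (2 ^ N)\<^sup>2"
    unfolding trace_superop_mat[OF A \<Lambda>, simplified] twirl_weight_def pm_zero adj_one
    by (auto intro!: arg_cong2[of _ _ _ _ "(/)"] sum.cong simp: left_mult_one_mat[OF A])
  moreover have "(\<Sum>p\<in>pvecs N. twirl_weight N A m p) = twirl_weight N A m (0, 0) + (\<Sum>p\<in>pvecs N - {(0, 0)}. twirl_weight N A m p)"
    by (rule sum.remove) (simp_all add: pvecs_def)
  ultimately show ?thesis
    using tot by (simp add: error_factor_def field_simps power2_eq_square power4_eq_xxxx)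
qed

section \<open>Averages of conjugated Pauli superoperators\<close>
lemma mult_mat_sum:
  assumes "W \<in> carrier_mat n n" "\<And>p. p \<in> I \<Longrightarrow> f p \<in> carrier_mat n n"
  shows "W * mat_sum n f I = mat_sum n (\<lambda>p. W * f p) I" "mat_sum n f I * W = mat_sum n (\<lambda>p. f p * W) I"
proof -
  show "W * mat_sum n f I = mat_sum n (\<lambda>p. W * f p) I"
  proof (rule eq_matI)
    fix i j assume "i < dim_row (mat_sum n (\<lambda>p. W * f p) I)" "j < dim_col (mat_sum n (\<lambda>p. W * f p) I)"
    then have ij: "i < n" "j < n" by (auto simp: mat_sum_def)
    have "(W * mat_sum n f I) $$ (i, j) = (\<Sum>l<n. \<Sum>p\<in>I. W $$ (i, l) * f p $$ (l, j))"
      unfolding mult_index[OF assms(1) mat_sum_carrier ij] using ij by (intro sum.cong refl) (simp add: sum_distrib_left)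
    also have "\<dots> = (\<Sum>p\<in>I. \<Sum>l<n. W $$ (i, l) * f p $$ (l, j))" by (rule sum.swap)
    also have "\<dots> = (\<Sum>p\<in>I. (W * f p) $$ (i, j))"
      using ij by (intro sum.cong refl) (simp only: mult_index[OF assms])
    finally show "(W * mat_sum n f I) $$ (i, j) = mat_sum n (\<lambda>p. W * f p) I $$ (i, j)" using ij by simp
  qed (use assms(1) in \<open>auto simp: mat_sum_def\<close>)
  show "mat_sum n f I * W = mat_sum n (\<lambda>p. f p * W) I"
  proof (rule eq_matI)
    fix i j assume "i < dim_row (mat_sum n (\<lambda>p. f p * W) I)" "j < dim_col (mat_sum n (\<lambda>p. f p * W) I)"
    then have ij: "i < n" "j < n" by (auto simp: mat_sum_def)
    have "(mat_sum n f I * W) $$ (i, j) = (\<Sum>l<n. \<Sum>p\<in>I. f p $$ (i, l) * W $$ (l, j))"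
      unfolding mult_index[OF mat_sum_carrier assms(1) ij] using ij by (intro sum.cong refl) (simp add: sum_distrib_right)
    also have "\<dots> = (\<Sum>p\<in>I. \<Sum>l<n. f p $$ (i, l) * W $$ (l, j))" by (rule sum.swap)
    also have "\<dots> = (\<Sum>p\<in>I. (f p * W) $$ (i, j))"
      using ij by (intro sum.cong refl) (simp only: mult_index[OF assms(2,1)])
    finally show "(mat_sum n f I * W) $$ (i, j) = mat_sum n (\<lambda>p. f p * W) I $$ (i, j)" using ij by simp
  qed (use assms(1) in \<open>auto simp: mat_sum_def\<close>)
qed

text \<open>The unitary \<open>C\<close> acts as \<open>g\<close> on the Pauli operators: \<open>C\<^sup>\<dagger> P\<^sub>p C\<close> is \<open>P\<^sub>g\<^sub>p\<close> up to a phase.\<close>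

definition conj_action :: "nat \<Rightarrow> complex mat \<Rightarrow> (pidx \<Rightarrow> pidx) \<Rightarrow> bool" where
  "conj_action N C g \<longleftrightarrow> C \<in> unitary (2 ^ N) \<and>
     (\<forall>p\<in>pvecs N. g p \<in> pvecs N \<and> (\<exists>\<omega>. cmod \<omega> = 1 \<and> C\<^sup>\<dagger> * pm N p * C = \<omega> \<cdot>\<^sub>m pm N (g p)))"

lemma smult_adj: "(c \<cdot>\<^sub>m A)\<^sup>\<dagger> = cnj c \<cdot>\<^sub>m A\<^sup>\<dagger>"
  by (rule eq_matI) simp_all

lemma smult_conj:
  assumes "cmod \<omega> = 1" "P \<in> carrier_mat n n" "\<rho> \<in> carrier_mat n n"
  shows "(\<omega> \<cdot>\<^sub>m P) * \<rho> * (\<omega> \<cdot>\<^sub>m P)\<^sup>\<dagger> = P * \<rho> * P\<^sup>\<dagger>"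
proof -
  have c: "P * \<rho> \<in> carrier_mat n n" using assms by (intro sq_closed)
  have "\<omega> * cnj \<omega> = 1" using complex_norm_square[of \<omega>] assms(1) by simp
  then show ?thesis
    unfolding smult_adj mult_smult_assoc_mat[OF assms(2,3)] mult_smult_assoc_mat[OF c smult_carrier_mat[OF adj_carrier[OF assms(2)]]]
      mult_smult_distrib[OF c adj_carrier[OF assms(2)]] smult_smult_mat
    by simp
qed

lemma pauli_mix_conj:
  assumes C: "conj_action N C g" and \<rho>: "\<rho> \<in> cmat N"
  shows "C\<^sup>\<dagger> * pauli_mix N \<alpha> (C * \<rho> * C\<^sup>\<dagger>) * C = mat_sum (2 ^ N) (\<lambda>p. \<alpha> p \<cdot>\<^sub>m (pm N (g p) * \<rho> * (pm N (g p))\<^sup>\<dagger>)) (pvecs N)"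
proof -
  have CU: "C \<in> cmat N" using C unitaryD(1) by (auto simp: conj_action_def)
  have Ca: "C\<^sup>\<dagger> \<in> cmat N" using CU by simp
  have s: "C * \<rho> * C\<^sup>\<dagger> \<in> cmat N" by (intro sq_closed CU \<rho> Ca)
  have c: "\<alpha> p \<cdot>\<^sub>m (pm N p * (C * \<rho> * C\<^sup>\<dagger>) * (pm N p)\<^sup>\<dagger>) \<in> cmat N" for p
    by (intro smult_carrier_mat pm_conj_carrier s)
  have "C\<^sup>\<dagger> * pauli_mix N \<alpha> (C * \<rho> * C\<^sup>\<dagger>) * C = mat_sum (2 ^ N) (\<lambda>p. C\<^sup>\<dagger> * (\<alpha> p \<cdot>\<^sub>m (pm N p * (C * \<rho> * C\<^sup>\<dagger>) * (pm N p)\<^sup>\<dagger>)) * C) (pvecs N)"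
    unfolding pauli_mix_def mult_mat_sum(1)[OF Ca c] by (rule mult_mat_sum(2)[OF CU sq_closed[OF Ca c]])
  also have "\<dots> = mat_sum (2 ^ N) (\<lambda>p. \<alpha> p \<cdot>\<^sub>m (pm N (g p) * \<rho> * (pm N (g p))\<^sup>\<dagger>)) (pvecs N)"
  proof (rule mat_sum_cong)
    fix p assume p: "p \<in> pvecs N"
    obtain \<omega> where \<omega>: "cmod \<omega> = 1" "C\<^sup>\<dagger> * pm N p * C = \<omega> \<cdot>\<^sub>m pm N (g p)"
      using C p by (auto simp: conj_action_def)
    let ?M = "pm N p * (C * \<rho> * C\<^sup>\<dagger>) * (pm N p)\<^sup>\<dagger>" and ?Q = "C\<^sup>\<dagger> * pm N p * C"
    have M: "?M \<in> cmat N" by (intro pm_conj_carrier s)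
    have "C\<^sup>\<dagger> * (\<alpha> p \<cdot>\<^sub>m ?M) * C = \<alpha> p \<cdot>\<^sub>m (C\<^sup>\<dagger> * ?M * C)"
      unfolding mult_smult_distrib[OF Ca M] by (rule mult_smult_assoc_mat[OF sq_closed[OF Ca M] CU])
    also have "C\<^sup>\<dagger> * ?M * C = ?Q * \<rho> * ?Q\<^sup>\<dagger>"
    proof -
      have "?Q\<^sup>\<dagger> = C\<^sup>\<dagger> * (pm N p)\<^sup>\<dagger> * C"
        using CU by (simp add: adj_mult[of _ "2 ^ N" "2 ^ N" _ "2 ^ N"] sq_assoc[of _ "2 ^ N"] sq_closed del: assoc_mult_mat)
      then show ?thesis
        using CU \<rho> by (simp add: sq_assoc[of _ "2 ^ N"] sq_closed del: assoc_mult_mat)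
    qed
    also have "\<dots> = pm N (g p) * \<rho> * (pm N (g p))\<^sup>\<dagger>"
      unfolding \<omega>(2) by (rule smult_conj[OF \<omega>(1) pm_carrier \<rho>])
    finally show "C\<^sup>\<dagger> * (\<alpha> p \<cdot>\<^sub>m ?M) * C = \<alpha> p \<cdot>\<^sub>m (pm N (g p) * \<rho> * (pm N (g p))\<^sup>\<dagger>)" .
  qed
  finally show ?thesis .
qed

text \<open>The Markov kernel of a uniformly chosen map \<open>g i\<close>.\<close>

definition avg_kernel :: "'i set \<Rightarrow> ('i \<Rightarrow> pidx \<Rightarrow> pidx) \<Rightarrow> pidx \<Rightarrow> pidx \<Rightarrow> real" where
  "avg_kernel I g p q = real (card {i\<in>I. g i p = q}) / real (card I)"

lemma pauli_mix_average:
  assumes I: "finite I" and C: "\<And>i. i \<in> I \<Longrightarrow> conj_action N (C i) (g i)" and \<rho>: "\<rho> \<in> cmat N"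
  shows "(1 / of_nat (card I)) \<cdot>\<^sub>m mat_sum (2 ^ N) (\<lambda>i. (C i)\<^sup>\<dagger> * pauli_mix N \<alpha> (C i * \<rho> * (C i)\<^sup>\<dagger>) * C i) I
     = pauli_mix N (\<lambda>q. \<Sum>p\<in>pvecs N. \<alpha> p * complex_of_real (avg_kernel I g p q)) \<rho>"
proof (rule eq_matI)
  define X where "X q = pm N q * \<rho> * (pm N q)\<^sup>\<dagger>" for q
  have X: "X q \<in> cmat N" for q unfolding X_def by (rule pm_conj_carrier[OF \<rho>])
  let ?R = "pauli_mix N (\<lambda>q. \<Sum>p\<in>pvecs N. \<alpha> p * complex_of_real (avg_kernel I g p q)) \<rho>"
  fix i j assume "i < dim_row ?R" "j < dim_col ?R"
  then have ij: "i < 2 ^ N" "j < 2 ^ N" by (auto simp: pauli_mix_def mat_sum_def)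
  have smX: "(c \<cdot>\<^sub>m X q) $$ (i, j) = c * X q $$ (i, j)" for c q using X[of q] ij by auto
  have t: "((C k)\<^sup>\<dagger> * pauli_mix N \<alpha> (C k * \<rho> * (C k)\<^sup>\<dagger>) * C k) $$ (i, j)
     = (\<Sum>p\<in>pvecs N. \<Sum>q\<in>pvecs N. if g k p = q then \<alpha> p * X q $$ (i, j) else 0)" if k: "k \<in> I" for k
  proof -
    have "((C k)\<^sup>\<dagger> * pauli_mix N \<alpha> (C k * \<rho> * (C k)\<^sup>\<dagger>) * C k) $$ (i, j) = (\<Sum>p\<in>pvecs N. \<alpha> p * X (g k p) $$ (i, j))"
      unfolding pauli_mix_conj[OF C[OF k] \<rho>] X_def[symmetric] mat_sum_index[OF ij] smX ..
    also have "\<dots> = (\<Sum>p\<in>pvecs N. \<Sum>q\<in>pvecs N. if g k p = q then \<alpha> p * X q $$ (i, j) else 0)"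
    proof (rule sum.cong)
      fix p assume "p \<in> pvecs N"
      then have "g k p \<in> pvecs N" using C[OF k] by (simp add: conj_action_def)
      then show "\<alpha> p * X (g k p) $$ (i, j) = (\<Sum>q\<in>pvecs N. if g k p = q then \<alpha> p * X q $$ (i, j) else 0)"
        by (simp add: sum.delta)
    qed simp
    finally show ?thesis .
  qed
  have "((1 / of_nat (card I)) \<cdot>\<^sub>m mat_sum (2 ^ N) (\<lambda>i. (C i)\<^sup>\<dagger> * pauli_mix N \<alpha> (C i * \<rho> * (C i)\<^sup>\<dagger>) * C i) I) $$ (i, j)
     = (1 / of_nat (card I)) * (\<Sum>k\<in>I. ((C k)\<^sup>\<dagger> * pauli_mix N \<alpha> (C k * \<rho> * (C k)\<^sup>\<dagger>) * C k) $$ (i, j))"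
    unfolding mat_sum_index[OF ij, symmetric] using ij by (intro index_smult_mat) (auto simp: mat_sum_def)
  also have "(\<Sum>k\<in>I. ((C k)\<^sup>\<dagger> * pauli_mix N \<alpha> (C k * \<rho> * (C k)\<^sup>\<dagger>) * C k) $$ (i, j))
     = (\<Sum>k\<in>I. \<Sum>p\<in>pvecs N. \<Sum>q\<in>pvecs N. if g k p = q then \<alpha> p * X q $$ (i, j) else 0)"
    by (rule sum.cong[OF refl t])
  also have "\<dots> = (\<Sum>p\<in>pvecs N. \<Sum>k\<in>I. \<Sum>q\<in>pvecs N. if g k p = q then \<alpha> p * X q $$ (i, j) else 0)" by (rule sum.swap)
  also have "\<dots> = (\<Sum>p\<in>pvecs N. \<Sum>q\<in>pvecs N. \<Sum>k\<in>I. if g k p = q then \<alpha> p * X q $$ (i, j) else 0)"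
    by (rule sum.cong[OF refl], rule sum.swap)
  also have "\<dots> = (\<Sum>q\<in>pvecs N. \<Sum>p\<in>pvecs N. \<Sum>k\<in>I. if g k p = q then \<alpha> p * X q $$ (i, j) else 0)" by (rule sum.swap)
  also have "\<dots> = (\<Sum>q\<in>pvecs N. \<Sum>p\<in>pvecs N. of_nat (card {k\<in>I. g k p = q}) * (\<alpha> p * X q $$ (i, j)))"
    using I by (intro sum.cong refl) (simp add: sum.If_cases Int_def)
  also have "1 / of_nat (card I) * \<dots> = (\<Sum>q\<in>pvecs N. (\<Sum>p\<in>pvecs N. \<alpha> p * complex_of_real (avg_kernel I g p q)) * X q $$ (i, j))"
    unfolding sum_distrib_left sum_distrib_right avg_kernel_def by (intro sum.cong refl) simp
  also have "\<dots> = ?R $$ (i, j)"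
    unfolding pauli_mix_def X_def[symmetric] mat_sum_index[OF ij] smX ..
  finally show "((1 / of_nat (card I)) \<cdot>\<^sub>m mat_sum (2 ^ N) (\<lambda>i. (C i)\<^sup>\<dagger> * pauli_mix N \<alpha> (C i * \<rho> * (C i)\<^sup>\<dagger>) * C i) I) $$ (i, j) = ?R $$ (i, j)" .
qed (simp_all add: pauli_mix_def mat_sum_def)

section \<open>The diamond norm of Pauli superoperators\<close>
lemma kron_one_carrier: "U \<in> carrier_mat d d \<Longrightarrow> U \<otimes>\<^sub>m 1\<^sub>m n \<in> carrier_mat (d * n) (d * n)"
  by (auto simp: kron_def)

lemma kron_one_index:
  "U \<in> carrier_mat d d \<Longrightarrow> i < d * n \<Longrightarrow> j < d * n \<Longrightarrow>
   (U \<otimes>\<^sub>m 1\<^sub>m n) $$ (i, j) = (if i mod n = j mod n then U $$ (i div n, j div n) else (0 :: complex))"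
  by (cases "n = 0") (auto simp: kron_def)

lemma add_mult_less: "a < d \<Longrightarrow> r < n \<Longrightarrow> a * n + r < d * (n::nat)"
proof -
  assume "a < d" "r < n"
  then have "a * n + r < Suc a * n" by simp
  also have "\<dots> \<le> d * n" using \<open>a < d\<close> by (intro mult_le_mono1) simp
  finally show ?thesis .
qed

lemma kron_one_mult_index:
  assumes U: "U \<in> carrier_mat d d" and M: "M \<in> carrier_mat (d * n) m" and i: "i < d * n" and j: "j < m"
  shows "((U \<otimes>\<^sub>m 1\<^sub>m n) * M) $$ (i, j) = (\<Sum>a<d. U $$ (i div n, a) * M $$ (a * n + i mod n, j))"
proof -
  have n: "0 < n" using i by (cases n) auto
  have "((U \<otimes>\<^sub>m 1\<^sub>m n) * M) $$ (i, j) = (\<Sum>k<d * n. (\<lambda>a r. if i mod n = r then U $$ (i div n, a) * M $$ (a * n + r, j) else 0) (k div n) (k mod n))"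
    unfolding mult_index[OF kron_one_carrier[OF U] M i j]
    by (intro sum.cong refl) (simp add: kron_one_index[OF U i])
  also have "\<dots> = (\<Sum>a<d. \<Sum>r<n. if i mod n = r then U $$ (i div n, a) * M $$ (a * n + r, j) else 0)"
    by (rule sum_divmod[OF n])
  finally show ?thesis using n by simp
qed

lemma kron_one_adj:
  assumes U: "U \<in> carrier_mat d d"
  shows "(U \<otimes>\<^sub>m 1\<^sub>m n)\<^sup>\<dagger> = U\<^sup>\<dagger> \<otimes>\<^sub>m 1\<^sub>m n"
proof (rule eq_matI)
  fix i j assume "i < dim_row (U\<^sup>\<dagger> \<otimes>\<^sub>m 1\<^sub>m n)" "j < dim_col (U\<^sup>\<dagger> \<otimes>\<^sub>m 1\<^sub>m n)"
  then have ij: "i < d * n" "j < d * n" using U by (auto simp: kron_def)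
  have dv: "i div n < d" "j div n < d" using ij by (auto simp: less_mult_imp_div_less)
  have "(U \<otimes>\<^sub>m 1\<^sub>m n)\<^sup>\<dagger> $$ (i, j) = cnj ((U \<otimes>\<^sub>m 1\<^sub>m n) $$ (j, i))"
    using kron_one_carrier[OF U, of n] ij by (intro adj_index) auto
  also have "\<dots> = (U\<^sup>\<dagger> \<otimes>\<^sub>m 1\<^sub>m n) $$ (i, j)"
    unfolding kron_one_index[OF U ij(2,1)] kron_one_index[OF adj_carrier[OF U] ij] using U dv by simp
  finally show "(U \<otimes>\<^sub>m 1\<^sub>m n)\<^sup>\<dagger> $$ (i, j) = (U\<^sup>\<dagger> \<otimes>\<^sub>m 1\<^sub>m n) $$ (i, j)" .
qed (use U in \<open>auto simp: kron_def\<close>)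

lemma kron_one_mult:
  assumes U: "U \<in> carrier_mat d d" and V: "V \<in> carrier_mat d d"
  shows "(U \<otimes>\<^sub>m 1\<^sub>m n) * (V \<otimes>\<^sub>m 1\<^sub>m n) = (U * V) \<otimes>\<^sub>m 1\<^sub>m n"
proof (rule eq_matI)
  have UV: "U * V \<in> carrier_mat d d" by (rule sq_closed[OF U V])
  fix i j assume "i < dim_row ((U * V) \<otimes>\<^sub>m 1\<^sub>m n)" "j < dim_col ((U * V) \<otimes>\<^sub>m 1\<^sub>m n)"
  then have ij: "i < d * n" "j < d * n" using U V by (auto simp: kron_def)
  then have n: "0 < n" by (cases n) auto
  have dv: "i div n < d" "j div n < d" using ij by (auto simp: less_mult_imp_div_less)
  have "((U \<otimes>\<^sub>m 1\<^sub>m n) * (V \<otimes>\<^sub>m 1\<^sub>m n)) $$ (i, j) = (\<Sum>a<d. U $$ (i div n, a) * (if i mod n = j mod n then V $$ (a, j div n) else 0))"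
    unfolding kron_one_mult_index[OF U kron_one_carrier[OF V] ij]
    using n by (intro sum.cong refl) (simp add: kron_one_index[OF V _ ij(2)] add_mult_less)
  also have "\<dots> = ((U * V) \<otimes>\<^sub>m 1\<^sub>m n) $$ (i, j)"
    unfolding kron_one_index[OF UV ij] mult_index[OF U V dv] by simp
  finally show "((U \<otimes>\<^sub>m 1\<^sub>m n) * (V \<otimes>\<^sub>m 1\<^sub>m n)) $$ (i, j) = ((U * V) \<otimes>\<^sub>m 1\<^sub>m n) $$ (i, j)" .
qed (use U V in \<open>auto simp: kron_def\<close>)

lemma kron_one_one: "1\<^sub>m d \<otimes>\<^sub>m 1\<^sub>m n = (1\<^sub>m (d * n) :: complex mat)"
proof (rule eq_matI)
  fix i j assume "i < dim_row (1\<^sub>m (d * n) :: complex mat)" "j < dim_col (1\<^sub>m (d * n) :: complex mat)"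
  then have ij: "i < d * n" "j < d * n" by auto
  then have dv: "i div n < d" "j div n < d" by (auto simp: less_mult_imp_div_less)
  have "i mod n = j mod n \<Longrightarrow> i div n = j div n \<Longrightarrow> i = j" by (metis div_mult_mod_eq)
  then show "(1\<^sub>m d \<otimes>\<^sub>m 1\<^sub>m n) $$ (i, j) = (1\<^sub>m (d * n) :: complex mat) $$ (i, j)"
    unfolding kron_one_index[OF one_carrier_mat ij] using ij dv by auto
qed (auto simp: kron_def)

lemma kron_one_unitary:
  assumes U: "U \<in> unitary d"
  shows "U \<otimes>\<^sub>m 1\<^sub>m n \<in> unitary (d * n)"
proof -
  note U' = unitaryD[OF U]
  have Ua: "U\<^sup>\<dagger> \<in> carrier_mat d d" using U'(1) by simp
  show ?thesis
    unfolding unitary_def mem_Collect_eq kron_one_adj[OF U'(1)] kron_one_mult[OF U'(1) Ua] kron_one_mult[OF Ua U'(1)] U'(2,3) kron_one_one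
    using kron_one_carrier[OF U'(1)] by simp
qed

lemma kron_one_conj_index:
  assumes U: "U \<in> carrier_mat d d" and \<rho>: "\<rho> \<in> carrier_mat (d * n) (d * n)" and ij: "i < d * n" "j < d * n"
  shows "((U \<otimes>\<^sub>m 1\<^sub>m n) * \<rho> * (U \<otimes>\<^sub>m 1\<^sub>m n)\<^sup>\<dagger>) $$ (i, j)
     = (U * mat d d (\<lambda>(a, b). \<rho> $$ (a * n + i mod n, b * n + j mod n)) * U\<^sup>\<dagger>) $$ (i div n, j div n)"
proof -
  let ?K = "U \<otimes>\<^sub>m 1\<^sub>m n" and ?B = "mat d d (\<lambda>(a, b). \<rho> $$ (a * n + i mod n, b * n + j mod n))"
  have n: "0 < n" using ij by (cases n) auto
  have dv: "i div n < d" "j div n < d" using ij by (auto simp: less_mult_imp_div_less)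
  have K: "?K \<in> carrier_mat (d * n) (d * n)" by (rule kron_one_carrier[OF U])
  have \<rho>a: "\<rho>\<^sup>\<dagger> \<in> carrier_mat (d * n) (d * n)" using \<rho> by simp
  have K\<rho>: "?K * \<rho>\<^sup>\<dagger> \<in> carrier_mat (d * n) (d * n)" by (rule sq_closed[OF K \<rho>a])
  have "?K * \<rho> * ?K\<^sup>\<dagger> = ?K * (?K * \<rho>\<^sup>\<dagger>)\<^sup>\<dagger>"
    unfolding adj_mult[OF K \<rho>a] adj_adj by (rule sq_assoc[OF K \<rho> adj_carrier[OF K]])
  then have "(?K * \<rho> * ?K\<^sup>\<dagger>) $$ (i, j) = (\<Sum>a<d. U $$ (i div n, a) * (?K * \<rho>\<^sup>\<dagger>)\<^sup>\<dagger> $$ (a * n + i mod n, j))"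
    by (simp only: kron_one_mult_index[OF U adj_carrier[OF K\<rho>] ij])
  also have "\<dots> = (\<Sum>a<d. \<Sum>b<d. U $$ (i div n, a) * ?B $$ (a, b) * U\<^sup>\<dagger> $$ (b, j div n))"
  proof (rule sum.cong)
    fix a assume "a \<in> {..<d}"
    then have a: "a < d" by simp
    then have an: "a * n + i mod n < d * n" using n by (simp add: add_mult_less)
    have "(?K * \<rho>\<^sup>\<dagger>)\<^sup>\<dagger> $$ (a * n + i mod n, j) = cnj ((?K * \<rho>\<^sup>\<dagger>) $$ (j, a * n + i mod n))"
      using K\<rho> an ij by (intro adj_index) auto
    also have "\<dots> = (\<Sum>b<d. cnj (U $$ (j div n, b)) * \<rho> $$ (a * n + i mod n, b * n + j mod n))"
      unfolding kron_one_mult_index[OF U \<rho>a ij(2) an]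
      using \<rho> an n by (simp add: add_mult_less)
    finally show "U $$ (i div n, a) * (?K * \<rho>\<^sup>\<dagger>)\<^sup>\<dagger> $$ (a * n + i mod n, j) = (\<Sum>b<d. U $$ (i div n, a) * ?B $$ (a, b) * U\<^sup>\<dagger> $$ (b, j div n))"
      using U a dv by (simp add: sum_distrib_left mult_ac)
  qed simp
  also have "\<dots> = (\<Sum>b<d. \<Sum>a<d. U $$ (i div n, a) * ?B $$ (a, b) * U\<^sup>\<dagger> $$ (b, j div n))" by (rule sum.swap)
  also have "\<dots> = (U * ?B * U\<^sup>\<dagger>) $$ (i div n, j div n)"
    by (rule mult3_index[OF U _ adj_carrier[OF U] dv, symmetric]) simp
  finally show ?thesis .
qed

lemma smult_index: "M \<in> carrier_mat n n \<Longrightarrow> i < n \<Longrightarrow> j < n \<Longrightarrow> (c \<cdot>\<^sub>m M) $$ (i, j) = c * M $$ (i, j)"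
  by simp

theorem diamond_norm_pauli_mix_le:
  assumes \<Lambda>: "\<And>\<rho>. \<rho> \<in> cmat N \<Longrightarrow> \<Lambda> \<rho> = pauli_mix N \<beta> \<rho>"
  shows "diamond_norm (2 ^ N) \<Lambda> \<le> ereal (\<Sum>p\<in>pvecs N. cmod (\<beta> p))"
  unfolding diamond_norm_def
proof (rule Sup_least)
  let ?D = "2 ^ N :: nat"
  fix e assume "e \<in> {ereal (trace_norm (extend_superop ?D n \<Lambda> \<rho>)) | n \<rho>.
     0 < n \<and> \<rho> \<in> carrier_mat (?D * n) (?D * n) \<and> trace_norm \<rho> = 1}"
  then obtain n \<rho> where e: "e = ereal (trace_norm (extend_superop ?D n \<Lambda> \<rho>))" and n: "0 < n"
    and \<rho>: "\<rho> \<in> carrier_mat (?D * n) (?D * n)" and tn: "trace_norm \<rho> = 1" by blast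
  have "extend_superop ?D n \<Lambda> \<rho>
     = mat_sum (?D * n) (\<lambda>p. \<beta> p \<cdot>\<^sub>m ((pm N p \<otimes>\<^sub>m 1\<^sub>m n) * \<rho> * (pm N p \<otimes>\<^sub>m 1\<^sub>m n)\<^sup>\<dagger>)) (pvecs N)"
  proof (rule eq_matI)
    fix i j assume "i < dim_row (mat_sum (?D * n) (\<lambda>p. \<beta> p \<cdot>\<^sub>m ((pm N p \<otimes>\<^sub>m 1\<^sub>m n) * \<rho> * (pm N p \<otimes>\<^sub>m 1\<^sub>m n)\<^sup>\<dagger>)) (pvecs N))"
      "j < dim_col (mat_sum (?D * n) (\<lambda>p. \<beta> p \<cdot>\<^sub>m ((pm N p \<otimes>\<^sub>m 1\<^sub>m n) * \<rho> * (pm N p \<otimes>\<^sub>m 1\<^sub>m n)\<^sup>\<dagger>)) (pvecs N))"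
    then have ij: "i < ?D * n" "j < ?D * n" by (auto simp: mat_sum_def)
    then have dv: "i div n < ?D" "j div n < ?D" by (auto simp: less_mult_imp_div_less)
    define B where "B = mat ?D ?D (\<lambda>(a, b). \<rho> $$ (a * n + i mod n, b * n + j mod n))"
    have B: "B \<in> cmat N" by (simp add: B_def)
    have K: "pm N p \<otimes>\<^sub>m 1\<^sub>m n \<in> carrier_mat (?D * n) (?D * n)" for p by (rule kron_one_carrier[OF pm_carrier])
    have "extend_superop ?D n \<Lambda> \<rho> $$ (i, j) = pauli_mix N \<beta> B $$ (i div n, j div n)"
      using ij by (simp add: extend_superop_def B_def[symmetric] \<Lambda>[OF B])
    also have "\<dots> = (\<Sum>p\<in>pvecs N. \<beta> p * (pm N p * B * (pm N p)\<^sup>\<dagger>) $$ (i div n, j div n))"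
      unfolding pauli_mix_def mat_sum_index[OF dv] smult_index[OF pm_conj_carrier[OF B] dv] ..
    also have "\<dots> = (\<Sum>p\<in>pvecs N. \<beta> p * ((pm N p \<otimes>\<^sub>m 1\<^sub>m n) * \<rho> * (pm N p \<otimes>\<^sub>m 1\<^sub>m n)\<^sup>\<dagger>) $$ (i, j))"
      unfolding B_def by (intro sum.cong refl) (simp only: kron_one_conj_index[OF pm_carrier \<rho> ij])
    also have "\<dots> = mat_sum (?D * n) (\<lambda>p. \<beta> p \<cdot>\<^sub>m ((pm N p \<otimes>\<^sub>m 1\<^sub>m n) * \<rho> * (pm N p \<otimes>\<^sub>m 1\<^sub>m n)\<^sup>\<dagger>)) (pvecs N) $$ (i, j)"
      unfolding mat_sum_index[OF ij] smult_index[OF sq_closed[OF sq_closed[OF K \<rho>] adj_carrier[OF K]] ij] ..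
    finally show "extend_superop ?D n \<Lambda> \<rho> $$ (i, j)
      = mat_sum (?D * n) (\<lambda>p. \<beta> p \<cdot>\<^sub>m ((pm N p \<otimes>\<^sub>m 1\<^sub>m n) * \<rho> * (pm N p \<otimes>\<^sub>m 1\<^sub>m n)\<^sup>\<dagger>)) (pvecs N) $$ (i, j)" .
  qed (simp_all add: extend_superop_def mat_sum_def)
  then have "trace_norm (extend_superop ?D n \<Lambda> \<rho>) \<le> (\<Sum>p\<in>pvecs N. cmod (\<beta> p)) * trace_norm \<rho>"
    using trace_norm_unitary_mixture[OF \<rho>, of "pvecs N" "\<lambda>p. pm N p \<otimes>\<^sub>m 1\<^sub>m n" \<beta>]
    by (simp add: kron_one_unitary pm_unitary)
  then show "e \<le> ereal (\<Sum>p\<in>pvecs N. cmod (\<beta> p))" by (simp add: e tn)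
qed

section \<open>Conjugation of Pauli operators by Clifford unitaries\<close>
lemma conj_smult:
  fixes A M B :: "complex mat"
  assumes "A \<in> carrier_mat n n" "M \<in> carrier_mat n n" "B \<in> carrier_mat n n"
  shows "A * (c \<cdot>\<^sub>m M) * B = c \<cdot>\<^sub>m (A * M * B)"
  unfolding mult_smult_distrib[OF assms(1,2)] by (rule mult_smult_assoc_mat[OF sq_closed[OF assms(1,2)] assms(3)])

lemma cmod_one_cnj: "cmod \<omega> = 1 \<Longrightarrow> cnj \<omega> * \<omega> = 1"
  using complex_norm_square[of \<omega>] by (simp add: mult.commute)

lemma pm_inj:
  assumes eq: "c \<cdot>\<^sub>m pm N p = c' \<cdot>\<^sub>m pm N p'" and p: "p \<in> pvecs N" "p' \<in> pvecs N" and c: "c \<noteq> 0" "c' \<noteq> 0"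
  shows "p = p'"
proof -
  have v: "fst p \<in> vecs N" "fst p' \<in> vecs N" "snd p \<in> vecs N" "snd p' \<in> vecs N" using p by (auto simp: pvecs_def)
  have e: "c * (if x = y + fst p then sg (dot N (snd p) y) else 0) = c' * (if x = y + fst p' then sg (dot N (snd p') y) else 0)"
    if "x \<in> vecs N" "y \<in> vecs N" for x y
    using arg_cong[OF eq, of "\<lambda>M. ent N M x y"] that by (simp add: ent_smult ent_pm)
  have f: "fst p = fst p'"
    using e[OF v(1) zero_in_vecs] c by (auto split: if_splits)
  have "c = c'" using e[OF v(1) zero_in_vecs] f by simp
  have "sg (dot N y (snd p + snd p')) = (1 :: complex)" if y: "y \<in> vecs N" for y
  proof -
    have "c * sg (dot N (snd p) y) = c * sg (dot N (snd p') y)"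
      using e[OF add_in_vecs[OF y v(1)] y] f \<open>c = c'\<close> by simp
    then have "sg (dot N (snd p) y) = (sg (dot N (snd p') y) :: complex)" using c by simp
    then show ?thesis by (simp add: dot_commute[of N y] dot_add_left sg_add)
  qed
  then have "(\<Sum>y\<in>vecs N. sg (dot N y (snd p + snd p'))) = (2 ^ N :: complex)" by (simp add: card_vecs)
  then have "snd p + snd p' = 0"
    unfolding sum_sg_dot[OF add_in_vecs[OF v(3,4)]] by (auto split: if_splits)
  then have "snd p = snd p'" by (simp only: bvec_add_eq_zero)
  then show ?thesis using f by (simp add: prod_eq_iff)
qed

lemma conj_actionD:
  assumes "conj_action N C g"
  shows "C \<in> unitary (2 ^ N)" "C \<in> cmat N" "p \<in> pvecs N \<Longrightarrow> g p \<in> pvecs N"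
    "p \<in> pvecs N \<Longrightarrow> \<exists>\<omega>. cmod \<omega> = 1 \<and> C\<^sup>\<dagger> * pm N p * C = \<omega> \<cdot>\<^sub>m pm N (g p)"
  using assms unitaryD(1) by (simp_all add: conj_action_def)

lemma conj_action_inverse:
  assumes C: "conj_action N C g" and p: "p \<in> pvecs N"
  shows "\<exists>\<omega>. cmod \<omega> = 1 \<and> C * pm N (g p) * C\<^sup>\<dagger> = \<omega> \<cdot>\<^sub>m pm N p"
proof -
  note C' = conj_actionD[OF C]
  obtain \<omega> where \<omega>: "cmod \<omega> = 1" "C\<^sup>\<dagger> * pm N p * C = \<omega> \<cdot>\<^sub>m pm N (g p)" using C'(4)[OF p] by (elim exE conjE)
  have "pm N p = C * (\<omega> \<cdot>\<^sub>m pm N (g p)) * C\<^sup>\<dagger>"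
    unfolding \<omega>(2)[symmetric] by (rule unitary_conj_cancel(1)[OF C'(1) pm_carrier, symmetric])
  also have "\<dots> = \<omega> \<cdot>\<^sub>m (C * pm N (g p) * C\<^sup>\<dagger>)"
    by (rule conj_smult[OF C'(2) pm_carrier adj_carrier[OF C'(2)]])
  finally have "cnj \<omega> \<cdot>\<^sub>m pm N p = (cnj \<omega> * \<omega>) \<cdot>\<^sub>m (C * pm N (g p) * C\<^sup>\<dagger>)"
    by (simp only: smult_smult_mat)
  then have "C * pm N (g p) * C\<^sup>\<dagger> = cnj \<omega> \<cdot>\<^sub>m pm N p" unfolding cmod_one_cnj[OF \<omega>(1)] by simp
  then show ?thesis using \<omega>(1) by (intro exI[of _ "cnj \<omega>"]) simp
qed

lemma conj_action_bij:
  assumes C: "conj_action N C g"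
  shows "bij_betw g (pvecs N) (pvecs N)"
proof -
  have inj: "inj_on g (pvecs N)"
  proof (rule inj_onI)
    fix p p' assume p: "p \<in> pvecs N" "p' \<in> pvecs N" and eq: "g p = g p'"
    obtain \<omega> where \<omega>: "cmod \<omega> = 1" "C * pm N (g p) * C\<^sup>\<dagger> = \<omega> \<cdot>\<^sub>m pm N p"
      using conj_action_inverse[OF C p(1)] by (elim exE conjE)
    obtain \<omega>' where \<omega>': "cmod \<omega>' = 1" "C * pm N (g p') * C\<^sup>\<dagger> = \<omega>' \<cdot>\<^sub>m pm N p'"
      using conj_action_inverse[OF C p(2)] by (elim exE conjE)
    have "\<omega> \<cdot>\<^sub>m pm N p = \<omega>' \<cdot>\<^sub>m pm N p'" using \<omega>(2) \<omega>'(2) eq by simp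
    then show "p = p'" using p \<omega>(1) \<omega>'(1) by (intro pm_inj[of \<omega> N p \<omega>' p']) auto
  qed
  have "g ` pvecs N \<subseteq> pvecs N" using conj_actionD(3)[OF C] by auto
  then have "g ` pvecs N = pvecs N" using inj by (intro endo_inj_surj) auto
  then show ?thesis using inj by (simp add: bij_betw_def)
qed

lemma conj_action_clifford:
  assumes C: "conj_action N C g"
  shows "C \<in> carrier (clifford_group N)"
proof -
  note C' = conj_actionD[OF C]
  have "C * M * C\<^sup>\<dagger> \<in> pauli_group N" if M: "M \<in> pauli_group N" for M
  proof -
    obtain \<omega> q where \<omega>: "M = \<omega> \<cdot>\<^sub>m pm N q" "cmod \<omega> = 1" and q: "q \<in> pvecs N"
      using M unfolding pauli_group_eq mem_Collect_eq by (elim exE conjE)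
    have "q \<in> g ` pvecs N" using q bij_betw_imp_surj_on[OF conj_action_bij[OF C]] by (simp only:)
    then obtain p where p: "q = g p" "p \<in> pvecs N" by (rule imageE)
    obtain \<omega>' where \<omega>': "cmod \<omega>' = 1" "C * pm N (g p) * C\<^sup>\<dagger> = \<omega>' \<cdot>\<^sub>m pm N p"
      using conj_action_inverse[OF C p(2)] by (elim exE conjE)
    have "C * M * C\<^sup>\<dagger> = (\<omega> * \<omega>') \<cdot>\<^sub>m pm N p"
      unfolding \<omega>(1) p(1) conj_smult[OF C'(2) pm_carrier adj_carrier[OF C'(2)]] \<omega>'(2) smult_smult_mat ..
    then show ?thesis
      unfolding pauli_group_eq mem_Collect_eq using \<omega>(2) \<omega>'(1) p(2)
      by (intro exI[of _ "\<omega> * \<omega>'"] exI[of _ p] conjI) (simp_all add: norm_mult)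
  qed
  then show ?thesis using C'(1) by (auto simp: clifford_group_def)
qed

lemma conj_action_one: "conj_action N (1\<^sub>m (2 ^ N)) id"
proof -
  have "1\<^sub>m (2 ^ N) \<in> unitary (2 ^ N)" by (simp add: unitary_def)
  moreover have "(1\<^sub>m (2 ^ N))\<^sup>\<dagger> * pm N p * 1\<^sub>m (2 ^ N) = 1 \<cdot>\<^sub>m pm N (id p)" for p
    by (simp add: left_mult_one_mat[OF pm_carrier] right_mult_one_mat[OF pm_carrier])
  ultimately show ?thesis unfolding conj_action_def by (auto intro!: exI[of _ 1])
qed

lemma conj_action_mult:
  assumes G: "conj_action N G g" and V: "conj_action N V h"
  shows "conj_action N (G * V) (h \<circ> g)"
  unfolding conj_action_def
proof (intro conjI ballI)
  note G' = conj_actionD[OF G] and V' = conj_actionD[OF V]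
  show "G * V \<in> unitary (2 ^ N)" by (rule unitary_mult[OF G'(1) V'(1)])
  fix p assume p: "p \<in> pvecs N"
  show "(h \<circ> g) p \<in> pvecs N" using G'(3)[OF p] V'(3) by simp
  obtain \<omega> where \<omega>: "cmod \<omega> = 1" "G\<^sup>\<dagger> * pm N p * G = \<omega> \<cdot>\<^sub>m pm N (g p)" using G'(4)[OF p] by (elim exE conjE)
  obtain \<omega>' where \<omega>': "cmod \<omega>' = 1" "V\<^sup>\<dagger> * pm N (g p) * V = \<omega>' \<cdot>\<^sub>m pm N (h (g p))"
    using V'(4)[OF G'(3)[OF p]] by (elim exE conjE)
  have "(G * V)\<^sup>\<dagger> * pm N p * (G * V) = V\<^sup>\<dagger> * (G\<^sup>\<dagger> * pm N p * G) * V"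
    using G'(2) V'(2) by (simp add: adj_mult[of _ "2 ^ N" "2 ^ N" _ "2 ^ N"] sq_assoc[of _ "2 ^ N"] sq_closed del: assoc_mult_mat)
  also have "\<dots> = (\<omega> * \<omega>') \<cdot>\<^sub>m pm N ((h \<circ> g) p)"
    unfolding \<omega>(2) conj_smult[OF adj_carrier[OF V'(2)] pm_carrier V'(2)] \<omega>'(2) smult_smult_mat by simp
  finally show "\<exists>\<omega>. cmod \<omega> = 1 \<and> (G * V)\<^sup>\<dagger> * pm N p * (G * V) = \<omega> \<cdot>\<^sub>m pm N ((h \<circ> g) p)"
    using \<omega>(1) \<omega>'(1) by (intro exI[of _ "\<omega> * \<omega>'"] conjI) (simp_all add: norm_mult)
qed

lemma conj_actionI:
  assumes C: "C \<in> unitary (2 ^ N)" and g: "\<And>p. p \<in> pvecs N \<Longrightarrow> g p \<in> pvecs N"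
    and \<omega>: "\<And>p. p \<in> pvecs N \<Longrightarrow> cmod (\<omega> p) = 1"
    and eq: "\<And>p x y. p \<in> pvecs N \<Longrightarrow> x \<in> vecs N \<Longrightarrow> y \<in> vecs N \<Longrightarrow>
      sg (dot N (snd p) (x + fst p)) * ent N C (x + fst p) y = \<omega> p * (ent N C x (y + fst (g p)) * sg (dot N (snd (g p)) y))"
  shows "conj_action N C g"
  unfolding conj_action_def
proof (intro conjI ballI C g)
  note C' = unitaryD[OF C]
  fix p assume p: "p \<in> pvecs N"
  have "pm N p * C = \<omega> p \<cdot>\<^sub>m (C * pm N (g p))"
  proof (rule ent_eqI[of _ N])
    fix x y assume xy: "x \<in> vecs N" "y \<in> vecs N"
    show "ent N (pm N p * C) x y = ent N (\<omega> p \<cdot>\<^sub>m (C * pm N (g p))) x y"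
      unfolding ent_smult[OF sq_closed[OF C'(1) pm_carrier] xy] ent_pm_mult[OF p C'(1) xy] ent_mult_pm[OF g[OF p] C'(1) xy]
      by (rule eq[OF p xy])
  qed (auto intro!: sq_closed smult_carrier_mat C'(1))
  then have "C\<^sup>\<dagger> * (pm N p * C) = \<omega> p \<cdot>\<^sub>m (C\<^sup>\<dagger> * (C * pm N (g p)))"
    using mult_smult_distrib[OF adj_carrier[OF C'(1)] sq_closed[OF C'(1) pm_carrier]] by simp
  also have "C\<^sup>\<dagger> * (C * pm N (g p)) = (C\<^sup>\<dagger> * C) * pm N (g p)"
    by (rule sq_assoc[OF adj_carrier[OF C'(1)] C'(1) pm_carrier, symmetric])
  also have "\<dots> = pm N (g p)" unfolding C'(3) by (rule left_mult_one_mat[OF pm_carrier])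
  also have "C\<^sup>\<dagger> * (pm N p * C) = C\<^sup>\<dagger> * pm N p * C"
    by (rule sq_assoc[OF adj_carrier[OF C'(1)] pm_carrier C'(1), symmetric])
  finally show "\<exists>\<omega>. cmod \<omega> = 1 \<and> C\<^sup>\<dagger> * pm N p * C = \<omega> \<cdot>\<^sub>m pm N (g p)"
    using \<omega>[OF p] by (intro exI[of _ "\<omega> p"] conjI)
qed

section \<open>Matrices of the gates\<close>

text \<open>The entries of the matrix of a symbolic gate, at rows and columns given by bit vectors.\<close>
fun sgate_entry :: "sgate \<Rightarrow> bvec \<Rightarrow> bvec \<Rightarrow> complex" where
  "sgate_entry (HG q) x y = (if \<forall>r. r \<noteq> q \<longrightarrow> x r = y r then complex_of_real (1 / sqrt 2) * sg (x q * y q) else 0)"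
| "sgate_entry (PG g) x y = (if x = y then
     if fst g = snd g then if x (fst g) = 0 then 1 else \<i> else sg (x (fst g) * x (snd g)) else 0)"
| "sgate_entry (CXG g) x y = (if x = cx g y then 1 else 0)"

declare sgate_entry.simps [simp del]

definition sgate_mat :: "nat \<Rightarrow> sgate \<Rightarrow> complex mat" where
  "sgate_mat N g = mat (2 ^ N) (2 ^ N) (\<lambda>(i, j). sgate_entry g (bits N i) (bits N j))"

lemma sgate_mat_carrier [simp]: "sgate_mat N g \<in> cmat N"
  by (simp add: sgate_mat_def)

lemma ent_sgate_mat: "x \<in> vecs N \<Longrightarrow> y \<in> vecs N \<Longrightarrow> ent N (sgate_mat N g) x y = sgate_entry g x y"
  by (simp add: ent_def sgate_mat_def)

lemma cx_add: "cx g (x + y) = cx g x + cx g y"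
  by (auto simp: cx_def fun_eq_iff bit_ac)

lemma cx_in_vecs: "snd g < N \<Longrightarrow> x \<in> vecs N \<Longrightarrow> cx g x \<in> vecs N"
  by (auto simp: cx_def vecs_def supported_def)

lemma sgate_act_pvecs:
  assumes "set (sgate_wires g) \<subseteq> {..<N}" "p \<in> pvecs N"
  shows "sgate_act g p \<in> pvecs N"
  using sgate_act_supported[OF assms(1), of p] assms(2) by (simp add: pvecs_def vecs_def mem_Times_iff)

lemma unitaryI_ent:
  assumes C: "C \<in> cmat N"
    and r: "\<And>x y. x \<in> vecs N \<Longrightarrow> y \<in> vecs N \<Longrightarrow> (\<Sum>z\<in>vecs N. ent N C x z * cnj (ent N C y z)) = (if x = y then 1 else 0)"
    and c: "\<And>x y. x \<in> vecs N \<Longrightarrow> y \<in> vecs N \<Longrightarrow> (\<Sum>z\<in>vecs N. cnj (ent N C z x) * ent N C z y) = (if x = y then 1 else 0)"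
  shows "C \<in> unitary (2 ^ N)"
proof -
  have Ca: "C\<^sup>\<dagger> \<in> cmat N" using C by simp
  have "C * C\<^sup>\<dagger> = 1\<^sub>m (2 ^ N)"
    by (rule ent_eqI[OF sq_closed[OF C Ca] one_carrier_mat])
      (simp add: ent_mult[OF C Ca] ent_adj[OF C] r ent_one)
  moreover have "C\<^sup>\<dagger> * C = 1\<^sub>m (2 ^ N)"
    by (rule ent_eqI[OF sq_closed[OF Ca C] one_carrier_mat])
      (simp add: ent_mult[OF Ca C] ent_adj[OF C] c ent_one)
  ultimately show ?thesis using C by (simp add: unitary_def)
qed

lemma HG_sum:
  assumes q: "q < N" and x: "x \<in> vecs N" and y: "y \<in> vecs N"
  shows "(\<Sum>z\<in>vecs N. sgate_entry (HG q) x z * sgate_entry (HG q) z y) = (if x = y then 1 else 0)"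
proof -
  let ?x0 = "x(q := 0)" and ?x1 = "x(q := 1)"
  have sub: "{?x0, ?x1} \<subseteq> vecs N" using x q by (auto simp: vecs_def supported_def)
  have ne: "?x0 \<noteq> ?x1" by (metis fun_upd_same zero_neq_one)
  have "(\<Sum>z\<in>vecs N. sgate_entry (HG q) x z * sgate_entry (HG q) z y) = (\<Sum>z\<in>{?x0, ?x1}. sgate_entry (HG q) x z * sgate_entry (HG q) z y)"
  proof (rule sum.mono_neutral_right[OF finite_vecs sub], rule ballI)
    fix z assume z: "z \<in> vecs N - {?x0, ?x1}"
    have "\<not> (\<forall>r. r \<noteq> q \<longrightarrow> x r = z r)"
    proof
      assume a: "\<forall>r. r \<noteq> q \<longrightarrow> x r = z r"
      have "z = ?x0 \<or> z = ?x1" using a by (cases "z q = 0") (auto simp: fun_eq_iff bit_not_zero_eq)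
      then show False using z by auto
    qed
    then have "sgate_entry (HG q) x z = 0" by (simp only: sgate_entry.simps if_False)
    then show "sgate_entry (HG q) x z * sgate_entry (HG q) z y = 0" by (simp only: mult_zero_left)
  qed
  also have "\<dots> = sgate_entry (HG q) x ?x0 * sgate_entry (HG q) ?x0 y + sgate_entry (HG q) x ?x1 * sgate_entry (HG q) ?x1 y"
    using ne by simp
  also have "\<dots> = (if x = y then 1 else 0)"
  proof -
    obtain k where k: "k = complex_of_real (1 / sqrt 2)" by blast
    have kk: "k * k = 1 / 2" unfolding k of_real_mult[symmetric] by simp
    have e: "sgate_entry (HG q) v w = (if \<forall>r. r \<noteq> q \<longrightarrow> v r = w r then k * sg (v q * w q) else 0)" for v w
      by (simp only: k sgate_entry.simps)
    have x0: "sgate_entry (HG q) x ?x0 = k" "sgate_entry (HG q) x ?x1 = k * sg (x q)" unfolding e by simp_all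
    show ?thesis
    proof (cases "\<forall>r. r \<noteq> q \<longrightarrow> x r = y r")
      case True
      then have y0: "sgate_entry (HG q) ?x0 y = k" "sgate_entry (HG q) ?x1 y = k * sg (y q)" unfolding e by simp_all
      have "k * k + (k * sg (x q)) * (k * sg (y q)) = k * k * (1 + sg (x q) * sg (y q))" by (simp add: algebra_simps)
      also have "\<dots> = (if x q = y q then 1 else 0)"
        unfolding kk by (cases "x q"; cases "y q") auto
      also have "x q = y q \<longleftrightarrow> x = y" using True by (auto simp: fun_eq_iff)
      finally show ?thesis unfolding x0 y0 .
    next
      case False
      then have "sgate_entry (HG q) ?x0 y = 0" "sgate_entry (HG q) ?x1 y = 0" unfolding e by auto
      moreover have "x \<noteq> y" using False by auto
      ultimately show ?thesis by simp
    qed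
  qed
  finally show ?thesis .
qed

lemma HG_sym: "sgate_entry (HG q) x y = sgate_entry (HG q) y x" "cnj (sgate_entry (HG q) x y) = sgate_entry (HG q) x y"
proof -
  have "(\<forall>r. r \<noteq> q \<longrightarrow> x r = y r) \<longleftrightarrow> (\<forall>r. r \<noteq> q \<longrightarrow> y r = x r)" by (simp only: eq_commute)
  then show "sgate_entry (HG q) x y = sgate_entry (HG q) y x" by (simp only: sgate_entry.simps mult.commute)
  show "cnj (sgate_entry (HG q) x y) = sgate_entry (HG q) x y" by (simp add: sgate_entry.simps)
qed

lemma sgate_mat_unitary:
  assumes "set (sgate_wires g) \<subseteq> {..<N}" "distinct (sgate_wires g)"
  shows "sgate_mat N g \<in> unitary (2 ^ N)"
proof (rule unitaryI_ent)
  fix x y assume xy: "x \<in> vecs N" "y \<in> vecs N"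
  have "(\<Sum>z\<in>vecs N. sgate_entry g x z * cnj (sgate_entry g y z)) = (if x = y then 1 else 0) \<and>
    (\<Sum>z\<in>vecs N. cnj (sgate_entry g z x) * sgate_entry g z y) = (if x = y then 1 else 0)"
  proof (cases g)
    case (HG q)
    then have q: "q < N" using assms by simp
    show ?thesis
      unfolding HG HG_sym(2) HG_sym(1)[of q y] HG_sym(1)[of q _ x] using HG_sum[OF q xy] by (intro conjI)
  next
    case (PG h)
    let ?c = "\<lambda>x. if fst h = snd h then if x (fst h) = 0 then 1 else \<i> else sg (x (fst h) * x (snd h))"
    have c: "?c x * cnj (?c x) = 1" for x :: bvec by simp
    have s: "sgate_entry g x z = (if z = x then ?c x else 0)" for x z unfolding PG by (auto simp: sgate_entry.simps)
    have s': "sgate_entry g z x = (if z = x then ?c x else 0)" for x z unfolding PG by (auto simp: sgate_entry.simps)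
    have "(\<Sum>z\<in>vecs N. sgate_entry g x z * cnj (sgate_entry g y z)) = (\<Sum>z\<in>vecs N. if z = x then (if x = y then ?c x * cnj (?c x) else 0) else 0)"
      unfolding s by (intro sum.cong refl) auto
    moreover have "(\<Sum>z\<in>vecs N. cnj (sgate_entry g z x) * sgate_entry g z y) = (\<Sum>z\<in>vecs N. if z = x then (if x = y then ?c x * cnj (?c x) else 0) else 0)"
      unfolding s' by (intro sum.cong refl) (auto simp: mult.commute)
    ultimately show ?thesis unfolding c using xy by simp
  next
    case (CXG h)
    then have h: "fst h < N" "snd h < N" "fst h \<noteq> snd h" using assms by auto
    note inv = cx_cx[OF h(3)]
    have fl: "x = cx h z \<longleftrightarrow> z = cx h x" for x z
    proof
      assume "x = cx h z"
      then have "cx h x = cx h (cx h z)" by (rule arg_cong)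
      then show "z = cx h x" by (simp only: inv)
    next
      assume "z = cx h x"
      then have "cx h z = cx h (cx h x)" by (rule arg_cong)
      then show "x = cx h z" by (simp only: inv)
    qed
    have s: "sgate_entry g x z = (if z = cx h x then 1 else 0)" for x z unfolding CXG sgate_entry.simps fl[of x z] ..
    have s': "sgate_entry g z x = (if z = cx h x then 1 else 0)" for x z unfolding CXG sgate_entry.simps ..
    have e: "cx h x = cx h y \<longleftrightarrow> x = y" unfolding fl[of "cx h x" y] inv by (rule eq_commute)
    have "(\<Sum>z\<in>vecs N. sgate_entry g x z * cnj (sgate_entry g y z)) = (\<Sum>z\<in>vecs N. if z = cx h x then (if x = y then 1 else 0) else 0)"
      unfolding s by (intro sum.cong refl) (auto simp: e)
    moreover have "(\<Sum>z\<in>vecs N. cnj (sgate_entry g z x) * sgate_entry g z y) = (\<Sum>z\<in>vecs N. if z = cx h x then (if x = y then 1 else 0) else 0)"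
      unfolding s' by (intro sum.cong refl) (auto simp: e)
    ultimately show ?thesis using cx_in_vecs[OF h(2) xy(1)] by simp
  qed
  then show "(\<Sum>z\<in>vecs N. ent N (sgate_mat N g) x z * cnj (ent N (sgate_mat N g) y z)) = (if x = y then 1 else 0)"
    "(\<Sum>z\<in>vecs N. cnj (ent N (sgate_mat N g) z x) * ent N (sgate_mat N g) z y) = (if x = y then 1 else 0)"
    using xy by (simp_all add: ent_sgate_mat cong: sum.cong)
qed simp

text \<open>The phase that \<open>sgate_act\<close> neglects.\<close>

fun gate_phase :: "sgate \<Rightarrow> pidx \<Rightarrow> complex" where
  "gate_phase (HG q) p = sg (fst p q * snd p q)"
| "gate_phase (PG g) p = (if fst g = snd g then if fst p (fst g) = 0 then 1 else - \<i>
     else sg (fst p (fst g) * fst p (snd g)))"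
| "gate_phase (CXG g) p = 1"

lemma bvec_off_eq:
  fixes y z :: bvec
  assumes "\<forall>r. r \<noteq> q \<longrightarrow> z r = y r"
  shows "z = y(q := y q + (y q + z q))"
proof
  fix r
  show "z r = (y(q := y q + (y q + z q))) r"
  proof (cases "r = q")
    case True
    show ?thesis unfolding True fun_upd_same by (rule bit_add_self_left[symmetric])
  next
    case False
    then show ?thesis unfolding fun_upd_other[OF False] using assms by (elim allE[of _ r] mp)
  qed
qed

lemma HG_conj:
  assumes q: "q < N"
  shows "sg (dot N b (x + a)) * sgate_entry (HG q) (x + a) y
    = sg (a q * b q) * (sgate_entry (HG q) x (y + a(q := b q)) * sg (dot N (b(q := a q)) y))"
proof (cases "\<forall>r. r \<noteq> q \<longrightarrow> (x + a) r = y r")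
  case True
  have "dot N b (x + a) = dot N b (y(q := y q + (y q + (x + a) q)))" by (rule arg_cong[OF bvec_off_eq[OF True]])
  also have "\<dots> = dot N b y + b q * (y q + (x + a) q)" by (rule dot_fun_upd[OF q])
  finally have d1: "dot N b (x + a) = dot N b y + b q * (y q + (x q + a q))" by simp
  have "b(q := a q) = b(q := b q + (b q + a q))" by simp
  then have "dot N (b(q := a q)) y = dot N y (b(q := b q + (b q + a q)))" by (simp only: dot_commute)
  also have "\<dots> = dot N y b + y q * (b q + a q)" by (rule dot_fun_upd[OF q])
  finally have d2: "dot N (b(q := a q)) y = dot N b y + y q * (b q + a q)" by (simp only: dot_commute)
  have off: "\<forall>r. r \<noteq> q \<longrightarrow> x r = (y + a(q := b q)) r"
  proof (intro allI impI)
    fix r assume "r \<noteq> q"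
    then have "x r + a r = y r" using True by simp
    then have "x r = y r + a r" by (cases "x r"; cases "a r"; cases "y r") auto
    then show "x r = (y + a(q := b q)) r" using \<open>r \<noteq> q\<close> by simp
  qed
  have s: "sg (b q * (y q + (x q + a q))) * sg ((x q + a q) * y q) = (sg (a q * b q) * sg (x q * (y q + b q)) * sg (y q * (b q + a q)) :: complex)"
    by (cases "x q"; cases "a q"; cases "y q"; cases "b q") auto
  define k where "k = complex_of_real (1 / sqrt 2)"
  define D :: complex where "D = sg (dot N b y)"
  have "sg (dot N b (x + a)) * sgate_entry (HG q) (x + a) y = D * k * (sg (b q * (y q + (x q + a q))) * sg ((x q + a q) * y q))"
    using True unfolding sgate_entry.simps d1 sg_add[of "dot N b y"] D_def[symmetric] k_def[symmetric] by simp
  also have "\<dots> = sg (a q * b q) * ((k * sg (x q * (y q + b q))) * (D * sg (y q * (b q + a q))))"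
    unfolding s by (simp only: mult_ac)
  also have "\<dots> = sg (a q * b q) * (sgate_entry (HG q) x (y + a(q := b q)) * sg (dot N (b(q := a q)) y))"
    using off unfolding sgate_entry.simps d2 sg_add[of "dot N b y"] D_def[symmetric] k_def[symmetric] by simp
  finally show ?thesis .
next
  case False
  have "\<not> (\<forall>r. r \<noteq> q \<longrightarrow> x r = (y + a(q := b q)) r)"
  proof
    assume *: "\<forall>r. r \<noteq> q \<longrightarrow> x r = (y + a(q := b q)) r"
    have "\<forall>r. r \<noteq> q \<longrightarrow> (x + a) r = y r"
    proof (intro allI impI)
      fix r assume r: "r \<noteq> q"
      then have "x r = y r + a r" using * by simp
      then show "(x + a) r = y r" by (simp add: add.assoc)
    qed
    then show False using False by blast
  qed
  then show ?thesis using False by (simp only: sgate_entry.simps if_False mult_zero_left mult_zero_right)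
qed

lemma PG_conj:
  assumes g: "fst g < N" "snd g < N"
  shows "sg (dot N b (x + a)) * sgate_entry (PG g) (x + a) y
    = gate_phase (PG g) (a, b) * (sgate_entry (PG g) x (y + a) * sg (dot N (b + pair_shift g a) y))"
proof (cases "x + a = y")
  case True
  have x: "x = y + a" by (rule iffD1[OF bvec_eq_add_iff True[symmetric]])
  have d: "dot N (b + pair_shift g a) y = dot N b y + pair_form g a y"
    unfolding dot_add_left dot_commute[of N "pair_shift g a"] dot_pair_shift[OF g] ..
  define D :: complex where "D = sg (dot N b y)"
  define c :: "bvec \<Rightarrow> complex" where
    "c x = (if fst g = snd g then if x (fst g) = 0 then 1 else \<i> else sg (x (fst g) * x (snd g)))" for x
  have c: "c y = gate_phase (PG g) (a, b) * (c (y + a) * sg (pair_form g a y))"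
  proof (cases "fst g = snd g")
    case True
    then show ?thesis unfolding c_def pair_form_def gate_phase.simps
      by (cases "y (fst g)"; cases "a (fst g)") auto
  next
    case False
    then show ?thesis unfolding c_def pair_form_def gate_phase.simps
      by (cases "y (fst g)"; cases "a (fst g)"; cases "y (snd g)"; cases "a (snd g)") auto
  qed
  have "sg (dot N b (x + a)) * sgate_entry (PG g) (x + a) y = D * c y"
    unfolding True sgate_entry.simps c_def D_def by simp
  also have "\<dots> = gate_phase (PG g) (a, b) * (c (y + a) * (D * sg (pair_form g a y)))"
    unfolding c by (simp only: mult_ac)
  also have "c (y + a) = sgate_entry (PG g) x (y + a)" unfolding x sgate_entry.simps c_def by simp
  finally show ?thesis unfolding d sg_add D_def .
next
  case False
  have "x \<noteq> y + a"
  proof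
    assume "x = y + a"
    then have "y = x + a" by (rule iffD1[OF bvec_eq_add_iff])
    then show False using False by (elim notE) (rule sym)
  qed
  then show ?thesis using False by (simp only: sgate_entry.simps if_False mult_zero_left mult_zero_right)
qed

lemma CXG_conj:
  assumes g: "fst g < N" "snd g < N" "fst g \<noteq> snd g"
  shows "sg (dot N b (x + a)) * sgate_entry (CXG g) (x + a) y
    = sgate_entry (CXG g) x (y + cx g a) * sg (dot N (cx (snd g, fst g) b) y)"
proof -
  have e: "cx g (y + cx g a) = cx g y + a" by (simp only: cx_add cx_cx[OF g(3)])
  show ?thesis
  proof (cases "x + a = cx g y")
    case True
    have x: "x = cx g y + a" by (rule iffD1[OF bvec_eq_add_iff True[symmetric]])
    have i: "cx (snd g, fst g) (cx (snd g, fst g) b) = b" using g(3) by (intro cx_cx) simp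
    have "dot N b (x + a) = dot N (cx g y) (cx (snd g, fst g) (cx (snd g, fst g) b))"
      unfolding True i by (rule dot_commute)
    also have "\<dots> = dot N y (cx (snd g, fst g) b)" by (rule dot_cx[OF g])
    also have "\<dots> = dot N (cx (snd g, fst g) b) y" by (rule dot_commute)
    finally have "dot N b (x + a) = dot N (cx (snd g, fst g) b) y" .
    then show ?thesis unfolding sgate_entry.simps e if_P[OF True] if_P[OF x] by (simp only: mult_1_left mult_1_right)
  next
    case False
    have "x \<noteq> cx g y + a"
    proof
      assume "x = cx g y + a"
      then have "cx g y = x + a" by (rule iffD1[OF bvec_eq_add_iff])
      then show False using False by (elim notE) (rule sym)
    qed
    then show ?thesis using False by (simp only: sgate_entry.simps e if_False mult_zero_left mult_zero_right)
  qed
qed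

theorem sgate_mat_conj_action:
  assumes w: "set (sgate_wires g) \<subseteq> {..<N}" "distinct (sgate_wires g)"
  shows "conj_action N (sgate_mat N g) (sgate_act g)"
proof (rule conj_actionI[where \<omega> = "gate_phase g"])
  show "sgate_mat N g \<in> unitary (2 ^ N)" by (rule sgate_mat_unitary[OF w])
  fix p assume p: "p \<in> pvecs N"
  show gp: "sgate_act g p \<in> pvecs N" by (rule sgate_act_pvecs[OF w(1) p])
  show "cmod (gate_phase g p) = 1" by (cases g) auto
  fix x y assume xy: "x \<in> vecs N" "y \<in> vecs N"
  have v: "x + fst p \<in> vecs N" "y + fst (sgate_act g p) \<in> vecs N"
    using p gp xy by (auto simp: pvecs_def mem_Times_iff intro: add_in_vecs)
  show "sg (dot N (snd p) (x + fst p)) * ent N (sgate_mat N g) (x + fst p) y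
    = gate_phase g p * (ent N (sgate_mat N g) x (y + fst (sgate_act g p)) * sg (dot N (snd (sgate_act g p)) y))"
    unfolding ent_sgate_mat[OF v(1) xy(2)] ent_sgate_mat[OF xy(1) v(2)]
  proof (cases g)
    case (HG q)
    then show "sg (dot N (snd p) (x + fst p)) * sgate_entry g (x + fst p) y
      = gate_phase g p * (sgate_entry g x (y + fst (sgate_act g p)) * sg (dot N (snd (sgate_act g p)) y))"
      using HG_conj[of q N "snd p" x "fst p" y] w by simp
  next
    case (PG h)
    then have "fst h < N" "snd h < N" using w by (auto split: if_splits)
    then show "sg (dot N (snd p) (x + fst p)) * sgate_entry g (x + fst p) y
      = gate_phase g p * (sgate_entry g x (y + fst (sgate_act g p)) * sg (dot N (snd (sgate_act g p)) y))"
      using PG_conj[of h N "snd p" x "fst p" y] unfolding PG by (simp only: sgate_act.simps fst_conv snd_conv prod.collapse)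
  next
    case (CXG h)
    then have h: "fst h < N" "snd h < N" "fst h \<noteq> snd h" using w by auto
    show "sg (dot N (snd p) (x + fst p)) * sgate_entry g (x + fst p) y
      = gate_phase g p * (sgate_entry g x (y + fst (sgate_act g p)) * sg (dot N (snd (sgate_act g p)) y))"
      unfolding CXG sgate_act.simps gate_phase.simps fst_conv snd_conv mult_1_left by (rule CXG_conj[OF h])
  qed
qed

text \<open>A gate on its own wires, renumbered from \<open>0\<close>. Its matrix on these wires is of the same form as the one on all qubits, so
  \<open>sgate_mat_conj_action\<close> also shows that it is a Clifford gate.\<close>

fun local_gate :: "sgate \<Rightarrow> sgate" where
  "local_gate (HG q) = HG 0"
| "local_gate (PG g) = (if fst g = snd g then PG (0, 0) else PG (0, 1))"
| "local_gate (CXG g) = CXG (0, 1)"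

definition to_gate :: "sgate \<Rightarrow> gate" where
  "to_gate g = (sgate_wires g, sgate_mat (length (sgate_wires g)) (local_gate g))"

lemma to_gate_clifford:
  assumes w: "set (sgate_wires g) \<subseteq> {..<N}" "distinct (sgate_wires g)"
  shows "clifford_gate N (to_gate g)"
proof -
  let ?k = "length (sgate_wires g)"
  have "set (sgate_wires (local_gate g)) \<subseteq> {..<?k}" "distinct (sgate_wires (local_gate g))"
    by (cases g; auto)+
  then have "sgate_mat ?k (local_gate g) \<in> carrier (clifford_group ?k)"
    by (intro conj_action_clifford[OF sgate_mat_conj_action])
  moreover have "?k \<in> {1, 2}" by (cases g) auto
  ultimately show ?thesis using w by (simp add: clifford_gate_def to_gate_def)
qed

definition bit_nat :: "bit \<Rightarrow> nat" where
  "bit_nat b = (if b = 0 then 0 else 1)"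

lemma qubit_idx: "x \<in> vecs N \<Longrightarrow> q < N \<Longrightarrow> qubit N (idx N x) q = bit_nat (x q)"
proof -
  assume x: "x \<in> vecs N" and q: "q < N"
  have "(of_nat (qubit N (idx N x) q) :: bit) = bits N (idx N x) q" using q by (simp add: bits_def)
  also have "\<dots> = x q" using x by simp
  finally show ?thesis using qubit_less[of N "idx N x" q] by (auto simp: bit_nat_def less_2_cases_iff)
qed

lemma bit_nat_less: "bit_nat b < 2"
  by (simp add: bit_nat_def)

lemma of_nat_bit_nat [simp]: "of_nat (bit_nat b) = b"
  by (cases b) (simp_all add: bit_nat_def)

lemma bit_nat_eq_iff: "bit_nat a = bit_nat b \<longleftrightarrow> a = b"
  by (cases a; cases b) (simp_all add: bit_nat_def)

lemma bits_1: "bits (Suc 0) (bit_nat a) = (\<lambda>q. if q = 0 then a else 0)"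
  using bit_nat_less[of a] by (auto simp: bits_def qubit_def fun_eq_iff)

lemma bits_2: "bits 2 (2 * bit_nat a + bit_nat b) = (\<lambda>q. if q = 0 then a else if q = 1 then b else 0)"
proof
  fix q
  show "bits 2 (2 * bit_nat a + bit_nat b) q = (if q = 0 then a else if q = 1 then b else 0)"
    using bit_nat_less[of a] bit_nat_less[of b] by (cases "q = 0"; cases "q = 1") (simp_all add: bits_def qubit_def)
qed

lemma ent_gate_unitary:
  assumes "x \<in> vecs N" "y \<in> vecs N"
  shows "ent N (gate_unitary N (qs, U)) x y
    = (if \<forall>q<N. q \<notin> set qs \<longrightarrow> x q = y q then U $$ (sub_index N qs (idx N x), sub_index N qs (idx N y)) else 0)"
proof -
  have "(\<forall>q<N. q \<notin> set qs \<longrightarrow> qubit N (idx N x) q = qubit N (idx N y) q) \<longleftrightarrow> (\<forall>q<N. q \<notin> set qs \<longrightarrow> x q = y q)"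
    using assms by (simp add: qubit_idx bit_nat_eq_iff)
  then show ?thesis using assms by (simp add: ent_def gate_unitary_def)
qed

lemma vecs_eq_off:
  assumes "x \<in> vecs N" "y \<in> vecs N"
  shows "(\<forall>q<N. q \<notin> Q \<longrightarrow> x q = y q) \<longleftrightarrow> (\<forall>q. q \<notin> Q \<longrightarrow> x q = y q)"
proof -
  have "x q = y q" if "\<not> q < N" for q using assms that by (simp add: vecs_def supported_def)
  then show ?thesis by blast
qed

lemma eq_off_iff:
  fixes x y :: bvec
  shows "(\<forall>r. r \<notin> Q \<longrightarrow> x r = y r) \<and> (\<forall>r\<in>Q. x r = y r) \<longleftrightarrow> x = y"
proof
  assume *: "(\<forall>r. r \<notin> Q \<longrightarrow> x r = y r) \<and> (\<forall>r\<in>Q. x r = y r)"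
  show "x = y"
  proof
    fix r
    show "x r = y r" by (cases "r \<in> Q") (use * in blast)+
  qed
qed simp

lemma gate_unitary_to_gate:
  assumes w: "set (sgate_wires g) \<subseteq> {..<N}" "distinct (sgate_wires g)"
  shows "gate_unitary N (to_gate g) = sgate_mat N g"
proof (rule ent_eqI[of _ N])
  show "gate_unitary N (to_gate g) \<in> cmat N" by (simp add: gate_unitary_def to_gate_def)
  fix x y assume xy: "x \<in> vecs N" "y \<in> vecs N"
  have one: "sub_index N [q] (idx N x) = bit_nat (x q)" if "q < N" "x \<in> vecs N" for q x
    using that by (simp add: sub_index_def qubit_idx)
  have two: "sub_index N [q, r] (idx N x) = 2 * bit_nat (x q) + bit_nat (x r)" if "q < N" "r < N" "x \<in> vecs N" for q r x
    using that by (simp add: sub_index_def qubit_idx)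
  have s1: "sgate_mat (Suc 0) h $$ (bit_nat a, bit_nat b) = sgate_entry h (\<lambda>q. if q = 0 then a else 0) (\<lambda>q. if q = 0 then b else 0)" for h a b
    using bit_nat_less by (simp add: sgate_mat_def bits_1)
  have s2: "sgate_mat 2 h $$ (2 * bit_nat a + bit_nat b, 2 * bit_nat a' + bit_nat b')
     = sgate_entry h (\<lambda>q. if q = 0 then a else if q = 1 then b else 0) (\<lambda>q. if q = 0 then a' else if q = 1 then b' else 0)" for h a b a' b'
  proof -
    have "2 * bit_nat a + bit_nat b < 4" "2 * bit_nat a' + bit_nat b' < 4"
      using bit_nat_less[of a] bit_nat_less[of b] bit_nat_less[of a'] bit_nat_less[of b'] by simp_all
    then show ?thesis by (simp add: sgate_mat_def bits_2)
  qed
  have L: "length [q] = Suc 0" "length [q, r] = 2" "set [q] = {q}" "set [q, r] = {q, r}" for q r :: nat by simp_all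
  have ind1: "(\<lambda>q::nat. if q = 0 then a else 0) = (\<lambda>q. if q = 0 then b else 0) \<longleftrightarrow> a = b" for a b :: bit
  proof
    assume eq: "(\<lambda>q::nat. if q = 0 then a else 0) = (\<lambda>q. if q = 0 then b else 0)"
    show "a = b" using fun_cong[OF eq, of 0] by simp
  qed (simp only:)
  have ind2: "(\<lambda>q::nat. if q = 0 then a else if q = 1 then b else 0) = (\<lambda>q. if q = 0 then a' else if q = 1 then b' else 0) \<longleftrightarrow> a = a' \<and> b = b'"
    for a b a' b' :: bit
  proof
    assume eq: "(\<lambda>q::nat. if q = 0 then a else if q = 1 then b else 0) = (\<lambda>q. if q = 0 then a' else if q = 1 then b' else 0)"
    show "a = a' \<and> b = b'" using fun_cong[OF eq, of 0] fun_cong[OF eq, of 1] by simp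
  qed (simp only:)
  have nest: "(if P then if Q then c else d else d) = (if P \<and> Q then c else d)" for P Q and c d :: complex
    by simp
  have e1: "sgate_entry (PG (0, 0)) (\<lambda>q. if q = 0 then a else 0) (\<lambda>q. if q = 0 then b else 0) = (if a = b then if a = 0 then 1 else \<i> else 0)" for a b
    unfolding sgate_entry.simps ind1 by simp
  have e2: "sgate_entry (PG (0, 1)) (\<lambda>q. if q = 0 then a else if q = 1 then b else 0) (\<lambda>q. if q = 0 then a' else if q = 1 then b' else 0)
    = (if a = a' \<and> b = b' then sg (a * b) else 0)" for a b a' b'
    unfolding sgate_entry.simps ind2 by simp
  have "ent N (gate_unitary N (to_gate g)) x y = sgate_entry g x y"
  proof (cases g)
    case (HG q)
    then have q: "q < N" using w by simp
    have "ent N (gate_unitary N (to_gate g)) x y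
      = (if \<forall>r. r \<notin> {q} \<longrightarrow> x r = y r then sgate_entry (HG 0) (\<lambda>r. if r = 0 then x q else 0) (\<lambda>r. if r = 0 then y q else 0) else 0)"
      unfolding to_gate_def ent_gate_unitary[OF xy] vecs_eq_off[OF xy] HG sgate_wires.simps local_gate.simps
        L one[OF q xy(1)] one[OF q xy(2)] s1 ..
    moreover have "sgate_entry (HG 0) (\<lambda>r. if r = 0 then x q else 0) (\<lambda>r. if r = 0 then y q else 0) = complex_of_real (1 / sqrt 2) * sg (x q * y q)"
      by (simp add: sgate_entry.simps)
    ultimately show ?thesis unfolding HG sgate_entry.simps by (simp only: singleton_iff)
  next
    case (PG h)
    show ?thesis
    proof (cases "fst h = snd h")
      case True
      then have q: "fst h < N" using w PG by simp
      have "ent N (gate_unitary N (to_gate g)) x y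
        = (if \<forall>r. r \<notin> {fst h} \<longrightarrow> x r = y r then sgate_entry (PG (0, 0)) (\<lambda>r. if r = 0 then x (fst h) else 0) (\<lambda>r. if r = 0 then y (fst h) else 0) else 0)"
        unfolding to_gate_def ent_gate_unitary[OF xy] vecs_eq_off[OF xy] PG sgate_wires.simps local_gate.simps if_P[OF True]
          L one[OF q xy(1)] one[OF q xy(2)] s1 ..
      also have "\<dots> = (if (\<forall>r. r \<notin> {fst h} \<longrightarrow> x r = y r) \<and> x (fst h) = y (fst h) then if x (fst h) = 0 then 1 else \<i> else 0)"
        unfolding e1 nest ..
      also have "(\<forall>r. r \<notin> {fst h} \<longrightarrow> x r = y r) \<and> x (fst h) = y (fst h) \<longleftrightarrow> x = y"
        unfolding eq_off_iff[of "{fst h}" x y, symmetric] by simp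
      finally show ?thesis unfolding PG sgate_entry.simps if_P[OF True] .
    next
      case False
      then have q: "fst h < N" "snd h < N" using w PG by simp_all
      have "ent N (gate_unitary N (to_gate g)) x y
        = (if \<forall>r. r \<notin> {fst h, snd h} \<longrightarrow> x r = y r then sgate_entry (PG (0, 1)) (\<lambda>r. if r = 0 then x (fst h) else if r = 1 then x (snd h) else 0)
            (\<lambda>r. if r = 0 then y (fst h) else if r = 1 then y (snd h) else 0) else 0)"
        unfolding to_gate_def ent_gate_unitary[OF xy] vecs_eq_off[OF xy] PG sgate_wires.simps local_gate.simps if_not_P[OF False]
          L two[OF q xy(1)] two[OF q xy(2)] s2 ..
      also have "\<dots> = (if (\<forall>r. r \<notin> {fst h, snd h} \<longrightarrow> x r = y r) \<and> x (fst h) = y (fst h) \<and> x (snd h) = y (snd h) then sg (x (fst h) * x (snd h)) else 0)"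
        unfolding e2 nest ..
      also have "(\<forall>r. r \<notin> {fst h, snd h} \<longrightarrow> x r = y r) \<and> x (fst h) = y (fst h) \<and> x (snd h) = y (snd h) \<longleftrightarrow> x = y"
        unfolding eq_off_iff[of "{fst h, snd h}" x y, symmetric] by simp
      finally show ?thesis unfolding PG sgate_entry.simps if_not_P[OF False] .
    qed
  next
    case (CXG h)
    then have q: "fst h < N" "snd h < N" "fst h \<noteq> snd h" using w by simp_all
    have "ent N (gate_unitary N (to_gate g)) x y
      = (if \<forall>r. r \<notin> {fst h, snd h} \<longrightarrow> x r = y r then sgate_entry (CXG (0, 1)) (\<lambda>r. if r = 0 then x (fst h) else if r = 1 then x (snd h) else 0)
          (\<lambda>r. if r = 0 then y (fst h) else if r = 1 then y (snd h) else 0) else 0)"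
      unfolding to_gate_def ent_gate_unitary[OF xy] vecs_eq_off[OF xy] CXG sgate_wires.simps local_gate.simps
        L two[OF q(1,2) xy(1)] two[OF q(1,2) xy(2)] s2 ..
    also have "cx (0, 1) (\<lambda>r. if r = 0 then y (fst h) else if r = 1 then y (snd h) else 0)
       = (\<lambda>r. if r = 0 then y (fst h) else if r = 1 then y (snd h) + y (fst h) else 0)"
      by (auto simp: cx_def fun_eq_iff)
    then have "sgate_entry (CXG (0, 1)) (\<lambda>r. if r = 0 then x (fst h) else if r = 1 then x (snd h) else 0)
          (\<lambda>r. if r = 0 then y (fst h) else if r = 1 then y (snd h) else 0)
       = (if x (fst h) = y (fst h) \<and> x (snd h) = y (snd h) + y (fst h) then 1 else 0)"
      unfolding sgate_entry.simps by (simp only: ind2)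
    also have "(if \<forall>r. r \<notin> {fst h, snd h} \<longrightarrow> x r = y r then if x (fst h) = y (fst h) \<and> x (snd h) = y (snd h) + y (fst h) then 1 else 0 else 0 :: complex)
      = (if (\<forall>r. r \<notin> {fst h, snd h} \<longrightarrow> x r = y r) \<and> x (fst h) = y (fst h) \<and> x (snd h) = y (snd h) + y (fst h) then 1 else 0)"
      unfolding nest ..
    also have "(\<forall>r. r \<notin> {fst h, snd h} \<longrightarrow> x r = y r) \<and> x (fst h) = y (fst h) \<and> x (snd h) = y (snd h) + y (fst h) \<longleftrightarrow> x = cx h y"
    proof -
      have c: "cx h y (fst h) = y (fst h)" "cx h y (snd h) = y (snd h) + y (fst h)" using q(3) by (simp_all add: cx_def)
      have "(\<forall>r. r \<notin> {fst h, snd h} \<longrightarrow> x r = y r) \<longleftrightarrow> (\<forall>r. r \<notin> {fst h, snd h} \<longrightarrow> x r = cx h y r)"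
        by (simp add: cx_def)
      then show ?thesis unfolding eq_off_iff[of "{fst h, snd h}" x "cx h y", symmetric] by (simp only: ball_simps simp_thms c)
    qed
    finally show ?thesis unfolding CXG sgate_entry.simps .
  qed
  then show "ent N (gate_unitary N (to_gate g)) x y = ent N (sgate_mat N g) x y" by (simp only: ent_sgate_mat[OF xy])
qed simp

definition to_circuit :: "sgate list list \<Rightarrow> circuit" where
  "to_circuit = map (map to_gate)"

lemma scircuit_ok_gate:
  assumes "scircuit_ok N ls" "l \<in> set ls" "g \<in> set l"
  shows "set (sgate_wires g) \<subseteq> {..<N}" "distinct (sgate_wires g)"
proof -
  have l: "distinct (concat (map sgate_wires l))" "set (concat (map sgate_wires l)) \<subseteq> {..<N}"
    using assms by (auto simp: scircuit_ok_def)
  obtain l1 l2 where "l = l1 @ g # l2" using split_list[OF assms(3)] by (elim exE)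
  then show "set (sgate_wires g) \<subseteq> {..<N}" "distinct (sgate_wires g)" using l by auto
qed

lemma to_circuit_clifford:
  assumes "scircuit_ok N ls"
  shows "clifford_circuit N (to_circuit ls)"
  unfolding clifford_circuit_def
proof (rule ballI)
  fix l' assume "l' \<in> set (to_circuit ls)"
  then obtain l where l: "l \<in> set ls" "l' = map to_gate l" by (auto simp: to_circuit_def)
  have "map fst l' = map sgate_wires l" unfolding l(2) by (simp add: to_gate_def)
  moreover have "distinct (concat (map sgate_wires l))" using assms l(1) by (simp add: scircuit_ok_def)
  moreover have "\<forall>g\<in>set l'. clifford_gate N g"
  proof
    fix g' assume "g' \<in> set l'"
    then obtain g where g: "g \<in> set l" "g' = to_gate g" unfolding l(2) by auto
    show "clifford_gate N g'" unfolding g(2) by (rule to_gate_clifford[OF scircuit_ok_gate[OF assms l(1) g(1)]])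
  qed
  ultimately show "(\<forall>g\<in>set l'. clifford_gate N g) \<and> distinct (concat (map fst l'))" by (simp only: simp_thms)
qed

lemma to_circuit_size: "gate_count (to_circuit ls) = length (concat ls)" "depth (to_circuit ls) = length ls"
  by (simp_all add: gate_count_def depth_def to_circuit_def map_concat[symmetric])

lemma foldl_conj_action:
  assumes "conj_action N V h" "\<And>g. g \<in> set gs \<Longrightarrow> set (sgate_wires g) \<subseteq> {..<N} \<and> distinct (sgate_wires g)"
  shows "conj_action N (foldl (\<lambda>V g. gate_unitary N g * V) V (map to_gate gs)) (h \<circ> act gs)"
  using assms
proof (induction gs arbitrary: V h)
  case Nil
  have "h \<circ> act [] = h" by (simp add: fun_eq_iff)
  then show ?case using Nil(1) by (simp only: list.map foldl_Nil)
next
  case (Cons g gs)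
  have w: "set (sgate_wires g) \<subseteq> {..<N}" "distinct (sgate_wires g)" using Cons.prems(2)[of g] by auto
  have "conj_action N (gate_unitary N (to_gate g) * V) (h \<circ> sgate_act g)"
    unfolding gate_unitary_to_gate[OF w] by (rule conj_action_mult[OF sgate_mat_conj_action[OF w] Cons.prems(1)])
  then have "conj_action N (foldl (\<lambda>V g. gate_unitary N g * V) (gate_unitary N (to_gate g) * V) (map to_gate gs)) (h \<circ> sgate_act g \<circ> act gs)"
    by (rule Cons.IH) (use Cons.prems(2) in auto)
  moreover have "h \<circ> sgate_act g \<circ> act gs = h \<circ> act (g # gs)" by (simp add: fun_eq_iff)
  ultimately show ?case by (simp only: list.map foldl_Cons)
qed

text \<open>The symbolic action describes the unitary of the circuit.\<close>

theorem circuit_conj_action: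
  assumes "scircuit_ok N ls"
  shows "conj_action N (circuit_unitary N (to_circuit ls)) (act (concat ls))"
proof -
  have "conj_action N (foldl (\<lambda>V g. gate_unitary N g * V) (1\<^sub>m (2 ^ N)) (map to_gate (concat ls))) (id \<circ> act (concat ls))"
    by (rule foldl_conj_action[OF conj_action_one]) (use scircuit_ok_gate[OF assms] in auto)
  then show ?thesis by (simp add: circuit_unitary_def to_circuit_def map_concat)
qed

section \<open>The symplectic group\<close>
lemma conj_action_zero:
  assumes C: "conj_action N C g"
  shows "g (0, 0) = (0, 0)"
proof -
  note C' = conj_actionD[OF C] and U = unitaryD[OF conj_actionD(1)[OF C]]
  have z: "(0, 0) \<in> pvecs N" by (simp add: pvecs_def)
  obtain \<omega> where \<omega>: "cmod \<omega> = 1" "C\<^sup>\<dagger> * pm N (0, 0) * C = \<omega> \<cdot>\<^sub>m pm N (g (0, 0))"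
    using C'(4)[OF z] by (elim exE conjE)
  have "C\<^sup>\<dagger> * pm N (0, 0) * C = C\<^sup>\<dagger> * C" unfolding pm_zero right_mult_one_mat[OF adj_carrier[OF C'(2)]] ..
  also have "\<dots> = pm N (0, 0)" unfolding U(3) pm_zero ..
  finally have "\<omega> \<cdot>\<^sub>m pm N (g (0, 0)) = 1 \<cdot>\<^sub>m pm N (0, 0)" using \<omega>(2) by simp
  then show ?thesis using \<omega>(1) by (intro pm_inj[of \<omega> N "g (0, 0)" 1, OF _ C'(3)[OF z] z]) auto
qed

lemma bvec_eq_add_iff_left: "(x::bvec) = y + a \<longleftrightarrow> a = x + y"
proof
  assume "x = y + a"
  then show "a = x + y" by (simp only: add_ac bvec_add_self bvec_add_self_left add_0_right add_0_left)
next
  assume "a = x + y"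
  then show "x = y + a" by (simp only: add_ac bvec_add_self bvec_add_self_left add_0_right add_0_left)
qed

lemma add_right_cancel_bvec: "(x::bvec) + a = y + a \<longleftrightarrow> x = y"
proof
  assume "x + a = y + a"
  then have "x + a + a = y + a + a" by (simp only:)
  then show "x = y" by (simp only: add.assoc bvec_add_self add_0_right)
qed simp

lemma pm_expansion:
  assumes M: "M \<in> cmat N"
  shows "mat_sum (2 ^ N) (\<lambda>p. trace ((pm N p)\<^sup>\<dagger> * M) \<cdot>\<^sub>m pm N p) (pvecs N) = 2 ^ N \<cdot>\<^sub>m M"
proof (rule ent_eqI[of _ N])
  show "2 ^ N \<cdot>\<^sub>m M \<in> cmat N" using M by simp
  fix x y assume xy: "x \<in> vecs N" "y \<in> vecs N"
  have u: "x + y \<in> vecs N" by (rule add_in_vecs[OF xy])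
  have "ent N (mat_sum (2 ^ N) (\<lambda>p. trace ((pm N p)\<^sup>\<dagger> * M) \<cdot>\<^sub>m pm N p) (pvecs N)) x y
    = (\<Sum>a\<in>vecs N. \<Sum>b\<in>vecs N. (if a = x + y then trace ((pm N (a, b))\<^sup>\<dagger> * M) * sg (dot N b y) else 0))"
    unfolding ent_mat_sum[OF xy] sum_pvecs
    by (intro sum.cong refl) (simp add: ent_smult[OF pm_carrier] ent_pm xy bvec_eq_add_iff_left)
  also have "\<dots> = (\<Sum>a\<in>vecs N. if a = x + y then (\<Sum>b\<in>vecs N. trace ((pm N (a, b))\<^sup>\<dagger> * M) * sg (dot N b y)) else 0)"
    by (intro sum.cong refl) simp
  also have "\<dots> = (\<Sum>b\<in>vecs N. trace ((pm N (x + y, b))\<^sup>\<dagger> * M) * sg (dot N b y))"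
    using u by (rule sum_delta_vecs)
  also have "\<dots> = (\<Sum>b\<in>vecs N. \<Sum>z\<in>vecs N. sg (dot N b (y + 0 + 0 + z)) * ent N M (z + (x + y)) z)"
  proof (rule sum.cong)
    fix b assume "b \<in> vecs N"
    then have p: "(x + y, b) \<in> pvecs N" using u by (simp add: pvecs_def)
    show "trace ((pm N (x + y, b))\<^sup>\<dagger> * M) * sg (dot N b y) = (\<Sum>z\<in>vecs N. sg (dot N b (y + 0 + 0 + z)) * ent N M (z + (x + y)) z)"
      unfolding trace_pm_adj_mult[OF p M] sum_distrib_right fst_conv snd_conv
      by (intro sum.cong refl) (simp add: dot_add_right sg_add mult_ac)
  qed simp
  also have "\<dots> = (\<Sum>z\<in>vecs N. (\<Sum>b\<in>vecs N. sg (dot N b (y + 0 + 0 + z))) * ent N M (z + (x + y)) z)"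
    unfolding sum_distrib_right by (rule sum.swap)
  also have "\<dots> = 2 ^ N * ent N M (y + 0 + 0 + (x + y)) (y + 0 + 0)"
    by (rule sum_sg_delta[OF xy(2) zero_in_vecs zero_in_vecs])
  also have "y + 0 + 0 + (x + y) = x" by (simp only: add_ac bvec_add_self bvec_add_self_left add_0_right add_0_left)
  finally show "ent N (mat_sum (2 ^ N) (\<lambda>p. trace ((pm N p)\<^sup>\<dagger> * M) \<cdot>\<^sub>m pm N p) (pvecs N)) x y = ent N (2 ^ N \<cdot>\<^sub>m M) x y"
    unfolding ent_smult[OF M xy] by (simp only: add_0_right)
qed simp

lemma pm_commute:
  assumes "p \<in> pvecs N" "q \<in> pvecs N"
  shows "\<exists>\<chi>. pm N p * (pm N q)\<^sup>\<dagger> * (pm N p)\<^sup>\<dagger> = \<chi> \<cdot>\<^sub>m (pm N q)\<^sup>\<dagger>"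
proof -
  let ?\<chi> = "sg (dot N (snd p) (fst q)) * sg (dot N (snd q) (fst p)) :: complex"
  have "pm N p * pm N q = sg (dot N (snd p) (fst q)) \<cdot>\<^sub>m pm N (fst p + fst q, snd p + snd q)" by (rule pm_mult[OF assms])
  moreover have "pm N q * pm N p = sg (dot N (snd q) (fst p)) \<cdot>\<^sub>m pm N (fst p + fst q, snd p + snd q)"
    unfolding pm_mult[OF assms(2,1)] by (simp only: add.commute)
  ultimately have c: "pm N p * pm N q = ?\<chi> \<cdot>\<^sub>m (pm N q * pm N p)"
    by (simp only: smult_smult_mat) (simp add: mult.assoc)
  let ?s = "sg (dot N (snd q) (fst q)) :: complex"
  have "pm N p * (pm N q)\<^sup>\<dagger> = ?s \<cdot>\<^sub>m (pm N p * pm N q)"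
    unfolding pm_adj[OF assms(2)] by (rule mult_smult_distrib[OF pm_carrier pm_carrier])
  also have "\<dots> = ?\<chi> \<cdot>\<^sub>m ((pm N q)\<^sup>\<dagger> * pm N p)"
    unfolding c pm_adj[OF assms(2)] mult_smult_assoc_mat[OF pm_carrier pm_carrier] smult_smult_mat by (simp only: mult.commute)
  finally have "pm N p * (pm N q)\<^sup>\<dagger> * (pm N p)\<^sup>\<dagger> = ?\<chi> \<cdot>\<^sub>m ((pm N q)\<^sup>\<dagger> * pm N p) * (pm N p)\<^sup>\<dagger>" by (simp only:)
  also have "\<dots> = ?\<chi> \<cdot>\<^sub>m ((pm N q)\<^sup>\<dagger> * pm N p * (pm N p)\<^sup>\<dagger>)"
    by (intro mult_smult_assoc_mat[of _ "2 ^ N" "2 ^ N" _ "2 ^ N"] sq_closed) simp_all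
  also have "(pm N q)\<^sup>\<dagger> * pm N p * (pm N p)\<^sup>\<dagger> = (pm N q)\<^sup>\<dagger> * (pm N p * (pm N p)\<^sup>\<dagger>)"
    by (rule sq_assoc[of _ "2 ^ N"]) simp_all
  also have "\<dots> = (pm N q)\<^sup>\<dagger>" unfolding unitaryD(2)[OF pm_unitary[OF assms(1)]]
    by (rule right_mult_one_mat[OF adj_carrier[OF pm_carrier]])
  finally show ?thesis by (rule exI)
qed

text \<open>A unitary that commutes with all Pauli operators up to phases has a non-zero coefficient at some \<open>P\<^sub>q\<close>. Comparing traces,
  these phases are those of \<open>P\<^sub>q\<close>, so \<open>P\<^sub>q\<^sup>\<dagger> M\<close> commutes with all Pauli operators and is a scalar by \<open>sum_pm_conj\<close>.\<close>

lemma conj_action_id_pauli: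
  assumes M: "conj_action N M id"
  shows "M \<in> pauli_group N"
proof -
  note M' = conj_actionD[OF M] and U = unitaryD[OF conj_actionD(1)[OF M]]
  have D: "0 < (2 ^ N :: nat)" by simp
  obtain q where q: "q \<in> pvecs N" and tr: "trace ((pm N q)\<^sup>\<dagger> * M) \<noteq> 0"
  proof (rule ccontr)
    assume "\<not> thesis"
    then have z: "trace ((pm N q)\<^sup>\<dagger> * M) = 0" if "q \<in> pvecs N" for q using that \<open>\<And>q. q \<in> pvecs N \<Longrightarrow> trace ((pm N q)\<^sup>\<dagger> * M) \<noteq> 0 \<Longrightarrow> thesis\<close> by blast
    have "2 ^ N \<cdot>\<^sub>m M = 0\<^sub>m (2 ^ N) (2 ^ N)"
      unfolding pm_expansion[OF M'(2), symmetric] by (rule eq_matI) (simp_all add: z mat_sum_def smult_index[OF pm_carrier])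
    then have "(1 / 2 ^ N) \<cdot>\<^sub>m (2 ^ N \<cdot>\<^sub>m M) = (1 / 2 ^ N) \<cdot>\<^sub>m 0\<^sub>m (2 ^ N) (2 ^ N)" by (simp only:)
    then have "M = 0\<^sub>m (2 ^ N) (2 ^ N)" by (simp add: smult_smult_mat)
    then have "M * M\<^sup>\<dagger> = 0\<^sub>m (2 ^ N) (2 ^ N)" using M'(2) by simp
    then have "(1\<^sub>m (2 ^ N) :: complex mat) = 0\<^sub>m (2 ^ N) (2 ^ N)" unfolding U(2) .
    then have "(1\<^sub>m (2 ^ N) :: complex mat) $$ (0, 0) = 0\<^sub>m (2 ^ N) (2 ^ N) $$ (0, 0)" by (simp only:)
    then show False by simp
  qed
  let ?Q = "pm N q"
  have Qa: "?Q\<^sup>\<dagger> \<in> cmat N" by simp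
  define K where "K = ?Q\<^sup>\<dagger> * M"
  have K: "K \<in> cmat N" unfolding K_def by (rule sq_closed[OF Qa M'(2)])
  have inv: "pm N p * K * (pm N p)\<^sup>\<dagger> = K" if p: "p \<in> pvecs N" for p
  proof -
    let ?P = "pm N p"
    have Pa: "?P\<^sup>\<dagger> \<in> cmat N" by simp
    note PU = unitaryD[OF pm_unitary[OF p]]
    obtain \<chi> where \<chi>: "?P * ?Q\<^sup>\<dagger> * ?P\<^sup>\<dagger> = \<chi> \<cdot>\<^sub>m ?Q\<^sup>\<dagger>" using pm_commute[OF p q] by (elim exE)
    obtain \<omega> where \<omega>: "M\<^sup>\<dagger> * ?P * M = \<omega> \<cdot>\<^sub>m ?P" using M'(4)[OF p] by (auto simp: id_def)
    have "?P * M = (M * M\<^sup>\<dagger>) * (?P * M)" unfolding U(2) using sq_closed[OF pm_carrier M'(2)] by (rule left_mult_one_mat[symmetric])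
    also have "\<dots> = M * (M\<^sup>\<dagger> * ?P * M)"
      using M'(2) by (simp add: sq_assoc[of _ "2 ^ N"] sq_closed del: assoc_mult_mat)
    also have "\<dots> = \<omega> \<cdot>\<^sub>m (M * ?P)" unfolding \<omega> by (rule mult_smult_distrib[OF M'(2) pm_carrier])
    finally have "?P * M * ?P\<^sup>\<dagger> = \<omega> \<cdot>\<^sub>m (M * ?P) * ?P\<^sup>\<dagger>" by (simp only:)
    also have "\<dots> = \<omega> \<cdot>\<^sub>m (M * ?P * ?P\<^sup>\<dagger>)" by (rule mult_smult_assoc_mat[OF sq_closed[OF M'(2) pm_carrier] Pa])
    also have "M * ?P * ?P\<^sup>\<dagger> = M * (?P * ?P\<^sup>\<dagger>)" by (rule sq_assoc[OF M'(2) pm_carrier Pa])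
    also have "\<dots> = M" unfolding PU(2) by (rule right_mult_one_mat[OF M'(2)])
    finally have PMP: "?P * M * ?P\<^sup>\<dagger> = \<omega> \<cdot>\<^sub>m M" .
    have "?P * K * ?P\<^sup>\<dagger> = ?P * ?Q\<^sup>\<dagger> * (?P\<^sup>\<dagger> * ?P) * M * ?P\<^sup>\<dagger>"
      unfolding PU(3) K_def right_mult_one_mat[OF sq_closed[OF pm_carrier Qa]]
      using M'(2) by (simp add: sq_assoc[of _ "2 ^ N"] sq_closed del: assoc_mult_mat)
    also have "\<dots> = (?P * ?Q\<^sup>\<dagger> * ?P\<^sup>\<dagger>) * (?P * M * ?P\<^sup>\<dagger>)"
      using M'(2) by (simp add: sq_assoc[of _ "2 ^ N"] sq_closed del: assoc_mult_mat)
    also have "\<dots> = (\<chi> * \<omega>) \<cdot>\<^sub>m K"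
      unfolding \<chi> PMP K_def mult_smult_assoc_mat[OF Qa smult_carrier_mat[OF M'(2)]] mult_smult_distrib[OF Qa M'(2)] smult_smult_mat ..
    finally have eq: "?P * K * ?P\<^sup>\<dagger> = (\<chi> * \<omega>) \<cdot>\<^sub>m K" .
    have "trace (?P * K * ?P\<^sup>\<dagger>) = trace (?P\<^sup>\<dagger> * (?P * K))"
      by (rule trace_mult_commute[OF sq_closed[OF pm_carrier K] Pa])
    also have "?P\<^sup>\<dagger> * (?P * K) = (?P\<^sup>\<dagger> * ?P) * K" by (rule sq_assoc[OF Pa pm_carrier K, symmetric])
    also have "\<dots> = K" unfolding PU(3) by (rule left_mult_one_mat[OF K])
    finally have "(\<chi> * \<omega>) * trace K = trace K" unfolding eq trace_smult[OF K] .
    then have "\<chi> * \<omega> = 1" using tr unfolding K_def by simp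
    then show ?thesis unfolding eq by simp
  qed
  have "mat_sum (2 ^ N) (\<lambda>p. pm N p * K * (pm N p)\<^sup>\<dagger>) (pvecs N) = mat_sum (2 ^ N) (\<lambda>p. K) (pvecs N)"
    by (rule mat_sum_cong[OF inv])
  also have "\<dots> = (2 ^ N)\<^sup>2 \<cdot>\<^sub>m K" using K by (intro eq_matI) (auto simp: card_pvecs mat_sum_def)
  finally have e: "(2 ^ N)\<^sup>2 \<cdot>\<^sub>m K = (2 ^ N * trace K) \<cdot>\<^sub>m 1\<^sub>m (2 ^ N)" unfolding sum_pm_conj[OF K] ..
  define k where "k = trace K / 2 ^ N"
  have "K = (1 / (2 ^ N)\<^sup>2) \<cdot>\<^sub>m ((2 ^ N)\<^sup>2 \<cdot>\<^sub>m K)" by (simp add: smult_smult_mat)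
  also have "\<dots> = k \<cdot>\<^sub>m 1\<^sub>m (2 ^ N)" unfolding e smult_smult_mat k_def by (simp add: power2_eq_square)
  finally have Kk: "K = k \<cdot>\<^sub>m 1\<^sub>m (2 ^ N)" .
  have "M = (?Q * ?Q\<^sup>\<dagger>) * M" unfolding unitaryD(2)[OF pm_unitary[OF q]] by (rule left_mult_one_mat[OF M'(2), symmetric])
  also have "\<dots> = ?Q * K" unfolding K_def by (rule sq_assoc[OF pm_carrier Qa M'(2)])
  also have "\<dots> = k \<cdot>\<^sub>m ?Q" unfolding Kk mult_smult_distrib[OF pm_carrier one_carrier_mat] right_mult_one_mat[OF pm_carrier] ..
  finally have Mk: "M = k \<cdot>\<^sub>m ?Q" .
  have "M * M\<^sup>\<dagger> = (k * cnj k) \<cdot>\<^sub>m (?Q * ?Q\<^sup>\<dagger>)"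
    unfolding Mk smult_adj mult_smult_assoc_mat[OF pm_carrier smult_carrier_mat[OF Qa]] mult_smult_distrib[OF pm_carrier Qa] smult_smult_mat ..
  then have "1\<^sub>m (2 ^ N) = (k * cnj k) \<cdot>\<^sub>m 1\<^sub>m (2 ^ N)" unfolding U(2) unitaryD(2)[OF pm_unitary[OF q]] .
  then have "1\<^sub>m (2 ^ N) $$ (0, 0) = ((k * cnj k) \<cdot>\<^sub>m 1\<^sub>m (2 ^ N)) $$ (0, 0)" by (simp only:)
  then have "complex_of_real ((cmod k)\<^sup>2) = 1" unfolding complex_norm_square by simp
  then have "(cmod k)\<^sup>2 = 1" by (simp only: of_real_eq_1_iff)
  then have "cmod k = 1" using norm_ge_zero[of k] unfolding power2_eq_1_iff by linarith
  then show ?thesis unfolding pauli_group_eq mem_Collect_eq using Mk q by (intro exI[of _ k] exI[of _ q] conjI)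
qed

lemma conj_action_pauli:
  assumes P: "P \<in> pauli_group N"
  shows "conj_action N P id"
proof -
  obtain \<omega> p where \<omega>: "P = \<omega> \<cdot>\<^sub>m pm N p" "cmod \<omega> = 1" and p: "p \<in> pvecs N"
    using P unfolding pauli_group_eq mem_Collect_eq by (elim exE conjE)
  have one: "\<omega> * cnj \<omega> = 1" "cnj \<omega> * \<omega> = 1" using cmod_one_cnj[OF \<omega>(2)] by (simp_all add: mult.commute)
  have Pa: "(pm N p)\<^sup>\<dagger> \<in> cmat N" by simp
  note U = unitaryD[OF pm_unitary[OF p]]
  have "P \<in> unitary (2 ^ N)"
    unfolding unitary_def mem_Collect_eq \<omega>(1) smult_adj mult_smult_assoc_mat[OF pm_carrier smult_carrier_mat[OF Pa]]
      mult_smult_assoc_mat[OF Pa smult_carrier_mat[OF pm_carrier]] mult_smult_distrib[OF pm_carrier Pa] mult_smult_distrib[OF Pa pm_carrier] smult_smult_mat one U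
    by simp
  moreover have "\<exists>\<omega>. cmod \<omega> = 1 \<and> P\<^sup>\<dagger> * pm N q * P = \<omega> \<cdot>\<^sub>m pm N (id q)" if q: "q \<in> pvecs N" for q
  proof -
    let ?\<chi> = "sg (dot N (snd p) (fst q)) * sg (dot N (snd q) (fst p)) :: complex"
    have "P\<^sup>\<dagger> * pm N q * P = P\<^sup>\<dagger> * pm N q * (P\<^sup>\<dagger>)\<^sup>\<dagger>" by simp
    also have "\<dots> = (pm N p)\<^sup>\<dagger> * pm N q * ((pm N p)\<^sup>\<dagger>)\<^sup>\<dagger>"
      unfolding \<omega>(1) smult_adj[of \<omega>] using \<omega>(2) by (intro smult_conj[of _ _ "2 ^ N"]) simp_all
    also have "\<dots> = (pm N p)\<^sup>\<dagger> * pm N q * pm N p" by simp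
    also have "\<dots> = pm N p * pm N q * (pm N p)\<^sup>\<dagger>" by (rule pm_conj_adj[OF p pm_carrier])
    also have "\<dots> = ?\<chi> \<cdot>\<^sub>m pm N q"
    proof (rule ent_eqI[OF pm_conj_carrier[OF pm_carrier] smult_carrier_mat[OF pm_carrier]])
      fix x y assume xy: "x \<in> vecs N" "y \<in> vecs N"
      have a: "x + fst p \<in> vecs N" "y + fst p \<in> vecs N" using p xy by (auto simp: pvecs_def add_in_vecs)
      have "x + fst p = y + fst p + fst q \<longleftrightarrow> x = y + fst q"
      proof -
        have "y + fst p + fst q = (y + fst q) + fst p" by (simp only: add_ac)
        then show ?thesis by (simp only: add_right_cancel_bvec)
      qed
      moreover have "dot N (snd p) (x + y) = dot N (snd p) (fst q)" if "x = y + fst q"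
      proof -
        have "x + y = fst q" unfolding that by (simp only: add_ac bvec_add_self bvec_add_self_left add_0_right add_0_left)
        then show ?thesis by (simp only:)
      qed
      ultimately show "ent N (pm N p * pm N q * (pm N p)\<^sup>\<dagger>) x y = ent N (?\<chi> \<cdot>\<^sub>m pm N q) x y"
        unfolding ent_pm_conj[OF p pm_carrier xy] ent_smult[OF pm_carrier xy] ent_pm[OF xy] ent_pm[OF a]
        by (auto simp: dot_add_right sg_add)
    qed
    finally show ?thesis by (intro exI[of _ ?\<chi>]) (simp add: norm_mult)
  qed
  ultimately show ?thesis by (simp add: conj_action_def)
qed

text \<open>The permutation of the Pauli operators induced by a Clifford unitary. The choice is unique on \<open>pvecs N\<close>
  (\<open>conj_action_unique\<close>).\<close>

definition clifford_action :: "nat \<Rightarrow> complex mat \<Rightarrow> pidx \<Rightarrow> pidx" where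
  "clifford_action N V p = (SOME q. q \<in> pvecs N \<and> (\<exists>\<omega>. cmod \<omega> = 1 \<and> V\<^sup>\<dagger> * pm N p * V = \<omega> \<cdot>\<^sub>m pm N q))"

lemma conj_action_unique:
  assumes "conj_action N V g" "p \<in> pvecs N"
  shows "clifford_action N V p = g p"
proof -
  obtain \<omega> where \<omega>: "cmod \<omega> = 1" "V\<^sup>\<dagger> * pm N p * V = \<omega> \<cdot>\<^sub>m pm N (g p)"
    using conj_actionD(4)[OF assms] by (elim exE conjE)
  note gp = conj_actionD(3)[OF assms]
  show ?thesis
    unfolding clifford_action_def
  proof (rule some_equality)
    show "g p \<in> pvecs N \<and> (\<exists>\<omega>. cmod \<omega> = 1 \<and> V\<^sup>\<dagger> * pm N p * V = \<omega> \<cdot>\<^sub>m pm N (g p))"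
      using gp \<omega> by (intro conjI exI)
    fix q assume "q \<in> pvecs N \<and> (\<exists>\<omega>. cmod \<omega> = 1 \<and> V\<^sup>\<dagger> * pm N p * V = \<omega> \<cdot>\<^sub>m pm N q)"
    then obtain \<omega>' where q: "q \<in> pvecs N" "cmod \<omega>' = 1" "V\<^sup>\<dagger> * pm N p * V = \<omega>' \<cdot>\<^sub>m pm N q" by (elim exE conjE)
    have "\<omega>' \<cdot>\<^sub>m pm N q = \<omega> \<cdot>\<^sub>m pm N (g p)" unfolding q(3)[symmetric] by (rule \<omega>(2))
    then show "q = g p" using q(2) \<omega>(1) by (intro pm_inj[of \<omega>' N q \<omega> "g p", OF _ q(1) gp]) auto
  qed
qed

lemma conj_action_cong:
  assumes "conj_action N V g" "\<And>p. p \<in> pvecs N \<Longrightarrow> h p = g p"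
  shows "conj_action N V h"
  using assms by (simp add: conj_action_def)

lemma conj_action_adj:
  assumes V: "conj_action N V g" and h: "\<And>p. p \<in> pvecs N \<Longrightarrow> h (g p) = p"
  shows "conj_action N (V\<^sup>\<dagger>) h"
  unfolding conj_action_def
proof (intro conjI ballI)
  show "V\<^sup>\<dagger> \<in> unitary (2 ^ N)" by (rule unitary_adj[OF conj_actionD(1)[OF V]])
  fix q assume "q \<in> pvecs N"
  then have "q \<in> g ` pvecs N" using bij_betw_imp_surj_on[OF conj_action_bij[OF V]] by (simp only:)
  then obtain p where p: "q = g p" "p \<in> pvecs N" by (rule imageE)
  show "h q \<in> pvecs N" unfolding p(1) h[OF p(2)] by (rule p(2))
  show "\<exists>\<omega>. cmod \<omega> = 1 \<and> (V\<^sup>\<dagger>)\<^sup>\<dagger> * pm N q * V\<^sup>\<dagger> = \<omega> \<cdot>\<^sub>m pm N (h q)"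
    unfolding adj_adj p(1) h[OF p(2)] by (rule conj_action_inverse[OF V p(2)])
qed

lemma clifford_conj_action:
  assumes V: "V \<in> carrier (clifford_group N)"
  shows "conj_action N V (clifford_action N V)"
proof -
  have U: "V \<in> unitary (2 ^ N)" and cl: "\<And>P. P \<in> pauli_group N \<Longrightarrow> V * P * V\<^sup>\<dagger> \<in> pauli_group N"
    using V by (auto simp: clifford_group_def)
  have ex: "\<exists>q. q \<in> pvecs N \<and> (\<exists>\<omega>. cmod \<omega> = 1 \<and> V * pm N p * V\<^sup>\<dagger> = \<omega> \<cdot>\<^sub>m pm N q)" if p: "p \<in> pvecs N" for p
  proof -
    have "1 \<cdot>\<^sub>m pm N p \<in> pauli_group N"
      unfolding pauli_group_eq mem_Collect_eq using p by (intro exI[of _ 1] exI[of _ p]) simp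
    then have "V * pm N p * V\<^sup>\<dagger> \<in> pauli_group N" using cl[of "pm N p"] by simp
    then obtain \<omega> q where "V * pm N p * V\<^sup>\<dagger> = \<omega> \<cdot>\<^sub>m pm N q" "cmod \<omega> = 1" "q \<in> pvecs N"
      unfolding pauli_group_eq mem_Collect_eq by (elim exE conjE)
    then show ?thesis by (intro exI conjI)
  qed
  define h where "h p = (SOME q. q \<in> pvecs N \<and> (\<exists>\<omega>. cmod \<omega> = 1 \<and> V * pm N p * V\<^sup>\<dagger> = \<omega> \<cdot>\<^sub>m pm N q))" for p
  have h: "h p \<in> pvecs N \<and> (\<exists>\<omega>. cmod \<omega> = 1 \<and> V * pm N p * V\<^sup>\<dagger> = \<omega> \<cdot>\<^sub>m pm N (h p))" if "p \<in> pvecs N" for p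
    unfolding h_def by (rule someI_ex[OF ex[OF that]])
  have VH: "conj_action N (V\<^sup>\<dagger>) h"
    unfolding conj_action_def adj_adj using unitary_adj[OF U] h by (intro conjI ballI) simp_all
  have "conj_action N ((V\<^sup>\<dagger>)\<^sup>\<dagger>) (inv_into (pvecs N) h)"
    by (rule conj_action_adj[OF VH inv_into_f_f[OF bij_betw_imp_inj_on[OF conj_action_bij[OF VH]]]])
  then have *: "conj_action N V (inv_into (pvecs N) h)" by simp
  show ?thesis by (rule conj_action_cong[OF * conj_action_unique[OF *]])
qed

text \<open>A coset of the Pauli group consists of the Clifford unitaries with the same action on Pauli operators.\<close>

lemma symplectic_class_eq:
  assumes V: "V \<in> carrier (clifford_group N)"
  shows "symplectic_class N V = {W \<in> carrier (clifford_group N). \<forall>p\<in>pvecs N. clifford_action N W p = clifford_action N V p}"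
proof -
  note VA = clifford_conj_action[OF V]
  note V' = conj_actionD[OF VA] and U = unitaryD[OF conj_actionD(1)[OF VA]]
  have eq: "symplectic_class N V = (\<lambda>P. P * V) ` pauli_group N"
    by (auto simp: symplectic_class_def r_coset_def clifford_group_def)
  show ?thesis
    unfolding eq
  proof (intro subset_antisym subsetI)
    fix W assume "W \<in> (\<lambda>P. P * V) ` pauli_group N"
    then obtain P where W: "W = P * V" and P: "P \<in> pauli_group N" by (rule imageE)
    have "conj_action N W (clifford_action N V \<circ> id)"
      unfolding W by (rule conj_action_mult[OF conj_action_pauli[OF P] VA])
    then have *: "conj_action N W (clifford_action N V)" by simp
    then show "W \<in> {W \<in> carrier (clifford_group N). \<forall>p\<in>pvecs N. clifford_action N W p = clifford_action N V p}"
      using conj_action_clifford[OF *] conj_action_unique[OF *] by simp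
  next
    fix W assume "W \<in> {W \<in> carrier (clifford_group N). \<forall>p\<in>pvecs N. clifford_action N W p = clifford_action N V p}"
    then have W: "W \<in> carrier (clifford_group N)" and same: "\<And>p. p \<in> pvecs N \<Longrightarrow> clifford_action N V p = clifford_action N W p" by auto
    have WV: "conj_action N W (clifford_action N V)" by (rule conj_action_cong[OF clifford_conj_action[OF W] same])
    note Wc = conj_actionD(2)[OF WV]
    note inj = bij_betw_imp_inj_on[OF conj_action_bij[OF VA]]
    define k where "k = inv_into (pvecs N) (clifford_action N V)"
    have Vk: "conj_action N (V\<^sup>\<dagger>) k" unfolding k_def by (rule conj_action_adj[OF VA inv_into_f_f[OF inj]])
    have "conj_action N (W * V\<^sup>\<dagger>) (k \<circ> clifford_action N V)" by (rule conj_action_mult[OF WV Vk])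
    moreover have "id p = (k \<circ> clifford_action N V) p" if "p \<in> pvecs N" for p
      using inv_into_f_f[OF inj that] by (simp add: k_def)
    ultimately have "conj_action N (W * V\<^sup>\<dagger>) id" by (rule conj_action_cong)
    then have P: "W * V\<^sup>\<dagger> \<in> pauli_group N" by (rule conj_action_id_pauli)
    have "(W * V\<^sup>\<dagger>) * V = W * (V\<^sup>\<dagger> * V)" by (rule sq_assoc[OF Wc adj_carrier[OF V'(2)] V'(2)])
    also have "\<dots> = W" unfolding U(3) by (rule right_mult_one_mat[OF Wc])
    finally show "W \<in> (\<lambda>P. P * V) ` pauli_group N" using P by (intro image_eqI[of _ _ "W * V\<^sup>\<dagger>"]) simp_all
  qed
qed

lemma symplectic_class_eqI:
  assumes "V \<in> carrier (clifford_group N)" "W \<in> carrier (clifford_group N)"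
    and "\<And>p. p \<in> pvecs N \<Longrightarrow> clifford_action N V p = clifford_action N W p"
  shows "symplectic_class N V = symplectic_class N W"
  unfolding symplectic_class_eq[OF assms(1)] symplectic_class_eq[OF assms(2)] using assms(3) by (simp cong: ball_cong)

lemma carrier_symplectic: "carrier (symplectic_group N) = symplectic_class N ` carrier (clifford_group N)"
  by (auto simp: symplectic_group_def FactGroup_def RCOSETS_def symplectic_class_def)

text \<open>The representative of a coset that the symplectic twirl uses.\<close>

definition rep :: "complex mat set \<Rightarrow> complex mat" where
  "rep c = (SOME C. C \<in> c)"

lemma rep_symplectic:
  assumes "c \<in> carrier (symplectic_group N)"
  shows "rep c \<in> carrier (clifford_group N)" "symplectic_class N (rep c) = c"
proof -
  obtain V where V: "V \<in> carrier (clifford_group N)" "c = symplectic_class N V"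
    using assms unfolding carrier_symplectic by (elim imageE)
  have c: "c = {W \<in> carrier (clifford_group N). \<forall>p\<in>pvecs N. clifford_action N W p = clifford_action N V p}"
    unfolding V(2) by (rule symplectic_class_eq[OF V(1)])
  then have "V \<in> c" using V(1) by simp
  then have r: "rep c \<in> c" unfolding rep_def by (rule someI)
  then have r': "rep c \<in> carrier (clifford_group N)" "\<And>p. p \<in> pvecs N \<Longrightarrow> clifford_action N (rep c) p = clifford_action N V p"
    unfolding c by simp_all
  show "rep c \<in> carrier (clifford_group N)" by (rule r'(1))
  show "symplectic_class N (rep c) = c" using symplectic_class_eqI[OF r'(1) V(1) r'(2)] V(2) by simp
qed

lemma clifford_action_rep:
  assumes V: "V \<in> carrier (clifford_group N)" and p: "p \<in> pvecs N"
  shows "clifford_action N (rep (symplectic_class N V)) p = clifford_action N V p"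
proof -
  have c: "symplectic_class N V \<in> carrier (symplectic_group N)" using V unfolding carrier_symplectic by (rule imageI)
  have "rep (symplectic_class N V) \<in> symplectic_class N (rep (symplectic_class N V))"
    unfolding symplectic_class_eq[OF rep_symplectic(1)[OF c]] using rep_symplectic(1)[OF c] by simp
  then have "rep (symplectic_class N V) \<in> symplectic_class N V" unfolding rep_symplectic(2)[OF c] .
  then show ?thesis unfolding symplectic_class_eq[OF V] using p by simp
qed

lemma finite_symplectic: "finite (carrier (symplectic_group N))"
proof -
  define G where "G c = (\<lambda>p. (p, clifford_action N (rep c) p)) ` pvecs N" for c
  have "inj_on G (carrier (symplectic_group N))"
  proof (rule inj_onI)
    fix c c' assume c: "c \<in> carrier (symplectic_group N)" "c' \<in> carrier (symplectic_group N)" and eq: "G c = G c'"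
    have "clifford_action N (rep c) p = clifford_action N (rep c') p" if p: "p \<in> pvecs N" for p
    proof -
      have "(p, clifford_action N (rep c) p) \<in> G c" unfolding G_def using p by (rule imageI)
      then have "(p, clifford_action N (rep c) p) \<in> G c'" unfolding eq .
      then show ?thesis unfolding G_def by (elim imageE) simp
    qed
    then have "symplectic_class N (rep c) = symplectic_class N (rep c')"
      by (rule symplectic_class_eqI[OF rep_symplectic(1)[OF c(1)] rep_symplectic(1)[OF c(2)]])
    then show "c = c'" unfolding rep_symplectic(2)[OF c(1)] rep_symplectic(2)[OF c(2)] .
  qed
  moreover have "G ` carrier (symplectic_group N) \<subseteq> Pow (pvecs N \<times> pvecs N)"
    using conj_actionD(3)[OF clifford_conj_action[OF rep_symplectic(1)]] by (auto simp: G_def)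
  then have "finite (G ` carrier (symplectic_group N))" by (rule finite_subset) simp
  ultimately show ?thesis by (intro finite_imageD[of G])
qed

lemma symplectic_nonempty: "carrier (symplectic_group N) \<noteq> {}"
  using conj_action_clifford[OF conj_action_one] unfolding carrier_symplectic by auto

abbreviation pnz :: "nat \<Rightarrow> pidx set" where
  "pnz N \<equiv> pvecs N - {(0, 0)}"

text \<open>Right multiplication by \<open>U\<close> maps the cosets that send \<open>p\<close> to \<open>q\<close> injectively to those that send \<open>p\<close> to the image of \<open>q\<close> under \<open>U\<close>.\<close>

lemma card_symplectic_le:
  assumes U: "U \<in> carrier (clifford_group N)" and p: "p \<in> pvecs N"
  shows "card {c \<in> carrier (symplectic_group N). clifford_action N (rep c) p = q} \<le> card {c \<in> carrier (symplectic_group N). clifford_action N (rep c) p = clifford_action N U q}"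
proof (rule card_inj_on_le)
  define T where "T c = symplectic_class N (rep c * U)" for c
  have UA: "conj_action N U (clifford_action N U)" by (rule clifford_conj_action[OF U])
  have RA: "conj_action N (rep c * U) (clifford_action N U \<circ> clifford_action N (rep c))" if "c \<in> carrier (symplectic_group N)" for c
    by (rule conj_action_mult[OF clifford_conj_action[OF rep_symplectic(1)[OF that]] UA])
  have R: "rep c * U \<in> carrier (clifford_group N)" if "c \<in> carrier (symplectic_group N)" for c
    by (rule conj_action_clifford[OF RA[OF that]])
  have gT: "clifford_action N (rep (T c)) p = clifford_action N U (clifford_action N (rep c) p)" if "c \<in> carrier (symplectic_group N)" "p \<in> pvecs N" for c p
    unfolding T_def clifford_action_rep[OF R[OF that(1)] that(2)] conj_action_unique[OF RA[OF that(1)] that(2)] by simp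
  show "inj_on T {c \<in> carrier (symplectic_group N). clifford_action N (rep c) p = q}"
  proof (rule inj_onI)
    fix c c' assume "c \<in> {c \<in> carrier (symplectic_group N). clifford_action N (rep c) p = q}" "c' \<in> {c \<in> carrier (symplectic_group N). clifford_action N (rep c) p = q}"
      and eq: "T c = T c'"
    then have c: "c \<in> carrier (symplectic_group N)" "c' \<in> carrier (symplectic_group N)" by auto
    have "clifford_action N (rep c) r = clifford_action N (rep c') r" if r: "r \<in> pvecs N" for r
    proof -
      have "clifford_action N U (clifford_action N (rep c) r) = clifford_action N U (clifford_action N (rep c') r)"
        unfolding gT[OF c(1) r, symmetric] gT[OF c(2) r, symmetric] eq ..
      then show ?thesis
        by (rule inj_onD[OF bij_betw_imp_inj_on[OF conj_action_bij[OF UA]]])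
          (intro conj_actionD(3)[OF clifford_conj_action[OF rep_symplectic(1)]] c r)+
    qed
    then have "symplectic_class N (rep c) = symplectic_class N (rep c')"
      by (rule symplectic_class_eqI[OF rep_symplectic(1)[OF c(1)] rep_symplectic(1)[OF c(2)]])
    then show "c = c'" unfolding rep_symplectic(2)[OF c(1)] rep_symplectic(2)[OF c(2)] .
  qed
  show "T ` {c \<in> carrier (symplectic_group N). clifford_action N (rep c) p = q} \<subseteq> {c \<in> carrier (symplectic_group N). clifford_action N (rep c) p = clifford_action N U q}"
  proof (rule image_subsetI)
    fix c assume "c \<in> {c \<in> carrier (symplectic_group N). clifford_action N (rep c) p = q}"
    then have c: "c \<in> carrier (symplectic_group N)" "clifford_action N (rep c) p = q" by auto
    have "T c \<in> carrier (symplectic_group N)" unfolding T_def carrier_symplectic by (rule imageI[OF R[OF c(1)]])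
    then show "T c \<in> {c \<in> carrier (symplectic_group N). clifford_action N (rep c) p = clifford_action N U q}"
      using gT[OF c(1) p] c(2) by simp
  qed
  show "finite {c \<in> carrier (symplectic_group N). clifford_action N (rep c) p = clifford_action N U q}"
    using finite_symplectic by simp
qed

text \<open>The Markov kernel of the twirl by the whole symplectic group.\<close>

definition symplectic_kernel :: "nat \<Rightarrow> pidx \<Rightarrow> pidx \<Rightarrow> real" where
  "symplectic_kernel N = avg_kernel (carrier (symplectic_group N)) (\<lambda>c. clifford_action N (rep c))"

lemma conj_action_nonzero:
  assumes "conj_action N V g" "p \<in> pnz N"
  shows "g p \<in> pnz N"
proof -
  have z: "(0, 0) \<in> pvecs N" by (simp add: pvecs_def)
  have "g p \<noteq> (0, 0)"
  proof
    assume "g p = (0, 0)"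
    then have "g p = g (0, 0)" using conj_action_zero[OF assms(1)] by simp
    then have "p = (0, 0)" by (rule inj_onD[OF bij_betw_imp_inj_on[OF conj_action_bij[OF assms(1)]]]) (use assms z in auto)
    then show False using assms(2) by simp
  qed
  then show ?thesis using conj_actionD(3)[OF assms(1), of p] assms(2) by simp
qed

lemma avg_kernel_zero:
  assumes I: "finite I" "I \<noteq> {}" and C: "\<And>i. i \<in> I \<Longrightarrow> conj_action N (C i) (g i)"
  shows "avg_kernel I g (0, 0) q = (if q = (0, 0) then 1 else 0)" "p \<in> pnz N \<Longrightarrow> avg_kernel I g p (0, 0) = 0"
proof -
  have "{i \<in> I. g i (0, 0) = q} = (if q = (0, 0) then I else {})" using conj_action_zero[OF C] by auto
  then show "avg_kernel I g (0, 0) q = (if q = (0, 0) then 1 else 0)"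
    using I by (simp add: avg_kernel_def)
  assume p: "p \<in> pnz N"
  have "{i \<in> I. g i p = (0, 0)} = {}" using conj_action_nonzero[OF C p] by auto
  then show "avg_kernel I g p (0, 0) = 0" unfolding avg_kernel_def by (simp only: card.empty of_nat_0 div_0)
qed

lemma sum_avg_kernel:
  assumes I: "finite I" "I \<noteq> {}" and C: "\<And>i. i \<in> I \<Longrightarrow> conj_action N (C i) (g i)" and p: "p \<in> pnz N"
  shows "(\<Sum>q\<in>pnz N. avg_kernel I g p q) = 1"
proof -
  have "(\<Sum>q\<in>pnz N. real (card {i \<in> I. g i p = q})) = (\<Sum>q\<in>pnz N. \<Sum>i\<in>I. if g i p = q then 1 else 0)"
    using I by (intro sum.cong refl) (simp add: sum.If_cases Int_def)
  also have "\<dots> = (\<Sum>i\<in>I. \<Sum>q\<in>pnz N. if g i p = q then 1 else 0)" by (rule sum.swap)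
  also have "\<dots> = (\<Sum>i\<in>I. 1)"
  proof (rule sum.cong)
    fix i assume i: "i \<in> I"
    show "(\<Sum>q\<in>pnz N. if g i p = q then 1 else 0) = (1 :: real)"
      using conj_action_nonzero[OF C[OF i] p] by (simp only: sum.delta' finite_Diff finite_pvecs if_True)
  qed simp
  finally have "(\<Sum>q\<in>pnz N. real (card {i \<in> I. g i p = q})) = real (card I)" by simp
  then show ?thesis using I unfolding avg_kernel_def by (simp flip: sum_divide_distrib)
qed

lemma card_pnz: "real (card (pnz N)) = (2 ^ N)\<^sup>2 - 1"
  by (simp add: card_Diff_singleton pvecs_def card_cartesian_product card_vecs power2_eq_square of_nat_diff)

lemma symplectic_kernel_uniform:
  assumes trans: "\<And>q q'. q \<in> pnz N \<Longrightarrow> q' \<in> pnz N \<Longrightarrow> \<exists>U\<in>carrier (clifford_group N). clifford_action N U q = q'"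
    and p: "p \<in> pnz N" and q: "q \<in> pnz N"
  shows "symplectic_kernel N p q = 1 / ((2 ^ N)\<^sup>2 - 1)"
proof -
  have le: "symplectic_kernel N p q \<le> symplectic_kernel N p q'" if qq: "q \<in> pnz N" "q' \<in> pnz N" for q q'
  proof -
    obtain U where U: "U \<in> carrier (clifford_group N)" "clifford_action N U q = q'" using trans[OF qq] by (elim bexE)
    show ?thesis
      using card_symplectic_le[OF U(1), of p q] p U(2) by (simp add: symplectic_kernel_def avg_kernel_def divide_right_mono)
  qed
  then have eq: "symplectic_kernel N p q' = symplectic_kernel N p q" if "q' \<in> pnz N" for q' using q that by (intro antisym) auto
  have "(\<Sum>q'\<in>pnz N. symplectic_kernel N p q') = 1"
    unfolding symplectic_kernel_def
    by (rule sum_avg_kernel[OF finite_symplectic symplectic_nonempty clifford_conj_action[OF rep_symplectic(1)] p])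
  then have "real (card (pnz N)) * symplectic_kernel N p q = 1" by (simp add: eq)
  moreover have "k = 1 / c" if "c * k = 1" for c k :: real
  proof -
    have "c \<noteq> 0" using that by auto
    then show ?thesis using that by (simp add: field_simps)
  qed
  ultimately show ?thesis unfolding card_pnz[symmetric] by blast
qed

lemma symplectic_twirl_pauli_mix:
  assumes \<Lambda>: "\<And>\<rho>. \<rho> \<in> cmat N \<Longrightarrow> \<Lambda> \<rho> = pauli_mix N \<alpha> \<rho>" and \<rho>: "\<rho> \<in> cmat N"
  shows "symplectic_twirl N \<Lambda> \<rho> = pauli_mix N (\<lambda>q. \<Sum>p\<in>pvecs N. \<alpha> p * complex_of_real (symplectic_kernel N p q)) \<rho>"
proof -
  let ?S = "carrier (symplectic_group N)"
  have A: "conj_action N (rep c) (clifford_action N (rep c))" if "c \<in> ?S" for c by (rule clifford_conj_action[OF rep_symplectic(1)[OF that]])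
  have "mat_sum (2 ^ N) (\<lambda>c. let C = (SOME C. C \<in> c) in C\<^sup>\<dagger> * \<Lambda> (C * \<rho> * C\<^sup>\<dagger>) * C) ?S
     = mat_sum (2 ^ N) (\<lambda>c. (rep c)\<^sup>\<dagger> * pauli_mix N \<alpha> (rep c * \<rho> * (rep c)\<^sup>\<dagger>) * rep c) ?S"
  proof (rule mat_sum_cong)
    fix c assume c: "c \<in> ?S"
    have r: "rep c \<in> cmat N" by (rule conj_actionD(2)[OF A[OF c]])
    have "rep c * \<rho> * (rep c)\<^sup>\<dagger> \<in> cmat N" using r by (intro sq_closed \<rho>) auto
    then show "(let C = (SOME C. C \<in> c) in C\<^sup>\<dagger> * \<Lambda> (C * \<rho> * C\<^sup>\<dagger>) * C) = (rep c)\<^sup>\<dagger> * pauli_mix N \<alpha> (rep c * \<rho> * (rep c)\<^sup>\<dagger>) * rep c"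
      unfolding Let_def rep_def[symmetric] by (simp only: \<Lambda>)
  qed
  then show ?thesis
    unfolding symplectic_twirl_def symplectic_kernel_def by (simp only: pauli_mix_average[OF finite_symplectic A \<rho>])
qed

text \<open>If all non-identity weights are equal, the superoperator is a combination of the identity map and the completely depolarizing map.\<close>

lemma pauli_mix_flat:
  assumes \<gamma>: "\<And>q. q \<in> pnz N \<Longrightarrow> \<gamma> q = \<beta>" and \<rho>: "\<rho> \<in> cmat N"
  shows "pauli_mix N \<gamma> \<rho> = (\<gamma> (0, 0) - \<beta>) \<cdot>\<^sub>m \<rho> + (\<beta> * (2 ^ N * trace \<rho>)) \<cdot>\<^sub>m 1\<^sub>m (2 ^ N)"
proof (rule ent_eqI[of _ N])
  fix x y assume xy: "x \<in> vecs N" "y \<in> vecs N"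
  define X where "X p = ent N (pm N p * \<rho> * (pm N p)\<^sup>\<dagger>) x y" for p
  have z: "(0, 0) \<in> pvecs N" by (simp add: pvecs_def)
  have X0: "X (0, 0) = ent N \<rho> x y"
    unfolding X_def ent_pm_conj[OF z \<rho> xy] by simp
  have s: "(\<Sum>p\<in>pvecs N. X p) = ent N ((2 ^ N * trace \<rho>) \<cdot>\<^sub>m 1\<^sub>m (2 ^ N)) x y"
    unfolding X_def sum_pm_conj[OF \<rho>, symmetric] ent_mat_sum[OF xy] ..
  have "ent N (pauli_mix N \<gamma> \<rho>) x y = (\<Sum>p\<in>pvecs N. \<gamma> p * X p)"
    unfolding pauli_mix_def ent_mat_sum[OF xy] ent_smult[OF pm_conj_carrier[OF \<rho>] xy] X_def ..
  also have "\<dots> = \<gamma> (0, 0) * X (0, 0) + (\<Sum>p\<in>pnz N. \<gamma> p * X p)" by (rule sum.remove[OF finite_pvecs z])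
  also have "(\<Sum>p\<in>pnz N. \<gamma> p * X p) = \<beta> * (\<Sum>p\<in>pnz N. X p)" unfolding sum_distrib_left by (intro sum.cong refl) (simp add: \<gamma>)
  also have "(\<Sum>p\<in>pnz N. X p) = (\<Sum>p\<in>pvecs N. X p) - X (0, 0)" using sum.remove[OF finite_pvecs z, of X] by simp
  also have "\<gamma> (0, 0) * X (0, 0) + \<beta> * ((\<Sum>p\<in>pvecs N. X p) - X (0, 0)) = (\<gamma> (0, 0) - \<beta>) * X (0, 0) + \<beta> * (\<Sum>p\<in>pvecs N. X p)"
    by (simp add: algebra_simps)
  also have "\<dots> = ent N ((\<gamma> (0, 0) - \<beta>) \<cdot>\<^sub>m \<rho> + (\<beta> * (2 ^ N * trace \<rho>)) \<cdot>\<^sub>m 1\<^sub>m (2 ^ N)) x y"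
    unfolding X0 s using \<rho> xy by (simp add: ent_def)
  finally show "ent N (pauli_mix N \<gamma> \<rho>) x y = ent N ((\<gamma> (0, 0) - \<beta>) \<cdot>\<^sub>m \<rho> + (\<beta> * (2 ^ N * trace \<rho>)) \<cdot>\<^sub>m 1\<^sub>m (2 ^ N)) x y" .
qed (use \<rho> in auto)

lemma pauli_mix_flat_invariant:
  assumes \<Lambda>: "\<And>\<rho>. \<rho> \<in> cmat N \<Longrightarrow> \<Lambda> \<rho> = pauli_mix N \<gamma> \<rho>" and \<gamma>: "\<And>q. q \<in> pnz N \<Longrightarrow> \<gamma> q = \<beta>"
  shows "unitarily_invariant (2 ^ N) \<Lambda>"
  unfolding unitarily_invariant_def
proof (intro ballI)
  fix U \<rho> assume U: "U \<in> unitary (2 ^ N)" and \<rho>: "\<rho> \<in> cmat N"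
  note U' = unitaryD[OF U]
  have Ua: "U\<^sup>\<dagger> \<in> cmat N" using U'(1) by simp
  have flat: "pauli_mix N \<gamma> \<sigma> = (\<gamma> (0, 0) - \<beta>) \<cdot>\<^sub>m \<sigma> + (\<beta> * (2 ^ N * trace \<sigma>)) \<cdot>\<^sub>m 1\<^sub>m (2 ^ N)" if "\<sigma> \<in> cmat N" for \<sigma>
    by (rule pauli_mix_flat[OF _ that]) (rule \<gamma>)
  let ?s = "U\<^sup>\<dagger> * \<rho> * U"
  have s: "?s \<in> cmat N" by (intro sq_closed Ua \<rho> U'(1))
  have "trace ?s = trace (U * (U\<^sup>\<dagger> * \<rho>))" by (rule trace_mult_commute[OF sq_closed[OF Ua \<rho>] U'(1)])
  also have "U * (U\<^sup>\<dagger> * \<rho>) = (U * U\<^sup>\<dagger>) * \<rho>" by (rule sq_assoc[OF U'(1) Ua \<rho>, symmetric])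
  also have "\<dots> = \<rho>" unfolding U'(2) by (rule left_mult_one_mat[OF \<rho>])
  finally have tr: "trace ?s = trace \<rho>" .
  let ?a = "\<gamma> (0, 0) - \<beta>" and ?b = "\<beta> * (2 ^ N * trace \<rho>)"
  have "\<Lambda> ?s = ?a \<cdot>\<^sub>m ?s + ?b \<cdot>\<^sub>m 1\<^sub>m (2 ^ N)"
    unfolding \<Lambda>[OF s] flat[OF s] tr ..
  then have "U * \<Lambda> ?s * U\<^sup>\<dagger> = U * (?a \<cdot>\<^sub>m ?s + ?b \<cdot>\<^sub>m 1\<^sub>m (2 ^ N)) * U\<^sup>\<dagger>" by (simp only:)
  also have "\<dots> = (U * (?a \<cdot>\<^sub>m ?s) + U * (?b \<cdot>\<^sub>m 1\<^sub>m (2 ^ N))) * U\<^sup>\<dagger>"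
    by (subst mult_add_distrib_mat[OF U'(1) smult_carrier_mat[OF s] smult_carrier_mat[OF one_carrier_mat]]) (rule refl)
  also have "\<dots> = U * (?a \<cdot>\<^sub>m ?s) * U\<^sup>\<dagger> + U * (?b \<cdot>\<^sub>m 1\<^sub>m (2 ^ N)) * U\<^sup>\<dagger>"
    by (rule add_mult_distrib_mat[OF sq_closed[OF U'(1) smult_carrier_mat[OF s]] sq_closed[OF U'(1) smult_carrier_mat[OF one_carrier_mat]] Ua])
  also have "\<dots> = ?a \<cdot>\<^sub>m (U * ?s * U\<^sup>\<dagger>) + ?b \<cdot>\<^sub>m (U * 1\<^sub>m (2 ^ N) * U\<^sup>\<dagger>)"
    unfolding conj_smult[OF U'(1) s Ua] conj_smult[OF U'(1) one_carrier_mat Ua] ..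
  also have "U * ?s * U\<^sup>\<dagger> = \<rho>" by (rule unitary_conj_cancel(1)[OF U \<rho>])
  also have "U * 1\<^sub>m (2 ^ N) * U\<^sup>\<dagger> = 1\<^sub>m (2 ^ N)" unfolding right_mult_one_mat[OF U'(1)] by (rule U'(2))
  also have "?a \<cdot>\<^sub>m \<rho> + ?b \<cdot>\<^sub>m 1\<^sub>m (2 ^ N) = \<Lambda> \<rho>"
    unfolding \<Lambda>[OF \<rho>] flat[OF \<rho>] ..
  finally show "U * \<Lambda> (U\<^sup>\<dagger> * \<rho> * U) * U\<^sup>\<dagger> = \<Lambda> \<rho>" .
qed

section \<open>Twirling by the random circuits\<close>
lemma pauli_mix_diff:
  assumes \<rho>: "\<rho> \<in> cmat N"
  shows "pauli_mix N \<alpha> \<rho> - pauli_mix N \<beta> \<rho> = pauli_mix N (\<lambda>p. \<alpha> p - \<beta> p) \<rho>"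
proof (rule ent_eqI[of _ N])
  fix x y assume xy: "x \<in> vecs N" "y \<in> vecs N"
  have "ent N (pauli_mix N \<alpha> \<rho> - pauli_mix N \<beta> \<rho>) x y = ent N (pauli_mix N \<alpha> \<rho>) x y - ent N (pauli_mix N \<beta> \<rho>) x y"
    using pauli_mix_carrier[of N \<alpha> \<rho>] pauli_mix_carrier[of N \<beta> \<rho>] xy by (simp add: ent_def del: pauli_mix_carrier)
  also have "\<dots> = ent N (pauli_mix N (\<lambda>p. \<alpha> p - \<beta> p) \<rho>) x y"
    unfolding ent_pauli_mix[OF \<rho> xy] by (simp add: left_diff_distrib sum_subtractf)
  finally show "ent N (pauli_mix N \<alpha> \<rho> - pauli_mix N \<beta> \<rho>) x y = ent N (pauli_mix N (\<lambda>p. \<alpha> p - \<beta> p) \<rho>) x y" .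
qed (auto intro: minus_carrier_mat)

lemma blists_bit_strings: "bit_strings r = blists r"
  by (simp add: bit_strings_def blists_def)

lemma trans_prob_avg_kernel: "trans_prob r circ p q = avg_kernel (bit_strings r) (\<lambda>b. act (concat (circ b))) p q"
  by (simp add: trans_prob_def avg_kernel_def blists_bit_strings card_blists)

lemma sampled_twirl_pauli_mix:
  assumes ok: "\<And>b. scircuit_ok N (circ b)" and \<Lambda>: "\<And>\<rho>. \<rho> \<in> cmat N \<Longrightarrow> \<Lambda> \<rho> = pauli_mix N \<alpha> \<rho>" and \<rho>: "\<rho> \<in> cmat N"
  shows "sampled_twirl N r (\<lambda>b. to_circuit (circ b)) \<Lambda> \<rho>
    = pauli_mix N (\<lambda>q. \<Sum>p\<in>pvecs N. \<alpha> p * complex_of_real (trans_prob r circ p q)) \<rho>"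
proof -
  let ?C = "\<lambda>b. circuit_unitary N (to_circuit (circ b))"
  have A: "conj_action N (?C b) (act (concat (circ b)))" for b by (rule circuit_conj_action[OF ok])
  have fin: "finite (bit_strings r)" by (simp add: blists_bit_strings)
  have card: "(2 :: complex) ^ r = of_nat (card (bit_strings r))" by (simp add: blists_bit_strings card_blists)
  have "mat_sum (2 ^ N) (\<lambda>b. let C = ?C b in C\<^sup>\<dagger> * \<Lambda> (C * \<rho> * C\<^sup>\<dagger>) * C) (bit_strings r)
     = mat_sum (2 ^ N) (\<lambda>b. (?C b)\<^sup>\<dagger> * pauli_mix N \<alpha> (?C b * \<rho> * (?C b)\<^sup>\<dagger>) * ?C b) (bit_strings r)"
  proof (rule mat_sum_cong)
    fix b
    have c: "?C b \<in> cmat N" by (rule conj_actionD(2)[OF A])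
    have "?C b * \<rho> * (?C b)\<^sup>\<dagger> \<in> cmat N" by (intro sq_closed \<rho> c adj_carrier)
    then show "(let C = ?C b in C\<^sup>\<dagger> * \<Lambda> (C * \<rho> * C\<^sup>\<dagger>) * C) = (?C b)\<^sup>\<dagger> * pauli_mix N \<alpha> (?C b * \<rho> * (?C b)\<^sup>\<dagger>) * ?C b"
      unfolding Let_def by (simp only: \<Lambda>)
  qed
  then show ?thesis
    unfolding sampled_twirl_def card trans_prob_avg_kernel by (simp only: pauli_mix_average[OF fin A \<rho>])
qed

lemma sampled_subset_symplectic:
  assumes "\<And>b. scircuit_ok N (circ b)"
  shows "sampled_subset N r (\<lambda>b. to_circuit (circ b)) \<subseteq> carrier (symplectic_group N)"
  unfolding sampled_subset_def carrier_symplectic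
  using conj_action_clifford[OF circuit_conj_action[OF assms]] by (intro image_subsetI imageI)

text \<open>Transitivity follows from mixing: a transition of probability \<open>0\<close> would already deviate from the uniform distribution by more
  than \<open>1 / D ^ 3\<close>.\<close>

lemma symplectic_transitive:
  assumes N: "1 \<le> N" and ok: "\<And>b. scircuit_ok N (circ b)"
    and mix: "\<And>p. p \<in> pnz N \<Longrightarrow> (\<Sum>q\<in>pnz N. \<bar>trans_prob r circ p q - 1 / ((2 ^ N)\<^sup>2 - 1)\<bar>) \<le> 1 / (2 ^ N) ^ 3"
    and q: "q \<in> pnz N" "q' \<in> pnz N"
  shows "\<exists>U\<in>carrier (clifford_group N). clifford_action N U q = q'"
proof -
  define D :: real where "D = 2 ^ N"
  have "(2::real) ^ 1 \<le> 2 ^ N" using N by (intro power_increasing) auto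
  then have D: "2 \<le> D" by (simp add: D_def)
  have "\<bar>trans_prob r circ q q' - 1 / (D\<^sup>2 - 1)\<bar> \<le> (\<Sum>q'\<in>pnz N. \<bar>trans_prob r circ q q' - 1 / (D\<^sup>2 - 1)\<bar>)"
    using q(2) by (intro member_le_sum) auto
  also have "\<dots> \<le> 1 / D ^ 3" using mix[OF q(1)] by (simp add: D_def)
  also have "1 / D ^ 3 < 1 / (D\<^sup>2 - 1)"
  proof (rule divide_strict_left_mono)
    have "1 * 1 < D * D" using D by (intro mult_strict_mono) auto
    then show "0 < D ^ 3 * (D\<^sup>2 - 1)" using D by (simp add: power2_eq_square)
    have "1 * (D * D) \<le> D * (D * D)" using D by (intro mult_right_mono) auto
    then show "D\<^sup>2 - 1 < D ^ 3" unfolding power2_eq_square power3_eq_cube mult.assoc by linarith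
  qed simp
  finally have "trans_prob r circ q q' \<noteq> 0" by auto
  then have "{bs \<in> blists r. act (concat (circ bs)) q = q'} \<noteq> {}" unfolding trans_prob_def by force
  then obtain bs where bs: "act (concat (circ bs)) q = q'" by auto
  let ?U = "circuit_unitary N (to_circuit (circ bs))"
  have A: "conj_action N ?U (act (concat (circ bs)))" by (rule circuit_conj_action[OF ok])
  show ?thesis
    using conj_action_unique[OF A, of q] q bs by (intro bexI[OF _ conj_action_clifford[OF A]]) simp
qed

lemma sum_kernel_diff:
  fixes T S :: "pidx \<Rightarrow> pidx \<Rightarrow> real" and a :: "pidx \<Rightarrow> real"
  assumes a: "\<And>p. 0 \<le> a p"
    and T0: "\<And>q. T (0, 0) q = S (0, 0) q" and Tz: "\<And>p. p \<in> pnz N \<Longrightarrow> T p (0, 0) = S p (0, 0)"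
    and mix: "\<And>p. p \<in> pnz N \<Longrightarrow> (\<Sum>q\<in>pnz N. \<bar>T p q - S p q\<bar>) \<le> \<delta>"
  shows "(\<Sum>q\<in>pvecs N. cmod ((\<Sum>p\<in>pvecs N. complex_of_real (a p) * complex_of_real (T p q)) - (\<Sum>p\<in>pvecs N. complex_of_real (a p) * complex_of_real (S p q))))
     \<le> (\<Sum>p\<in>pnz N. a p) * \<delta>"
proof -
  have z: "(0, 0) \<in> pvecs N" by (simp add: pvecs_def)
  have d: "(\<Sum>p\<in>pvecs N. complex_of_real (a p) * complex_of_real (T p q)) - (\<Sum>p\<in>pvecs N. complex_of_real (a p) * complex_of_real (S p q))
     = complex_of_real (\<Sum>p\<in>pnz N. a p * (T p q - S p q))" for q
  proof -
    have "(\<Sum>p\<in>pvecs N. complex_of_real (a p) * complex_of_real (T p q)) - (\<Sum>p\<in>pvecs N. complex_of_real (a p) * complex_of_real (S p q))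
      = complex_of_real (\<Sum>p\<in>pvecs N. a p * (T p q - S p q))"
      by (simp add: sum_subtractf right_diff_distrib)
    also have "(\<Sum>p\<in>pvecs N. a p * (T p q - S p q)) = (\<Sum>p\<in>pnz N. a p * (T p q - S p q))"
      unfolding sum.remove[OF finite_pvecs z] by (simp add: T0)
    finally show ?thesis .
  qed
  have "(\<Sum>q\<in>pvecs N. cmod ((\<Sum>p\<in>pvecs N. complex_of_real (a p) * complex_of_real (T p q)) - (\<Sum>p\<in>pvecs N. complex_of_real (a p) * complex_of_real (S p q))))
     = (\<Sum>q\<in>pvecs N. \<bar>\<Sum>p\<in>pnz N. a p * (T p q - S p q)\<bar>)"
    unfolding d by (simp only: norm_of_real)
  also have "\<dots> = (\<Sum>q\<in>pnz N. \<bar>\<Sum>p\<in>pnz N. a p * (T p q - S p q)\<bar>)"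
    unfolding sum.remove[OF finite_pvecs z] by (simp add: Tz)
  also have "\<dots> \<le> (\<Sum>q\<in>pnz N. \<Sum>p\<in>pnz N. a p * \<bar>T p q - S p q\<bar>)"
    using a by (intro sum_mono order_trans[OF sum_abs]) (simp add: abs_mult)
  also have "\<dots> = (\<Sum>p\<in>pnz N. a p * (\<Sum>q\<in>pnz N. \<bar>T p q - S p q\<bar>))"
    unfolding sum_distrib_left by (rule sum.swap)
  also have "\<dots> \<le> (\<Sum>p\<in>pnz N. a p * \<delta>)" using a mix by (intro sum_mono mult_left_mono) auto
  finally show ?thesis by (simp only: sum_distrib_right)
qed

lemma eps0_ge:
  assumes "1 \<le> N"
  shows "1 / (2 ^ N) ^ 3 \<le> eps0 N / (2 ^ N)\<^sup>2"
proof -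
  define D :: real where "D = 2 ^ N"
  have "(2::real) ^ 1 \<le> 2 ^ N" using assms by (intro power_increasing) auto
  then have D: "2 \<le> D" by (simp add: D_def)
  have "1 / D ^ 3 = 1 / D / D\<^sup>2" using D by (simp add: power2_eq_square power3_eq_cube)
  also have "1 / D \<le> 1 / (D - 1 / D)"
  proof (rule divide_left_mono)
    have "1 / D \<le> 1" using D by simp
    then have "0 < D - 1 / D" using D by linarith
    then show "0 < D * (D - 1 / D)" using D by simp
    show "D - 1 / D \<le> D" using D by simp
  qed simp
  then have "1 / D / D\<^sup>2 \<le> 1 / (D - 1 / D) / D\<^sup>2" by (intro divide_right_mono) auto
  finally show ?thesis by (simp add: D_def eps0_def)
qed

lemma twirls_of_mixing_circuits:
  assumes N: "1 \<le> N" and ok: "\<And>b. scircuit_ok N (circ b)"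
    and mix: "\<And>p. p \<in> pnz N \<Longrightarrow> (\<Sum>q\<in>pnz N. \<bar>trans_prob r circ p q - 1 / ((2 ^ N)\<^sup>2 - 1)\<bar>) \<le> 1 / (2 ^ N) ^ 3"
    and \<Lambda>: "completely_positive (2 ^ N) \<Lambda>" and \<epsilon>: "0 < \<epsilon>"
  shows "pauli_superop N (pauli_twirl N \<Lambda>)"
    "unitarily_invariant (2 ^ N) (symplectic_twirl N (pauli_twirl N \<Lambda>))"
    "diamond_norm (2 ^ N) (\<lambda>\<rho>. sampled_twirl N r (\<lambda>b. to_circuit (circ b)) (pauli_twirl N \<Lambda>) \<rho> - symplectic_twirl N (pauli_twirl N \<Lambda>) \<rho>)
      \<le> ereal (error_factor (2 ^ N) \<Lambda> * (eps0 N + \<epsilon>))"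
proof -
  obtain m :: nat and A where "m \<le> (2 ^ N)\<^sup>2" and AK: "\<forall>k<m. A k \<in> cmat N" "\<forall>\<rho>\<in>cmat N. \<Lambda> \<rho> = mat_sum (2 ^ N) (\<lambda>k. A k * \<rho> * (A k)\<^sup>\<dagger>) {..<m}"
    using \<Lambda> unfolding completely_positive_def by (elim exE conjE)
  have A: "A k \<in> cmat N" if "k < m" for k using AK(1) that by simp
  have K: "\<Lambda> \<rho> = mat_sum (2 ^ N) (\<lambda>k. A k * \<rho> * (A k)\<^sup>\<dagger>) {..<m}" if "\<rho> \<in> cmat N" for \<rho>
    using AK(2) that by (rule bspec)
  let ?a = "twirl_weight N A m"
  have P: "pauli_twirl N \<Lambda> \<rho> = pauli_mix N (\<lambda>p. complex_of_real (?a p)) \<rho>" if "\<rho> \<in> cmat N" for \<rho>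
    using A K that by (rule pauli_twirl_eq_pauli_mix)
  show "pauli_superop N (pauli_twirl N \<Lambda>)" using P by (rule pauli_superop_pauli_mix)
  let ?S = "carrier (symplectic_group N)"
  have SA: "conj_action N (rep c) (clifford_action N (rep c))" if "c \<in> ?S" for c by (rule clifford_conj_action[OF rep_symplectic(1)[OF that]])
  have sk: "symplectic_kernel N p q = 1 / ((2 ^ N)\<^sup>2 - 1)" if "p \<in> pnz N" "q \<in> pnz N" for p q
    using symplectic_transitive[OF N ok mix] that by (rule symplectic_kernel_uniform)
  have z: "(0, 0) \<in> pvecs N" by (simp add: pvecs_def)
  let ?\<gamma> = "\<lambda>q. \<Sum>p\<in>pvecs N. complex_of_real (?a p) * complex_of_real (symplectic_kernel N p q)"
  have U: "symplectic_twirl N (pauli_twirl N \<Lambda>) \<rho> = pauli_mix N ?\<gamma> \<rho>" if "\<rho> \<in> cmat N" for \<rho>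
    using P that by (rule symplectic_twirl_pauli_mix)
  have "?\<gamma> q = (\<Sum>p\<in>pnz N. complex_of_real (?a p)) * complex_of_real (1 / ((2 ^ N)\<^sup>2 - 1))" if q: "q \<in> pnz N" for q
  proof -
    have "symplectic_kernel N (0, 0) q = 0"
      unfolding symplectic_kernel_def using avg_kernel_zero(1)[OF finite_symplectic symplectic_nonempty SA] q by simp
    then have "?\<gamma> q = (\<Sum>p\<in>pnz N. complex_of_real (?a p) * complex_of_real (symplectic_kernel N p q))"
      unfolding sum.remove[OF finite_pvecs z] by simp
    also have "\<dots> = (\<Sum>p\<in>pnz N. complex_of_real (?a p) * complex_of_real (1 / ((2 ^ N)\<^sup>2 - 1)))"
      by (rule sum.cong[OF refl]) (simp only: sk[OF _ q])
    finally show ?thesis by (simp only: sum_distrib_right)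
  qed
  with U show "unitarily_invariant (2 ^ N) (symplectic_twirl N (pauli_twirl N \<Lambda>))" by (rule pauli_mix_flat_invariant)
  let ?\<tau> = "\<lambda>q. \<Sum>p\<in>pvecs N. complex_of_real (?a p) * complex_of_real (trans_prob r circ p q)"
  have "sampled_twirl N r (\<lambda>b. to_circuit (circ b)) (pauli_twirl N \<Lambda>) \<rho> - symplectic_twirl N (pauli_twirl N \<Lambda>) \<rho>
     = pauli_mix N (\<lambda>q. ?\<tau> q - ?\<gamma> q) \<rho>" if \<rho>: "\<rho> \<in> cmat N" for \<rho>
  proof -
    have "sampled_twirl N r (\<lambda>b. to_circuit (circ b)) (pauli_twirl N \<Lambda>) \<rho> = pauli_mix N ?\<tau> \<rho>"
      using ok P \<rho> by (rule sampled_twirl_pauli_mix)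
    then show ?thesis unfolding U[OF \<rho>] by (simp only: pauli_mix_diff[OF \<rho>])
  qed
  then have "diamond_norm (2 ^ N) (\<lambda>\<rho>. sampled_twirl N r (\<lambda>b. to_circuit (circ b)) (pauli_twirl N \<Lambda>) \<rho> - symplectic_twirl N (pauli_twirl N \<Lambda>) \<rho>)
     \<le> ereal (\<Sum>q\<in>pvecs N. cmod (?\<tau> q - ?\<gamma> q))"
    by (rule diamond_norm_pauli_mix_le)
  also have "(\<Sum>q\<in>pvecs N. cmod (?\<tau> q - ?\<gamma> q)) \<le> (\<Sum>p\<in>pnz N. ?a p) * (1 / (2 ^ N) ^ 3)"
  proof (rule sum_kernel_diff[OF twirl_weight_nonneg])
    have fb: "finite (bit_strings r)" "bit_strings r \<noteq> {}" using card_blists[of r] by (auto simp: blists_bit_strings)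
    have CA: "conj_action N (circuit_unitary N (to_circuit (circ b))) (act (concat (circ b)))" for b by (rule circuit_conj_action[OF ok])
    have "symplectic_kernel N (0, 0) q = (if q = (0, 0) then 1 else 0)" for q
      unfolding symplectic_kernel_def by (rule avg_kernel_zero(1)[OF finite_symplectic symplectic_nonempty]) (rule SA)
    moreover have "trans_prob r circ (0, 0) q = (if q = (0, 0) then 1 else 0)" for q
      unfolding trans_prob_avg_kernel by (rule avg_kernel_zero(1)[OF fb]) (rule CA)
    ultimately show "trans_prob r circ (0, 0) q = symplectic_kernel N (0, 0) q" for q by (simp only:)
    fix p assume p: "p \<in> pnz N"
    have "symplectic_kernel N p (0, 0) = 0"
      unfolding symplectic_kernel_def by (rule avg_kernel_zero(2)[OF finite_symplectic symplectic_nonempty _ p]) (rule SA)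
    moreover have "trans_prob r circ p (0, 0) = 0"
      unfolding trans_prob_avg_kernel by (rule avg_kernel_zero(2)[OF fb _ p]) (rule CA)
    ultimately show "trans_prob r circ p (0, 0) = symplectic_kernel N p (0, 0)" by (simp only:)
    have "(\<Sum>q\<in>pnz N. \<bar>trans_prob r circ p q - symplectic_kernel N p q\<bar>) = (\<Sum>q\<in>pnz N. \<bar>trans_prob r circ p q - 1 / ((2 ^ N)\<^sup>2 - 1)\<bar>)"
      by (rule sum.cong[OF refl]) (simp only: sk[OF p])
    then show "(\<Sum>q\<in>pnz N. \<bar>trans_prob r circ p q - symplectic_kernel N p q\<bar>) \<le> 1 / (2 ^ N) ^ 3" using mix[OF p] by simp
  qed
  also have "(\<Sum>p\<in>pnz N. ?a p) * (1 / (2 ^ N) ^ 3) \<le> (\<Sum>p\<in>pnz N. ?a p) * (eps0 N / (2 ^ N)\<^sup>2)"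
    by (intro mult_left_mono eps0_ge N sum_nonneg twirl_weight_nonneg)
  also have "\<dots> = error_factor (2 ^ N) \<Lambda> * eps0 N"
    using error_factor_twirl_weight[of m A N \<Lambda>, OF A K] by simp
  also have "\<dots> \<le> error_factor (2 ^ N) \<Lambda> * (eps0 N + \<epsilon>)"
    using error_factor_twirl_weight[of m A N \<Lambda>, OF A K] \<epsilon> by (intro mult_left_mono) (auto intro!: divide_nonneg_nonneg sum_nonneg twirl_weight_nonneg)
  finally show "diamond_norm (2 ^ N) (\<lambda>\<rho>. sampled_twirl N r (\<lambda>b. to_circuit (circ b)) (pauli_twirl N \<Lambda>) \<rho> - symplectic_twirl N (pauli_twirl N \<Lambda>) \<rho>)
      \<le> ereal (error_factor (2 ^ N) \<Lambda> * (eps0 N + \<epsilon>))" by simp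
qed

theorem theorem5p2p14:
  shows "\<exists>c::real. c > 0 \<and> (\<forall>N::nat. N \<ge> 1 \<longrightarrow> (\<forall>\<epsilon>::real. \<epsilon> > 0 \<longrightarrow>
    (\<exists>(r::nat) (circ :: bool list \<Rightarrow> circuit).
      (\<forall>b\<in>bit_strings r. clifford_circuit N (circ b)) \<and>
      sampled_subset N r circ \<subseteq> carrier (symplectic_group N) \<and>
      (\<forall>\<Lambda>. completely_positive (2 ^ N) \<Lambda> \<longrightarrow>
        (let \<Lambda>\<^sub>P = pauli_twirl N \<Lambda>;
             \<Lambda>\<^sub>U = symplectic_twirl N \<Lambda>\<^sub>P;
             \<Lambda>\<^sub>\<epsilon> = sampled_twirl N r circ \<Lambda>\<^sub>P
         in pauli_superop N \<Lambda>\<^sub>P \<and>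
            unitarily_invariant (2 ^ N) \<Lambda>\<^sub>U \<and>
            diamond_norm (2 ^ N) (\<lambda>\<rho>. \<Lambda>\<^sub>\<epsilon> \<rho> - \<Lambda>\<^sub>U \<rho>) \<le> ereal (error_factor (2 ^ N) \<Lambda> * (eps0 N + \<epsilon>)))) \<and>
      (\<epsilon> \<le> 1 / 2 \<longrightarrow>
        (\<forall>b\<in>bit_strings r.
           real (gate_count (circ b)) \<le> c * (real N * log 2 (1 / \<epsilon>)) \<and>
           (N \<ge> 2 \<longrightarrow> real (depth (circ b)) \<le> c * (log 2 (real N) * log 2 (1 / \<epsilon>)))) \<and>
        real r \<le> c * (real N * log 2 (1 / \<epsilon>)) \<and>
        real (card (sampled_subset N r circ)) \<le> 2 powr (c * (real N * log 2 (1 / \<epsilon>)))))))"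
proof -
  obtain C :: nat where C: "\<forall>N\<ge>1. \<exists>r circ. (\<forall>bs. scircuit_ok N (circ bs) \<and> length (concat (circ bs)) \<le> C * N
       \<and> real (length (circ bs)) \<le> real C * (1 + log 2 (real N))) \<and> r \<le> C * N \<and>
     (\<forall>v\<in>vecs N \<times> vecs N - {(0, 0)}. (\<Sum>w\<in>vecs N \<times> vecs N - {(0, 0)}. \<bar>trans_prob r circ v w - 1 / ((2 ^ N)\<^sup>2 - 1)\<bar>) \<le> 1 / (2 ^ N) ^ 3)"
    using ex_mixing_circuits by (elim exE)
  \<comment> \<open>for \<open>N \<ge> 2\<close> the depth bound \<open>C * (1 + log 2 N)\<close> is at most \<open>2 * C * log 2 N\<close>, and \<open>log 2 (1 / \<epsilon>) \<ge> 1\<close> for \<open>\<epsilon> \<le> 1 / 2\<close>;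
    the summand \<open>1\<close> makes \<open>c\<close> positive\<close>
  define c where "c = 2 * real C + 1"
  show ?thesis
  proof (intro exI[of _ c] conjI allI impI)
    show "0 < c" by (simp add: c_def)
    fix N :: nat and \<epsilon> :: real assume N: "1 \<le> N" and \<epsilon>: "0 < \<epsilon>"
    obtain r circ where circ: "\<forall>bs. scircuit_ok N (circ bs) \<and> length (concat (circ bs)) \<le> C * N
       \<and> real (length (circ bs)) \<le> real C * (1 + log 2 (real N))" and r: "r \<le> C * N"
     and mix: "\<forall>v\<in>vecs N \<times> vecs N - {(0, 0)}. (\<Sum>w\<in>vecs N \<times> vecs N - {(0, 0)}. \<bar>trans_prob r circ v w - 1 / ((2 ^ N)\<^sup>2 - 1)\<bar>) \<le> 1 / (2 ^ N) ^ 3"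
      using C N by (elim allE[of _ N] impE exE conjE)
    have ok: "scircuit_ok N (circ b)" and gates: "length (concat (circ b)) \<le> C * N"
      and dep: "real (length (circ b)) \<le> real C * (1 + log 2 (real N))" for b using circ by auto
    have mix': "(\<Sum>q\<in>pnz N. \<bar>trans_prob r circ p q - 1 / ((2 ^ N)\<^sup>2 - 1)\<bar>) \<le> 1 / (2 ^ N) ^ 3" if "p \<in> pnz N" for p
      using mix that unfolding pvecs_def by (rule bspec)
    let ?circ = "\<lambda>b. to_circuit (circ b)"
    have small: "real C * real N \<le> c * (real N * log 2 (1 / \<epsilon>))" and dsmall: "2 \<le> N \<Longrightarrow> real C * (1 + log 2 (real N)) \<le> c * (log 2 (real N) * log 2 (1 / \<epsilon>))"
      if "\<epsilon> \<le> 1 / 2"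
    proof -
      have "log 2 2 \<le> log 2 (1 / \<epsilon>)" using \<epsilon> that by (subst log_le_cancel_iff) (auto simp: field_simps)
      then have l: "1 \<le> log 2 (1 / \<epsilon>)" by simp
      have "real C * real N \<le> c * real N" by (intro mult_right_mono) (simp_all add: c_def)
      also have "\<dots> \<le> c * (real N * log 2 (1 / \<epsilon>))"
        using l mult_left_mono[OF l, of "real N"] by (intro mult_left_mono) (simp_all add: c_def)
      finally show "real C * real N \<le> c * (real N * log 2 (1 / \<epsilon>))" .
      assume "2 \<le> N"
      then have "log 2 2 \<le> log 2 (real N)" by (subst log_le_cancel_iff) auto
      then have n: "1 \<le> log 2 (real N)" by simp
      have "real C * (1 + log 2 (real N)) \<le> real C * (2 * log 2 (real N))" using n by (intro mult_left_mono) auto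
      also have "\<dots> \<le> c * log 2 (real N)" using n by (simp add: c_def algebra_simps)
      also have "\<dots> \<le> c * (log 2 (real N) * log 2 (1 / \<epsilon>))"
        using n mult_left_mono[OF l, of "log 2 (real N)"] by (intro mult_left_mono) (simp_all add: c_def)
      finally show "real C * (1 + log 2 (real N)) \<le> c * (log 2 (real N) * log 2 (1 / \<epsilon>))" .
    qed
    show "\<exists>(r::nat) (circ :: bool list \<Rightarrow> circuit).
      (\<forall>b\<in>bit_strings r. clifford_circuit N (circ b)) \<and>
      sampled_subset N r circ \<subseteq> carrier (symplectic_group N) \<and>
      (\<forall>\<Lambda>. completely_positive (2 ^ N) \<Lambda> \<longrightarrow>
        (let \<Lambda>\<^sub>P = pauli_twirl N \<Lambda>;
             \<Lambda>\<^sub>U = symplectic_twirl N \<Lambda>\<^sub>P;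
             \<Lambda>\<^sub>\<epsilon> = sampled_twirl N r circ \<Lambda>\<^sub>P
         in pauli_superop N \<Lambda>\<^sub>P \<and>
            unitarily_invariant (2 ^ N) \<Lambda>\<^sub>U \<and>
            diamond_norm (2 ^ N) (\<lambda>\<rho>. \<Lambda>\<^sub>\<epsilon> \<rho> - \<Lambda>\<^sub>U \<rho>) \<le> ereal (error_factor (2 ^ N) \<Lambda> * (eps0 N + \<epsilon>)))) \<and>
      (\<epsilon> \<le> 1 / 2 \<longrightarrow>
        (\<forall>b\<in>bit_strings r.
           real (gate_count (circ b)) \<le> c * (real N * log 2 (1 / \<epsilon>)) \<and>
           (N \<ge> 2 \<longrightarrow> real (depth (circ b)) \<le> c * (log 2 (real N) * log 2 (1 / \<epsilon>)))) \<and>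
        real r \<le> c * (real N * log 2 (1 / \<epsilon>)) \<and>
        real (card (sampled_subset N r circ)) \<le> 2 powr (c * (real N * log 2 (1 / \<epsilon>))))"
      unfolding Let_def
    proof (intro exI[of _ r] exI[of _ ?circ] conjI ballI allI impI)
      fix b
      show "clifford_circuit N (to_circuit (circ b))" by (rule to_circuit_clifford[OF ok])
    next
      show "sampled_subset N r ?circ \<subseteq> carrier (symplectic_group N)" by (rule sampled_subset_symplectic[OF ok])
    next
      fix \<Lambda> assume \<Lambda>: "completely_positive (2 ^ N) \<Lambda>"
      note cw = twirls_of_mixing_circuits[OF N ok mix' \<Lambda> \<epsilon>]
      show "pauli_superop N (pauli_twirl N \<Lambda>)" by (rule cw(1))
      show "unitarily_invariant (2 ^ N) (symplectic_twirl N (pauli_twirl N \<Lambda>))" by (rule cw(2))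
      show "diamond_norm (2 ^ N) (\<lambda>\<rho>. sampled_twirl N r ?circ (pauli_twirl N \<Lambda>) \<rho> - symplectic_twirl N (pauli_twirl N \<Lambda>) \<rho>)
        \<le> ereal (error_factor (2 ^ N) \<Lambda> * (eps0 N + \<epsilon>))" by (rule cw(3))
    next
      fix b assume \<epsilon>2: "\<epsilon> \<le> 1 / 2"
      have "real (gate_count (to_circuit (circ b))) \<le> real (C * N)" unfolding to_circuit_size(1) of_nat_le_iff by (rule gates)
      also have "\<dots> \<le> c * (real N * log 2 (1 / \<epsilon>))" using small[OF \<epsilon>2] by simp
      finally show "real (gate_count (to_circuit (circ b))) \<le> c * (real N * log 2 (1 / \<epsilon>))" .
      assume "2 \<le> N"
      show "real (depth (to_circuit (circ b))) \<le> c * (log 2 (real N) * log 2 (1 / \<epsilon>))"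
        unfolding to_circuit_size(2) by (rule order_trans[OF dep dsmall[OF \<epsilon>2 \<open>2 \<le> N\<close>]])
    next
      assume \<epsilon>2: "\<epsilon> \<le> 1 / 2"
      have "real r \<le> real (C * N)" unfolding of_nat_le_iff by (rule r)
      also have "\<dots> \<le> c * (real N * log 2 (1 / \<epsilon>))" using small[OF \<epsilon>2] by simp
      finally show rr: "real r \<le> c * (real N * log 2 (1 / \<epsilon>))" .
      have "card (sampled_subset N r ?circ) \<le> card (bit_strings r)"
        unfolding sampled_subset_def by (rule card_image_le) (simp add: blists_bit_strings)
      then have "real (card (sampled_subset N r ?circ)) \<le> real (2 ^ r)"
        unfolding blists_bit_strings card_blists of_nat_le_iff .
      also have "\<dots> = 2 ^ r" by simp
      also have "\<dots> = 2 powr real r" by (simp add: powr_realpow)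
      also have "\<dots> \<le> 2 powr (c * (real N * log 2 (1 / \<epsilon>)))" using rr by (intro powr_mono) auto
      finally show "real (card (sampled_subset N r ?circ)) \<le> 2 powr (c * (real N * log 2 (1 / \<epsilon>)))" .
    qed
  qed
qed

end
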